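(* Let $0<\nu\le\frac12$. Then the polynomial $P_n$ exists and is unique for sufficiently large $n$. Moreover, the polynomial $\widetilde P_n(z)=(in\pi)^{-n}P_n(in\pi z)$ has the following behavior as $n\to\infty$: $$\widetilde P_n(z)=e^{ng(z)}\left(\frac{z\left(z+(z^2-1)^{1/2}\right)}{2(z^2-1)}\right)^{1/4}\left(\frac{(z^2-1)^{1/2}-i}{(z^2-1)^{1/2}+i}\right)^{-\nu/4}\left(1+\mathcal O(\epsilon_n)\right),\qquad \epsilon_n=\frac{n^{\nu-1/2}}{(\log n)^{\nu+1/2}},$$ uniformly for $z$ in compact subsets of $\mathbb C\setminus[-1,1]$. Here the branch of $(z^2-1)^{1/2}$ is the one that is analytic in $\mathbb C\setminus[-1,1]$ and positive for real $z>1$.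
   Context: The $g$-function is $g(z)=\int_{-1}^1\log(z-x)\psi(x)\,dx$, analytic in $\mathbb C\setminus(-\infty,1]$, where $\psi(x)=\frac1\pi\log\frac{1+\sqrt{1-x^2}}{|x|}$ for $x\in[-1,1]$ (a probability density); $e^{ng}$ extends analytically to $\mathbb C\setminus[-1,1]$. The powers $(\cdot)^{1/4}$ and $(\cdot)^{-\nu/4}$ in the formula are the branches analytic in $\mathbb C\setminus[-1,1]$ that tend to $1$ as $z\to\infty$. Let $J_\nu$ be the Bessel function of order $\nu\ge 0$. The polynomials $P_n$ are the monic polynomials of degree $n$ that are "orthogonal with respect to $J_\nu$ on $[0,\infty)$" in the regularized sense: for $s>0$ let $P_n(\cdot;s)$ be the monic polynomial of degree $n$ with $\int_0^\infty P_n(x;s)x^jJ_\nu(x)e^{-sx}\,dx=0$ for $j=0,\dots,n-1$, and $P_n(x)=\lim_{s\to0+}P_n(x;s)$. Equivalently, with the regularized moments $$m_j=\lim_{s\to0+}\int_0^\infty x^jJ_\nu(x)e^{-sx}\,dx=2^j\,\frac{\Gamma(\frac{1+\nu+j}{2})}{\Gamma(\frac{1+\nu-j}{2})}$$ (with $1/\Gamma=0$ at the poles of $\Gamma$) and $\Delta_n=\det[m_{i+j}]_{i,j=0}^{n-1}$, the polynomial $P_n$ exists (and is unique) if and only if $\Delta_n\ne0$, and then $P_n(x)=\frac1{\Delta_n}\det M_n(x)$, where $M_n(x)$ is the $(n+1)\times(n+1)$ matrix whose rows $i=0,\dots,n-1$ are $(m_i,m_{i+1},\dots,m_{i+n})$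 and whose last row is $(1,x,\dots,x^n)$. *)

theory Defs
  imports "HOL-Complex_Analysis.Complex_Analysis" "Jordan_Normal_Form.Determinant"
begin

text \<open>
  The Bessel function of the first kind of real order \<open>\<nu> > 0\<close> on \<open>[0, \<infinity>)\<close>.
  (For \<open>\<nu> = 0\<close> the value at \<open>x = 0\<close> would be wrong, as \<open>0 powr 0 = 0\<close>.)
\<close>

definition bessel_J :: "real \<Rightarrow> real \<Rightarrow> real" where
  "bessel_J \<nu> x =
     (\<Sum>k. (-1) ^ k / (fact k * Gamma (real k + \<nu> + 1)) * (x / 2) powr (2 * real k + \<nu>))"

definition damped_bessel_OP :: "real \<Rightarrow> nat \<Rightarrow> real \<Rightarrow> complex poly \<Rightarrow> bool" where
  "damped_bessel_OP \<nu> n s p \<longleftrightarrow>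
     degree p = n \<and> lead_coeff p = 1 \<and>
     (\<forall>j<n. ((\<lambda>x. poly p (of_real x) * of_real (x ^ j * bessel_J \<nu> x * exp (- s * x)))
               has_integral 0) {0..})"

text \<open>
  Only small \<open>s\<close> matter for the limit, and the damped polynomial need not exist for every \<open>s > 0\<close>.
  No uniqueness for a single \<open>s\<close> is built in: any choice \<open>Q s\<close> with a limit counts, so that
  uniqueness of the limit polynomial is a genuine assertion.
\<close>

definition bessel_OP_rel :: "real \<Rightarrow> nat \<Rightarrow> complex poly \<Rightarrow> bool" where
  "bessel_OP_rel \<nu> n p \<longleftrightarrow>
     degree p = n \<and> lead_coeff p = 1 \<and>
     (\<exists>Q. (\<forall>\<^sub>F s in at_right 0. damped_bessel_OP \<nu> n s (Q s)) \<and>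
          (\<forall>x. ((\<lambda>s. poly (Q s) x) \<longlongrightarrow> poly p x) (at_right 0)))"

definition bessel_OP :: "real \<Rightarrow> nat \<Rightarrow> complex poly" where
  "bessel_OP \<nu> n = (THE p. bessel_OP_rel \<nu> n p)"

definition bessel_moment :: "real \<Rightarrow> nat \<Rightarrow> real" where
  "bessel_moment \<nu> j =
     Lim (at_right 0) (\<lambda>s. integral {0..} (\<lambda>x. x ^ j * bessel_J \<nu> x * exp (- s * x)))"

definition bessel_hankel_det :: "real \<Rightarrow> nat \<Rightarrow> real" where
  "bessel_hankel_det \<nu> n =
     Determinant.det (Matrix.mat n n (\<lambda>(i, j). bessel_moment \<nu> (i + j)))"

definition rescaled_bessel_OP :: "real \<Rightarrow> nat \<Rightarrow> complex \<Rightarrow> complex" where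
  "rescaled_bessel_OP \<nu> n z =
     poly (bessel_OP \<nu> n) (\<i> * of_nat n * of_real pi * z) / (\<i> * of_nat n * of_real pi) ^ n"

definition psi_density :: "real \<Rightarrow> real" where
  "psi_density x = ln ((1 + sqrt (1 - x\<^sup>2)) / \<bar>x\<bar>) / pi"

text \<open>
  For \<open>z < -1\<close> the principal logarithm makes this the boundary value from the upper
  half-plane. Since the density has total mass 1, the boundary values from the two sides differ by
  \<open>2 \<pi> \<i>\<close>, so for natural \<open>n\<close> the function \<open>exp (n * g_fun z)\<close> on \<open>\<complex> \<setminus> [-1, 1]\<close> is exactly the
  analytic extension of \<open>e\<^sup>n\<^sup>g\<close>.
\<close>

definition g_fun :: "complex \<Rightarrow> complex" where
  "g_fun z = integral {-1..1} (\<lambda>x. Ln (z - of_real x) * of_real (psi_density x))"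

definition slit_plane :: "complex set" where
  "slit_plane = - complex_of_real ` {-1..1}"

text \<open>The branch of \<open>(z\<^sup>2 - 1)\<^sup>1\<^sup>/\<^sup>2\<close> that is analytic off \<open>[-1, 1]\<close>; its characterising
  properties are proved at the end of the theory.\<close>

definition sqrt_branch :: "complex \<Rightarrow> complex" where
  "sqrt_branch z = z * csqrt (1 - 1 / z\<^sup>2)"

definition quarter_base :: "complex \<Rightarrow> complex" where
  "quarter_base z = z * (z + sqrt_branch z) / (2 * (z\<^sup>2 - 1))"

definition nu_base :: "complex \<Rightarrow> complex" where
  "nu_base z = (sqrt_branch z - \<i>) / (sqrt_branch z + \<i>)"

text \<open>
  On \<open>\<complex> \<setminus> [-1, 1]\<close> both bases avoid \<open>(-\<infinity>, 0]\<close> and tend to 1 at infinity. Hence the principal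
  powers below are the branches that are analytic off \<open>[-1, 1]\<close> and tend to 1 at infinity; this is
  proved at the end of the theory.
\<close>

definition leading_term :: "real \<Rightarrow> nat \<Rightarrow> complex \<Rightarrow> complex" where
  "leading_term \<nu> n z =
     exp (of_nat n * g_fun z) * quarter_base z powr (1 / 4) * nu_base z powr (- of_real \<nu> / 4)"

definition err :: "real \<Rightarrow> nat \<Rightarrow> real" where
  "err \<nu> n = real n powr (\<nu> - 1 / 2) / ln (real n) powr (\<nu> + 1 / 2)"


lemma slit_plane_nonzero: "z \<in> slit_plane \<Longrightarrow> z \<noteq> 0"
  unfolding slit_plane_def by (metis ComplD atLeastAtMost_iff image_eqI neg_le_0_iff_le of_real_0 zero_le_one)

lemma open_slit_plane: "open slit_plane"
  unfolding slit_plane_def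
  by (intro open_Compl compact_imp_closed compact_continuous_image continuous_intros) auto

lemma one_minus_inv_sq_notin:
  assumes "z \<in> slit_plane"
  shows "1 - 1 / z\<^sup>2 \<notin> \<real>\<^sub>\<le>\<^sub>0"
proof
  assume "1 - 1 / z\<^sup>2 \<in> \<real>\<^sub>\<le>\<^sub>0"
  then obtain t where t: "1 - 1 / z\<^sup>2 = of_real t" "t \<le> 0"
    by (auto elim!: nonpos_Reals_cases)
  have z0: "z \<noteq> 0" using assms by (rule slit_plane_nonzero)
  have e: "1 / z\<^sup>2 = complex_of_real (1 - t)"
    using t(1) by (simp add: algebra_simps)
  define r where "r = 1 / sqrt (1 - t)"
  have r: "r\<^sup>2 = 1 / (1 - t)" "0 < r" "r \<le> 1"
    using t(2) by (auto simp: r_def power_divide)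
  have "z\<^sup>2 = 1 / (1 / z\<^sup>2)" by simp
  also have "\<dots> = of_real (r\<^sup>2)"
    unfolding e r(1) by simp
  finally have "z\<^sup>2 = (of_real r)\<^sup>2" by simp
  then have "z = of_real r \<or> z = - of_real r"
    by (simp add: power2_eq_iff)
  then have "z = of_real r \<or> z = of_real (- r)" by simp
  moreover have "r \<in> {-1..1}" "- r \<in> {-1..1}" using r by auto
  ultimately show False
    using assms unfolding slit_plane_def by blast
qed

lemma sqrt_branch_sq: "z \<in> slit_plane \<Longrightarrow> (sqrt_branch z)\<^sup>2 = z\<^sup>2 - 1"
  using slit_plane_nonzero[of z]
  by (simp add: sqrt_branch_def power_mult_distrib algebra_simps)

lemma sqrt_branch_holomorphic: "sqrt_branch holomorphic_on slit_plane"
  unfolding sqrt_branch_def[abs_def]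
  by (intro holomorphic_intros) (auto simp: one_minus_inv_sq_notin slit_plane_nonzero)

lemma sqrt_branch_real:
  assumes "x > 1"
  shows "sqrt_branch (of_real x) = of_real (sqrt (x\<^sup>2 - 1))"
proof -
  have x2: "1 \<le> x\<^sup>2" using assms by (simp add: one_le_power)
  then have p: "0 \<le> 1 - 1 / x\<^sup>2" by (subst diff_ge_0_iff_ge) (subst divide_le_eq_1_pos, auto)
  have "csqrt (1 - 1 / (of_real x)\<^sup>2) = csqrt (of_real (1 - 1 / x\<^sup>2))" by simp
  also have "\<dots> = of_real (sqrt (1 - 1 / x\<^sup>2))" using p by (rule of_real_sqrt [symmetric])
  finally have "sqrt_branch (of_real x) = of_real (x * sqrt (1 - 1 / x\<^sup>2))"
    by (simp add: sqrt_branch_def)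
  also have "x * sqrt (1 - 1 / x\<^sup>2) = sqrt (x\<^sup>2 * (1 - 1 / x\<^sup>2))"
    using assms by (simp add: real_sqrt_mult)
  also have "x\<^sup>2 * (1 - 1 / x\<^sup>2) = x\<^sup>2 - 1"
    using assms by (simp add: algebra_simps)
  finally show ?thesis .
qed

lemma sqrt_branch_nonzero: "z \<in> slit_plane \<Longrightarrow> sqrt_branch z \<noteq> 0"
  using one_minus_inv_sq_notin[of z] slit_plane_nonzero[of z]
  by (auto simp: sqrt_branch_def)

lemma sqrt_branch_notin:
  assumes "z \<in> slit_plane" "Re (sqrt_branch z) = 0"
  shows "1 < \<bar>Im (sqrt_branch z)\<bar>"
proof (rule ccontr)
  assume n: "\<not> 1 < \<bar>Im (sqrt_branch z)\<bar>"
  define b where "b = Im (sqrt_branch z)"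
  have b: "b\<^sup>2 \<le> 1" using n by (simp add: b_def abs_square_le_1)
  have "sqrt_branch z = \<i> * of_real b"
    using assms(2) by (simp add: b_def complex_eq_iff)
  then have "z\<^sup>2 = of_real (1 - b\<^sup>2)"
    using sqrt_branch_sq[OF assms(1)] by (simp add: power_mult_distrib algebra_simps)
  also have "\<dots> = (of_real (sqrt (1 - b\<^sup>2)))\<^sup>2"
    using b by (metis diff_ge_0_iff_ge of_real_power real_sqrt_pow2)
  finally have "z = of_real (sqrt (1 - b\<^sup>2)) \<or> z = - of_real (sqrt (1 - b\<^sup>2))"
    by (simp add: power2_eq_iff)
  then have "z = of_real (sqrt (1 - b\<^sup>2)) \<or> z = of_real (- sqrt (1 - b\<^sup>2))" by simp
  moreover have "sqrt (1 - b\<^sup>2) \<in> {-1..1}" "- sqrt (1 - b\<^sup>2) \<in> {-1..1}"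
  proof -
    have "0 \<le> sqrt (1 - b\<^sup>2)" "sqrt (1 - b\<^sup>2) \<le> 1" using b by simp_all
    then show "sqrt (1 - b\<^sup>2) \<in> {-1..1}" "- sqrt (1 - b\<^sup>2) \<in> {-1..1}"
      unfolding atLeastAtMost_iff by linarith+
  qed
  ultimately show False
    using assms(1) unfolding slit_plane_def by blast
qed

lemma quarter_base_notin:
  assumes "z \<in> slit_plane"
  shows "quarter_base z \<notin> \<real>\<^sub>\<le>\<^sub>0"
proof
  assume a: "quarter_base z \<in> \<real>\<^sub>\<le>\<^sub>0"
  define c where "c = csqrt (1 - 1 / z\<^sup>2)"
  define t where "t = 1 / c"
  have z0: "z \<noteq> 0" using assms by (rule slit_plane_nonzero)
  have c0: "c \<noteq> 0" using one_minus_inv_sq_notin[OF assms] by (auto simp: c_def)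
  have "Re c \<noteq> 0"
  proof
    assume "Re c = 0"
    then have "c\<^sup>2 \<in> \<real>\<^sub>\<le>\<^sub>0" by (simp add: complex_nonpos_Reals_iff power2_eq_square)
    then show False using one_minus_inv_sq_notin[OF assms] by (simp add: c_def)
  qed
  moreover have "0 \<le> Re c"
    using csqrt_principal[of "1 - 1 / z\<^sup>2"] by (auto simp: c_def)
  ultimately have "0 < Re c" by simp
  then have t: "0 < Re t" by (auto simp: t_def Re_divide intro!: divide_pos_pos add_pos_nonneg)
  have "quarter_base z = z * (z + z * c) / (2 * (z * c)\<^sup>2)"
    using sqrt_branch_sq[OF assms] unfolding quarter_base_def by (simp add: sqrt_branch_def c_def)
  also have "\<dots> = t * (1 + t) / 2"
    using z0 c0 by (simp add: t_def field_simps power2_eq_square)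
  finally have q: "quarter_base z = t * (1 + t) / 2" .
  have "Im (t * (1 + t)) = 0" "Re (t * (1 + t)) \<le> 0"
    using a unfolding q by (auto simp: complex_nonpos_Reals_iff)
  then have "Im t * (1 + 2 * Re t) = 0" "Re t * (1 + Re t) \<le> (Im t)\<^sup>2"
    by (auto simp: algebra_simps power2_eq_square)
  then have "Im t = 0" "Re t * (1 + Re t) \<le> (Im t)\<^sup>2" using t by auto
  then show False using t by (simp add: mult_le_0_iff)
qed

lemma nu_base_notin:
  assumes "z \<in> slit_plane"
  shows "nu_base z \<notin> \<real>\<^sub>\<le>\<^sub>0"
proof
  assume "nu_base z \<in> \<real>\<^sub>\<le>\<^sub>0"
  then obtain c where c: "nu_base z = of_real c" "c \<le> 0"
    by (auto elim!: nonpos_Reals_cases)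
  define R where "R = sqrt_branch z"
  have ne: "R + \<i> \<noteq> 0"
    using sqrt_branch_notin[OF assms] unfolding R_def[symmetric] by (auto simp: complex_eq_iff)
  have "R - \<i> = of_real c * (R + \<i>)"
    using c(1) ne by (simp add: nu_base_def R_def[symmetric] divide_eq_eq)
  then have re: "Re R * (1 - c) = 0" and im: "Im R * (1 - c) = 1 + c"
    by (auto simp: complex_eq_iff algebra_simps)
  have "Re R = 0" using re c(2) by auto
  moreover have "Im R = (1 + c) / (1 - c)" using im c(2) by (subst eq_divide_eq) auto
  then have "\<bar>Im R\<bar> \<le> 1" using c(2) by (simp add: abs_divide divide_le_eq_1)
  ultimately show False
    using sqrt_branch_notin[OF assms] unfolding R_def[symmetric] by linarith
qed

lemma quarter_power_holomorphic: "(\<lambda>z. quarter_base z powr (1 / 4)) holomorphic_on slit_plane"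
proof -
  have "z\<^sup>2 - 1 \<noteq> 0" if "z \<in> slit_plane" for z
    using sqrt_branch_sq[OF that] sqrt_branch_nonzero[OF that] by auto
  then have "quarter_base holomorphic_on slit_plane"
    unfolding quarter_base_def[abs_def]
    by (intro holomorphic_intros sqrt_branch_holomorphic) auto
  then show ?thesis
    by (intro holomorphic_intros) (auto simp: quarter_base_notin)
qed

lemma nu_power_holomorphic: "(\<lambda>z. nu_base z powr a) holomorphic_on slit_plane"
proof -
  have "sqrt_branch z + \<i> \<noteq> 0" if "z \<in> slit_plane" for z
    using sqrt_branch_notin[OF that] by (auto simp: complex_eq_iff)
  then have "nu_base holomorphic_on slit_plane"
    unfolding nu_base_def[abs_def]
    by (intro holomorphic_intros sqrt_branch_holomorphic) auto
  then show ?thesis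
    by (intro holomorphic_intros) (auto simp: nu_base_notin)
qed

lemma eventually_slit_plane: "\<forall>\<^sub>F z in at_infinity. z \<in> slit_plane"
proof -
  have "\<forall>\<^sub>F z in at_infinity. 2 \<le> norm (z :: complex)"
    by (auto simp: eventually_at_infinity)
  then show ?thesis
    by eventually_elim (auto simp: slit_plane_def)
qed

lemma csqrt_part_tendsto: "((\<lambda>z. csqrt (1 - 1 / z\<^sup>2)) \<longlongrightarrow> 1) at_infinity"
proof -
  have "((\<lambda>z. 1 - (inverse z)\<^sup>2) \<longlongrightarrow> 1 - 0\<^sup>2) (at_infinity :: complex filter)"
    by (intro tendsto_intros tendsto_inverse_0)
  then have "((\<lambda>z :: complex. 1 - 1 / z\<^sup>2) \<longlongrightarrow> 1) at_infinity"
    by (simp add: divide_inverse power_inverse)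
  moreover have "isCont csqrt 1" by (rule continuous_at_csqrt) simp
  ultimately show ?thesis
    using isCont_tendsto_compose[of 1 csqrt] by fastforce
qed

lemma quarter_power_tendsto: "((\<lambda>z. quarter_base z powr (1 / 4)) \<longlongrightarrow> 1) at_infinity"
proof -
  let ?c = "\<lambda>z :: complex. csqrt (1 - 1 / z\<^sup>2)"
  have "((\<lambda>z. (1 + ?c z) / (2 * (?c z)\<^sup>2)) \<longlongrightarrow> (1 + 1) / (2 * 1\<^sup>2)) at_infinity"
    by (intro tendsto_intros csqrt_part_tendsto) simp
  moreover have "\<forall>\<^sub>F z in at_infinity. (1 + ?c z) / (2 * (?c z)\<^sup>2) = quarter_base z"
    using eventually_slit_plane
  proof eventually_elim
    case (elim z)
    have "quarter_base z = z * (z + z * ?c z) / (2 * (z * ?c z)\<^sup>2)"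
      using sqrt_branch_sq[OF elim] unfolding quarter_base_def by (simp add: sqrt_branch_def)
    also have "\<dots> = (z\<^sup>2 * (1 + ?c z)) / (z\<^sup>2 * (2 * (?c z)\<^sup>2))"
      by (simp only: power_mult_distrib) (simp add: algebra_simps power2_eq_square)
    also have "\<dots> = (1 + ?c z) / (2 * (?c z)\<^sup>2)"
      using slit_plane_nonzero[OF elim] by simp
    finally show ?case by (rule sym)
  qed
  ultimately have "(quarter_base \<longlongrightarrow> 1) at_infinity"
    using Lim_transform_eventually by fastforce
  then have "((\<lambda>z. quarter_base z powr (1 / 4)) \<longlongrightarrow> 1 powr (1 / 4)) at_infinity"
    by (intro tendsto_powr_complex tendsto_const) auto
  then show ?thesis by simp
qed

lemma nu_power_tendsto: "((\<lambda>z. nu_base z powr a) \<longlongrightarrow> 1) at_infinity"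
proof -
  let ?c = "\<lambda>z :: complex. csqrt (1 - 1 / z\<^sup>2)"
  have "((\<lambda>z. (?c z - \<i> * inverse z) / (?c z + \<i> * inverse z)) \<longlongrightarrow>
          (1 - \<i> * 0) / (1 + \<i> * 0)) at_infinity"
    by (intro tendsto_intros csqrt_part_tendsto tendsto_inverse_0) simp
  moreover have "\<forall>\<^sub>F z in at_infinity.
      (?c z - \<i> * inverse z) / (?c z + \<i> * inverse z) = nu_base z"
    using eventually_slit_plane
  proof eventually_elim
    case (elim z)
    have z0: "z \<noteq> 0" using elim by (rule slit_plane_nonzero)
    have "nu_base z = (z * (?c z - \<i> * inverse z)) / (z * (?c z + \<i> * inverse z))"
      using z0 by (simp add: nu_base_def sqrt_branch_def algebra_simps)
    also have "\<dots> = (?c z - \<i> * inverse z) / (?c z + \<i> * inverse z)"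
      using z0 by simp
    finally show ?case by (rule sym)
  qed
  ultimately have "(nu_base \<longlongrightarrow> 1) at_infinity"
    using Lim_transform_eventually by fastforce
  then have "((\<lambda>z. nu_base z powr a) \<longlongrightarrow> 1 powr a) at_infinity"
    by (intro tendsto_powr_complex tendsto_const) auto
  then show ?thesis by simp
qed

end

theory Submission
  imports Defs "HOL-Real_Asymp.Real_Asymp"
begin

text \<open>
  Under \<open>y = i \<pi> x\<close> the regularized moments of \<open>J\<^sub>\<nu>\<close> become, up to a constant factor, the moments
  of the weight \<open>exp (- i\<pi>\<nu> sgn(x) / 2) K\<^sub>\<nu>(\<pi>\<bar>x\<bar>)\<close> on the real line, \<open>K\<^sub>\<nu>\<close> being the Macdonald function. Its argument is
  at most \<open>\<pi>/4\<close> in modulus, so the associated bilinear form is coercive; this gives existence and uniqueness for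
  every \<open>n\<close>. The weight is close, away from the origin, to \<open>\<Gamma>(1/4 - \<eta> + ix) \<Gamma>(1/4 + \<eta> - ix)\<close> with
  \<open>\<eta>\<close> near \<open>\<nu>/2\<close>, whose orthogonal polynomials are of Meixner--Pollaczek type and satisfy an explicit
  three-term recurrence. Coercivity turns the weighted \<open>L\<^sup>2\<close> distance of the two weights into a bound on the
  difference of the two polynomials, and the Christoffel kernel of the symmetric case \<open>\<eta> = 0\<close> turns this
  \<open>L\<^sup>2\<close> bound into a pointwise one. The Meixner--Pollaczek polynomials themselves are handled by a discrete WKB
  argument for the recurrence. For \<open>\<nu> = 1/2\<close> the choice \<open>\<eta> = \<nu>/2\<close> would make the comparison weight
  singular at the origin, so there \<open>\<eta> = 1/4 - n powr (- 1/8)\<close> is used.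
\<close>

section \<open>Meixner--Pollaczek polynomials\<close>

text \<open>The weight is complex, so extremal and positivity arguments fail; what survives is a
  bilinear form whose value at \<open>p * cnjp p\<close> has positive real part. If \<open>q\<close>
  and its comparison polynomial share the leading coefficient \<open>2^n / n!\<close>, their
  difference \<open>e\<close> has degree below \<open>n\<close>, and testing with
  \<open>cnjp e\<close> leaves only the integral of the difference of the two weights.

  The Gamma weight fits because with parameters \<open>1/4 - eta\<close>, \<open>1/4 + eta\<close>
  it has the envelope \<open>|x|^(-1/2) exp(- pi |x|)\<close> and the phases
  \<open>exp(-/+ i pi eta)\<close> on the two half-lines; at \<open>eta = nu/2\<close> both agree
  with the Macdonald weight up to a relative error \<open>O(1/|x|)\<close>. Near the origin the
  weights are not close at all. There the smallness of the comparison polynomials helps: order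
  \<open>n^(eta - 3/4)\<close> at \<open>0\<close>, while their norm is bounded by order
  \<open>n^(-1/4)\<close>.

  The kernel costs a factor \<open>sqrt n\<close> on squared norms. The resulting relative error is
  \<open>O(n^(5 nu/8 - 1/2))\<close> for \<open>nu < 1/2\<close> and \<open>O(n^(-1/16))\<close> at
  \<open>nu = 1/2\<close>, a power of \<open>n\<close> below the claimed rate, so crude constants
  and a crude cut-off near the origin suffice.\<close>

definition bin :: "complex \<Rightarrow> complex \<Rightarrow> complex fps" where
 "bin s \<alpha> = Abs_fps (\<lambda>k. (\<alpha> gchoose k) * s ^ k)"

lemma bin_nth [simp]: "fps_nth (bin s \<alpha>) k = (\<alpha> gchoose k) * s ^ k"
 by (simp add: bin_def)

lemma bin_add: "bin s (\<alpha> + \<beta>) = bin s \<alpha> * bin s \<beta>"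
proof (rule fps_ext)
 fix n
 have "fps_nth (bin s \<alpha> * bin s \<beta>) n = (\<Sum>k\<le>n. ((\<alpha> gchoose k) * (\<beta> gchoose (n - k))) * s ^ n)"
  unfolding fps_mult_nth atLeast0AtMost
  by (intro sum.cong) (auto simp flip: power_add simp: mult_ac)
 also have "\<dots> = (\<Sum>k\<le>n. (\<alpha> gchoose k) * (\<beta> gchoose (n - k))) * s ^ n"
  by (simp add: sum_distrib_right)
 also have "\<dots> = ((\<alpha> + \<beta>) gchoose n) * s ^ n"
  unfolding atLeast0AtMost[symmetric] gbinomial_Vandermonde ..
 finally show "fps_nth (bin s (\<alpha> + \<beta>)) n = fps_nth (bin s \<alpha> * bin s \<beta>) n" by simp
qed

lemma bin_1: "bin s 1 = 1 + fps_const s * fps_X"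
proof (rule fps_ext)
 fix n
 have "((1::complex) gchoose n) = of_nat (1 choose n)" by (simp add: binomial_gbinomial)
 then show "fps_nth (bin s 1) n = fps_nth (1 + fps_const s * fps_X) n"
  by (cases n rule: nat.exhaust[case_product nat.exhaust]) (auto simp: fps_X_def)
qed

lemma bin_deriv: "fps_deriv (bin s \<alpha>) = fps_const (s * \<alpha>) * bin s (\<alpha> - 1)"
proof (rule fps_ext)
 fix k
 have "of_nat (Suc k) * (\<alpha> gchoose Suc k) = \<alpha> * (\<alpha> - 1 gchoose k)"
  by (rule gbinomial_absorption)
 then show "fps_nth (fps_deriv (bin s \<alpha>)) k = fps_nth (fps_const (s * \<alpha>) * bin s (\<alpha> - 1)) k"
  by (simp del: of_nat_Suc add: mult_ac)
qed

text \<open>Generating function \<open>(1 - i X)^(i x - b) (1 + i X)^(- i x - a)\<close>. Its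
  coefficients are the Meixner--Pollaczek polynomials with parameter \<open>(a + b)/2\<close> and
  angle \<open>pi/2\<close>, taken at \<open>x + i (b - a)/2\<close>.\<close>

definition mpG :: "real \<Rightarrow> real \<Rightarrow> complex \<Rightarrow> complex fps" where
 "mpG a b x = bin (- \<i>) (\<i> * x - of_real b) * bin \<i> (- \<i> * x - of_real a)"

definition mp :: "real \<Rightarrow> real \<Rightarrow> nat \<Rightarrow> complex \<Rightarrow> complex" where
 "mp a b n x = fps_nth (mpG a b x) n"

lemma mpG_b: "mpG a b x = (1 - fps_const \<i> * fps_X) * mpG a (b + 1) x"
proof -
 have "bin (- \<i>) (\<i> * x - of_real b) = (1 + fps_const (- \<i>) * fps_X) * bin (- \<i>) (\<i> * x - of_real (b + 1))"
  unfolding bin_1[symmetric] bin_add[symmetric] by simp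
 then show ?thesis by (simp add: mpG_def mult.assoc flip: fps_const_neg)
qed

lemma mpG_a: "mpG a b x = (1 + fps_const \<i> * fps_X) * mpG (a + 1) b x"
proof -
 have "bin \<i> (- \<i> * x - of_real a) = (1 + fps_const \<i> * fps_X) * bin \<i> (- \<i> * x - of_real (a + 1))"
  unfolding bin_1[symmetric] bin_add[symmetric] by simp
 then show ?thesis by (simp add: mpG_def mult.left_commute)
qed

text \<open>A unit moves from one exponent to the other when \<open>x\<close> is shifted by
  \<open>- i\<close>. The weight has the matching property \<open>rho_shift\<close>, and the two
  meet in the orthogonality proof.\<close>

lemma mpG_shift: "mpG a (b + 1) (x - \<i>) = mpG (a + 1) b x"
 by (simp add: mpG_def algebra_simps)

lemma mpG_deriv:
 "fps_deriv (mpG a b x) = fps_const (\<i> * (of_real b - \<i> * x)) * mpG a (b + 1) x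
   - fps_const (\<i> * (of_real a + \<i> * x)) * mpG (a + 1) b x"
proof -
 have 1: "\<i> * x - of_real b - 1 = \<i> * x - of_real (b + 1)" "- \<i> * x - of_real a - 1 = - \<i> * x - of_real (a + 1)"
  by auto
 have 2: "fps_const (- \<i> * (\<i> * x - of_real b)) = fps_const (\<i> * (of_real b - \<i> * x))"
     "fps_const (\<i> * (- \<i> * x - of_real a)) = - fps_const (\<i> * (of_real a + \<i> * x))"
  by (simp_all add: algebra_simps)
 show ?thesis
  unfolding mpG_def fps_deriv_mult bin_deriv 1 2
  by (simp only: mult_minus_left mult_minus_right mult_ac diff_conv_add_uminus add_ac)
qed

text \<open>Coefficient comparison in \<open>mpG_deriv\<close>. It acts as a Rodrigues formula: the
  two linear factors are exactly those that raise a parameter of the Gamma weight in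
  \<open>rho_step\<close>.\<close>

lemma mp_Suc_deriv:
 "of_nat (Suc n) * mp a b (Suc n) x =
  \<i> * (of_real b - \<i> * x) * mp a (b + 1) n x - \<i> * (of_real a + \<i> * x) * mp (a + 1) b n x"
proof -
 have "fps_nth (fps_deriv (mpG a b x)) n = of_nat (Suc n) * mp a b (Suc n) x"
  by (simp add: mp_def)
 then show ?thesis unfolding mpG_deriv by (simp add: mp_def)
qed

lemma mp_shift: "mp a (b + 1) n (x - \<i>) = mp (a + 1) b n x"
 by (simp add: mp_def mpG_shift)

lemma mp_0 [simp]: "mp a b 0 x = 1"
 by (simp add: mp_def mpG_def)

lemma mp_1: "mp a b (Suc 0) x = 2 * x + \<i> * of_real (b - a)"
 using mp_Suc_deriv[of 0 a b x] by (simp add: algebra_simps)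

text \<open>\<open>mpG_a\<close> and \<open>mpG_b\<close> express the two series in
  \<open>mpG_deriv\<close> through \<open>G\<close> itself once the equation is multiplied by
  \<open>1 + X^2 = (1 - i X)(1 + i X)\<close>. The result is a first-order differential equation for
  \<open>G\<close> with polynomial coefficients, whose coefficients give the recurrence.\<close>

lemma mp_rec:
 "of_nat (n + 2) * mp a b (n + 2) x =
  (2 * x + \<i> * of_real (b - a)) * mp a b (n + 1) x - (of_nat n + of_real (a + b)) * mp a b n x"
proof -
 let ?X = "fps_X :: complex fps"
 define U where "U = mpG a (b+1) x"
 define V where "V = mpG (a+1) b x"
 define G where "G = mpG a b x"
 have GU: "G = (1 - fps_const \<i> * ?X) * U" and GV: "G = (1 + fps_const \<i> * ?X) * V"
  unfolding G_def U_def V_def by (rule mpG_b, rule mpG_a)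
 have D: "fps_deriv G = fps_const (\<i> * (of_real b - \<i> * x)) * U - fps_const (\<i> * (of_real a + \<i> * x)) * V"
  unfolding G_def U_def V_def by (rule mpG_deriv)
 have ii: "fps_const \<i> * fps_const \<i> = - 1" by simp
 define I where "I = fps_const \<i>"
 define P where "P = fps_const (\<i> * (of_real b - \<i> * x))"
 define Q where "Q = fps_const (\<i> * (of_real a + \<i> * x))"
 have "(1 - I * ?X) * (1 + I * ?X) = 1 - (I * I) * ?X^2"
  by (simp add: algebra_simps power2_eq_square)
 then have X2: "(1 + ?X^2) = (1 - I * ?X) * (1 + I * ?X)"
  unfolding I_def ii by simp
 have "(1 + ?X^2) * fps_deriv G = P * (1 + I * ?X) * ((1 - I * ?X) * U) - Q * (1 - I * ?X) * ((1 + I * ?X) * V)"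
  unfolding D P_def[symmetric] Q_def[symmetric] X2 by (simp add: algebra_simps)
 also have "\<dots> = (P * (1 + I * ?X) - Q * (1 - I * ?X)) * G"
  unfolding GU[folded I_def, symmetric] GV[folded I_def, symmetric] by (simp add: algebra_simps)
 also have "P * (1 + I * ?X) - Q * (1 - I * ?X) =
  fps_const (2 * x + \<i> * of_real (b - a)) - fps_const (of_real (a + b)) * ?X"
  unfolding P_def Q_def I_def by (rule fps_ext) (auto simp: algebra_simps fps_X_def)
 finally have "(1 + ?X^2) * fps_deriv G = fps_const (2 * x + \<i> * of_real (b - a)) * G - fps_const (of_real (a + b)) * (?X * G)"
  by (simp add: algebra_simps)
 then have "fps_nth ((1 + ?X^2) * fps_deriv G) (Suc n) =
  fps_nth (fps_const (2 * x + \<i> * of_real (b - a)) * G - fps_const (of_real (a + b)) * (?X * G)) (Suc n)"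
  by simp
 moreover have "fps_nth ((1 + ?X^2) * fps_deriv G) (Suc n) = of_nat (n+2) * mp a b (n+2) x + of_nat n * mp a b n x"
  by (cases n) (auto simp: distrib_right fps_X_power_mult_nth mp_def G_def)
 ultimately show ?thesis
  by (simp add: mp_def G_def algebra_simps)
qed

text \<open>Built from the recurrence, not from the generating function, so that degree and leading
  coefficient follow by induction.\<close>

fun mp_poly :: "real \<Rightarrow> real \<Rightarrow> nat \<Rightarrow> complex poly" where
 "mp_poly a b 0 = 1"
| "mp_poly a b (Suc 0) = [: \<i> * of_real (b - a), 2 :]"
| "mp_poly a b (Suc (Suc n)) =
  Polynomial.smult (1 / of_nat (n + 2)) ([: \<i> * of_real (b - a), 2 :] * mp_poly a b (Suc n)
   - Polynomial.smult (of_nat n + of_real (a + b)) (mp_poly a b n))"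

lemma poly_mp_poly: "poly (mp_poly a b n) x = mp a b n x"
proof (induction a b n rule: mp_poly.induct)
 case (3 a b n)
 have nz: "complex_of_nat (n + 2) \<noteq> 0" unfolding of_nat_eq_0_iff by simp
 have "mp a b (n + 2) x = 1 / of_nat (n + 2) * (of_nat (n + 2) * mp a b (n + 2) x)"
  using nz by simp
 also have "\<dots> = poly (mp_poly a b (Suc (Suc n))) x"
  unfolding mp_rec using 3 by (simp add: algebra_simps)
 finally show ?case by simp
qed (auto simp: mp_1 algebra_simps)

lemma mp_poly_degree: "degree (mp_poly a b n) \<le> n"
proof (induction a b n rule: mp_poly.induct)
 case (3 a b n)
 then show ?case
  by (auto intro!: degree_smult_le[THEN order_trans] degree_diff_le degree_mult_le[THEN order_trans] simp del: mult_pCons_left)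
qed auto

lemma mp_poly_coeff: "coeff (mp_poly a b n) n = 2 ^ n / fact n"
proof (induction a b n rule: mp_poly.induct)
 case (3 a b n)
 have "coeff (mp_poly a b n) (Suc (Suc n)) = 0" "coeff (mp_poly a b (Suc n)) (Suc (Suc n)) = 0"
  using mp_poly_degree[of a b n] mp_poly_degree[of a b "Suc n"] by (auto intro!: coeff_eq_0)
 moreover have "fact (Suc (Suc n)) = (of_nat (n + 2) :: complex) * fact (Suc n)" by (simp add: algebra_simps)
 ultimately show ?case using 3 by (simp add: field_simps)
qed auto

lemma degree_mp_poly: "degree (mp_poly a b n) = n"
 using mp_poly_coeff[of a b n] mp_poly_degree[of a b n] le_degree[of "mp_poly a b n" n] by force

section \<open>WKB ansatz on the slit plane\<close>
text \<open>Image of \<open>slit_plane\<close> under \<open>1/z\<close>, with \<open>0\<close> added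
  for the point at infinity.\<close>

definition slit_disk :: "complex set" where
 "slit_disk = {p. Im p = 0 \<longrightarrow> \<bar>Re p\<bar> < 1}"

definition cc :: "complex \<Rightarrow> complex" where "cc p = csqrt (1 - p\<^sup>2)"
text \<open>Logarithm of the dominant root \<open>(1 + cc p)/2\<close> of
  \<open>t^2 - t + p^2/4 = 0\<close>, which is the recurrence \<open>mono_ratio_Suc\<close> with
  frozen coefficients and vanishing step. \<open>LL\<close>, its primitive with value
  \<open>0\<close> at \<open>0\<close>, is the WKB phase; \<open>AA\<close> is the amplitude solving
  the transport equation at the next order.\<close>

definition ell :: "complex \<Rightarrow> complex" where "ell p = Ln ((1 + cc p) / 2)"
definition LL :: "complex \<Rightarrow> complex" where "LL p = p * ell p + Arcsin p - p"
definition AA :: "real \<Rightarrow> complex \<Rightarrow> complex" where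
 "AA eta p = (ell p / 4 - Ln (cc p) / 2) + of_real eta * (\<i> * Arcsin p)"

lemma slit_disk_notin: "p \<in> slit_disk \<Longrightarrow> 1 - p\<^sup>2 \<notin> \<real>\<^sub>\<le>\<^sub>0"
proof
 assume p: "p \<in> slit_disk" and a: "1 - p\<^sup>2 \<in> \<real>\<^sub>\<le>\<^sub>0"
 have i: "Re p * Im p = 0" and r: "1 \<le> (Re p)\<^sup>2 - (Im p)\<^sup>2"
  using a by (auto simp: complex_nonpos_Reals_iff power2_eq_square)
 have "Re p \<noteq> 0"
 proof
  assume "Re p = 0"
  then have "1 \<le> - ((Im p)\<^sup>2)" using r by simp
  then show False using zero_le_power2[of "Im p"] by linarith
 qed
 then have "Im p = 0" using i by auto
 then have "\<bar>Re p\<bar> < 1" "1 \<le> (Re p)\<^sup>2" using p r by (auto simp: slit_disk_def)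
 then show False using abs_square_less_1[of "Re p"] by linarith
qed

lemma open_slit_disk: "open slit_disk"
proof -
 have "slit_disk = - ({p. Im p = 0} \<inter> {p. 1 \<le> \<bar>Re p\<bar>})"
  by (auto simp: slit_disk_def)
 moreover have "closed ({p. Im p = 0} \<inter> {p::complex. 1 \<le> \<bar>Re p\<bar>})"
  by (intro closed_Int closed_Collect_eq closed_Collect_le continuous_intros)
 ultimately show ?thesis by (metis open_Compl)
qed

lemma cc_sq [simp]: "(cc p)\<^sup>2 = 1 - p\<^sup>2" by (simp add: cc_def)

lemma Re_cc: "p \<in> slit_disk \<Longrightarrow> 0 < Re (cc p)"
proof -
 assume p: "p \<in> slit_disk"
 have "0 \<le> Re (cc p)" using csqrt_principal[of "1 - p\<^sup>2"] by (auto simp: cc_def)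
 moreover have "Re (cc p) \<noteq> 0"
 proof
  assume "Re (cc p) = 0"
  then have "(cc p)\<^sup>2 \<in> \<real>\<^sub>\<le>\<^sub>0" by (simp add: complex_nonpos_Reals_iff power2_eq_square)
  then show False using slit_disk_notin[OF p] by simp
 qed
 ultimately show ?thesis by simp
qed

lemma cc_nz: "p \<in> slit_disk \<Longrightarrow> cc p \<noteq> 0" using Re_cc by fastforce

lemma one_plus_cc: "p \<in> slit_disk \<Longrightarrow> 1 + cc p \<noteq> 0" "p \<in> slit_disk \<Longrightarrow> (1 + cc p) / 2 \<notin> \<real>\<^sub>\<le>\<^sub>0"
  "p \<in> slit_disk \<Longrightarrow> 1 < cmod (1 + cc p)"
proof -
 assume p: "p \<in> slit_disk"
 show "(1 + cc p) / 2 \<notin> \<real>\<^sub>\<le>\<^sub>0" using Re_cc[OF p] by (auto simp: complex_nonpos_Reals_iff)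
 have "1 < Re (1 + cc p)" using Re_cc[OF p] by simp
 also have "\<dots> \<le> cmod (1 + cc p)" by (rule complex_Re_le_cmod)
 finally show "1 < cmod (1 + cc p)" .
 then show "1 + cc p \<noteq> 0" by auto
qed

lemma cc_deriv: "p \<in> slit_disk \<Longrightarrow> (cc has_field_derivative (- p / cc p)) (at p)"
proof -
 assume p: "p \<in> slit_disk"
 have "((\<lambda>p. 1 - p\<^sup>2) has_field_derivative (- (2 * p))) (at p)"
  by (auto intro!: derivative_eq_intros)
 then have "((\<lambda>p. csqrt (1 - p\<^sup>2)) has_field_derivative (- (2 * p)) / (2 * csqrt (1 - p\<^sup>2))) (at p)"
  by (rule has_field_derivative_csqrt') (rule slit_disk_notin[OF p])
 then show ?thesis by (simp add: cc_def[abs_def])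
qed

lemma exp_Arcsin: "exp (\<i> * Arcsin p) = cc p + \<i> * p" "exp (- (\<i> * Arcsin p)) = cc p - \<i> * p"
proof -
 show 1: "exp (\<i> * Arcsin p) = cc p + \<i> * p"
  using Arcsin_body_lemma[of p] by (simp add: Arcsin_def cc_def add.commute)
 have "(cc p + \<i> * p) * (cc p - \<i> * p) = (cc p)\<^sup>2 + p\<^sup>2"
  by (simp add: algebra_simps power2_eq_square)
 then have "(cc p + \<i> * p) * (cc p - \<i> * p) = 1" by simp
 then show "exp (- (\<i> * Arcsin p)) = cc p - \<i> * p"
  by (simp add: exp_minus 1 inverse_unique)
qed

lemma cos_Arcsin_cc: "cos (Arcsin p) = cc p"
 using exp_Arcsin[of p] by (simp add: cos_exp_eq)

lemma Arcsin_deriv: "p \<in> slit_disk \<Longrightarrow> (Arcsin has_field_derivative (1 / cc p)) (at p)"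
 using has_field_derivative_Arcsin[of p]
 by (simp add: slit_disk_def cos_Arcsin_cc divide_inverse)

lemma ell_deriv: "p \<in> slit_disk \<Longrightarrow> (ell has_field_derivative (- p / (cc p * (1 + cc p)))) (at p)"
proof -
 assume p: "p \<in> slit_disk"
 have "((\<lambda>p. (1 + cc p) / 2) has_field_derivative ((0 + - p / cc p) / 2)) (at p)"
  by (intro DERIV_cdivide DERIV_add DERIV_const cc_deriv p)
 from DERIV_chain2[OF has_field_derivative_Ln[OF one_plus_cc(2)[OF p]] this]
 show ?thesis using one_plus_cc(1)[OF p] cc_nz[OF p] by (simp add: ell_def[abs_def] divide_simps mult.commute)
qed

lemma LL_deriv: "p \<in> slit_disk \<Longrightarrow> (LL has_field_derivative ell p) (at p)"
proof -
 assume p: "p \<in> slit_disk"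
 note [simp] = cc_nz[OF p] one_plus_cc(1)[OF p]
 have "p * (- p / (cc p * (1 + cc p))) = - (1 - (cc p)\<^sup>2) / (cc p * (1 + cc p))"
  by (simp only: cc_sq) (simp add: power2_eq_square)
 also have "\<dots> = 1 - 1 / cc p" by (simp add: divide_simps del: cc_sq) (simp add: algebra_simps power2_eq_square del: cc_sq)
 finally have e: "p * (- p / (cc p * (1 + cc p))) = 1 - 1 / cc p" .
 have "(LL has_field_derivative (1 * ell p + (- p / (cc p * (1 + cc p))) * p + 1 / cc p - 1)) (at p)"
  unfolding LL_def[abs_def]
  by (intro DERIV_diff DERIV_add DERIV_mult ell_deriv Arcsin_deriv p DERIV_ident)
 moreover have "1 * ell p + (- p / (cc p * (1 + cc p))) * p + 1 / cc p - 1 = ell p + (p * (- p / (cc p * (1 + cc p))) - (1 - 1 / cc p))"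
  by (simp add: algebra_simps)
 ultimately show ?thesis unfolding e diff_self add_0_right by argo
qed

definition A0 :: "complex \<Rightarrow> complex" where "A0 p = ell p / 4 - Ln (cc p) / 2"
definition A0' :: "complex \<Rightarrow> complex" where
 "A0' p = - p / (cc p * (1 + cc p)) / 4 + p / (cc p)\<^sup>2 / 2"

lemma A0_deriv: "p \<in> slit_disk \<Longrightarrow> (A0 has_field_derivative A0' p) (at p)"
proof -
 assume p: "p \<in> slit_disk"
 have "cc p \<notin> \<real>\<^sub>\<le>\<^sub>0" using Re_cc[OF p] by (auto simp: complex_nonpos_Reals_iff)
 then have "((\<lambda>p. Ln (cc p)) has_field_derivative (- p / cc p) / cc p) (at p)"
  using DERIV_chain2[OF has_field_derivative_Ln cc_deriv[OF p]] by (simp add: divide_simps)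
 then have "(A0 has_field_derivative (- p / (cc p * (1 + cc p))) / 4 - ((- p / cc p) / cc p) / 2) (at p)"
  unfolding A0_def[abs_def]
  by (intro DERIV_diff DERIV_cdivide ell_deriv p)
 then show ?thesis by (simp add: A0'_def power2_eq_square)
qed

lemma AA_A0: "AA eta p = A0 p + of_real eta * (\<i> * Arcsin p)" by (simp add: AA_def A0_def)

lemma holo_from_deriv:
 "(\<And>p. p \<in> slit_disk \<Longrightarrow> (f has_field_derivative f' p) (at p)) \<Longrightarrow> f holomorphic_on slit_disk"
 by (auto simp: holomorphic_on_open[OF open_slit_disk])

section \<open>Uniform Taylor expansion of the ansatz and its residual in one recurrence
  step\<close>

lemma taylor_uniform:
 assumes f: "f holomorphic_on slit_disk" and S: "compact S" "S \<subseteq> slit_disk"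
 shows "\<exists>C\<ge>0. \<forall>p h. closed_segment p (p + h) \<subseteq> S \<longrightarrow>
  cmod (f (p + h) - (\<Sum>i\<le>n. (deriv ^^ i) f p * h ^ i / fact i)) \<le> C * cmod h ^ Suc n"
proof -
 have hol: "(deriv ^^ i) f holomorphic_on slit_disk" for i
  by (rule holomorphic_higher_deriv[OF f open_slit_disk])
 have "continuous_on S ((deriv ^^ Suc n) f)"
  using hol S(2) holomorphic_on_imp_continuous_on continuous_on_subset by blast
 then have "bounded ((deriv ^^ Suc n) f ` S)"
  using S(1) compact_continuous_image compact_imp_bounded by blast
 then obtain B where B: "\<And>x. x \<in> S \<Longrightarrow> cmod ((deriv ^^ Suc n) f x) \<le> B" "B > 0"
  unfolding bounded_pos by (metis image_eqI)
 show ?thesis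
 proof (intro exI[of _ "B / fact n"] conjI allI impI)
  fix p h assume sg: "closed_segment p (p + h) \<subseteq> S"
  have "cmod ((deriv ^^ 0) f (p + h) - (\<Sum>i\<le>n. (deriv ^^ i) f p * (p + h - p) ^ i / fact i))
    \<le> B * cmod (p + h - p) ^ Suc n / fact n"
  proof (rule complex_Taylor[where S = "closed_segment p (p + h)" and f = "\<lambda>i. (deriv ^^ i) f"])
   fix i x assume x: "x \<in> closed_segment p (p + h)"
   then have "x \<in> slit_disk" using sg S(2) by auto
   then have "((deriv ^^ i) f has_field_derivative (deriv ^^ Suc i) f x) (at x)"
    using hol[of i] open_slit_disk by (simp add: holomorphic_derivI)
   then show "((deriv ^^ i) f has_field_derivative (deriv ^^ Suc i) f x) (at x within closed_segment p (p + h))"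
    by (rule has_field_derivative_at_within)
  qed (use sg B in auto)
  then show "cmod (f (p + h) - (\<Sum>i\<le>n. (deriv ^^ i) f p * h ^ i / fact i)) \<le> B / fact n * cmod h ^ Suc n"
   by simp
 qed (use B in auto)
qed

lemma deriv_LL: "p \<in> slit_disk \<Longrightarrow> deriv LL p = ell p"
 by (rule DERIV_imp_deriv[OF LL_deriv])

lemma deriv2_LL: "p \<in> slit_disk \<Longrightarrow> deriv (deriv LL) p = - p / (cc p * (1 + cc p))"
proof -
 assume p: "p \<in> slit_disk"
 have "(deriv LL has_field_derivative (- p / (cc p * (1 + cc p)))) (at p)"
  by (rule has_field_derivative_transform_within_open[OF ell_deriv[OF p] open_slit_disk p])
   (simp add: deriv_LL)
 then show ?thesis by (rule DERIV_imp_deriv)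
qed

lemma exp_second_order:
 fixes w :: complex assumes "cmod w \<le> 1" shows "cmod (exp w - (1 + w)) \<le> 3 * (cmod w)\<^sup>2"
proof -
 have "cmod (exp w - (\<Sum>i\<le>1. (w ^ i) / (fact i))) \<le> exp \<bar>Re w\<bar> * (cmod w) ^ Suc 1 / fact 1"
  by (rule Taylor_exp)
 also have "\<dots> \<le> 3 * (cmod w)\<^sup>2"
 proof -
  have "exp \<bar>Re w\<bar> \<le> exp 1" using assms abs_Re_le_cmod[of w] by simp
  also have "\<dots> \<le> 3" by (rule exp_le)
  finally show ?thesis by (simp add: power2_eq_square mult_right_mono)
 qed
 finally show ?thesis by simp
qed

lemma bounded_on_compact:
 fixes f :: "complex \<Rightarrow> complex"
 assumes "continuous_on slit_disk f" "compact S" "S \<subseteq> slit_disk"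
 shows "\<exists>B\<ge>0. \<forall>p\<in>S. cmod (f p) \<le> B"
proof -
 have "bounded (f ` S)"
  by (intro compact_imp_bounded compact_continuous_image continuous_on_subset[OF assms(1,3)] assms(2))
 then obtain B where "\<And>p. p \<in> S \<Longrightarrow> cmod (f p) \<le> B" by (auto simp: bounded_iff)
 then show ?thesis by (intro exI[of _ "max 0 B"]) (auto simp: le_max_iff_disj)
qed

lemma continuous_cc: "continuous_on slit_disk cc"
 by (intro continuous_at_imp_continuous_on ballI DERIV_isCont[OF cc_deriv])

text \<open>With \<open>p = k/x\<close> and \<open>h = 1/x\<close>, \<open>exp (D1 eta p h)\<close>
  and \<open>exp (D2 eta p h)\<close> are the quotients of the ansatz at \<open>k + 1\<close> and at
  \<open>k - 1\<close> by its value at \<open>k\<close>; see \<open>wkb_ratio\<close>.\<close>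

definition D1 where "D1 eta p h = (LL (p + h) - LL p) / h + (AA eta (p + h) - AA eta p)"
definition D2 where "D2 eta p h = (LL (p - h) - LL p) / h + (AA eta (p - h) - AA eta p)"

text \<open>\<open>u\<close> and \<open>v\<close> are the first-order Taylor coefficients of the two
  exponents. The closing identity is the transport equation, that is, the vanishing of the
  order-\<open>h\<close> term of the recurrence; it is what determines \<open>AA\<close>. Hiding the
  derivatives behind \<open>u\<close> and \<open>v\<close> leaves only the facts that the step
  estimate uses.\<close>

lemma wkb_expansion:
 assumes S: "compact S" "S \<subseteq> slit_disk"
 shows "\<exists>U T. 0 \<le> U \<and> 0 \<le> T \<and> (\<forall>p h eta. h \<noteq> 0 \<and> 0 \<le> eta \<and> eta \<le> 1 \<and> closed_segment p (p + h) \<subseteq> S \<and> closed_segment p (p - h) \<subseteq> S \<longrightarrow>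
  (\<exists>u v. cmod u \<le> U \<and> cmod v \<le> U \<and> cmod (D1 eta p h - (ell p + h * u)) \<le> T * (cmod h)\<^sup>2
    \<and> cmod (D2 eta p h - (- ell p + h * v)) \<le> T * (cmod h)\<^sup>2
    \<and> (1 + cc p) / 2 * u + (1 - cc p) / 2 * v - p / (4 * (1 + cc p)) = \<i> * of_real eta))"
proof -
 have hol: "LL holomorphic_on slit_disk" "A0 holomorphic_on slit_disk" "Arcsin holomorphic_on slit_disk"
  by (auto intro!: holo_from_deriv LL_deriv A0_deriv Arcsin_deriv)
 obtain C1 where C1: "C1 \<ge> 0" "\<And>p h. closed_segment p (p + h) \<subseteq> S \<Longrightarrow>
  cmod (LL (p + h) - (\<Sum>i\<le>2. (deriv ^^ i) LL p * h ^ i / fact i)) \<le> C1 * cmod h ^ Suc 2"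
  using taylor_uniform[OF hol(1) S, of 2] by blast
 obtain C2 where C2: "C2 \<ge> 0" "\<And>p h. closed_segment p (p + h) \<subseteq> S \<Longrightarrow>
  cmod (A0 (p + h) - (\<Sum>i\<le>1. (deriv ^^ i) A0 p * h ^ i / fact i)) \<le> C2 * cmod h ^ Suc 1"
  using taylor_uniform[OF hol(2) S, of 1] by blast
 obtain C3 where C3: "C3 \<ge> 0" "\<And>p h. closed_segment p (p + h) \<subseteq> S \<Longrightarrow>
  cmod (Arcsin (p + h) - (\<Sum>i\<le>1. (deriv ^^ i) Arcsin p * h ^ i / fact i)) \<le> C3 * cmod h ^ Suc 1"
  using taylor_uniform[OF hol(3) S, of 1] by blast
 define l' where "l' p = - p / (cc p * (1 + cc p))" for p
 have cl: "continuous_on slit_disk l'" "continuous_on slit_disk A0'" "continuous_on slit_disk (\<lambda>p. 1 / cc p)"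
  unfolding l'_def A0'_def by (auto intro!: continuous_intros continuous_cc simp: cc_nz one_plus_cc simp del: cc_sq)
 obtain B1 where B1: "B1 \<ge> 0" "\<And>p. p \<in> S \<Longrightarrow> cmod (l' p) \<le> B1"
  using bounded_on_compact[OF cl(1) S] by blast
 obtain B2 where B2: "B2 \<ge> 0" "\<And>p. p \<in> S \<Longrightarrow> cmod (A0' p) \<le> B2"
  using bounded_on_compact[OF cl(2) S] by blast
 obtain B3 where B3: "B3 \<ge> 0" "\<And>p. p \<in> S \<Longrightarrow> cmod (1 / cc p) \<le> B3"
  using bounded_on_compact[OF cl(3) S] by blast
 show ?thesis
 proof (rule exI[of _ "B1 / 2 + B2 + B3"], rule exI[of _ "C1 + C2 + C3"], intro conjI allI impI)
  fix p h :: complex and eta :: real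
  assume A: "h \<noteq> 0 \<and> 0 \<le> eta \<and> eta \<le> 1 \<and> closed_segment p (p + h) \<subseteq> S \<and> closed_segment p (p - h) \<subseteq> S"
  then have pS: "p \<in> S" by auto
  then have p: "p \<in> slit_disk" using S by auto
  define A' where "A' = A0' p + of_real eta * (\<i> * (1 / cc p))"
  have A'b: "cmod A' \<le> B2 + B3"
  proof -
   have "cmod A' \<le> cmod (A0' p) + \<bar>eta\<bar> * cmod (1 / cc p)"
    unfolding A'_def by (rule norm_triangle_ineq[THEN order_trans]) (simp add: norm_mult norm_divide)
   also have "\<dots> \<le> B2 + 1 * B3"
    using A pS B2 B3 by (intro add_mono mult_mono) auto
   finally show ?thesis by simp
  qed
  have tay: "cmod ((LL (p + k) - LL p) / k - ell p - l' p * k / 2) \<le> C1 * (cmod k)\<^sup>2"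
    "cmod (AA eta (p + k) - AA eta p - A' * k) \<le> (C2 + C3) * (cmod k)\<^sup>2"
   if k: "closed_segment p (p + k) \<subseteq> S" "k \<noteq> 0" for k
  proof -
   have "cmod (LL (p + k) - LL p - ell p * k - l' p * k\<^sup>2 / 2) \<le> C1 * cmod k ^ 3"
    using C1(2)[OF k(1)] by (simp add: numeral_2_eq_2 numeral_3_eq_3 deriv_LL[OF p] deriv2_LL[OF p] l'_def algebra_simps)
   moreover have "LL (p + k) - LL p - ell p * k - l' p * k\<^sup>2 / 2 = ((LL (p + k) - LL p) / k - ell p - l' p * k / 2) * k"
    using k by (simp add: field_simps power2_eq_square)
   ultimately have "cmod ((LL (p + k) - LL p) / k - ell p - l' p * k / 2) * cmod k \<le> C1 * (cmod k)\<^sup>2 * cmod k"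
    by (simp add: norm_mult power2_eq_square power3_eq_cube mult_ac)
   then show "cmod ((LL (p + k) - LL p) / k - ell p - l' p * k / 2) \<le> C1 * (cmod k)\<^sup>2"
    using k by simp
   have 1: "cmod (A0 (p + k) - A0 p - A0' p * k) \<le> C2 * (cmod k)\<^sup>2"
    using C2(2)[OF k(1)] by (simp add: numeral_2_eq_2 DERIV_imp_deriv[OF A0_deriv[OF p]] diff_diff_eq)
   have 2: "cmod (Arcsin (p + k) - Arcsin p - 1 / cc p * k) \<le> C3 * (cmod k)\<^sup>2"
    using C3(2)[OF k(1)] by (simp add: numeral_2_eq_2 DERIV_imp_deriv[OF Arcsin_deriv[OF p]] diff_diff_eq)
   have "AA eta (p + k) - AA eta p - A' * k = (A0 (p + k) - A0 p - A0' p * k)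
     + of_real eta * \<i> * (Arcsin (p + k) - Arcsin p - 1 / cc p * k)"
    by (simp add: AA_A0 A'_def algebra_simps)
   also have "cmod \<dots> \<le> cmod (A0 (p + k) - A0 p - A0' p * k) + \<bar>eta\<bar> * cmod (Arcsin (p + k) - Arcsin p - 1 / cc p * k)"
    by (rule norm_triangle_ineq[THEN order_trans]) (simp add: norm_mult)
   also have "\<dots> \<le> C2 * (cmod k)\<^sup>2 + 1 * (C3 * (cmod k)\<^sup>2)"
    using A by (intro add_mono mult_mono 1 2) auto
   finally show "cmod (AA eta (p + k) - AA eta p - A' * k) \<le> (C2 + C3) * (cmod k)\<^sup>2"
    by (simp add: algebra_simps)
  qed
  note t1 = tay[of h] and t2 = tay[of "- h"]
  show "\<exists>u v. cmod u \<le> B1 / 2 + B2 + B3 \<and> cmod v \<le> B1 / 2 + B2 + B3 \<and>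
    cmod (D1 eta p h - (ell p + h * u)) \<le> (C1 + C2 + C3) * (cmod h)\<^sup>2
    \<and> cmod (D2 eta p h - (- ell p + h * v)) \<le> (C1 + C2 + C3) * (cmod h)\<^sup>2
    \<and> (1 + cc p) / 2 * u + (1 - cc p) / 2 * v - p / (4 * (1 + cc p)) = \<i> * of_real eta"
  proof (rule exI[of _ "l' p / 2 + A'"], rule exI[of _ "l' p / 2 - A'"], intro conjI)
   have "cmod (l' p / 2) \<le> B1 / 2" using B1(2)[OF pS] by (simp add: norm_divide)
   then show "cmod (l' p / 2 + A') \<le> B1 / 2 + B2 + B3" "cmod (l' p / 2 - A') \<le> B1 / 2 + B2 + B3"
    using A'b norm_triangle_ineq[of "l' p / 2" A'] norm_triangle_ineq4[of "l' p / 2" A'] by linarith+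
   have "D1 eta p h - (ell p + h * (l' p / 2 + A')) =
    ((LL (p + h) - LL p) / h - ell p - l' p * h / 2) + (AA eta (p + h) - AA eta p - A' * h)"
    by (simp add: D1_def algebra_simps)
   also have "cmod \<dots> \<le> C1 * (cmod h)\<^sup>2 + (C2 + C3) * (cmod h)\<^sup>2"
    using t1 A by (intro norm_triangle_mono) auto
   finally show "cmod (D1 eta p h - (ell p + h * (l' p / 2 + A'))) \<le> (C1 + C2 + C3) * (cmod h)\<^sup>2"
    by (simp add: algebra_simps)
   have "D2 eta p h - (- ell p + h * (l' p / 2 - A')) =
    (AA eta (p + - h) - AA eta p - A' * (- h)) - ((LL (p + - h) - LL p) / (- h) - ell p - l' p * (- h) / 2)"
    by (simp add: D2_def algebra_simps)
   also have "cmod \<dots> \<le> (C2 + C3) * (cmod h)\<^sup>2 + C1 * (cmod h)\<^sup>2"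
    by (rule norm_triangle_le_diff, rule add_mono) (use t2 A in auto)
   finally show "cmod (D2 eta p h - (- ell p + h * (l' p / 2 - A'))) \<le> (C1 + C2 + C3) * (cmod h)\<^sup>2"
    by (simp add: algebra_simps)
   define c where "c = cc p"
   have c: "c \<noteq> 0" "1 + c \<noteq> 0" using cc_nz[OF p] one_plus_cc(1)[OF p] by (auto simp: c_def)
   have "4 + c * 4 = 4 * (1 + c)" by simp
   then have c4: "4 + c * 4 \<noteq> 0" using c by (metis mult_eq_0_iff zero_neq_numeral)
   have "(1 + c) / 2 * (l' p / 2 + A') + (1 - c) / 2 * (l' p / 2 - A') - p / (4 * (1 + c)) = l' p / 2 + c * A' - p / (4 * (1 + c))"
    by (simp add: field_simps)
   also have "\<dots> = \<i> * of_real eta"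
    using c c4 unfolding l'_def A'_def A0'_def c_def[symmetric] by (simp add: divide_simps) (simp add: algebra_simps power2_eq_square)
   finally show "(1 + cc p) / 2 * (l' p / 2 + A') + (1 - cc p) / 2 * (l' p / 2 - A') - p / (4 * (1 + cc p)) = \<i> * of_real eta"
    by (simp add: c_def)
  qed
 qed (use B1 B2 B3 C1 C2 C3 in auto)
qed

text \<open>Four facts about one step: the residual of the recurrence is \<open>O(h^2)\<close>; the
  recessive coefficient is smaller than the dominant one by a fixed factor \<open>r\<close>, which
  gives stability; the dominant quotient stays away from \<open>0\<close>; and the terms multiplied
  by \<open>(2x)^k / k!\<close> grow at least geometrically, which later controls the Christoffel
  sum.\<close>

lemma wkb_step:
 assumes S: "compact S" "S \<subseteq> slit_disk"
 shows "\<exists>C h0 r. 0 < C \<and> 0 < h0 \<and> 0 < r \<and> r < 1 \<and> (\<forall>p h eta. h \<noteq> 0 \<and> cmod h \<le> h0 \<and> 0 \<le> eta \<and> eta \<le> 1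
  \<and> closed_segment p (p + h) \<subseteq> S \<and> closed_segment p (p - h) \<subseteq> S \<longrightarrow>
  cmod (exp (D1 eta p h) + (p\<^sup>2 / 4 - p * h / 8) * exp (D2 eta p h) - 1 - \<i> * of_real eta * h) \<le> C * (cmod h)\<^sup>2 \<and>
  cmod ((p\<^sup>2 / 4 - p * h / 8) * exp (D2 eta p h)) \<le> r * cmod (exp (D1 eta p h)) \<and>
  1 / 4 \<le> cmod (exp (D1 eta p h)) \<and> cmod (p + h) \<le> r * (2 * cmod (exp (D1 eta p h))))"
proof -
 obtain U T where UT: "0 \<le> U" "0 \<le> T" "\<And>p h eta. h \<noteq> 0 \<and> 0 \<le> eta \<and> eta \<le> 1 \<and> closed_segment p (p + h) \<subseteq> S \<and> closed_segment p (p - h) \<subseteq> S \<Longrightarrow>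
  (\<exists>u v. cmod u \<le> U \<and> cmod v \<le> U \<and> cmod (D1 eta p h - (ell p + h * u)) \<le> T * (cmod h)\<^sup>2
    \<and> cmod (D2 eta p h - (- ell p + h * v)) \<le> T * (cmod h)\<^sup>2
    \<and> (1 + cc p) / 2 * u + (1 - cc p) / 2 * v - p / (4 * (1 + cc p)) = \<i> * of_real eta)"
  using wkb_expansion[OF S] by blast
 obtain B4 where B4: "B4 \<ge> 0" "\<And>p. p \<in> S \<Longrightarrow> cmod p \<le> B4"
  using bounded_on_compact[OF continuous_on_id S] by blast
 have "continuous_on slit_disk (\<lambda>p. (1 + cc p) / 2)" by (intro continuous_intros continuous_cc) auto
 from bounded_on_compact[OF this S] obtain B5 where B5: "B5 \<ge> 0" "\<And>p. p \<in> S \<Longrightarrow> cmod ((1 + cc p) / 2) \<le> B5"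
  by blast
 \<comment> \<open>On a compact set \<open>|1 - cc p| / |1 + cc p|\<close> has a maximum, below
   \<open>1\<close> because \<open>Re (cc p) > 0\<close>. The square \<open>s^2\<close> is used
   since \<open>|p|^2 = 4 |P| |Qm|\<close> then yields \<open>|p| <= 2 s |P|\<close>.\<close>
 have "\<exists>s. 0 < s \<and> s < 1 \<and> (\<forall>p\<in>S. cmod (1 - cc p) \<le> s\<^sup>2 * cmod (1 + cc p))"
 proof (cases "S = {}")
  case False
  have "continuous_on S (\<lambda>p. cmod ((1 - cc p) / (1 + cc p)))"
   using S(2) one_plus_cc(1) by (intro continuous_intros continuous_on_subset[OF continuous_cc S(2)]) auto
  from continuous_attains_sup[OF S(1) False this] obtain p0 where p0: "p0 \<in> S"
   "\<And>p. p \<in> S \<Longrightarrow> cmod ((1 - cc p) / (1 + cc p)) \<le> cmod ((1 - cc p0) / (1 + cc p0))" by blast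
  have pos: "0 < Re (cc p0)" using Re_cc p0(1) S(2) by blast
  have "(cmod (1 - cc p0))\<^sup>2 < (cmod (1 + cc p0))\<^sup>2"
   unfolding cmod_power2 using pos by (simp add: power2_eq_square algebra_simps)
  then have "cmod (1 - cc p0) < cmod (1 + cc p0)" by (simp add: power2_less_imp_less)
  then have lt: "cmod ((1 - cc p0) / (1 + cc p0)) < 1"
   by (simp add: norm_divide divide_less_eq_1)
  define q where "q = cmod ((1 - cc p0) / (1 + cc p0))"
  define s where "s = sqrt ((1 + q) / 2)"
  have q: "0 \<le> q" "q < 1" using lt by (auto simp: q_def)
  have s2: "s\<^sup>2 = (1 + q) / 2" using q by (simp add: s_def)
  show ?thesis
  proof (intro exI[of _ s] conjI ballI)
   show "0 < s" "s < 1" using q by (auto simp: s_def real_sqrt_lt_1_iff)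
   fix p assume p: "p \<in> S"
   have "cmod (1 - cc p) / cmod (1 + cc p) \<le> q"
    using p0(2)[OF p] unfolding q_def[symmetric] by (simp add: norm_divide)
   also have "q \<le> s\<^sup>2" using q unfolding s2 by simp
   finally have "cmod (1 - cc p) / cmod (1 + cc p) \<le> s\<^sup>2" .
   moreover have "0 < cmod (1 + cc p)" using one_plus_cc(1) p S(2) by auto
   ultimately show "cmod (1 - cc p) \<le> s\<^sup>2 * cmod (1 + cc p)" by (simp add: divide_le_eq)
  qed
 qed (auto intro: exI[of _ "1/2"])
 then obtain s where s: "0 < s" "s < 1" "\<And>p. p \<in> S \<Longrightarrow> cmod (1 - cc p) \<le> s\<^sup>2 * cmod (1 + cc p)" by blast
 define V where "V = U + T"
 define X where "X = 3 * V\<^sup>2 + T"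
 define B6 where "B6 = B4\<^sup>2 / 4 + B4 / 8"
 define C where "C = B5 * X + 2 * B6 * X + B4 * U / 4 + 1"
 define W where "W = B5 * U + B4 / 4 + C"
 \<comment> \<open>The second bound keeps the exponents below \<open>1\<close> in modulus, as
   \<open>exp_second_order\<close> requires; the third makes the total first-order perturbation
   \<open>W * m\<close> at most an eighth of the gap \<open>1 - s\<close>, so that
   \<open>r = (1 + s)/2\<close> still separates the two roots.\<close>
 define h0 where "h0 = min 1 (min (1 / (V + 1)) ((1 - s) / (8 * W)))"
 have nn: "0 \<le> V" "0 \<le> X" "0 \<le> B6" "0 < C" "1 \<le> C" using UT B4 B5 by (auto simp: V_def X_def B6_def C_def add_nonneg_pos)
 have W: "1 \<le> W" "0 < W" using nn UT B4 B5 by (auto simp: W_def intro!: add_nonneg_pos add_increasing)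
 have h0: "0 < h0" using nn W s by (auto simp: h0_def)
 define r where "r = (1 + s) / 2"
 show ?thesis
 proof (rule exI[of _ C], rule exI[of _ h0], rule exI[of _ r], intro conjI allI impI)
  show "0 < C" "0 < h0" "0 < r" "r < 1" using nn h0 s by (auto simp: r_def)
  fix p h :: complex and eta :: real
  assume A: "h \<noteq> 0 \<and> cmod h \<le> h0 \<and> 0 \<le> eta \<and> eta \<le> 1
  \<and> closed_segment p (p + h) \<subseteq> S \<and> closed_segment p (p - h) \<subseteq> S"
  define m where "m = cmod h"
  have pS: "p \<in> S" using A by auto
  then have p: "p \<in> slit_disk" using S by auto
  have m: "0 < m" "m \<le> 1" "m \<le> 1 / (V + 1)" "m \<le> (1 - s) / (8 * W)" using A by (auto simp: m_def h0_def)
  have m2: "m\<^sup>2 \<le> m" using m by (simp add: power2_eq_square mult_left_le)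
  obtain u v where uv: "cmod u \<le> U" "cmod v \<le> U" "cmod (D1 eta p h - (ell p + h * u)) \<le> T * m\<^sup>2"
    "cmod (D2 eta p h - (- ell p + h * v)) \<le> T * m\<^sup>2"
    "(1 + cc p) / 2 * u + (1 - cc p) / 2 * v - p / (4 * (1 + cc p)) = \<i> * of_real eta"
   using UT(3)[of h eta p] A by (auto simp: m_def)
  have ex: "cmod (exp w - (1 + h * x)) \<le> X * m\<^sup>2" if "cmod x \<le> U" "cmod (w - h * x) \<le> T * m\<^sup>2" for w x
  proof -
   have hx: "cmod (h * x) \<le> U * m" using that(1) m by (simp add: norm_mult m_def mult_mono mult.commute)
   have "T * m\<^sup>2 \<le> T * m" using UT m2 by (intro mult_left_mono)
   then have "cmod w \<le> V * m" using hx that(2) norm_triangle_sub[of w "h * x"] by (simp add: V_def algebra_simps)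
   moreover have "V * m \<le> 1"
   proof -
    have "V * m \<le> (V + 1) * (1 / (V + 1))" using m nn by (intro mult_mono) auto
    then show ?thesis using nn by simp
   qed
   ultimately have "cmod (exp w - (1 + w)) \<le> 3 * (cmod w)\<^sup>2" "(cmod w)\<^sup>2 \<le> (V * m)\<^sup>2"
    by (auto intro!: exp_second_order power_mono)
   then have "cmod (exp w - (1 + w)) \<le> 3 * V\<^sup>2 * m\<^sup>2" by (simp add: power_mult_distrib)
   moreover have "exp w - (1 + h * x) = (exp w - (1 + w)) + (w - h * x)" by simp
   ultimately show ?thesis
    using that(2) norm_triangle_ineq[of "exp w - (1 + w)" "w - h * x"] by (simp add: X_def algebra_simps)
  qed
  define P where "P = (1 + cc p) / 2"
  define Qm where "Qm = (1 - cc p) / 2"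
  have P: "P \<noteq> 0" "1 / 2 < cmod P" "cmod P \<le> B5" "exp (ell p) = P"
   using one_plus_cc[OF p] B5(2)[OF pS] by (auto simp: P_def ell_def norm_divide)
  have invP: "cmod (1 / P) \<le> 2" using P by (simp add: norm_divide divide_le_eq)
  have PQ: "P * Qm = p\<^sup>2 / 4"
  proof -
   have "P * Qm = (1 - (cc p)\<^sup>2) / 4" unfolding P_def Qm_def by (simp add: field_simps power2_eq_square del: cc_sq)
   then show ?thesis by simp
  qed
  have QP: "cmod Qm \<le> s\<^sup>2 * cmod P" using s(3)[OF pS] by (simp add: P_def Qm_def norm_divide)
  have s21: "s\<^sup>2 \<le> s" using s by (simp add: power2_eq_square mult_left_le)
  define b where "b = p\<^sup>2 / 4 - p * h / 8"
  have pb: "cmod p \<le> B4" using B4 pS by auto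
  have bb: "cmod b \<le> B6"
  proof -
   have "cmod b \<le> cmod (p\<^sup>2 / 4) + cmod (p * h / 8)" unfolding b_def by (rule norm_triangle_ineq4)
   also have "\<dots> = (cmod p)\<^sup>2 / 4 + cmod p * m / 8" by (simp add: norm_divide norm_power norm_mult m_def)
   also have "\<dots> \<le> B4\<^sup>2 / 4 + B4 * 1 / 8" using pb m B4 by (intro add_mono divide_right_mono power_mono mult_mono) auto
   finally show ?thesis by (simp add: B6_def)
  qed
  define R1 where "R1 = exp (D1 eta p h) - P * (1 + h * u)"
  define R2 where "R2 = exp (D2 eta p h) - 1 / P * (1 + h * v)"
  have R1: "cmod R1 \<le> B5 * X * m\<^sup>2"
  proof -
   have "R1 = P * (exp (D1 eta p h - ell p) - (1 + h * u))"
    using P by (simp add: R1_def exp_diff algebra_simps)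
   also have "cmod \<dots> \<le> B5 * (X * m\<^sup>2)"
    unfolding norm_mult using P B5 uv by (intro mult_mono ex) (auto simp: algebra_simps)
   finally show ?thesis by (simp add: mult_ac)
  qed
  have R2: "cmod R2 \<le> 2 * X * m\<^sup>2"
  proof -
   have "R2 = 1 / P * (exp (D2 eta p h + ell p) - (1 + h * v))"
    using P by (simp add: R2_def exp_add algebra_simps)
   also have "cmod \<dots> \<le> 2 * (X * m\<^sup>2)"
    unfolding norm_mult using invP uv by (intro mult_mono ex) (auto simp: algebra_simps)
   finally show ?thesis by (simp add: mult_ac)
  qed
  have bR2: "cmod (b * R2) \<le> 2 * B6 * X * m\<^sup>2"
  proof -
   have "cmod (b * R2) \<le> B6 * (2 * X * m\<^sup>2)" unfolding norm_mult using bb R2 nn by (intro mult_mono) auto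
   then show ?thesis by (simp add: mult_ac)
  qed
  have bP: "b * (1 / P * (1 + h * v)) = Qm * (1 + h * v) - p * h / (8 * P) - p * h / (8 * P) * h * v"
  proof -
   have "b = P * Qm - p * h / 8" by (simp add: b_def PQ)
   then have "b * (1 / P * (1 + h * v)) = (P * Qm - p * h / 8) * (1 / P * (1 + h * v))" by simp
   also have "\<dots> = Qm * (1 + h * v) - p * h / (8 * P) - p * h / (8 * P) * h * v"
    using P(1) by (simp add: divide_simps) (simp add: algebra_simps)
   finally show ?thesis .
  qed
  have sm: "cmod (p * h / (8 * P) * h * v) \<le> B4 * U / 4 * m\<^sup>2"
  proof -
   have "cmod (p * h / (8 * P) * h * v) = (cmod p * cmod (1 / P)) * (cmod v * m\<^sup>2) / 8"
    by (simp add: norm_mult norm_divide m_def power2_eq_square mult_ac)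
   also have "\<dots> \<le> (B4 * 2) * (U * m\<^sup>2) / 8"
    using pb invP uv B4 UT by (intro divide_right_mono mult_mono) auto
   finally show ?thesis by simp
  qed
  have key: "P * u + Qm * v - p / (8 * P) = \<i> * of_real eta"
  proof -
   have "8 * P = 4 * (1 + cc p)" by (simp add: P_def)
   then show ?thesis using uv(5) unfolding P_def[symmetric] Qm_def[symmetric] by simp
  qed
  \<comment> \<open>The order-zero part cancels by \<open>P + Qm = 1\<close> and the
    order-\<open>h\<close> part by \<open>key\<close>, so only remainders of size \<open>h^2\<close>
    survive.\<close>
  have "exp (D1 eta p h) + b * exp (D2 eta p h) - 1 - \<i> * of_real eta * h =
   R1 + b * R2 - p * h / (8 * P) * h * v + (P * (1 + h * u) + (Qm * (1 + h * v) - p * h / (8 * P)) - 1 - \<i> * of_real eta * h)"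
   using bP by (simp add: R1_def R2_def algebra_simps)
  also have "P * (1 + h * u) + (Qm * (1 + h * v) - p * h / (8 * P)) - 1 - \<i> * of_real eta * h
   = (P + Qm - 1) + h * (P * u + Qm * v - p / (8 * P) - \<i> * of_real eta)"
   by (simp add: algebra_simps)
  also have "\<dots> = 0" unfolding key by (simp add: P_def Qm_def field_simps)
  finally have E: "exp (D1 eta p h) + b * exp (D2 eta p h) - 1 - \<i> * of_real eta * h = R1 + b * R2 - p * h / (8 * P) * h * v"
   by simp
  have "cmod (R1 + b * R2 - p * h / (8 * P) * h * v) \<le> B5 * X * m\<^sup>2 + 2 * B6 * X * m\<^sup>2 + B4 * U / 4 * m\<^sup>2"
   using R1 bR2 sm by (intro norm_triangle_ineq4[THEN order_trans] add_mono norm_triangle_ineq[THEN order_trans])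
  also have "\<dots> \<le> C * m\<^sup>2" by (simp add: C_def algebra_simps)
  finally show "cmod (exp (D1 eta p h) + (p\<^sup>2 / 4 - p * h / 8) * exp (D2 eta p h) - 1 - \<i> * of_real eta * h) \<le> C * (cmod h)\<^sup>2"
   using E by (simp add: b_def m_def)
  have Cm: "B5 * X * m\<^sup>2 \<le> C * m" "2 * B6 * X * m\<^sup>2 + B4 * U / 4 * m\<^sup>2 \<le> C * m"
  proof -
   have "B5 * X * m\<^sup>2 \<le> C * m\<^sup>2" "2 * B6 * X * m\<^sup>2 + B4 * U / 4 * m\<^sup>2 \<le> C * m\<^sup>2"
    unfolding distrib_right[symmetric] using nn B5 B4 UT by (auto simp: C_def intro!: mult_right_mono)
   moreover have "C * m\<^sup>2 \<le> C * m" using m2 nn by simp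
   ultimately show "B5 * X * m\<^sup>2 \<le> C * m" "2 * B6 * X * m\<^sup>2 + B4 * U / 4 * m\<^sup>2 \<le> C * m" by linarith+
  qed
  have e1: "cmod P - W * m \<le> cmod (exp (D1 eta p h))"
  proof -
   have "P = exp (D1 eta p h) - (R1 + P * (h * u))" by (simp add: R1_def algebra_simps)
   then have "cmod P \<le> cmod (exp (D1 eta p h)) + cmod (R1 + P * (h * u))" by (metis norm_triangle_ineq4)
   also have "cmod (R1 + P * (h * u)) \<le> cmod R1 + cmod (P * (h * u))" by (rule norm_triangle_ineq)
   also have "cmod (P * (h * u)) \<le> B5 * (m * U)"
    unfolding norm_mult m_def[symmetric] using P uv B5 UT m by (intro mult_mono) auto
   also have "cmod R1 \<le> C * m" using R1 Cm by linarith
   finally have "cmod P \<le> cmod (exp (D1 eta p h)) + (C * m + B5 * (m * U))" by simp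
   also have "C * m + B5 * (m * U) \<le> W * m" using B4 m by (simp add: W_def algebra_simps)
   finally show ?thesis by simp
  qed
  have e2: "cmod (b * exp (D2 eta p h)) \<le> s * cmod P + W * m"
  proof -
   have "b * exp (D2 eta p h) = Qm + (Qm * (h * v) - p * h / (8 * P) - p * h / (8 * P) * h * v + b * R2)"
    using bP by (simp add: R2_def algebra_simps)
   also have "cmod \<dots> \<le> cmod Qm + (cmod (Qm * (h * v)) + cmod (p * h / (8 * P)) + cmod (p * h / (8 * P) * h * v) + cmod (b * R2))"
    by (intro norm_triangle_ineq4[THEN order_trans] add_mono norm_triangle_ineq[THEN order_trans] order_refl)
   also have "cmod (Qm * (h * v)) \<le> B5 * (m * U)"
   proof -
    have "cmod Qm \<le> 1 * cmod P" using QP s s21 by (intro order_trans[OF QP] mult_right_mono) auto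
    then have "cmod Qm \<le> B5" using P by simp
    then show ?thesis unfolding norm_mult m_def[symmetric] using uv B5 UT m by (intro mult_mono) auto
   qed
   also have "cmod (p * h / (8 * P)) \<le> B4 / 4 * m"
   proof -
    have "cmod (p * h / (8 * P)) = (cmod p * cmod (1 / P)) * m / 8" by (simp add: norm_mult norm_divide m_def)
    also have "\<dots> \<le> (B4 * 2) * m / 8" using pb invP B4 m by (intro divide_right_mono mult_mono) auto
    finally show ?thesis by simp
   qed
   also note sm
   also note bR2
   finally have "cmod (b * exp (D2 eta p h)) \<le> cmod Qm + (B5 * (m * U) + B4 / 4 * m + (2 * B6 * X * m\<^sup>2 + B4 * U / 4 * m\<^sup>2))"
    by simp
   also have "\<dots> \<le> cmod Qm + (B5 * (m * U) + B4 / 4 * m + C * m)" using Cm by simp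
   also have "\<dots> = cmod Qm + W * m" by (simp add: W_def algebra_simps)
   also have "cmod Qm \<le> s * cmod P" using QP mult_right_mono[OF s21, of "cmod P"] by simp
   finally show ?thesis by simp
  qed
  have mW: "8 * (W * m) \<le> 1 - s" using m W by (simp add: field_simps)
  have P4: "(1 - s) / 4 \<le> (1 - s) / 2 * cmod P" using P(2) s mult_left_mono[of "1/2" "cmod P" "(1 - s) / 2"] by simp
  show "1 / 4 \<le> cmod (exp (D1 eta p h))" using e1 P(2) mW s by linarith
  have rW: "r * (W * m) \<le> 1 * (W * m)" using s W m by (intro mult_right_mono) (auto simp: r_def)
  have re1: "r * (cmod P - W * m) \<le> r * cmod (exp (D1 eta p h))" using e1 s by (intro mult_left_mono) (auto simp: r_def)
  have rP: "r * (cmod P - W * m) = s * cmod P + (1 - s) / 2 * cmod P - r * (W * m)" by (simp add: r_def field_simps)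
  define Y where "Y = (1 - s) / 2 * cmod P"
  define Wm where "Wm = W * m"
  define rWm where "rWm = r * Wm"
  define sP where "sP = s * cmod P"
  define rE where "rE = r * cmod (exp (D1 eta p h))"
  note fold = Y_def[symmetric] Wm_def[symmetric] rWm_def[symmetric] sP_def[symmetric] rE_def[symmetric]
  have lin: "sP + Y - rWm \<le> rE" "rWm \<le> Wm" "1 - s \<le> 4 * Y" "8 * Wm \<le> 1 - s"
   using re1 rW P4 mW unfolding rP unfolding fold mult_1 by auto
  show "cmod ((p\<^sup>2 / 4 - p * h / 8) * exp (D2 eta p h)) \<le> r * cmod (exp (D1 eta p h))"
   using e2 lin unfolding b_def[symmetric] fold by linarith
  have "cmod (p + h) \<le> cmod p + m" unfolding m_def by (rule norm_triangle_ineq)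
  also have "m \<le> W * m" using W m by simp
  also have "cmod p \<le> 2 * (s * cmod P)"
  proof -
   have "(cmod p)\<^sup>2 = 4 * (cmod Qm * cmod P)"
    using arg_cong[OF PQ, of cmod] by (simp add: norm_mult norm_divide norm_power mult_ac)
   also have "\<dots> \<le> 4 * ((s\<^sup>2 * cmod P) * cmod P)" using QP by (intro mult_left_mono mult_right_mono) auto
   also have "\<dots> = (2 * (s * cmod P))\<^sup>2" by (simp add: power2_eq_square)
   finally show ?thesis by (rule power2_le_imp_le) (use s in auto)
  qed
  finally have "cmod (p + h) \<le> 2 * sP + Wm" unfolding fold by simp
  also have "\<dots> \<le> 2 * rE" using lin s by linarith
  finally show "cmod (p + h) \<le> r * (2 * cmod (exp (D1 eta p h)))"
   unfolding rE_def by (simp add: mult_ac)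
 qed
qed

section \<open>From one step to all degrees: stability of the perturbed recurrence\<close>

lemma slit_plane_inverse: "z \<in> slit_plane \<Longrightarrow> \<bar>u\<bar> \<le> 1 \<Longrightarrow> of_real u / z \<in> slit_disk"
proof -
 assume z: "z \<in> slit_plane" and u: "\<bar>u\<bar> \<le> 1"
 have z0: "z \<noteq> 0" using z by (rule slit_plane_nonzero)
 show ?thesis
 proof (rule ccontr)
  assume "of_real u / z \<notin> slit_disk"
  then have im: "Im (of_real u / z) = 0" and re: "1 \<le> \<bar>Re (of_real u / z)\<bar>" by (auto simp: slit_disk_def)
  define t where "t = Re (of_real u / z)"
  have "of_real u / z = of_real t" using im by (simp add: complex_eq_iff t_def)
  then have "of_real u = of_real t * z" using z0 by (simp add: field_simps)
  moreover have "t \<noteq> 0" using re by (auto simp: t_def)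
  ultimately have "z = of_real (u / t)" by simp
  moreover have "u / t \<in> {-1..1}"
  proof -
   have "\<bar>u / t\<bar> \<le> 1" using u re by (simp add: t_def[symmetric] abs_divide divide_le_eq_1)
   then show ?thesis unfolding atLeastAtMost_iff abs_le_iff by linarith
  qed
  ultimately show False using z unfolding slit_plane_def by blast
 qed
qed

lemma segment_radial:
 fixes \<zeta> :: complex
 shows "closed_segment (of_real a * \<zeta>) (of_real b * \<zeta>) \<subseteq> (\<lambda>t. of_real t * \<zeta>) ` closed_segment a b"
proof
 fix x assume "x \<in> closed_segment (of_real a * \<zeta>) (of_real b * \<zeta>)"
 then obtain u where u: "0 \<le> u" "u \<le> 1" "x = (1 - u) *\<^sub>R (of_real a * \<zeta>) + u *\<^sub>R (of_real b * \<zeta>)"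
  by (auto simp: closed_segment_def)
 have "x = of_real ((1 - u) * a + u * b) * \<zeta>"
  unfolding u(3) by (simp add: scaleR_conv_of_real algebra_simps)
 moreover have "(1 - u) * a + u * b \<in> closed_segment a b"
  using u by (auto simp: closed_segment_def)
 ultimately show "x \<in> (\<lambda>t. of_real t * \<zeta>) ` closed_segment a b" by blast
qed

text \<open>\<open>q\<close> is the quotient of the exact solution by the ansatz. In terms of
  differences the step reads \<open>d' = (B/P) d - (E/P) q\<close> with
  \<open>|B/P| <= r < 1\<close>, so differences do not accumulate and \<open>q\<close> drifts by at
  most a constant times \<open>epsilon\<close> per step. At \<open>k = 0\<close> the truncated
  \<open>k - 1\<close> makes the initial difference zero.\<close>

lemma perturbed_recurrence_near_one:
 fixes q :: "nat \<Rightarrow> complex"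
 assumes q0: "q 0 = 1" and r: "0 \<le> r" "r < 1" and C: "0 \<le> C" and \<epsilon>: "0 \<le> \<epsilon>"
  and step: "\<And>k. k < n \<Longrightarrow> P k * (q (Suc k) - q k) = B k * (q k - q (k - 1)) - E k * q k"
  and B: "\<And>k. k < n \<Longrightarrow> cmod (B k) \<le> r * cmod (P k)"
  and P: "\<And>k. k < n \<Longrightarrow> 1 / 4 \<le> cmod (P k)"
  and E: "\<And>k. k < n \<Longrightarrow> cmod (E k) \<le> C * \<epsilon>"
  and small: "real n * (8 * C / (1 - r) * \<epsilon>) \<le> 1"
 shows "k \<le> n \<Longrightarrow> cmod (q k - 1) \<le> real n * (8 * C / (1 - r) * \<epsilon>)"
proof -
 \<comment> \<open>Fixed point of \<open>M = r M + 8 C epsilon\<close>; the \<open>8\<close> is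
   \<open>2 * 4\<close>, from \<open>|q k| <= 2\<close> and \<open>1/|P k| <= 4\<close>.\<close>
 define M where "M = 8 * C / (1 - r) * \<epsilon>"
 have M: "0 \<le> M" "M = r * M + 8 * C * \<epsilon>" using r C \<epsilon> by (auto simp: M_def field_simps)
 have main: "k \<le> n \<Longrightarrow> cmod (q k - 1) \<le> real k * M \<and> cmod (q k - q (k - 1)) \<le> M" for k
 proof (induction k)
  case 0
  then show ?case using q0 M by simp
 next
  case (Suc k)
  then have k: "k < n" and IH: "cmod (q k - 1) \<le> real k * M" "cmod (q k - q (k - 1)) \<le> M" by auto
  have "real k * M \<le> real n * M" using k M by (intro mult_right_mono) auto
  then have "cmod (q k - 1) \<le> 1" using IH small by (simp add: M_def)
  then have qk: "cmod (q k) \<le> 2" using norm_triangle_ineq[of "q k - 1" 1] by simp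
  have "cmod (P k) * cmod (q (Suc k) - q k) = cmod (B k * (q k - q (k - 1)) - E k * q k)"
   using step[OF k] by (metis norm_mult)
  also have "\<dots> \<le> cmod (B k) * cmod (q k - q (k - 1)) + cmod (E k) * cmod (q k)"
   by (metis norm_triangle_ineq4 norm_mult)
  also have "\<dots> \<le> (r * cmod (P k)) * M + (C * \<epsilon>) * 2"
   using B[OF k] E[OF k] IH qk r C \<epsilon> by (intro add_mono mult_mono) auto
  also have "\<dots> \<le> (r * cmod (P k)) * M + (8 * C * \<epsilon>) * cmod (P k)"
  proof -
   have "(8 * C * \<epsilon>) * (1 / 4) \<le> (8 * C * \<epsilon>) * cmod (P k)"
    using P[OF k] C \<epsilon> by (intro mult_left_mono) auto
   then show ?thesis by simp
  qed
  also have "\<dots> = cmod (P k) * (r * M + 8 * C * \<epsilon>)" by (simp add: algebra_simps)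
  finally have "cmod (P k) * cmod (q (Suc k) - q k) \<le> cmod (P k) * M" using M(2) by simp
  moreover have "0 < cmod (P k)" using P[OF k] by linarith
  ultimately have d: "cmod (q (Suc k) - q k) \<le> M" by simp
  have "q (Suc k) - 1 = (q (Suc k) - q k) + (q k - 1)" by simp
  then have "cmod (q (Suc k) - 1) \<le> M + real k * M"
   using d IH norm_triangle_ineq[of "q (Suc k) - q k" "q k - 1"] by simp
  then show ?case using d by (simp add: algebra_simps)
 qed
 assume k: "k \<le> n"
 have "real k * M \<le> real n * M" using k M by (intro mult_right_mono) auto
 then show ?thesis using main[OF k] unfolding M_def by linarith
qed

text \<open>The polynomial divided by its leading monomial \<open>(2x)^k / k!\<close>: the sequence
  starts at \<open>1\<close> and its recurrence depends on \<open>k\<close> only through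
  \<open>k/x\<close>, up to order \<open>1/x\<close>.\<close>

definition mono_ratio :: "real \<Rightarrow> complex \<Rightarrow> nat \<Rightarrow> complex" where
 "mono_ratio eta x k = fact k * mp (1/4 - eta) (1/4 + eta) k x / (2 * x) ^ k"

lemma mono_ratio_0: "mono_ratio eta x 0 = 1" by (simp add: mono_ratio_def)

text \<open>Valid from \<open>k = 0\<close> on: there the coefficient of the second term vanishes,
  so the truncated index \<open>k - 1\<close> does no harm.\<close>

lemma mono_ratio_Suc:
 assumes x: "x \<noteq> 0"
 shows "mono_ratio eta x (Suc k) = (1 + \<i> * of_real eta * (1 / x)) * mono_ratio eta x k
  - ((of_nat k * (1 / x))\<^sup>2 / 4 - (of_nat k * (1 / x)) * (1 / x) / 8) * mono_ratio eta x (k - 1)"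
proof (cases k)
 case 0
 then show ?thesis using x by (simp add: mono_ratio_def mp_1 field_simps)
next
 case (Suc m)
 define c where "c j = mp (1/4 - eta) (1/4 + eta) j x" for j
 define F where "F = (fact (Suc m) :: complex)"
 have F: "fact (Suc (Suc m)) = of_nat (m + 2) * F" "F = of_nat (Suc m) * fact m" by (simp_all add: F_def)
 have rec: "of_nat (m + 2) * c (m + 2) = (2 * x + \<i> * of_real (2 * eta)) * c (m + 1) - (of_nat m + 1 / 2) * c m"
  using mp_rec[of m "1/4 - eta" "1/4 + eta" x] unfolding c_def by simp
 have "mono_ratio eta x (Suc k) = F * (of_nat (m + 2) * c (m + 2)) / (2 * x) ^ (m + 2)"
  unfolding mono_ratio_def Suc F c_def by (simp add: mult_ac)
 also have "\<dots> = (2 * x + \<i> * of_real (2 * eta)) / (2 * x) * (F * c (m + 1) / (2 * x) ^ (m + 1))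
   - (of_nat (Suc m) * (of_nat m + 1 / 2)) / (2 * x)\<^sup>2 * (fact m * c m / (2 * x) ^ m)"
  unfolding rec using x by (simp add: F(2) divide_simps power2_eq_square) (simp add: algebra_simps)
 also have "(2 * x + \<i> * of_real (2 * eta)) / (2 * x) = 1 + \<i> * of_real eta * (1 / x)"
  using x by (simp add: field_simps)
 also have "(of_nat (Suc m) * (of_nat m + 1 / 2)) / (2 * x)\<^sup>2 = (of_nat k * (1 / x))\<^sup>2 / 4 - (of_nat k * (1 / x)) * (1 / x) / 8"
  unfolding Suc using x by (simp add: field_simps power2_eq_square)
 finally show ?thesis unfolding mono_ratio_def Suc F_def c_def by simp
qed

definition wkb :: "real \<Rightarrow> complex \<Rightarrow> nat \<Rightarrow> complex" where
 "wkb eta x k = exp (x * LL (of_nat k / x) + AA eta (of_nat k / x))"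

lemma wkb_0: "wkb eta x 0 = 1"
 by (simp add: wkb_def LL_def AA_def ell_def cc_def)

lemma wkb_nz: "wkb eta x k \<noteq> 0" by (simp add: wkb_def)

lemma wkb_ratio:
 assumes "x \<noteq> 0"
 shows "wkb eta x (Suc k) = exp (D1 eta (of_nat k * (1 / x)) (1 / x)) * wkb eta x k"
  "k > 0 \<Longrightarrow> wkb eta x (k - 1) = exp (D2 eta (of_nat k * (1 / x)) (1 / x)) * wkb eta x k"
proof -
 have 1: "of_nat (Suc k) / x = of_nat k * (1 / x) + 1 / x" by (simp add: add_divide_distrib)
 show "wkb eta x (Suc k) = exp (D1 eta (of_nat k * (1 / x)) (1 / x)) * wkb eta x k"
  unfolding wkb_def 1 D1_def exp_add[symmetric] using assms
  by (intro arg_cong[where f = exp]) (simp add: algebra_simps)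
 assume "k > 0"
 then have 2: "of_nat (k - 1) / x = of_nat k * (1 / x) - 1 / x" by (simp add: diff_divide_distrib of_nat_diff)
 show "wkb eta x (k - 1) = exp (D2 eta (of_nat k * (1 / x)) (1 / x)) * wkb eta x k"
  unfolding wkb_def 2 D2_def exp_add[symmetric] using assms
  by (intro arg_cong[where f = exp]) (simp add: algebra_simps)
qed

text \<open>With \<open>x = n z\<close> the step size is \<open>h = 1/(n z)\<close>, so
  \<open>n\<close> steps with residual \<open>O(h^2)\<close> give a total relative error
  \<open>O(1/n)\<close>, uniformly in \<open>eta\<close> and in \<open>z\<close> from
  \<open>K\<close>. The second conclusion is the geometric growth of the terms of the Christoffel
  sum.\<close>

lemma mp_wkb:
 assumes K: "compact K" "K \<subseteq> slit_plane"
 shows "\<exists>C N r. 0 < C \<and> 0 < r \<and> r < 1 \<and> N \<ge> 1 \<and> (\<forall>n\<ge>N. \<forall>z\<in>K. \<forall>eta. 0 \<le> eta \<and> eta \<le> 1 \<longrightarrow>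
  (\<forall>k\<le>n. cmod (mono_ratio eta (of_nat n * z) k / wkb eta (of_nat n * z) k - 1) \<le> C / real n) \<and>
  (\<forall>k<n. real (Suc k) * cmod (wkb eta (of_nat n * z) k) \<le> r * cmod (2 * (of_nat n * z) * wkb eta (of_nat n * z) (Suc k))))"
proof -
 define S where "S = (\<lambda>(t, z). complex_of_real t / z) ` ({-1..1} \<times> K)"
 have z0: "z \<noteq> 0" if "z \<in> K" for z using that K slit_plane_nonzero by blast
 have S: "compact S" "S \<subseteq> slit_disk"
 proof -
  show "compact S" unfolding S_def
   by (intro compact_continuous_image compact_Times K compact_Icc)
    (auto intro!: continuous_intros simp: case_prod_beta z0)
  show "S \<subseteq> slit_disk" unfolding S_def using K slit_plane_inverse by force
 qed
 obtain C h0 r where C: "0 < C" "0 < h0" "0 < r" "r < 1" and st: "\<And>p h eta. h \<noteq> 0 \<and> cmod h \<le> h0 \<and> 0 \<le> eta \<and> eta \<le> 1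
  \<and> closed_segment p (p + h) \<subseteq> S \<and> closed_segment p (p - h) \<subseteq> S \<Longrightarrow>
  cmod (exp (D1 eta p h) + (p\<^sup>2 / 4 - p * h / 8) * exp (D2 eta p h) - 1 - \<i> * of_real eta * h) \<le> C * (cmod h)\<^sup>2 \<and>
  cmod ((p\<^sup>2 / 4 - p * h / 8) * exp (D2 eta p h)) \<le> r * cmod (exp (D1 eta p h)) \<and>
  1 / 4 \<le> cmod (exp (D1 eta p h)) \<and> cmod (p + h) \<le> r * (2 * cmod (exp (D1 eta p h)))"
  using wkb_step[OF S] by blast
 have "continuous_on K (\<lambda>z. 1 / z)" using z0 by (intro continuous_intros) auto
 then have "bounded ((\<lambda>z. 1 / z) ` K)" by (intro compact_imp_bounded compact_continuous_image K)
 then obtain Z where Z: "Z > 0" "\<And>z. z \<in> K \<Longrightarrow> cmod (1 / z) \<le> Z" unfolding bounded_pos by blast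
 define C' where "C' = 8 * C / (1 - r) * Z\<^sup>2"
 have C': "C' > 0" using C Z by (auto simp: C'_def)
 define N where "N = nat \<lceil>max (Z / h0) C'\<rceil> + 1"
 show ?thesis
 proof (rule exI[of _ C'], rule exI[of _ N], rule exI[of _ r], intro conjI C' C allI impI ballI)
  show "1 \<le> N" by (simp add: N_def)
  fix n z and eta :: real assume n: "N \<le> n" and z: "z \<in> K" and eta: "0 \<le> eta \<and> eta \<le> 1"
  have nN: "max (Z / h0) C' \<le> real n" "n > 0" using n by (auto simp: N_def) linarith+
  define x where "x = of_nat n * z"
  define h where "h = 1 / x"
  define p where "p k = of_nat k * h" for k :: nat
  have x0: "x \<noteq> 0" using z0[OF z] nN by (simp add: x_def)
  have h: "h \<noteq> 0" "cmod h \<le> Z / real n"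
   using x0 Z(2)[OF z] nN by (auto simp: h_def x_def norm_divide norm_mult field_simps)
  have hh0: "cmod h \<le> h0"
  proof -
   have "Z / real n \<le> h0" using nN C by (simp add: field_simps)
   then show ?thesis using h by simp
  qed
  have seg: "closed_segment (p k) (p k + h) \<subseteq> S" "closed_segment (p k) (p k - h) \<subseteq> S" if k: "k < n" for k
  proof -
   have sub: "(\<lambda>t. complex_of_real t * (1 / z)) ` closed_segment (real k / real n) ((real k + s) / real n) \<subseteq> S" if s: "s = 1 \<or> s = -1" for s
   proof -
    have "closed_segment (real k / real n) ((real k + s) / real n) \<subseteq> {-1..1}"
     using k s by (auto simp: closed_segment_eq_real_ivl field_simps split: if_splits)
    then show ?thesis unfolding S_def using z by auto
   qed
   have e: "p k = complex_of_real (real k / real n) * (1 / z)" "p k + h = complex_of_real ((real k + 1) / real n) * (1 / z)"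
    "p k - h = complex_of_real ((real k + - 1) / real n) * (1 / z)"
    using nN z0[OF z] by (auto simp: p_def h_def x_def field_simps)
   show "closed_segment (p k) (p k + h) \<subseteq> S"
    unfolding e(2) unfolding e(1) by (rule order_trans[OF segment_radial sub]) simp
   show "closed_segment (p k) (p k - h) \<subseteq> S"
    unfolding e(3) unfolding e(1) by (rule order_trans[OF segment_radial sub]) simp
  qed
  have st': "cmod (exp (D1 eta (p k) h) + ((p k)\<^sup>2 / 4 - p k * h / 8) * exp (D2 eta (p k) h) - 1 - \<i> * of_real eta * h) \<le> C * (cmod h)\<^sup>2"
  "cmod (((p k)\<^sup>2 / 4 - p k * h / 8) * exp (D2 eta (p k) h)) \<le> r * cmod (exp (D1 eta (p k) h))"
  "1 / 4 \<le> cmod (exp (D1 eta (p k) h))" "cmod (p k + h) \<le> r * (2 * cmod (exp (D1 eta (p k) h)))" if k: "k < n" for k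
   using st[of h eta "p k"] h hh0 eta seg[OF k] by auto
  have wr: "wkb eta x (Suc k) = exp (D1 eta (p k) h) * wkb eta x k" for k
   using wkb_ratio(1)[OF x0] by (simp add: p_def h_def)
  define q where "q k = mono_ratio eta x k / wkb eta x k" for k
  have hn: "real n * (8 * C / (1 - r) * (cmod h)\<^sup>2) \<le> C' / real n"
  proof -
   have "(cmod h)\<^sup>2 \<le> (Z / real n)\<^sup>2" using h by (intro power_mono) auto
   then have "real n * (8 * C / (1 - r) * (cmod h)\<^sup>2) \<le> real n * (8 * C / (1 - r) * (Z / real n)\<^sup>2)"
    using C by (intro mult_left_mono) auto
   also have "\<dots> = C' / real n" using nN by (simp add: C'_def power2_eq_square)
   finally show ?thesis .
  qed
  have "cmod (q k - 1) \<le> real n * (8 * C / (1 - r) * (cmod h)\<^sup>2)" if k: "k \<le> n" for k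
  proof (rule perturbed_recurrence_near_one[where r = r and C = C and P = "\<lambda>k. exp (D1 eta (p k) h)" and
    B = "\<lambda>k. ((p k)\<^sup>2 / 4 - p k * h / 8) * exp (D2 eta (p k) h)" and
    E = "\<lambda>k. exp (D1 eta (p k) h) + ((p k)\<^sup>2 / 4 - p k * h / 8) * exp (D2 eta (p k) h) - 1 - \<i> * of_real eta * h"])
   show "q 0 = 1" by (simp add: q_def mono_ratio_0 wkb_0)
   show "real n * (8 * C / (1 - r) * (cmod h)\<^sup>2) \<le> 1"
    using nN by (intro order_trans[OF hn]) (auto simp: divide_le_eq_1)
   fix k assume k: "k < n"
   define b where "b = (p k)\<^sup>2 / 4 - p k * h / 8"
   define E1 where "E1 = exp (D1 eta (p k) h)"
   define E2 where "E2 = exp (D2 eta (p k) h)"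
   have E10: "E1 \<noteq> 0" by (simp add: E1_def)
   have "E1 * q (Suc k) = mono_ratio eta x (Suc k) / wkb eta x k"
    using E10 unfolding q_def wr E1_def by simp
   also have "mono_ratio eta x (Suc k) = (1 + \<i> * of_real eta * h) * mono_ratio eta x k - b * mono_ratio eta x (k - 1)"
    unfolding mono_ratio_Suc[OF x0] by (simp add: b_def p_def h_def)
   also have "\<dots> / wkb eta x k = (1 + \<i> * of_real eta * h) * q k - b * (mono_ratio eta x (k - 1) / wkb eta x k)"
    by (simp add: q_def diff_divide_distrib)
   also have "b * (mono_ratio eta x (k - 1) / wkb eta x k) = b * (E2 * q (k - 1))"
   proof (cases "k = 0")
    case True
    then have "b = 0" by (simp add: b_def p_def)
    then show ?thesis by simp
   next
    case False
    then have "wkb eta x (k - 1) = E2 * wkb eta x k"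
     using wkb_ratio(2)[OF x0, of k eta] by (simp add: E2_def p_def h_def)
    moreover have "E2 \<noteq> 0" by (simp add: E2_def)
    ultimately show ?thesis using wkb_nz[of eta x k] by (simp add: q_def)
   qed
   finally have "E1 * q (Suc k) = (1 + \<i> * of_real eta * h) * q k - b * (E2 * q (k - 1))" .
   then show "exp (D1 eta (p k) h) * (q (Suc k) - q k) = ((p k)\<^sup>2 / 4 - p k * h / 8) * exp (D2 eta (p k) h) * (q k - q (k - 1)) -
    (exp (D1 eta (p k) h) + ((p k)\<^sup>2 / 4 - p k * h / 8) * exp (D2 eta (p k) h) - 1 - \<i> * of_real eta * h) * q k"
    unfolding b_def[symmetric] E1_def[symmetric] E2_def[symmetric] by (simp add: algebra_simps)
  qed (use C st' k in auto)
  then show "\<And>k. k \<le> n \<Longrightarrow> cmod (mono_ratio eta (of_nat n * z) k / wkb eta (of_nat n * z) k - 1) \<le> C' / real n"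
   using hn unfolding q_def x_def[symmetric] by (meson order_trans)
  fix k assume k: "k < n"
  have "p k + h = of_nat (Suc k) * h" by (simp add: p_def algebra_simps)
  then have "real (Suc k) * cmod h \<le> r * (2 * cmod (exp (D1 eta (p k) h)))"
   using st'(4)[OF k] by (simp only: norm_mult norm_of_nat)
  moreover have "cmod h = 1 / cmod x" by (simp add: h_def norm_divide)
  ultimately have "real (Suc k) \<le> r * (2 * cmod (exp (D1 eta (p k) h))) * cmod x" using x0 by (simp add: field_simps)
  then have "real (Suc k) * cmod (wkb eta x k) \<le> r * (2 * cmod (exp (D1 eta (p k) h))) * cmod x * cmod (wkb eta x k)"
   by (intro mult_right_mono) auto
  then show "real (Suc k) * cmod (wkb eta (of_nat n * z) k) \<le> r * cmod (2 * (of_nat n * z) * wkb eta (of_nat n * z) (Suc k))"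
   unfolding x_def[symmetric] wr by (simp add: norm_mult mult_ac)
 qed
qed

section \<open>Gamma weights and orthogonality\<close>
lemma integrable_abs_line:
 fixes g :: "real \<Rightarrow> 'a :: {banach, second_countable_topology}"
 assumes "set_integrable lborel {0..} g"
 shows "integrable lborel (\<lambda>x. g \<bar>x\<bar>)"
proof -
 have 1: "integrable lborel (\<lambda>x. indicator {0..} x *\<^sub>R g x)" using assms by (simp add: set_integrable_def)
 have 2: "integrable lborel (\<lambda>x. indicator {0..} (0 + (-1) * x) *\<^sub>R g (0 + (-1) * x))"
  using lborel_integrable_real_affine[OF 1, of "-1" 0] by simp
 have "integrable lborel (\<lambda>x. indicator {0..} x *\<^sub>R g x + indicator {0..} (0 + (-1) * x) *\<^sub>R g (0 + (-1) * x))"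
  by (rule Bochner_Integration.integrable_add[OF 1 2])
 moreover have "AE x in lborel. indicator {0..} x *\<^sub>R g x + indicator {0..} (0 + (-1) * x) *\<^sub>R g (0 + (-1) * x) = g \<bar>x\<bar>"
  using AE_lborel_singleton[of "0::real"] by eventually_elim (auto simp: indicator_def)
 moreover have "(\<lambda>x. g \<bar>x\<bar>) \<in> borel_measurable lborel"
 proof -
  have m: "(\<lambda>x. indicator {0..} x *\<^sub>R g x) \<in> borel_measurable lborel" using 1 by auto
  have "(\<lambda>x. (\<lambda>x. indicator {0..} x *\<^sub>R g x) \<bar>x\<bar>) \<in> borel_measurable lborel"
   by (rule measurable_compose[OF _ m]) simp
  then show ?thesis by simp
 qed
 ultimately show ?thesis by (subst integrable_cong_AE[symmetric]) (auto intro: borel_measurable_integrable)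
qed

lemma decay_integrable: "integrable lborel (\<lambda>x::real. (1 + \<bar>x\<bar>) powr (-3/2))"
proof -
 have "(\<integral>\<^sup>+x. ennreal ((1 + \<bar>x\<bar>) powr (-3/2)) * indicator {0::real ..} x \<partial>lborel) = ennreal (0 - (- 2 * (1 + 0) powr (-1/2)))"
 proof (rule nn_integral_FTC_atLeast)
  show "(\<lambda>x::real. (1 + \<bar>x\<bar>) powr (-3/2)) \<in> borel_measurable borel" by simp
  fix x :: real assume x: "0 \<le> x"
  have "((\<lambda>x. - 2 * (1 + x) powr (-1/2)) has_real_derivative (1 + x) powr (-3/2)) (at x)"
   using x by (auto intro!: derivative_eq_intros)
  then show "((\<lambda>x. - 2 * (1 + x) powr (-1/2)) has_real_derivative (1 + \<bar>x\<bar>) powr (-3/2)) (at x)" using x by simp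
  show "0 \<le> (1 + \<bar>x\<bar>) powr (-3/2)" by simp
 next
  show "((\<lambda>x::real. - 2 * (1 + x) powr (-1/2)) \<longlongrightarrow> 0) at_top" by real_asymp
 qed
 then have "set_integrable lborel {0..} (\<lambda>x::real. (1 + \<bar>x\<bar>) powr (-3/2))"
  unfolding set_integrable_def
  by (intro integrableI_nonneg) (auto simp: mult.commute nn_integral_multc ennreal_indicator[symmetric] ennreal_mult'[symmetric] simp flip: ennreal_mult'')
 then show ?thesis using integrable_abs_line[of "\<lambda>x. (1 + \<bar>x\<bar>) powr (-3/2)"] by simp
qed

lemma integral_symmetric_limit:
 fixes f :: "real \<Rightarrow> complex"
 assumes f: "integrable lborel f"
 shows "(\<lambda>n. integral {- real n..real n} f) \<longlonglongrightarrow> integral\<^sup>L lborel f"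
proof -
 have "(\<lambda>n. \<integral>x. indicator {- real n..real n} x *\<^sub>R f x \<partial>lborel) \<longlonglongrightarrow> (\<integral>x. f x \<partial>lborel)"
 proof (rule integral_dominated_convergence[where w = "\<lambda>x. norm (f x)"])
  show "AE x in lborel. (\<lambda>n. indicator {- real n..real n} x *\<^sub>R f x) \<longlonglongrightarrow> f x"
  proof (rule AE_I2)
   fix x :: real
   obtain N where N: "\<bar>x\<bar> \<le> real N" using real_arch_simple by blast
   then have "\<forall>\<^sub>F n in sequentially. indicator {- real n..real n} x *\<^sub>R f x = f x"
    by (intro eventually_mono[OF eventually_ge_at_top[of N]]) (auto simp: indicator_def)
   then show "(\<lambda>n. indicator {- real n..real n} x *\<^sub>R f x) \<longlonglongrightarrow> f x"
    by (rule tendsto_eventually)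
  qed
 qed (use f in \<open>auto simp: indicator_def\<close>)
 moreover have "(\<integral>x. indicator {- real n..real n} x *\<^sub>R f x \<partial>lborel) = integral {- real n..real n} f" for n
 proof -
  have "set_integrable lborel {- real n..real n} f"
   using f unfolding set_integrable_def by (intro integrable_mult_indicator) auto
  from set_borel_integral_eq_integral(2)[OF this] show ?thesis by (simp add: set_lebesgue_integral_def)
 qed
 ultimately show ?thesis by simp
qed

text \<open>Contour shift by means of a primitive on the convex region: over \<open>[-T, T]\<close>
  the two horizontal integrals differ by increments of the primitive along the vertical sides, and
  these are \<open>O(T powr (-3/2))\<close>.\<close>

lemma horizontal_shift:
 assumes S: "open S" "convex S" "f holomorphic_on S"
  and sub: "\<And>z. y1 \<le> Im z \<Longrightarrow> Im z \<le> y2 \<Longrightarrow> z \<in> S"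
  and bd: "\<And>z. y1 \<le> Im z \<Longrightarrow> Im z \<le> y2 \<Longrightarrow> cmod (f z) \<le> B * (1 + \<bar>Re z\<bar>) powr (-3/2)"
  and y: "y1 \<le> y2"
 shows "integrable lborel (\<lambda>x. f (Complex x y1))" "integrable lborel (\<lambda>x. f (Complex x y2))"
  "integral\<^sup>L lborel (\<lambda>x. f (Complex x y1)) = integral\<^sup>L lborel (\<lambda>x. f (Complex x y2))"
proof -
 have cont: "continuous_on S f" by (rule holomorphic_on_imp_continuous_on[OF S(3)])
 have int: "integrable lborel (\<lambda>x. f (Complex x y))" if yy: "y1 \<le> y" "y \<le> y2" for y
 proof (rule Bochner_Integration.integrable_bound[of _ "\<lambda>x. B * (1 + \<bar>x\<bar>) powr (-3/2)"])
  show "integrable lborel (\<lambda>x. B * (1 + \<bar>x\<bar>) powr (-3/2))" using decay_integrable by simp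
  have "continuous_on UNIV (\<lambda>x. f (Complex x y))"
   by (rule continuous_on_compose2[OF cont]) (use sub yy in \<open>auto intro!: continuous_intros simp: Complex_eq\<close>)
  then show "(\<lambda>x. f (Complex x y)) \<in> borel_measurable lborel" by (simp add: borel_measurable_continuous_onI)
  show "AE x in lborel. norm (f (Complex x y)) \<le> norm (B * (1 + \<bar>x\<bar>) powr (- 3 / 2))"
   using bd[of "Complex _ y"] yy by (intro AE_I2) (auto intro: order_trans[OF _ abs_ge_self])
 qed
 show "integrable lborel (\<lambda>x. f (Complex x y1))" "integrable lborel (\<lambda>x. f (Complex x y2))" using int y by auto
 obtain F where F: "\<And>z. z \<in> S \<Longrightarrow> (F has_field_derivative f z) (at z)"
  using holomorphic_convex_primitive'[OF S(2) S(1) S(3)] S(1) by (metis at_within_open)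
 have ftc: "integral {-T..T} (\<lambda>x. f (Complex x y)) = F (Complex T y) - F (Complex (-T) y)"
  if yy: "y1 \<le> y" "y \<le> y2" and T: "0 \<le> T" for y T
 proof (rule integral_unique, rule fundamental_theorem_of_calculus)
  show "- T \<le> T" using T by simp
  fix x :: real
  have "((\<lambda>x. Complex x y) has_vector_derivative 1) (at x within {- T..T})"
   unfolding Complex_eq by (auto intro!: derivative_eq_intros)
  from field_vector_diff_chain_within[OF this has_field_derivative_at_within[OF F[of "Complex x y"]]]
  show "((\<lambda>x. F (Complex x y)) has_vector_derivative f (Complex x y)) (at x within {- T..T})"
   using sub yy by (simp add: o_def)
 qed
 have vert: "cmod (F (Complex x y2) - F (Complex x y1)) \<le> B * (1 + \<bar>x\<bar>) powr (-3/2) * (y2 - y1)" for x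
 proof -
  have "cmod (F (Complex x y2) - F (Complex x y1)) \<le> B * (1 + \<bar>x\<bar>) powr (-3/2) * cmod (Complex x y2 - Complex x y1)"
  proof (rule field_differentiable_bound[where S = "closed_segment (Complex x y1) (Complex x y2)" and f' = f])
   fix z assume "z \<in> closed_segment (Complex x y1) (Complex x y2)"
   then have z: "Re z = x" "y1 \<le> Im z" "Im z \<le> y2"
    using y by (auto simp: closed_segment_same_Re closed_segment_eq_real_ivl split: if_splits)
   show "(F has_field_derivative f z) (at z within closed_segment (Complex x y1) (Complex x y2))"
    by (rule has_field_derivative_at_within[OF F[OF sub[OF z(2,3)]]])
   show "cmod (f z) \<le> B * (1 + \<bar>x\<bar>) powr (-3/2)" using bd[of z] z by simp
  qed auto
  also have "cmod (Complex x y2 - Complex x y1) = y2 - y1" using y by (simp add: cmod_def)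
  finally show ?thesis .
 qed
 have d: "integral {- real n..real n} (\<lambda>x. f (Complex x y1)) - integral {- real n..real n} (\<lambda>x. f (Complex x y2)) =
  (F (Complex (- real n) y2) - F (Complex (- real n) y1)) - (F (Complex (real n) y2) - F (Complex (real n) y1))" for n
  using ftc[of y1 "real n"] ftc[of y2 "real n"] y by simp
 have "(\<lambda>n. integral {- real n..real n} (\<lambda>x. f (Complex x y1)) - integral {- real n..real n} (\<lambda>x. f (Complex x y2))) \<longlonglongrightarrow> 0"
 proof (rule Lim_null_comparison)
  show "\<forall>\<^sub>F n in sequentially. cmod (integral {- real n..real n} (\<lambda>x. f (Complex x y1)) - integral {- real n..real n} (\<lambda>x. f (Complex x y2)))
   \<le> 2 * (B * (y2 - y1)) * (1 + real n) powr (-3/2)"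
  proof (rule always_eventually, rule allI)
   fix n
   show "cmod (integral {- real n..real n} (\<lambda>x. f (Complex x y1)) - integral {- real n..real n} (\<lambda>x. f (Complex x y2)))
   \<le> 2 * (B * (y2 - y1)) * (1 + real n) powr (-3/2)"
   proof -
    have "cmod (integral {- real n..real n} (\<lambda>x. f (Complex x y1)) - integral {- real n..real n} (\<lambda>x. f (Complex x y2)))
     \<le> B * (1 + \<bar>- real n\<bar>) powr (-3/2) * (y2 - y1) + B * (1 + \<bar>real n\<bar>) powr (-3/2) * (y2 - y1)"
     unfolding d by (rule norm_triangle_le_diff, rule add_mono[OF vert vert])
    also have "\<dots> = 2 * (B * (y2 - y1)) * (1 + real n) powr (-3/2)" by (simp add: algebra_simps)
    finally show ?thesis .
   qed
  qed
  have "((\<lambda>n. (1 + real n) powr (-3/2)) \<longlonglongrightarrow> 0)" by real_asymp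
  from tendsto_mult_right_zero[OF this] show "(\<lambda>n. 2 * (B * (y2 - y1)) * (1 + real n) powr (-3/2)) \<longlonglongrightarrow> 0" .
 qed
 moreover have "(\<lambda>n. integral {- real n..real n} (\<lambda>x. f (Complex x y1)) - integral {- real n..real n} (\<lambda>x. f (Complex x y2)))
   \<longlonglongrightarrow> integral\<^sup>L lborel (\<lambda>x. f (Complex x y1)) - integral\<^sup>L lborel (\<lambda>x. f (Complex x y2))"
  by (intro tendsto_diff integral_symmetric_limit int) (use y in auto)
 ultimately have "integral\<^sup>L lborel (\<lambda>x. f (Complex x y1)) - integral\<^sup>L lborel (\<lambda>x. f (Complex x y2)) = 0"
  using LIMSEQ_unique by blast
 then show "integral\<^sup>L lborel (\<lambda>x. f (Complex x y1)) = integral\<^sup>L lborel (\<lambda>x. f (Complex x y2))" by simp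
qed

text \<open>In Euler's limit the numerator has the same modulus at \<open>a + i t\<close> as at
  \<open>a\<close>, while each factor \<open>a + i t + k\<close> of the denominator has modulus at
  least \<open>a + k\<close>.\<close>

lemma norm_Gamma_le: "0 < a \<Longrightarrow> cmod (Gamma (Complex a t)) \<le> Gamma a"
proof -
 assume a: "0 < a"
 have "cmod (Gamma_series (Complex a t) n) \<le> Gamma_series a n" if n: "n > 0" for n
 proof -
  have "pochhammer a (n + 1) \<le> cmod (pochhammer (Complex a t) (n + 1))"
   unfolding pochhammer_prod prod_norm[symmetric]
   by (intro prod_mono conjI) (use a in \<open>auto intro!: order_trans[OF _ complex_Re_le_cmod]\<close>)
  moreover have "0 < pochhammer a (n + 1)" using a by (rule pochhammer_pos)
  moreover from calculation have "0 < cmod (pochhammer (Complex a t) (n + 1))" by linarith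
  ultimately show ?thesis
   unfolding Gamma_series_def norm_divide norm_mult by (auto intro!: divide_left_mono mult_pos_pos)
 qed
 then have "\<forall>\<^sub>F n in sequentially. cmod (Gamma_series (Complex a t) n) \<le> Gamma_series a n"
  by (intro eventually_mono[OF eventually_gt_at_top[of 0]]) auto
 moreover have "(\<lambda>n. cmod (Gamma_series (Complex a t) n)) \<longlonglongrightarrow> cmod (Gamma (Complex a t))"
  by (intro tendsto_norm Gamma_series_LIMSEQ)
 ultimately show ?thesis using Gamma_series_LIMSEQ[of a] tendsto_le sequentially_bot by blast
qed

text \<open>Polynomial decay of any order, uniformly in the strip: \<open>Gamma (z + m)\<close> is
  bounded, and dividing by the \<open>m\<close> factors of \<open>pochhammer z m\<close> gains
  \<open>|t|^m\<close>. This is enough to beat any polynomial in the contour shift.\<close>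

lemma Gamma_decay:
 assumes a: "0 < a"
 shows "\<exists>C>0. \<forall>s t. a \<le> s \<and> s \<le> a + 1 \<longrightarrow> cmod (Gamma (Complex s t)) \<le> C / (1 + \<bar>t\<bar>) ^ m"
proof -
 define I where "I = {a..a + 1 + real m}"
 have "continuous_on I (\<lambda>x::real. Gamma x)"
  unfolding I_def using a by (intro continuous_intros) (auto elim!: nonpos_Ints_cases)
 then have "bounded ((\<lambda>x::real. Gamma x) ` I)"
  by (intro compact_imp_bounded compact_continuous_image) (auto simp: I_def)
 then obtain D where D: "D > 0" "\<And>x. x \<in> I \<Longrightarrow> \<bar>Gamma x\<bar> \<le> D" unfolding bounded_pos by auto
 show ?thesis
 proof (intro exI[of _ "D * 2 ^ m"] conjI allI impI)
  show "0 < D * 2 ^ m" using D by simp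
  fix s t assume s: "a \<le> s \<and> s \<le> a + 1"
  have G: "cmod (Gamma (Complex (s + real k) t)) \<le> D" if "k \<le> m" for k
  proof -
   have "cmod (Gamma (Complex (s + real k) t)) \<le> Gamma (s + real k)" using s a by (intro norm_Gamma_le) auto
   also have "\<dots> \<le> D" using D(2)[of "s + real k"] s that by (auto simp: I_def)
   finally show ?thesis .
  qed
  have pos: "0 < (1 + \<bar>t\<bar>) ^ m" by (intro zero_less_power) auto
  have "cmod (Gamma (Complex s t)) * (1 + \<bar>t\<bar>) ^ m \<le> D * 2 ^ m"
  proof (cases "\<bar>t\<bar> \<le> 1")
   case True
   have "(1 + \<bar>t\<bar>) ^ m \<le> 2 ^ m" using True by (intro power_mono) auto
   then show ?thesis using G[of 0] D by (intro mult_mono) auto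
  next
   case False
   have z: "Complex s t \<notin> \<int>\<^sub>\<le>\<^sub>0" using s a by (auto elim!: nonpos_Ints_cases simp: complex_eq_iff)
   have "pochhammer (Complex s t) m * Gamma (Complex s t) = Gamma (Complex s t + of_nat m)"
    using pochhammer_Gamma[OF z, of m] z by (simp add: Gamma_eq_zero_iff)
   also have "Complex s t + of_nat m = Complex (s + real m) t" by (simp add: complex_eq_iff)
   finally have e: "cmod (pochhammer (Complex s t) m) * cmod (Gamma (Complex s t)) \<le> D"
    using G[of m] by (metis norm_mult order_refl)
   have "((1 + \<bar>t\<bar>) / 2) ^ m = (\<Prod>i\<in>{0..<m}. (1 + \<bar>t\<bar>) / 2)" by simp
   also have "\<dots> \<le> cmod (pochhammer (Complex s t) m)"
    unfolding pochhammer_prod prod_norm[symmetric]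
   proof (intro prod_mono conjI)
    fix i
    have "(1 + \<bar>t\<bar>) / 2 \<le> \<bar>Im (Complex s t + of_nat i)\<bar>" using False by simp
    also have "\<dots> \<le> cmod (Complex s t + of_nat i)" by (rule abs_Im_le_cmod)
    finally show "(1 + \<bar>t\<bar>) / 2 \<le> cmod (Complex s t + of_nat i)" .
   qed auto
   finally have "((1 + \<bar>t\<bar>) / 2) ^ m * cmod (Gamma (Complex s t)) \<le> D"
    using e by (meson mult_right_mono norm_ge_zero order_trans)
   then show ?thesis by (simp add: power_divide field_simps)
  qed
  then show "cmod (Gamma (Complex s t)) \<le> D * 2 ^ m / (1 + \<bar>t\<bar>) ^ m" using pos by (simp add: field_simps)
 qed
qed

section \<open>The complex Gamma weight and orthogonality by contour shift\<close>

lemma poly_growth: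
 fixes p :: "complex poly"
 shows "\<exists>D>0. \<exists>d. \<forall>z. \<bar>Im z\<bar> \<le> 1 \<longrightarrow> cmod (poly p z) \<le> D * (1 + \<bar>Re z\<bar>) ^ d"
proof (induction p)
 case 0
 show ?case by (intro exI[of _ 1] conjI exI[of _ 0]) auto
next
 case (pCons c p)
 then obtain D d where D: "D > 0" "\<And>z. \<bar>Im z\<bar> \<le> 1 \<Longrightarrow> cmod (poly p z) \<le> D * (1 + \<bar>Re z\<bar>) ^ d" by blast
 show ?case
 proof (intro exI[of _ "cmod c + D"] conjI exI[of _ "Suc d"] allI impI)
  show "0 < cmod c + D" using D by (simp add: add_nonneg_pos)
  fix z assume z: "\<bar>Im z\<bar> \<le> 1"
  define u where "u = 1 + \<bar>Re z\<bar>"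
  have u: "1 \<le> u" "cmod z \<le> u" using z cmod_le[of z] by (auto simp: u_def)
  have "cmod (poly (pCons c p) z) \<le> cmod c + cmod z * cmod (poly p z)"
   by (simp add: norm_mult norm_triangle_ineq[THEN order_trans])
  also have "\<dots> \<le> cmod c * u ^ Suc d + u * (D * u ^ d)"
   using D(2)[OF z] u by (intro add_mono mult_mono) (auto simp: u_def mult_le_cancel_left1 intro!: one_le_power simp del: power_Suc)
  also have "\<dots> = (cmod c + D) * u ^ Suc d" by (simp add: algebra_simps)
  finally show "cmod (poly (pCons c p) z) \<le> (cmod c + D) * (1 + \<bar>Re z\<bar>) ^ Suc d" unfolding u_def .
 qed
qed

text \<open>Written as an analytic function of \<open>z\<close>, so that the line of integration can
  be moved. For \<open>a = b\<close> and real \<open>z\<close> it is the positive weight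
  \<open>|Gamma(a + i z)|^2\<close>.\<close>

definition rho :: "real \<Rightarrow> real \<Rightarrow> complex \<Rightarrow> complex" where
 "rho a b z = Gamma (of_real a + \<i> * z) * Gamma (of_real b - \<i> * z)"

lemma rho_step:
 "a > 0 \<Longrightarrow> (of_real a + \<i> * of_real x) * rho a b (of_real x) = rho (a + 1) b (of_real x)"
 "b > 0 \<Longrightarrow> (of_real b - \<i> * of_real x) * rho a b (of_real x) = rho a (b + 1) (of_real x)"
proof -
 have e: "of_real (a + 1) + \<i> * of_real x = (of_real a + \<i> * of_real x) + 1"
  "of_real (b + 1) - \<i> * of_real x = (of_real b - \<i> * of_real x) + (1::complex)" by simp_all
 show "(of_real a + \<i> * of_real x) * rho a b (of_real x) = rho (a + 1) b (of_real x)" if "a > 0"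
 proof -
  have "of_real a + \<i> * of_real x \<notin> \<int>\<^sub>\<le>\<^sub>0" using that by (auto elim!: nonpos_Ints_cases simp: complex_eq_iff)
  from Gamma_plus1[OF this] show ?thesis unfolding rho_def e by (simp only: mult_ac)
 qed
 show "(of_real b - \<i> * of_real x) * rho a b (of_real x) = rho a (b + 1) (of_real x)" if "b > 0"
 proof -
  have "of_real b - \<i> * of_real x \<notin> \<int>\<^sub>\<le>\<^sub>0" using that by (auto elim!: nonpos_Ints_cases simp: complex_eq_iff)
  from Gamma_plus1[OF this] show ?thesis unfolding rho_def e by (simp only: mult_ac)
 qed
qed

lemma rho_shift: "rho (a + 1) b (x + \<i>) = rho a (b + 1) x"
 by (simp add: rho_def algebra_simps)

text \<open>The first Gamma factor is regular for \<open>Im z < a + 1\<close> and the second for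
  \<open>Im z > - b\<close>, so the closed strip \<open>0 <= Im z <= 1\<close> is free of poles.
  Moving the line by \<open>i\<close> exchanges the raised parameter.\<close>

lemma rho_poly_shift:
 assumes ab: "0 < a" "0 < b"
 shows "integrable lborel (\<lambda>x. rho (a + 1) b (of_real x) * poly p (of_real x))"
  "integrable lborel (\<lambda>x. rho a (b + 1) (of_real x) * poly p (of_real x + \<i>))"
  "integral\<^sup>L lborel (\<lambda>x. rho (a + 1) b (of_real x) * poly p (of_real x)) =
  integral\<^sup>L lborel (\<lambda>x. rho a (b + 1) (of_real x) * poly p (of_real x + \<i>))"
proof -
 obtain D d where D: "D > 0" "\<And>z. \<bar>Im z\<bar> \<le> 1 \<Longrightarrow> cmod (poly p z) \<le> D * (1 + \<bar>Re z\<bar>) ^ d"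
  using poly_growth[of p] by blast
 obtain C1 where C1: "C1 > 0" "\<And>s t. a \<le> s \<Longrightarrow> s \<le> a + 1 \<Longrightarrow> cmod (Gamma (Complex s t)) \<le> C1 / (1 + \<bar>t\<bar>) ^ (d + 2)"
  using Gamma_decay[OF ab(1), of "d + 2"] by blast
 obtain C2 where C2: "C2 > 0" "\<And>s t. b \<le> s \<Longrightarrow> s \<le> b + 1 \<Longrightarrow> cmod (Gamma (Complex s t)) \<le> C2 / (1 + \<bar>t\<bar>) ^ 0"
  using Gamma_decay[OF ab(2), of 0] by blast
 define S where "S = {z. - b < Im z} \<inter> {z. Im z < a + 1}"
 define f where "f z = rho (a + 1) b z * poly p z" for z
 have S: "open S" "convex S" unfolding S_def
  by (auto intro!: open_Int open_halfspace_Im_gt open_halfspace_Im_lt convex_Int convex_halfspace_Im_gt convex_halfspace_Im_lt)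
 have f: "f holomorphic_on S"
  unfolding f_def rho_def
  by (intro holomorphic_intros) (auto simp: S_def elim!: nonpos_Ints_cases simp: complex_eq_iff)
 have bd: "cmod (f z) \<le> (C1 * C2 * D) * (1 + \<bar>Re z\<bar>) powr (-3/2)" if z: "0 \<le> Im z" "Im z \<le> 1" for z
 proof -
  define u where "u = 1 + \<bar>Re z\<bar>"
  have u: "1 \<le> u" by (simp add: u_def)
  have "of_real (a + 1) + \<i> * z = Complex (a + 1 - Im z) (Re z)" "of_real b - \<i> * z = Complex (b + Im z) (- Re z)"
   by (auto simp: complex_eq_iff)
  then have "cmod (f z) = cmod (Gamma (Complex (a + 1 - Im z) (Re z))) * cmod (Gamma (Complex (b + Im z) (- Re z))) * cmod (poly p z)"
   by (simp add: f_def rho_def norm_mult)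
  also have "\<dots> \<le> (C1 / u ^ (d + 2)) * C2 * (D * u ^ d)"
   using C1(2)[of "a + 1 - Im z" "Re z"] C2(2)[of "b + Im z" "- Re z"] D z C1(1) C2(1) u
   by (intro mult_mono) (auto simp: u_def)
  also have "\<dots> = (C1 * C2 * D) * u powr (- 2)"
   using u by (simp add: powr_minus powr_numeral power_add field_simps power2_eq_square)
  also have "\<dots> \<le> (C1 * C2 * D) * u powr (-3/2)"
   using u C1 C2 D by (intro mult_left_mono powr_mono) auto
  finally show ?thesis unfolding u_def .
 qed
 have e: "Complex x 0 = of_real x" "Complex x 1 = of_real x + \<i>" for x by (auto simp: complex_eq_iff)
 have sub: "z \<in> S" if "0 \<le> Im z" "Im z \<le> 1" for z using that ab by (auto simp: S_def)
 note hs = horizontal_shift[OF S f, of 0 1, OF sub bd, simplified, unfolded e, unfolded f_def rho_shift]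
 show "integrable lborel (\<lambda>x. rho (a + 1) b (of_real x) * poly p (of_real x))"
  "integrable lborel (\<lambda>x. rho a (b + 1) (of_real x) * poly p (of_real x + \<i>))"
  "integral\<^sup>L lborel (\<lambda>x. rho (a + 1) b (of_real x) * poly p (of_real x)) =
  integral\<^sup>L lborel (\<lambda>x. rho a (b + 1) (of_real x) * poly p (of_real x + \<i>))"
  by (rule hs; simp)+
qed

lemma rho_poly_integrable:
 assumes "0 < a" "0 < b"
 shows "integrable lborel (\<lambda>x. rho a b (of_real x) * poly p (of_real x))"
proof -
 have ab: "0 < a / 2" "0 < b" using assms by auto
 obtain D d where D: "D > 0" "\<And>z. \<bar>Im z\<bar> \<le> 1 \<Longrightarrow> cmod (poly p z) \<le> D * (1 + \<bar>Re z\<bar>) ^ d"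
  using poly_growth[of p] by blast
 obtain C1 where C1: "C1 > 0" "\<And>s t. a \<le> s \<Longrightarrow> s \<le> a + 1 \<Longrightarrow> cmod (Gamma (Complex s t)) \<le> C1 / (1 + \<bar>t\<bar>) ^ (d + 2)"
  using Gamma_decay[OF assms(1), of "d + 2"] by blast
 obtain C2 where C2: "C2 > 0" "\<And>s t. b \<le> s \<Longrightarrow> s \<le> b + 1 \<Longrightarrow> cmod (Gamma (Complex s t)) \<le> C2 / (1 + \<bar>t\<bar>) ^ 0"
  using Gamma_decay[OF assms(2), of 0] by blast
 show ?thesis
 proof (rule Bochner_Integration.integrable_bound[of _ "\<lambda>x. (C1 * C2 * D) * (1 + \<bar>x\<bar>) powr (-3/2)"])
  show "integrable lborel (\<lambda>x. (C1 * C2 * D) * (1 + \<bar>x\<bar>) powr (-3/2))" using decay_integrable by simp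
  define S where "S = {z. - b < Im z \<and> Im z < a}"
  have "(\<lambda>z. rho a b z * poly p z) holomorphic_on S"
   unfolding rho_def
   by (intro holomorphic_intros) (auto simp: S_def elim!: nonpos_Ints_cases simp: complex_eq_iff)
  then have "continuous_on S (\<lambda>z. rho a b z * poly p z)" by (rule holomorphic_on_imp_continuous_on)
  then have "continuous_on UNIV (\<lambda>x. rho a b (complex_of_real x) * poly p (of_real x))"
   by (rule continuous_on_compose2[where f = complex_of_real]) (use assms in \<open>auto simp: S_def intro!: continuous_intros\<close>)
  then show "(\<lambda>x. rho a b (complex_of_real x) * poly p (of_real x)) \<in> borel_measurable lborel"
   by (simp add: borel_measurable_continuous_onI)
  show "AE x in lborel. norm (rho a b (complex_of_real x) * poly p (of_real x)) \<le> norm (C1 * C2 * D * (1 + \<bar>x\<bar>) powr (- 3 / 2))"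
  proof (rule AE_I2)
   fix x :: real
   define u where "u = 1 + \<bar>x\<bar>"
   have u: "1 \<le> u" by (simp add: u_def)
   have "of_real a + \<i> * of_real x = Complex a x" "of_real b - \<i> * of_real x = Complex b (- x)"
    by (auto simp: complex_eq_iff)
   then have "norm (rho a b (complex_of_real x) * poly p (of_real x)) = cmod (Gamma (Complex a x)) * cmod (Gamma (Complex b (- x))) * cmod (poly p (of_real x))"
    by (simp add: rho_def norm_mult)
   also have "\<dots> \<le> (C1 / u ^ (d + 2)) * C2 * (D * u ^ d)"
    using C1(2)[of a x] C2(2)[of b "- x"] D(2)[of "of_real x"] C1(1) C2(1) D(1) u
    by (intro mult_mono) (auto simp: u_def)
   also have "\<dots> = (C1 * C2 * D) * u powr (- 2)"
    using u by (simp add: powr_minus powr_numeral power_add field_simps power2_eq_square)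
   also have "\<dots> \<le> (C1 * C2 * D) * u powr (-3/2)"
    using u C1 C2 D by (intro mult_left_mono powr_mono) auto
   finally show "norm (rho a b (complex_of_real x) * poly p (of_real x)) \<le> norm (C1 * C2 * D * (1 + \<bar>x\<bar>) powr (- 3 / 2))"
    using C1 C2 D by (simp add: u_def)
  qed
 qed
qed

text \<open>The finite difference lowers the degree; it drives the induction in
  \<open>mp_orthogonal\<close>.\<close>

lemma degree_shift_diff:
 fixes q :: "complex poly"
 assumes "degree q > 0"
 shows "degree (q - pcompose q [:c, 1:]) < degree q"
proof -
 have d: "degree (pcompose q [:c, 1:]) = degree q" by (simp add: degree_pcompose)
 have "lead_coeff (pcompose q [:c, 1:]) = lead_coeff q" by (simp add: lead_coeff_comp)
 then have c: "Polynomial.coeff (q - pcompose q [:c, 1:]) (degree q) = 0" using d by simp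
 have le: "degree (q - pcompose q [:c, 1:]) \<le> degree q" using d by (metis degree_diff_le order_refl)
 show ?thesis
 proof (rule ccontr)
  assume "\<not> ?thesis"
  then have "degree (q - pcompose q [:c, 1:]) = degree q" using le by simp
  then have "q - pcompose q [:c, 1:] = 0" using c by (metis leading_coeff_0_iff)
  then show False using \<open>degree (q - pcompose q [:c, 1:]) = degree q\<close> assms by simp
 qed
qed

text \<open>\<open>mp_Suc_deriv\<close> and \<open>rho_step\<close> turn the integral into one with
  \<open>rho a (b + 1)\<close> minus one with \<open>rho (a + 1) b\<close>. Shifting the contour in
  the latter makes both weights equal and the polynomial factors \<open>mp a (b + 1) n\<close>
  coincide, so only \<open>q x - q (x + i)\<close> remains against degree \<open>n\<close>: an
  integration by parts with finite differences.\<close>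

lemma mp_orthogonal:
 assumes "0 < a" "0 < b" "degree q < n"
 shows "(\<integral>x. rho a b (of_real x) * poly (mp_poly a b n * q) (of_real x) \<partial>lborel) = 0"
 using assms
proof (induction n arbitrary: a b q)
 case (Suc n)
 note ab = Suc.prems(1,2)
 define C where "C = mp_poly a (b + 1) n"
 define C' where "C' = pcompose C [:- \<i>, 1:]"
 define q' where "q' = pcompose q [:\<i>, 1:]"
 have C': "poly C' x = mp (a + 1) b n x" "poly C' (x + \<i>) = poly C x" for x
  by (simp_all add: C'_def C_def poly_pcompose poly_mp_poly mp_shift[symmetric])
 have nz: "of_nat (Suc n) \<noteq> (0::complex)" by (rule of_nat_neq_0)
 have eq: "of_nat (Suc n) * (rho a b (of_real x) * poly (mp_poly a b (Suc n) * q) (of_real x)) =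
   \<i> * (rho a (b + 1) (of_real x) * poly (C * q) (of_real x)) - \<i> * (rho (a + 1) b (of_real x) * poly (C' * q) (of_real x))" for x
 proof -
  have "of_nat (Suc n) * (rho a b (of_real x) * poly (mp_poly a b (Suc n) * q) (of_real x))
   = (of_nat (Suc n) * mp a b (Suc n) (of_real x)) * (rho a b (of_real x) * poly q (of_real x))"
   by (simp add: poly_mp_poly mult_ac del: of_nat_Suc)
  also have "\<dots> = \<i> * (((of_real b - \<i> * of_real x) * rho a b (of_real x)) * (poly C (of_real x) * poly q (of_real x)))
   - \<i> * (((of_real a + \<i> * of_real x) * rho a b (of_real x)) * (poly C' (of_real x) * poly q (of_real x)))"
   unfolding mp_Suc_deriv C'(1) C_def poly_mp_poly by (simp add: algebra_simps)
  finally show ?thesis unfolding rho_step(1)[OF ab(1)] rho_step(2)[OF ab(2)] by simp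
 qed
 have "of_nat (Suc n) * (\<integral>x. rho a b (of_real x) * poly (mp_poly a b (Suc n) * q) (of_real x) \<partial>lborel) =
  (\<integral>x. \<i> * (rho a (b + 1) (of_real x) * poly (C * q) (of_real x)) - \<i> * (rho (a + 1) b (of_real x) * poly (C' * q) (of_real x)) \<partial>lborel)"
  by (subst Bochner_Integration.integral_mult_right_zero[symmetric]) (intro Bochner_Integration.integral_cong refl eq)
 also have "\<dots> = \<i> * (\<integral>x. rho a (b + 1) (of_real x) * poly (C * q) (of_real x) \<partial>lborel)
   - \<i> * (\<integral>x. rho (a + 1) b (of_real x) * poly (C' * q) (of_real x) \<partial>lborel)"
  using ab by (subst Bochner_Integration.integral_diff)
   (simp_all only: Bochner_Integration.integral_mult_right_zero, (intro integrable_mult_right rho_poly_integrable; simp)+)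
 also have "(\<integral>x. rho (a + 1) b (of_real x) * poly (C' * q) (of_real x) \<partial>lborel) =
  (\<integral>x. rho a (b + 1) (of_real x) * poly (C * q') (of_real x) \<partial>lborel)"
  unfolding rho_poly_shift(3)[OF ab] by (simp add: C'(2) q'_def poly_pcompose add.commute[of \<i>])
 also have "\<i> * (\<integral>x. rho a (b + 1) (of_real x) * poly (C * q) (of_real x) \<partial>lborel)
   - \<i> * (\<integral>x. rho a (b + 1) (of_real x) * poly (C * q') (of_real x) \<partial>lborel)
  = \<i> * (\<integral>x. rho a (b + 1) (of_real x) * poly (C * (q - q')) (of_real x) \<partial>lborel)"
 proof -
  have "(\<integral>x. rho a (b + 1) (of_real x) * poly (C * (q - q')) (of_real x) \<partial>lborel) =
   (\<integral>x. rho a (b + 1) (of_real x) * poly (C * q) (of_real x) - rho a (b + 1) (of_real x) * poly (C * q') (of_real x) \<partial>lborel)"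
   by (intro Bochner_Integration.integral_cong refl) (simp add: right_diff_distrib)
  also have "\<dots> = (\<integral>x. rho a (b + 1) (of_real x) * poly (C * q) (of_real x) \<partial>lborel) - (\<integral>x. rho a (b + 1) (of_real x) * poly (C * q') (of_real x) \<partial>lborel)"
   using ab by (intro Bochner_Integration.integral_diff rho_poly_integrable) auto
  finally show ?thesis by (simp only: right_diff_distrib)
 qed
 also have "(\<integral>x. rho a (b + 1) (of_real x) * poly (C * (q - q')) (of_real x) \<partial>lborel) = 0"
 proof (cases "degree q = 0")
  case True
  then have "q' = q" unfolding q'_def by (auto elim!: degree_eq_zeroE simp: pcompose_pCons)
  then show ?thesis by simp
 next
  case False
  then have d: "degree (q - q') < n" using degree_shift_diff[of q \<i>] Suc.prems(3) by (simp add: q'_def)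
  have "0 < b + 1" using ab by simp
  from Suc.IH[OF ab(1) this d] show ?thesis unfolding C_def .
 qed
 finally show ?case using nz by simp
qed simp

section \<open>The symmetric case \<open>eta = 0\<close>: positive reference weight, norms and
  Christoffel kernel\<close>

definition om :: "real \<Rightarrow> real" where "om x = (cmod (Gamma (Complex (1/4) x)))\<^sup>2"

lemma rho_om: "rho (1/4) (1/4) (of_real x) = of_real (om x)"
proof -
 have "of_real (1/4) + \<i> * of_real x = Complex (1/4) x" "of_real (1/4) - \<i> * of_real x = cnj (Complex (1/4) x)"
  by (auto simp: complex_eq_iff)
 then show ?thesis unfolding rho_def om_def by (simp only: complex_norm_square cnj_Gamma)
qed

lemma om_pos: "0 < om x"
proof -
 have "Complex (1/4) x \<notin> \<int>\<^sub>\<le>\<^sub>0" by (auto elim!: nonpos_Ints_cases simp: complex_eq_iff)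
 then show ?thesis by (simp add: om_def Gamma_eq_zero_iff)
qed

abbreviation mq :: "nat \<Rightarrow> complex poly" where "mq \<equiv> mp_poly (1/4) (1/4)"

lemma mp_cnj: "cnj (mp a a n (of_real x)) = mp a a n (of_real x)"
proof (induction n rule: less_induct)
 case (less n)
 consider "n = 0" | "n = 1" | m where "n = m + 2" by (metis One_nat_def Suc_1 add_Suc_right add_0_right not0_implies_Suc)
 then show ?case
 proof cases
  case 3
  have nz: "of_nat (m + 2) \<noteq> (0::complex)" unfolding of_nat_eq_0_iff by simp
  have r: "of_nat (m + 2) * mp a a (m + 2) (of_real x) =
  (2 * of_real x) * mp a a (m + 1) (of_real x) - (of_nat m + of_real (a + a)) * mp a a m (of_real x)"
   using mp_rec[of m a a "of_real x"] by simp
  have "of_nat (m + 2) * cnj (mp a a (m + 2) (of_real x)) = cnj (of_nat (m + 2) * mp a a (m + 2) (of_real x))"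
   by (simp only: complex_cnj_mult complex_cnj_of_nat)
  also have "\<dots> = (2 * of_real x) * mp a a (m + 1) (of_real x) - (of_nat m + of_real (a + a)) * mp a a m (of_real x)"
   unfolding r using less.IH[of "m + 1"] less.IH[of m] 3 by (simp del: of_real_add)
  finally have "of_nat (m + 2) * cnj (mp a a (m + 2) (of_real x)) = of_nat (m + 2) * mp a a (m + 2) (of_real x)"
   unfolding r .
  then show ?thesis using nz 3 by simp
 qed (auto simp: mp_1)
qed

lemma om_integrable: "integrable lborel (\<lambda>x. complex_of_real (om x) * poly p (of_real x))"
 using rho_poly_integrable[of "1/4" "1/4" p] by (simp add: rho_om[simplified])

text \<open>On the real line multiplication by \<open>cnjp p\<close> is multiplication by the
  conjugate of \<open>p\<close>; this lets bilinear pairings of polynomials express squared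
  norms.\<close>

definition cnjp :: "complex poly \<Rightarrow> complex poly" where "cnjp p = map_poly cnj p"

lemma poly_cnjp: "poly (cnjp p) (of_real x) = cnj (poly p (of_real x))"
 by (induction p) (auto simp: cnjp_def map_poly_pCons)

lemma degree_cnjp: "degree (cnjp p) = degree p" unfolding cnjp_def by (rule degree_map_poly) simp

lemma om_sq_integrable: "integrable lborel (\<lambda>x. om x * (cmod (poly p (of_real x)))\<^sup>2)"
proof -
 have "integrable lborel (\<lambda>x. Re (complex_of_real (om x) * poly (p * cnjp p) (of_real x)))"
  by (intro integrable_Re om_integrable)
 moreover have "Re (complex_of_real (om x) * poly (p * cnjp p) (of_real x)) = om x * (cmod (poly p (of_real x)))\<^sup>2" for x
  unfolding poly_mult poly_cnjp complex_norm_square[symmetric] by simp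
 ultimately show ?thesis by (simp only:)
qed

definition oip :: "complex poly \<Rightarrow> complex" where
 "oip p = (\<integral>x. complex_of_real (om x) * poly p (of_real x) \<partial>lborel)"

lemma oip_add: "oip (p + q) = oip p + oip q"
 unfolding oip_def poly_add distrib_left by (intro Bochner_Integration.integral_add om_integrable)
lemma oip_diff: "oip (p - q) = oip p - oip q"
 unfolding oip_def poly_diff right_diff_distrib by (intro Bochner_Integration.integral_diff om_integrable)
lemma oip_smult: "oip (Polynomial.smult c p) = c * oip p"
 unfolding oip_def by (subst Bochner_Integration.integral_mult_right_zero[symmetric]) (simp add: mult_ac)
lemma oip_sum: "oip (sum f A) = (\<Sum>k\<in>A. oip (f k))"
proof -
 have "oip 0 = 0" by (simp add: oip_def)
 then show ?thesis by (induction A rule: infinite_finite_induct) (auto simp: oip_add)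
qed

lemma oip_orth: "degree q < n \<Longrightarrow> oip (mq n * q) = 0"
 using mp_orthogonal[of "1/4" "1/4" q n] by (simp add: oip_def rho_om[simplified] del: poly_mult)

lemma oip_orth': "j \<noteq> k \<Longrightarrow> oip (mq j * mq k) = 0"
 using oip_orth[of "mq k" j] oip_orth[of "mq j" k] by (cases "j < k") (auto simp: degree_mp_poly mult.commute)

definition hh :: "nat \<Rightarrow> real" where "hh k = (\<integral>x. om x * (cmod (poly (mq k) (of_real x)))\<^sup>2 \<partial>lborel)"

lemma oip_cnj: "oip (p * cnjp p) = of_real (\<integral>x. om x * (cmod (poly p (of_real x)))\<^sup>2 \<partial>lborel)"
 unfolding oip_def integral_complex_of_real[symmetric] poly_mult poly_cnjp complex_norm_square[symmetric]
 by simp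

lemma cnjp_mq: "poly (cnjp (mq k)) (of_real x) = poly (mq k) (of_real x)"
 unfolding poly_cnjp by (simp add: poly_mp_poly mp_cnj)

lemma oip_sq: "oip (mq k * mq k) = of_real (hh k)"
 unfolding hh_def oip_cnj[symmetric] oip_def poly_mult cnjp_mq ..

lemma hh_0: "0 < hh 0"
proof -
 have "integrable lborel (\<lambda>x. om x)" using om_sq_integrable[of 1] by simp
 moreover have "\<not> (AE x in lborel. om x = 0)"
 proof
  assume "AE x in lborel. om x = 0"
  then have "AE x in lborel :: real measure. False" using om_pos by (metis (mono_tags, lifting) AE_cong less_irrefl)
  then have "emeasure lborel (UNIV :: real set) = 0" using AE_iff_null[of "lborel :: real measure" "\<lambda>x. False"] by auto
  then show False by simp
 qed
 ultimately have "integral\<^sup>L lborel om \<noteq> 0"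
  using integral_nonneg_eq_0_iff_AE[of lborel om] om_pos by (auto simp: less_imp_le)
 moreover have "0 \<le> integral\<^sup>L lborel om" by (intro integral_nonneg_AE AE_I2) (simp add: om_pos less_imp_le)
 ultimately show ?thesis by (simp add: hh_def)
qed

text \<open>The integral of \<open>2x\<close> times two consecutive polynomials is computed twice,
  expanding \<open>2x\<close> times either factor by the three-term recurrence.\<close>

lemma hh_rec: "real (k + 1) * hh (k + 1) = (real k + 1/2) * hh k"
proof -
 have X: "oip ([:0, 2:] * (mq k * mq (k + 1))) = of_nat (k + 1) * hh (k + 1)"
 proof (cases k)
  case 0
  have "mq 1 = [:0, 2:]" by simp
  then have "oip ([:0, 2:] * (mq k * mq (k + 1))) = oip (mq 1 * mq 1)" using 0 by simp
  then show ?thesis using 0 by (simp only: oip_sq) simp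
 next
  case (Suc m)
  have nz: "of_nat (m + 2) \<noteq> (0::complex)" unfolding of_nat_eq_0_iff by simp
  have "Polynomial.smult (of_nat (m + 2)) (mq (m + 2)) = [:0, 2:] * mq (m + 1) - Polynomial.smult (of_nat m + 1 / 2) (mq m)"
   using nz by (simp add: numeral_2_eq_2 del: of_nat_Suc of_nat_add)
  then have "[:0, 2:] * mq k = Polynomial.smult (of_nat (m + 2)) (mq (m + 2)) + Polynomial.smult (of_nat m + 1 / 2) (mq m)"
   using Suc by simp
  then have "[:0, 2:] * (mq k * mq (k + 1)) = Polynomial.smult (of_nat (m + 2)) (mq (m + 2) * mq (m + 2)) + Polynomial.smult (of_nat m + 1 / 2) (mq m * mq (m + 2))"
   using Suc by (simp add: mult.assoc[symmetric] distrib_right del: mult_pCons_left mp_poly.simps)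
  then show ?thesis using Suc oip_orth'[of m "m + 2"] by (simp add: oip_add oip_smult oip_sq del: mp_poly.simps)
 qed
 have nz: "of_nat (k + 2) \<noteq> (0::complex)" unfolding of_nat_eq_0_iff by simp
 have "Polynomial.smult (of_nat (k + 2)) (mq (k + 2)) = [:0, 2:] * mq (k + 1) - Polynomial.smult (of_nat k + 1 / 2) (mq k)"
  using nz by (simp add: numeral_2_eq_2 del: of_nat_Suc of_nat_add)
 then have e: "Polynomial.smult (of_nat (k + 2)) (mq (k + 2)) * mq k = ([:0, 2:] * mq (k + 1) - Polynomial.smult (of_nat k + 1 / 2) (mq k)) * mq k"
  by (simp only:)
 have "Polynomial.smult (of_nat (k + 2)) (mq (k + 2) * mq k) = [:0, 2:] * (mq k * mq (k + 1)) - Polynomial.smult (of_nat k + 1 / 2) (mq k * mq k)"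
  using e by (simp only: left_diff_distrib right_diff_distrib mult_smult_left mult_smult_right mult_ac)
 from arg_cong[OF this, of oip]
 have "of_nat (k + 2) * oip (mq (k + 2) * mq k) = oip ([:0, 2:] * (mq k * mq (k + 1))) - (of_nat k + 1 / 2) * oip (mq k * mq k)"
  by (simp only: oip_diff oip_smult)
 then have "complex_of_real (real (k + 1) * hh (k + 1)) = of_real ((real k + 1/2) * hh k)"
  using X oip_orth'[of "k + 2" k] by (simp add: oip_sq del: mp_poly.simps)
 then show ?thesis using of_real_eq_iff by blast
qed

text \<open>\<open>hh k\<close> has the exact order \<open>k^(-1/2)\<close>. By
  \<open>hh_rec\<close> the sequence \<open>(k + 1) (hh k)^2\<close> decreases and
  \<open>k (hh k)^2\<close> increases; the two bounds are square roots of these facts.\<close>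

lemma hh_bounds: "0 < hh k" "hh k \<le> hh 0 / sqrt (real k + 1)" "hh 0 \<le> 2 * sqrt (real k + 1) * hh k"
proof -
 have main: "0 < hh k \<and> (hh k)\<^sup>2 * (real k + 1) \<le> (hh 0)\<^sup>2 \<and> (k > 0 \<longrightarrow> (hh 0)\<^sup>2 \<le> 4 * real k * (hh k)\<^sup>2)"
 proof (induction k)
  case 0
  then show ?case using hh_0 by simp
 next
  case (Suc k)
  define t where "t = (real k + 1/2) / (real k + 1)"
  have h: "hh (Suc k) = t * hh k" using hh_rec[of k] by (simp add: t_def field_simps)
  have t: "0 < t" by (simp add: t_def)
  have t1: "t\<^sup>2 * (real k + 2) \<le> real k + 1"
   unfolding t_def by (simp add: power_divide divide_le_eq) (simp add: power2_eq_square algebra_simps)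
  have t2: "real k \<le> t\<^sup>2 * (real k + 1)"
   unfolding t_def by (simp add: power_divide le_divide_eq) (simp add: power2_eq_square algebra_simps)
  have "(hh (Suc k))\<^sup>2 * (real (Suc k) + 1) = (t\<^sup>2 * (real k + 2)) * (hh k)\<^sup>2" by (simp add: h power_mult_distrib algebra_simps)
  also have "\<dots> \<le> (real k + 1) * (hh k)\<^sup>2" using t1 by (intro mult_right_mono) auto
  finally have u: "(hh (Suc k))\<^sup>2 * (real (Suc k) + 1) \<le> (hh 0)\<^sup>2" using Suc by (simp add: mult.commute)
  show ?case
  proof (intro conjI u)
   show "0 < hh (Suc k)" using h t Suc by simp
   show "0 < Suc k \<longrightarrow> (hh 0)\<^sup>2 \<le> 4 * real (Suc k) * (hh (Suc k))\<^sup>2"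
   proof (cases "k = 0")
    case True
    then have "hh 0 = 2 * hh (Suc 0)" using h by (simp add: t_def)
    then show ?thesis using True by (simp add: power_mult_distrib)
   next
    case False
    then have "(hh 0)\<^sup>2 \<le> real k * (4 * (hh k)\<^sup>2)" using Suc by simp
    also have "\<dots> \<le> (t\<^sup>2 * (real k + 1)) * (4 * (hh k)\<^sup>2)" using t2 by (intro mult_right_mono) auto
    finally show ?thesis by (simp add: h power_mult_distrib algebra_simps)
   qed
  qed
 qed
 show "0 < hh k" using main by simp
 have "(hh k)\<^sup>2 \<le> (hh 0 / sqrt (real k + 1))\<^sup>2" using main by (simp add: power_divide field_simps)
 then show "hh k \<le> hh 0 / sqrt (real k + 1)" by (rule power2_le_imp_le) (simp add: hh_0 less_imp_le)
 have "(hh 0)\<^sup>2 \<le> 4 * (real k + 1) * (hh k)\<^sup>2"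
 proof (cases "k = 0")
  case False
  then have "(hh 0)\<^sup>2 \<le> 4 * real k * (hh k)\<^sup>2" using main by simp
  also have "\<dots> \<le> 4 * (real k + 1) * (hh k)\<^sup>2" by (intro mult_right_mono) auto
  finally show ?thesis .
 qed simp
 then have "(hh 0)\<^sup>2 \<le> (2 * sqrt (real k + 1) * hh k)\<^sup>2" by (simp add: power_mult_distrib)
 then show "hh 0 \<le> 2 * sqrt (real k + 1) * hh k" by (rule power2_le_imp_le) (use main in \<open>simp add: less_imp_le\<close>)
qed

text \<open>Stating the degree bound through coefficients covers \<open>n = 0\<close>, where it
  forces \<open>e = 0\<close>.\<close>

lemma expand_mq:
 "(\<And>i. i \<ge> n \<Longrightarrow> Polynomial.coeff e i = 0) \<Longrightarrow> \<exists>\<beta>. e = (\<Sum>k<n. Polynomial.smult (\<beta> k) (mq k))"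
proof (induction n arbitrary: e)
 case 0
 then have "e = 0" by (intro poly_eqI) auto
 then show ?case by simp
next
 case (Suc n)
 define b where "b = Polynomial.coeff e n / Polynomial.coeff (mq n) n"
 define e' where "e' = e - Polynomial.smult b (mq n)"
 have nz: "Polynomial.coeff (mq n) n \<noteq> 0" by (simp add: mp_poly_coeff)
 have "Polynomial.coeff e' i = 0" if "i \<ge> n" for i
 proof (cases "i = n")
  case True
  then show ?thesis using nz by (simp add: e'_def b_def)
 next
  case False
  then have "Polynomial.coeff (mq n) i = 0" using that degree_mp_poly[of "1/4" "1/4" n] by (intro coeff_eq_0) simp
  then show ?thesis using Suc.prems[of i] that False by (simp add: e'_def)
 qed
 from Suc.IH[OF this] obtain \<beta> where \<beta>: "e' = (\<Sum>k<n. Polynomial.smult (\<beta> k) (mq k))" by blast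
 have "e = (\<Sum>k<Suc n. Polynomial.smult ((\<beta>(n := b)) k) (mq k))"
  using \<beta> by (simp add: e'_def algebra_simps)
 then show ?case by blast
qed

lemma parseval_mq:
 "(\<integral>x. om x * (cmod (\<Sum>k<n. \<beta> k * mp (1/4) (1/4) k (of_real x)))\<^sup>2 \<partial>lborel) = (\<Sum>k<n. (cmod (\<beta> k))\<^sup>2 * hh k)"
proof -
 define p where "p = (\<Sum>k<n. Polynomial.smult (\<beta> k) (mq k))"
 define p' where "p' = (\<Sum>k<n. Polynomial.smult (cnj (\<beta> k)) (mq k))"
 have pp: "poly p x = (\<Sum>k<n. \<beta> k * mp (1/4) (1/4) k x)" for x
  by (simp add: p_def poly_sum poly_mp_poly)
 have pp': "poly (cnjp p) (of_real x) = poly p' (of_real x)" for x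
  unfolding poly_cnjp by (simp add: p_def p'_def poly_sum poly_mp_poly mp_cnj)
 have "of_real (\<integral>x. om x * (cmod (poly p (of_real x)))\<^sup>2 \<partial>lborel) = oip (p * p')"
  unfolding oip_cnj[symmetric] oip_def poly_mult pp' ..
 also have "p * p' = (\<Sum>j<n. \<Sum>k<n. Polynomial.smult (\<beta> j * cnj (\<beta> k)) (mq j * mq k))"
  unfolding p_def p'_def sum_product by (simp add: mult.commute)
 also have "oip \<dots> = (\<Sum>j<n. \<Sum>k<n. \<beta> j * cnj (\<beta> k) * oip (mq j * mq k))"
  by (simp only: oip_sum oip_smult)
 also have "\<dots> = (\<Sum>j<n. \<Sum>k<n. if k = j then \<beta> j * cnj (\<beta> j) * oip (mq j * mq j) else 0)"
  by (intro sum.cong refl) (auto simp: oip_orth')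
 also have "\<dots> = (\<Sum>j<n. \<beta> j * cnj (\<beta> j) * of_real (hh j))"
  by (simp add: oip_sq)
 also have "\<dots> = of_real (\<Sum>k<n. (cmod (\<beta> k))\<^sup>2 * hh k)"
  by (simp add: complex_norm_square del: of_real_power)
 finally show ?thesis unfolding pp of_real_eq_iff .
qed

text \<open>Cauchy--Schwarz in the orthogonal expansion. The point \<open>X\<close> may be any
  complex number although the norm lives on the real line.\<close>

lemma christoffel_mq:
 assumes "\<And>i. i \<ge> n \<Longrightarrow> Polynomial.coeff e i = 0"
 shows "(cmod (poly e X))\<^sup>2 \<le> (\<integral>x. om x * (cmod (poly e (of_real x)))\<^sup>2 \<partial>lborel) * (\<Sum>k<n. (cmod (mp (1/4) (1/4) k X))\<^sup>2 / hh k)"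
proof -
 obtain \<beta> where \<beta>: "e = (\<Sum>k<n. Polynomial.smult (\<beta> k) (mq k))" using expand_mq[of n e] assms by blast
 have pe: "poly e x = (\<Sum>k<n. \<beta> k * mp (1/4) (1/4) k x)" for x
  by (simp add: \<beta> poly_sum poly_mp_poly)
 have "cmod (poly e X) \<le> (\<Sum>k<n. (cmod (\<beta> k) * sqrt (hh k)) * (cmod (mp (1/4) (1/4) k X) / sqrt (hh k)))"
  unfolding pe using hh_bounds(1) by (intro sum_norm_le) (simp add: norm_mult less_imp_neq[THEN not_sym])
 then have "(cmod (poly e X))\<^sup>2 \<le> (\<Sum>k<n. (cmod (\<beta> k) * sqrt (hh k)) * (cmod (mp (1/4) (1/4) k X) / sqrt (hh k)))\<^sup>2"
  by (intro power_mono) auto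
 also have "\<dots> \<le> (\<Sum>k<n. (cmod (\<beta> k) * sqrt (hh k))\<^sup>2) * (\<Sum>k<n. (cmod (mp (1/4) (1/4) k X) / sqrt (hh k))\<^sup>2)"
  by (rule Cauchy_Schwarz_ineq_sum)
 also have "(\<Sum>k<n. (cmod (\<beta> k) * sqrt (hh k))\<^sup>2) = (\<Sum>k<n. (cmod (\<beta> k))\<^sup>2 * hh k)"
  using hh_bounds(1) by (intro sum.cong) (auto simp: power_mult_distrib less_imp_le)
 also have "(\<Sum>k<n. (cmod (mp (1/4) (1/4) k X) / sqrt (hh k))\<^sup>2) = (\<Sum>k<n. (cmod (mp (1/4) (1/4) k X))\<^sup>2 / hh k)"
  using hh_bounds(1) by (intro sum.cong) (auto simp: power_divide less_imp_le)
 finally show ?thesis unfolding parseval_mq[of \<beta> n, symmetric] pe .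
qed

section \<open>Pointwise and mean-square bounds\<close>
lemma rising_nonneg: "0 \<le> x \<Longrightarrow> 0 \<le> pochhammer (x :: real) n"
 unfolding pochhammer_prod by (intro prod_nonneg) auto

text \<open>\<open>(n + 1)^(- s)\<close> is a supersolution of the recurrence in moduli. Expanding
  to first order in \<open>1/n\<close>, the requirement reads
  \<open>2 tau + s - 1/2 <= 1 - s\<close>, and \<open>s = 3/4 - tau\<close> is the extreme case.
  Bernoulli's inequality bounds the older term from above, \<open>ln (1 + y) <= y\<close> the newer
  one from below.\<close>

lemma three_term_majorant:
 fixes c :: "nat \<Rightarrow> complex"
 assumes c: "c 0 = 1" "c 1 = 2 * \<xi>"
  and rec: "\<And>n. of_nat (n + 2) * c (n + 2) = 2 * \<xi> * c (n + 1) - (of_nat n + 1/2) * c n"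
  and \<tau>: "cmod \<xi> \<le> \<tau>" "\<tau> \<le> 1/2"
 shows "cmod (c n) \<le> 2 * (real n + 1) powr (\<tau> - 3/4)"
proof -
 define s where "s = 3/4 - \<tau>"
 have s: "1/4 \<le> s" "s \<le> 3/4" using \<tau> norm_ge_zero[of \<xi>] by (auto simp: s_def simp del: norm_ge_zero)
 have \<tau>0: "0 \<le> \<tau>" using \<tau> norm_ge_zero order_trans by blast
 define f where "f n = (real n + 1) powr (- s)" for n :: nat
 have fstep: "2 * \<tau> * f (n + 1) + (real n + 1/2) * f n \<le> real (n + 2) * f (n + 2)" for n
 proof -
  define k where "k = real n + 1"
  have k: "1 \<le> k" by (simp add: k_def)
  have a: "f (n + 2) = (k + 1) powr (- s) * (1 + 1 / (k + 1)) powr (- s)"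
  proof -
   have "(k + 1) * (1 + 1 / (k + 1)) = k + 2" using k by (simp add: field_simps)
   then show ?thesis using k by (subst powr_mult[symmetric]) (auto simp: f_def k_def add_ac)
  qed
  have b: "f n = (k + 1) powr (- s) * (1 + 1 / k) powr s"
  proof -
   have "(1 + 1 / k) powr s = ((k + 1) / k) powr s" using k by (simp add: field_simps)
   also have "\<dots> = (k + 1) powr s / k powr s" using k by (simp add: powr_divide)
   finally show ?thesis using k by (simp add: f_def k_def powr_minus field_simps)
  qed
  have c: "f (n + 1) = (k + 1) powr (- s)" by (simp add: f_def k_def add_ac)
  have B1: "1 - s * (1 / (k + 1)) \<le> (1 + 1 / (k + 1)) powr (- s)"
  proof -
   have "s * ln (1 + 1 / (k + 1)) \<le> s * (1 / (k + 1))"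
    using s k by (intro mult_left_mono ln_add_one_self_le_self) auto
   moreover have "1 + (- s * ln (1 + 1 / (k + 1))) \<le> exp (- s * ln (1 + 1 / (k + 1)))"
    by (rule exp_ge_add_one_self)
   moreover have "1 + 1 / (k + 1) \<noteq> 0" using k by (simp add: field_simps)
   ultimately show ?thesis by (simp add: powr_def)
  qed
  have B2: "(1 + 1 / k) powr s \<le> 1 + s * (1 / k)"
  proof -
   have "0 < 1 + 1 / k" using k by (simp add: add_pos_pos)
   then show ?thesis using Youngs_inequality_0[of s "1 - s" "1 + 1 / k" 1] s k by (simp add: algebra_simps)
  qed
  have "2 * \<tau> + (k - 1/2) * (1 + 1 / k) powr s \<le> 2 * \<tau> + (k - 1/2) * (1 + s * (1 / k))"
   using B2 k by (intro add_left_mono mult_left_mono) auto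
  also have "\<dots> = 2 * \<tau> + k - 1/2 + s - s / (2 * k)" using k by (simp add: field_simps)
  also have "\<dots> \<le> 2 * \<tau> + k - 1/2 + s" using s k by simp
  also have "\<dots> = (k + 1) - s" by (simp add: s_def)
  also have "\<dots> = (k + 1) * (1 - s * (1 / (k + 1)))" using k by (simp add: field_simps)
  also have "\<dots> \<le> (k + 1) * (1 + 1 / (k + 1)) powr (- s)" using B1 k by (intro mult_left_mono) auto
  finally have *: "2 * \<tau> + (k - 1/2) * (1 + 1 / k) powr s \<le> (k + 1) * (1 + 1 / (k + 1)) powr (- s)" .
  have "2 * \<tau> * f (n + 1) + (real n + 1/2) * f n = (k + 1) powr (- s) * (2 * \<tau> + (k - 1/2) * (1 + 1 / k) powr s)"
   unfolding b c by (simp add: k_def algebra_simps)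
  also have "\<dots> \<le> (k + 1) powr (- s) * ((k + 1) * (1 + 1 / (k + 1)) powr (- s))"
   by (intro mult_left_mono *) auto
  also have "\<dots> = real (n + 2) * f (n + 2)" unfolding a by (simp add: k_def algebra_simps)
  finally show ?thesis .
 qed
 have "cmod (c n) \<le> 2 * f n"
 proof (induction n rule: less_induct)
  case (less n)
  consider "n = 0" | "n = 1" | m where "n = m + 2" by (metis One_nat_def Suc_1 add_Suc_right add_0_right not0_implies_Suc)
  then show ?case
  proof cases
   case 1
   then show ?thesis by (simp add: c f_def)
  next
   case 2
   have "(1/2::real) = 2 powr (-1)" by (simp add: powr_minus)
   also have "\<dots> \<le> 2 powr (- s)" using s by (intro powr_mono) auto
   finally have "1/2 \<le> f 1" by (simp add: f_def)
   then show ?thesis using \<tau> c(2) 2 by (simp add: norm_mult)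
  next
   case 3
   have "real (m + 2) * cmod (c (m + 2)) = cmod (of_nat (m + 2) * c (m + 2))" by (simp only: norm_mult norm_of_nat)
   also have "\<dots> \<le> cmod (2 * \<xi> * c (m + 1)) + cmod ((of_nat m + 1/2) * c m)"
    unfolding rec by (rule norm_triangle_ineq4)
   also have "cmod ((of_nat m + 1/2) * c m) = (real m + 1/2) * cmod (c m)"
   proof -
    have "complex_of_nat m + 1/2 = of_real (real m + 1/2)" by simp
    then show ?thesis by (simp only: norm_mult norm_of_real)
   qed
   also have "cmod (2 * \<xi> * c (m + 1)) = 2 * cmod \<xi> * cmod (c (m + 1))" by (simp add: norm_mult)
   also have "2 * cmod \<xi> * cmod (c (m + 1)) + (real m + 1/2) * cmod (c m) \<le> 2 * \<tau> * (2 * f (m + 1)) + (real m + 1/2) * (2 * f m)"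
    using less.IH[of "m + 1"] less.IH[of m] 3 \<tau> \<tau>0 by (intro add_mono mult_mono) auto
   also have "\<dots> = 2 * (2 * \<tau> * f (m + 1) + (real m + 1/2) * f m)" by (simp add: algebra_simps)
   also have "\<dots> \<le> 2 * (real (m + 2) * f (m + 2))" using fstep[of m] by simp
   finally have "real (m + 2) * cmod (c (m + 2)) \<le> real (m + 2) * (2 * f (m + 2))" by simp
   then show ?thesis unfolding 3 by simp
  qed
 qed
 then show ?thesis by (simp add: f_def s_def)
qed

text \<open>As \<open>b - a = 2 eta\<close>, the recurrence is the symmetric one at the argument
  \<open>xi + i eta\<close>. Near the origin this gives smallness of order
  \<open>n^(eta - 3/4)\<close> up to \<open>n^|xi|\<close>.\<close>

lemma mp_pointwise:
 assumes "cmod (\<xi> + \<i> * of_real eta) \<le> \<tau>" "\<tau> \<le> 1/2"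
 shows "cmod (mp (1/4 - eta) (1/4 + eta) n \<xi>) \<le> 2 * (real n + 1) powr (\<tau> - 3/4)"
proof (rule three_term_majorant[OF _ _ _ assms])
 fix n
 show "of_nat (n + 2) * mp (1/4 - eta) (1/4 + eta) (n + 2) \<xi> =
    2 * (\<xi> + \<i> * of_real eta) * mp (1/4 - eta) (1/4 + eta) (n + 1) \<xi> - (of_nat n + 1/2) * mp (1/4 - eta) (1/4 + eta) n \<xi>"
  using mp_rec[of n "1/4 - eta" "1/4 + eta" \<xi>] by (simp add: algebra_simps)
qed (simp_all add: mp_1 algebra_simps)

section \<open>Binomial coefficients and connection coefficients to the symmetric case\<close>

lemma rising_le_powr:
 assumes "0 \<le> \<alpha>" "\<alpha> \<le> 1"
 shows "pochhammer \<alpha> k / fact k \<le> (real k + 1) powr (\<alpha> - 1)"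
proof (induction k)
 case (Suc k)
 have "pochhammer \<alpha> (Suc k) / fact (Suc k) = (pochhammer \<alpha> k / fact k) * ((\<alpha> + real k) / (real k + 1))"
  by (simp add: pochhammer_rec' field_simps)
 also have "\<dots> \<le> (real k + 1) powr (\<alpha> - 1) * ((\<alpha> + real k) / (real k + 1))"
  using Suc assms by (intro mult_right_mono) auto
 also have "(\<alpha> + real k) / (real k + 1) \<le> ((real k + 2) / (real k + 1)) powr (\<alpha> - 1)"
 proof -
  have "((real k + 2) / (real k + 1)) powr (1 - \<alpha>) \<le> (1 - \<alpha>) * ((real k + 2) / (real k + 1)) + \<alpha>"
   using Youngs_inequality_0[of "1 - \<alpha>" \<alpha> "(real k + 2) / (real k + 1)" 1] assms by simp
  also have "\<dots> = 1 + (1 - \<alpha>) / (real k + 1)" by (simp add: field_simps)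
  finally have u: "((real k + 2) / (real k + 1)) powr (1 - \<alpha>) \<le> 1 + (1 - \<alpha>) / (real k + 1)" .
  have e: "(\<alpha> + real k) / (real k + 1) = 1 - (1 - \<alpha>) / (real k + 1)" by (simp add: field_simps)
  have nn: "0 \<le> (\<alpha> + real k) / (real k + 1)" using assms by simp
  have "(\<alpha> + real k) / (real k + 1) * ((real k + 2) / (real k + 1)) powr (1 - \<alpha>)
   \<le> (1 - (1 - \<alpha>) / (real k + 1)) * (1 + (1 - \<alpha>) / (real k + 1))"
   using mult_left_mono[OF u nn] unfolding e .
  also have "\<dots> \<le> 1"
  proof -
   have "(1 - A) * (1 + A) \<le> 1" for A :: real by (simp add: algebra_simps)
   then show ?thesis .
  qed
  finally have "(\<alpha> + real k) / (real k + 1) * ((real k + 2) / (real k + 1)) powr (1 - \<alpha>) \<le> 1" .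
  moreover have "((real k + 2) / (real k + 1)) powr (\<alpha> - 1) = 1 / ((real k + 2) / (real k + 1)) powr (1 - \<alpha>)"
   using powr_minus_divide[of "(real k + 2) / (real k + 1)" "1 - \<alpha>"] by simp
  ultimately show ?thesis by (simp add: le_divide_eq)
 qed
 also have "(real k + 1) powr (\<alpha> - 1) * ((real k + 2) / (real k + 1)) powr (\<alpha> - 1) = (real (Suc k) + 1) powr (\<alpha> - 1)"
 proof -
  have "(real k + 1) * ((real k + 2) / (real k + 1)) = real (Suc k) + 1" by simp
  then show ?thesis by (subst powr_mult[symmetric]) (auto simp: add_ac)
 qed
 finally show ?case by (simp add: mult_left_mono)
qed simp

lemma rising_le_powr2:
 assumes "0 \<le> eta" "eta \<le> 1"
 shows "pochhammer (1 + eta) k / fact k \<le> 2 * (real k + 1) powr eta"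
proof -
 have main: "pochhammer (1 + eta) (Suc k) / fact (Suc k) \<le> 2 * (real (Suc k)) powr eta" for k
 proof (induction k)
  case 0
  then show ?case using assms by simp
 next
  case (Suc k)
  define y where "y = 1 / (real k + 2)"
  have y: "0 < y" "y < 1" by (auto simp: y_def)
  have "pochhammer (1 + eta) (Suc (Suc k)) / fact (Suc (Suc k)) = (pochhammer (1 + eta) (Suc k) / fact (Suc k)) * (1 + eta * y)"
   unfolding pochhammer_rec'[of "1 + eta" "Suc k"] fact_Suc[of "Suc k"] by (simp add: y_def field_simps del: fact_Suc)
  also have "\<dots> \<le> (2 * (real (Suc k)) powr eta) * (1 + eta * y)"
   using Suc assms y by (intro mult_right_mono) auto
  also have "1 + eta * y \<le> (1 / (1 - y)) powr eta"
  proof -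
   have "y \<le> - ln (1 - y)" using ln_add_one_self_le_self2[of "- y"] y by simp
   then have "eta * y \<le> eta * - ln (1 - y)" using assms by (intro mult_left_mono) auto
   moreover have "1 + (eta * - ln (1 - y)) \<le> exp (eta * - ln (1 - y))" by (rule exp_ge_add_one_self)
   ultimately show ?thesis using y by (simp add: powr_def ln_div)
  qed
  also have "(2 * (real (Suc k)) powr eta) * (1 / (1 - y)) powr eta = 2 * (real (Suc k) * (1 / (1 - y))) powr eta"
   using y by (subst powr_mult) auto
  also have "real (Suc k) * (1 / (1 - y)) = real (Suc (Suc k))" by (simp add: y_def field_simps)
  finally show ?case using y by (simp add: mult_left_mono)
 qed
 show ?thesis
 proof (cases k)
  case (Suc m)
  have "real (Suc m) powr eta \<le> (real k + 1) powr eta" using Suc assms by (intro powr_mono2) auto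
  then show ?thesis using main[of m] Suc by simp
 qed simp
qed

lemma norm_gbinomial_neg: "0 \<le> \<alpha> \<Longrightarrow> cmod ((- of_real \<alpha>) gchoose k) = pochhammer \<alpha> k / fact k"
proof -
 assume "0 \<le> \<alpha>"
 then have "0 \<le> pochhammer \<alpha> k" by (rule rising_nonneg)
 moreover have "(- complex_of_real \<alpha>) gchoose k = (-1) ^ k * of_real (pochhammer \<alpha> k) / fact k"
  unfolding gbinomial_pochhammer by (simp add: pochhammer_of_real)
 ultimately show ?thesis by (simp add: norm_divide norm_mult norm_power)
qed

text \<open>For \<open>0 <= eta <= 1\<close> the numbers \<open>pochhammer (- eta) m\<close> are
  nonpositive except at \<open>m = 0\<close>, where the value is \<open>1\<close>; the summand
  \<open>2\<close> corrects the sign there. In this form the absolute values can be convolved by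
  \<open>rising_vandermonde\<close>.\<close>

lemma norm_gbinomial_pos:
 assumes "0 \<le> eta" "eta \<le> 1"
 shows "cmod ((of_real eta) gchoose m) = (if m = 0 then 2 else 0) - pochhammer (- eta) m / fact m"
proof (cases m)
 case (Suc j)
 have "pochhammer (- eta) (Suc j) = - eta * pochhammer (1 - eta) j" by (simp add: pochhammer_rec)
 moreover have "0 \<le> pochhammer (1 - eta) j" using assms by (intro rising_nonneg) simp
 ultimately have neg: "pochhammer (- eta) m \<le> 0" using assms Suc by (simp add: mult_nonneg_nonneg)
 have "(complex_of_real eta) gchoose m = (-1) ^ m * of_real (pochhammer (- eta) m) / fact m"
  unfolding gbinomial_pochhammer by (simp flip: pochhammer_of_real)
 moreover have "m \<noteq> 0" using Suc by simp
 ultimately show ?thesis using neg by (simp add: norm_divide norm_mult norm_power)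
qed simp

lemma rising_vandermonde:
 fixes \<alpha> \<beta> :: real
 shows "(\<Sum>k\<le>n. pochhammer \<alpha> k / fact k * (pochhammer \<beta> (n - k) / fact (n - k))) = pochhammer (\<alpha> + \<beta>) n / fact n"
proof -
 have e: "pochhammer x k / fact k = (-1) ^ k * ((- x) gchoose k)" for x :: real and k
  unfolding gbinomial_pochhammer by simp
 have "(\<Sum>k\<le>n. pochhammer \<alpha> k / fact k * (pochhammer \<beta> (n - k) / fact (n - k))) =
  (\<Sum>k\<le>n. (-1) ^ n * (((- \<alpha>) gchoose k) * ((- \<beta>) gchoose (n - k))))"
  unfolding e by (intro sum.cong refl) (simp add: power_add[symmetric] mult_ac)
 also have "\<dots> = (-1) ^ n * ((- \<alpha> + - \<beta>) gchoose n)"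
  unfolding sum_distrib_left[symmetric] atLeast0AtMost[symmetric] gbinomial_Vandermonde ..
 finally show ?thesis unfolding e by simp
qed

text \<open>The generating functions for \<open>(a, b)\<close> and \<open>(1/4, 1/4)\<close> differ
  by the factor \<open>(1 - i X)^(1/4 - b) (1 + i X)^(1/4 - a)\<close>, free of \<open>x\<close>;
  these are its coefficients.\<close>

definition conn :: "real \<Rightarrow> real \<Rightarrow> nat \<Rightarrow> complex" where
 "conn \<alpha> \<beta> j = fps_nth (bin (- \<i>) (of_real \<alpha>) * bin \<i> (of_real \<beta>)) j"

lemma norm_conn: "cmod (conn \<alpha> \<beta> n) \<le> (\<Sum>k\<le>n. cmod ((of_real \<alpha>) gchoose k) * cmod ((of_real \<beta>) gchoose (n - k)))"
 unfolding conn_def fps_mult_nth atLeast0AtMost by (intro sum_norm_le) (simp add: norm_mult norm_power)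

lemma mp_connection: "mp a b n x = (\<Sum>k<Suc n. conn (1/4 - b) (1/4 - a) (n - k) * mp (1/4) (1/4) k x)"
proof -
 have "mpG a b x = mpG (1/4) (1/4) x * (bin (- \<i>) (of_real (1/4 - b)) * bin \<i> (of_real (1/4 - a)))"
 proof -
  have 1: "\<i> * x - of_real b = (\<i> * x - of_real (1/4)) + of_real (1/4 - b)"
   "- \<i> * x - of_real a = (- \<i> * x - of_real (1/4)) + of_real (1/4 - a)" by simp_all
  show ?thesis unfolding mpG_def 1 bin_add by (simp only: mult_ac)
 qed
 then show ?thesis unfolding mp_def conn_def by (simp only: fps_mult_nth atLeast0AtMost lessThan_Suc_atMost mult.commute)
qed

text \<open>After taking absolute values the convolution equals twice its top term minus the rising
  factorial of \<open>alpha - eta\<close>, which is nonnegative because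
  \<open>eta <= alpha\<close>.\<close>

lemma conn_bound_neg:
 assumes "0 \<le> eta" "eta \<le> 1" "eta \<le> \<alpha>"
 shows "cmod (conn (- \<alpha>) eta n) \<le> 2 * (pochhammer \<alpha> n / fact n)"
proof -
 have \<alpha>: "0 \<le> \<alpha>" using assms by linarith
 have "cmod (conn (- \<alpha>) eta n) \<le> (\<Sum>k\<le>n. cmod ((of_real (- \<alpha>)) gchoose k) * cmod ((of_real eta) gchoose (n - k)))"
  by (rule norm_conn)
 also have "\<dots> = (\<Sum>k\<le>n. pochhammer \<alpha> k / fact k * ((if n - k = 0 then 2 else 0) - pochhammer (- eta) (n - k) / fact (n - k)))"
  using norm_gbinomial_neg[OF \<alpha>] norm_gbinomial_pos[OF assms(1,2)] by simp
 also have "\<dots> = (\<Sum>k\<le>n. if k = n then 2 * (pochhammer \<alpha> n / fact n) else 0) -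
   (\<Sum>k\<le>n. pochhammer \<alpha> k / fact k * (pochhammer (- eta) (n - k) / fact (n - k)))"
  unfolding sum_subtractf[symmetric] by (intro sum.cong refl) (auto simp: algebra_simps)
 also have "\<dots> = 2 * (pochhammer \<alpha> n / fact n) - pochhammer (\<alpha> + - eta) n / fact n"
  unfolding rising_vandermonde by simp
 also have "\<dots> \<le> 2 * (pochhammer \<alpha> n / fact n)" using assms rising_nonneg[of "\<alpha> + - eta" n] by simp
 finally show ?thesis .
qed

text \<open>Both exponents are nonpositive with sum \<open>-1\<close>, so the absolute values
  convolve to the coefficients of \<open>1/(1 - X)\<close>, all equal to \<open>1\<close>.\<close>

lemma conn_bound_one:
 assumes "0 \<le> eta" "eta \<le> 1"
 shows "cmod (conn (- eta) (eta - 1) n) \<le> 1"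
proof -
 have "cmod (conn (- eta) (eta - 1) n) \<le> (\<Sum>k\<le>n. cmod ((of_real (- eta)) gchoose k) * cmod ((of_real (eta - 1)) gchoose (n - k)))"
  by (rule norm_conn)
 also have "\<dots> = (\<Sum>k\<le>n. pochhammer eta k / fact k * (pochhammer (1 - eta) (n - k) / fact (n - k)))"
  using norm_gbinomial_neg[of eta] norm_gbinomial_neg[of "1 - eta"] assms by simp
 also have "\<dots> = 1" unfolding rising_vandermonde by (simp add: pochhammer_fact[symmetric])
 finally show ?thesis by simp
qed

section \<open>Norms of the asymmetric polynomials in the reference weight\<close>

definition nrm :: "real \<Rightarrow> real \<Rightarrow> nat \<Rightarrow> real" where
 "nrm a b n = (\<integral>x. om x * (cmod (mp a b n (of_real x)))\<^sup>2 \<partial>lborel)"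

lemma nrm_integrable: "integrable lborel (\<lambda>x. om x * (cmod (mp a b n (of_real x)))\<^sup>2)"
 using om_sq_integrable[of "mp_poly a b n"] by (simp add: poly_mp_poly)

lemma nrm_eq: "nrm a b n = (\<Sum>k<Suc n. (cmod (conn (1/4 - b) (1/4 - a) (n - k)))\<^sup>2 * hh k)"
 unfolding nrm_def mp_connection[of a b] parseval_mq ..

lemma sum_inv_sqrt: "(\<Sum>k<n. 1 / sqrt (real k + 1)) \<le> 2 * sqrt (real n)"
proof (induction n)
 case (Suc n)
 define u v where "u = sqrt (real n)" and "v = sqrt (real n + 1)"
 have uv: "0 \<le> u" "0 < v" "v\<^sup>2 = u\<^sup>2 + 1" by (auto simp: u_def v_def)
 have "0 \<le> (v - u)\<^sup>2" by simp
 then have "2 * u * v + 1 \<le> 2 * v\<^sup>2" using uv(3) by (simp add: power2_eq_square algebra_simps)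
 then have "2 * u + 1 / v \<le> 2 * v" using uv by (simp add: field_simps power2_eq_square)
 then show ?case using Suc by (simp add: u_def v_def add.commute)
qed simp

lemma sum_three_halves: "(\<Sum>k<n. (real k + 1) powr (-3/2)) \<le> 3"
proof -
 \<comment> \<open>Strengthened by the tail \<open>2 / sqrt n\<close> so that the induction
   telescopes.\<close>
 have "(\<Sum>k<n. (real k + 1) powr (-3/2)) \<le> 3 - (if n = 0 then 0 else 2 / sqrt (real n))"
 proof (induction n)
  case (Suc n)
  show ?case
  proof (cases "n = 0")
   case False
   define u v where "u = sqrt (real n)" and "v = sqrt (real n + 1)"
   have uv: "0 < u" "0 < v" "v\<^sup>2 = u\<^sup>2 + 1" "u < v" using False by (auto simp: u_def v_def)
   have "(real n + 1) powr (-3/2) = 1 / v ^ 3"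
   proof -
    have "(real n + 1) powr (-3/2) = ((real n + 1) powr (1/2)) powr (-3)" by (simp add: powr_powr)
    also have "\<dots> = 1 / v ^ 3" using uv by (simp add: v_def powr_half_sqrt powr_minus_divide powr_numeral)
    finally show ?thesis .
   qed
   also have "\<dots> \<le> 2 / u - 2 / v"
   proof -
    have "(v - u) * (v + u) = 1" using uv by (simp add: algebra_simps power2_eq_square)
    then have e: "v - u = 1 / (v + u)" using uv by (simp add: field_simps)
    have "2 / u - 2 / v = 2 * (v - u) / (u * v)" using uv by (simp add: field_simps)
    also have "\<dots> = 2 / ((v + u) * u * v)" unfolding e by simp
    finally have "2 / u - 2 / v = 2 / ((v + u) * u * v)" .
    moreover have "(v + u) * u * v \<le> (2 * v) * v * v" using uv by (intro mult_mono) auto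
    then have "2 / ((2 * v) * v * v) \<le> 2 / ((v + u) * u * v)" using uv by (intro divide_left_mono) auto
    moreover have "1 / v ^ 3 = 2 / ((2 * v) * v * v)" using uv by (simp add: power3_eq_cube)
    ultimately show ?thesis by simp
   qed
   finally show ?thesis using Suc False by (simp add: u_def v_def add.commute)
  qed simp
 qed simp
 moreover have "0 \<le> (if n = 0 then 0 else 2 / sqrt (real n))" by simp
 ultimately show ?thesis by linarith
qed

lemma hh_sum: "(\<Sum>k<n. hh k) \<le> 2 * hh 0 * sqrt (real n)"
proof -
 have "(\<Sum>k<n. hh k) \<le> (\<Sum>k<n. hh 0 * (1 / sqrt (real k + 1)))"
  using hh_bounds(2) by (intro sum_mono) simp
 also have "\<dots> = hh 0 * (\<Sum>k<n. 1 / sqrt (real k + 1))" by (simp add: sum_distrib_left)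
 also have "\<dots> \<le> hh 0 * (2 * sqrt (real n))" using hh_0 by (intro mult_left_mono sum_inv_sqrt) auto
 finally show ?thesis by simp
qed

text \<open>Here the connection coefficients grow like the power \<open>eta\<close>; squared and
  summed against \<open>hh k\<close>, of order \<open>k^(-1/2)\<close>, they give the exponent
  \<open>2 eta + 1/2\<close>.\<close>

lemma nrm_b:
 assumes "0 \<le> eta" "eta \<le> 1"
 shows "nrm (1/4 - eta) (1/4 + eta + 1) n \<le> 32 * hh 0 * (real n + 1) powr (2 * eta + 1/2)"
proof -
 have "nrm (1/4 - eta) (1/4 + eta + 1) n = (\<Sum>k<Suc n. (cmod (conn (- (1 + eta)) eta (n - k)))\<^sup>2 * hh k)"
  unfolding nrm_eq by (simp add: algebra_simps)
 also have "\<dots> \<le> (\<Sum>k<Suc n. (16 * (real n + 1) powr (2 * eta)) * hh k)"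
 proof (intro sum_mono mult_right_mono)
  fix k
  have "cmod (conn (- (1 + eta)) eta (n - k)) \<le> 2 * (pochhammer (1 + eta) (n - k) / fact (n - k))"
   using assms by (intro conn_bound_neg) auto
  also have "\<dots> \<le> 2 * (2 * (real (n - k) + 1) powr eta)" using assms by (intro mult_left_mono rising_le_powr2) auto
  also have "\<dots> \<le> 2 * (2 * (real n + 1) powr eta)" using assms by (intro mult_left_mono powr_mono2) auto
  finally have "(cmod (conn (- (1 + eta)) eta (n - k)))\<^sup>2 \<le> (4 * (real n + 1) powr eta)\<^sup>2" by (intro power_mono) auto
  also have "\<dots> = 16 * (real n + 1) powr (2 * eta)"
   by (simp add: power_mult_distrib power2_eq_square powr_add[symmetric])
  finally show "(cmod (conn (- (1 + eta)) eta (n - k)))\<^sup>2 \<le> 16 * (real n + 1) powr (2 * eta)" .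
  show "0 \<le> hh k" using hh_bounds(1)[of k] by simp
 qed
 also have "\<dots> = (16 * (real n + 1) powr (2 * eta)) * (\<Sum>k<Suc n. hh k)" by (simp only: sum_distrib_left)
 also have "\<dots> \<le> (16 * (real n + 1) powr (2 * eta)) * (2 * hh 0 * sqrt (real (Suc n)))"
  by (intro mult_left_mono hh_sum) auto
 also have "sqrt (real (Suc n)) = (real n + 1) powr (1/2)" by (simp add: powr_half_sqrt add.commute)
 finally show ?thesis by (simp add: powr_add mult_ac)
qed

lemma nrm_a:
 assumes "0 \<le> eta" "eta \<le> 1"
 shows "nrm (1/4 - eta + 1) (1/4 + eta) n \<le> 2 * hh 0 * sqrt (real n + 1)"
proof -
 have "nrm (1/4 - eta + 1) (1/4 + eta) n = (\<Sum>k<Suc n. (cmod (conn (- eta) (eta - 1) (n - k)))\<^sup>2 * hh k)"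
  unfolding nrm_eq by (simp add: algebra_simps)
 also have "\<dots> \<le> (\<Sum>k<Suc n. 1 * hh k)"
 proof (intro sum_mono mult_right_mono)
  fix k
  show "(cmod (conn (- eta) (eta - 1) (n - k)))\<^sup>2 \<le> 1" using conn_bound_one[OF assms] by (simp add: power_le_one)
  show "0 \<le> hh k" using hh_bounds(1)[of k] by simp
 qed
 also have "\<dots> \<le> 2 * hh 0 * sqrt (real (Suc n))" using hh_sum[of "Suc n"] by simp
 finally show ?thesis by (simp add: add.commute)
qed

text \<open>The connection coefficients decay like the power \<open>eta - 1\<close>, at worst
  \<open>-3/4\<close>, so their squares are summable and the convolution with
  \<open>k^(-1/2)\<close> keeps the order \<open>n^(-1/2)\<close> uniformly up to
  \<open>eta = 1/4\<close>.\<close>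

lemma nrm_0:
 assumes "0 \<le> eta" "eta \<le> 1/4"
 shows "nrm (1/4 - eta) (1/4 + eta) n \<le> 20 * hh 0 / sqrt (real n + 1)"
proof -
 define N where "N = real n + 1"
 have N: "1 \<le> N" by (simp add: N_def)
 have "nrm (1/4 - eta) (1/4 + eta) n = (\<Sum>k<Suc n. (cmod (conn (- eta) eta (n - k)))\<^sup>2 * hh k)"
  unfolding nrm_eq by simp
 also have "\<dots> \<le> (\<Sum>k<Suc n. 4 * hh 0 / N * (sqrt N * (real (n - k) + 1) powr (-3/2) + 1 / sqrt (real k + 1)))"
 proof (rule sum_mono)
  fix k assume "k \<in> {..<Suc n}"
  then have k: "k \<le> n" by simp
  define i j where "i = real (n - k) + 1" and "j = real k + 1"
  have ij: "1 \<le> i" "1 \<le> j" "N \<le> i + j" "j \<le> N" using k by (auto simp: i_def j_def N_def)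
  have "cmod (conn (- eta) eta (n - k)) \<le> 2 * (pochhammer eta (n - k) / fact (n - k))"
   using assms by (intro conn_bound_neg) auto
  also have "\<dots> \<le> 2 * i powr (eta - 1)" unfolding i_def using assms by (intro mult_left_mono rising_le_powr) auto
  also have "\<dots> \<le> 2 * i powr (-3/4)" using assms ij by (intro mult_left_mono powr_mono) auto
  finally have "(cmod (conn (- eta) eta (n - k)))\<^sup>2 \<le> (2 * i powr (-3/4))\<^sup>2" by (intro power_mono) auto
  also have "\<dots> = 4 * i powr (-3/2)" by (simp add: power_mult_distrib power2_eq_square powr_add[symmetric])
  finally have "(cmod (conn (- eta) eta (n - k)))\<^sup>2 * hh k \<le> (4 * i powr (-3/2)) * (hh 0 / sqrt j)"
   using hh_bounds(1,2)[of k] by (intro mult_mono) (auto simp: j_def less_imp_le)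
  also have "\<dots> = 4 * hh 0 / N * (N * (i powr (-3/2) / sqrt j))" using N by (simp add: field_simps)
  \<comment> \<open>The factor \<open>N <= i + j\<close> splits the convolution: with
    \<open>i\<close> the first factor becomes bounded, with \<open>j\<close> the second one turns
    into at most \<open>sqrt N\<close>.\<close>
  also have "\<dots> \<le> 4 * hh 0 / N * ((i + j) * (i powr (-3/2) / sqrt j))"
   using ij hh_0 N by (intro mult_left_mono mult_right_mono) auto
  also have "(i + j) * (i powr (-3/2) / sqrt j) = i * i powr (-3/2) * (1 / sqrt j) + i powr (-3/2) * sqrt j"
  proof -
   have "sqrt j * sqrt j = j" using ij by simp
   then show ?thesis using ij by (simp add: field_simps)
  qed
  also have "4 * hh 0 / N * (i * i powr (-3/2) * (1 / sqrt j) + i powr (-3/2) * sqrt j) \<le> 4 * hh 0 / N * (1 * (1 / sqrt j) + i powr (-3/2) * sqrt N)"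
  proof (intro mult_left_mono add_mono mult_mono)
   have "i * i powr (-3/2) = i powr (-1/2)" using ij powr_add[of i 1 "-3/2"] by simp
   also have "\<dots> \<le> i powr 0" using ij by (intro powr_mono) auto
   finally show "i * i powr (-3/2) \<le> 1" using ij by simp
  qed (use ij hh_0 N in auto)
  finally show "(cmod (conn (- eta) eta (n - k)))\<^sup>2 * hh k \<le> 4 * hh 0 / N * (sqrt N * (real (n - k) + 1) powr (-3/2) + 1 / sqrt (real k + 1))"
   using hh_0 N by (simp add: i_def j_def mult_left_mono mult_ac add_ac)
 qed
 also have "\<dots> = 4 * hh 0 / N * (sqrt N * (\<Sum>k<Suc n. (real (n - k) + 1) powr (-3/2)) + (\<Sum>k<Suc n. 1 / sqrt (real k + 1)))"
  by (simp only: sum_distrib_left[symmetric] sum.distrib)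
 also have "(\<Sum>k<Suc n. (real (n - k) + 1) powr (-3/2)) = (\<Sum>k<Suc n. (real k + 1) powr (-3/2))"
  using sum.nat_diff_reindex[of "\<lambda>k. (real k + 1) powr (-3/2)" "Suc n"] by simp
 also have "4 * hh 0 / N * (sqrt N * (\<Sum>k<Suc n. (real k + 1) powr (-3/2)) + (\<Sum>k<Suc n. 1 / sqrt (real k + 1)))
   \<le> 4 * hh 0 / N * (sqrt N * 3 + 2 * sqrt (real (Suc n)))"
  using hh_0 N by (intro mult_left_mono add_mono sum_three_halves sum_inv_sqrt) auto
 also have "\<dots> = 20 * hh 0 * (sqrt N / N)" by (simp add: N_def add.commute)
 also have "sqrt N / N = 1 / sqrt N" using N by (simp add: real_div_sqrt field_simps)
 finally show ?thesis by (simp add: N_def)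
qed

text \<open>\<open>mp_Suc_deriv\<close> expresses the polynomial through those with one raised
  parameter, gaining \<open>1/n^2\<close> in the square. The factors \<open>a + i x\<close> and
  \<open>b - i x\<close> that appear are absorbed by \<open>1/(1 + x^2)\<close>.\<close>

lemma mp_weighted_norm:
 assumes eta: "0 \<le> eta" "eta < 1/4" and n: "n \<ge> 1"
 shows "integrable lborel (\<lambda>x. om x * (cmod (mp (1/4 - eta) (1/4 + eta) n (of_real x)))\<^sup>2 / (1 + x\<^sup>2))"
  "(\<integral>x. om x * (cmod (mp (1/4 - eta) (1/4 + eta) n (of_real x)))\<^sup>2 / (1 + x\<^sup>2) \<partial>lborel) \<le> 68 * hh 0 * real n powr (2 * eta - 3/2)"
proof -
 define a b where "a = 1/4 - eta" and "b = 1/4 + eta"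
 have ab: "0 \<le> a" "a \<le> 1" "0 \<le> b" "b \<le> 1" using eta by (auto simp: a_def b_def)
 obtain m where m: "n = Suc m" using n by (cases n) auto
 let ?f = "\<lambda>x. om x * (cmod (mp a b n (of_real x)))\<^sup>2 / (1 + x\<^sup>2)"
 let ?g = "\<lambda>x. 2 / (real n)\<^sup>2 * (om x * (cmod (mp a (b + 1) m (of_real x)))\<^sup>2 + om x * (cmod (mp (a + 1) b m (of_real x)))\<^sup>2)"
 have pt: "?f x \<le> ?g x" for x
 proof -
  define A B where "A = cmod (mp a (b + 1) m (of_real x))" and "B = cmod (mp (a + 1) b m (of_real x))"
  define t where "t = sqrt (1 + x\<^sup>2)"
  have t: "0 < t" "t\<^sup>2 = 1 + x\<^sup>2" by (auto simp: t_def add_pos_nonneg)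
  have le: "cmod (of_real c + \<i> * of_real y) \<le> t" if "0 \<le> c" "c \<le> 1" "y\<^sup>2 = x\<^sup>2" for c y
   unfolding t_def cmod_def using that by (intro real_sqrt_le_mono) (simp add: power_le_one)
  have ca: "cmod (of_real a + \<i> * of_real x) \<le> t" using le[of a x] ab by simp
  have cb: "cmod (of_real b - \<i> * of_real x) \<le> t" using le[of b "- x"] ab by simp
  have "real n * cmod (mp a b n (of_real x)) = cmod (of_nat (Suc m) * mp a b (Suc m) (of_real x))"
   unfolding m by (simp only: norm_mult norm_of_nat)
  also have "\<dots> \<le> cmod (of_real b - \<i> * of_real x) * A + cmod (of_real a + \<i> * of_real x) * B"
   unfolding mp_Suc_deriv A_def B_def
   by (rule norm_triangle_ineq4[THEN order_trans]) (simp add: norm_mult)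
  also have "\<dots> \<le> t * A + t * B" using ca cb by (intro add_mono mult_right_mono) (auto simp: A_def B_def)
  finally have "(real n * cmod (mp a b n (of_real x)))\<^sup>2 \<le> (t * (A + B))\<^sup>2"
   by (intro power_mono) (auto simp: algebra_simps)
  also have "\<dots> \<le> (1 + x\<^sup>2) * (2 * (A\<^sup>2 + B\<^sup>2))"
  proof -
   have "0 \<le> (A - B)\<^sup>2" by simp
   then have "(A + B)\<^sup>2 \<le> 2 * (A\<^sup>2 + B\<^sup>2)" by (simp add: power2_eq_square algebra_simps)
   then show ?thesis unfolding power_mult_distrib t(2) by (intro mult_left_mono) auto
  qed
  finally have "(cmod (mp a b n (of_real x)))\<^sup>2 / (1 + x\<^sup>2) \<le> 2 / (real n)\<^sup>2 * (A\<^sup>2 + B\<^sup>2)"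
   using n t by (simp add: field_simps power_mult_distrib add_pos_nonneg)
  from mult_left_mono[OF this, of "om x"] show ?thesis
   using om_pos[of x] unfolding A_def B_def by (simp add: algebra_simps less_imp_le)
 qed
 have g: "integrable lborel ?g" by (intro integrable_mult_right Bochner_Integration.integrable_add nrm_integrable)
 have nn: "0 \<le> ?f x" for x using om_pos[of x] by (simp add: less_imp_le)
 have f: "integrable lborel ?f"
 proof (rule Bochner_Integration.integrable_bound[OF g])
  have "(\<lambda>x. om x * (cmod (mp a b n (of_real x)))\<^sup>2) \<in> borel_measurable lborel"
   using nrm_integrable by (rule borel_measurable_integrable)
  then show "?f \<in> borel_measurable lborel" by measurable
  show "AE x in lborel. norm (?f x) \<le> norm (?g x)"
   unfolding real_norm_def abs_of_nonneg[OF nn] abs_of_nonneg[OF order_trans[OF nn pt]] by (intro AE_I2 pt)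
 qed
 show "integrable lborel (\<lambda>x. om x * (cmod (mp (1/4 - eta) (1/4 + eta) n (of_real x)))\<^sup>2 / (1 + x\<^sup>2))"
  using f by (simp only: a_def b_def)
 have "integral\<^sup>L lborel ?f \<le> integral\<^sup>L lborel ?g" by (intro integral_mono f g pt)
 also have "\<dots> = 2 / (real n)\<^sup>2 * (nrm a (b + 1) m + nrm (a + 1) b m)"
  unfolding nrm_def by (simp only: Bochner_Integration.integral_mult_right_zero Bochner_Integration.integral_add[OF nrm_integrable nrm_integrable])
 also have "\<dots> \<le> 2 / (real n)\<^sup>2 * (32 * hh 0 * real n powr (2 * eta + 1/2) + 2 * hh 0 * real n powr (2 * eta + 1/2))"
 proof (intro mult_left_mono add_mono)
  show "nrm a (b + 1) m \<le> 32 * hh 0 * real n powr (2 * eta + 1/2)"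
   using nrm_b[of eta m] eta by (simp add: a_def b_def m add.commute)
  have "nrm (a + 1) b m \<le> 2 * hh 0 * sqrt (real n)"
   using nrm_a[of eta m] eta by (simp add: a_def b_def m add.commute)
  also have "sqrt (real n) = real n powr (1/2)" by (simp add: powr_half_sqrt)
  also have "2 * hh 0 * real n powr (1/2) \<le> 2 * hh 0 * real n powr (2 * eta + 1/2)"
   using n eta hh_0 by (intro mult_left_mono powr_mono) auto
  finally show "nrm (a + 1) b m \<le> 2 * hh 0 * real n powr (2 * eta + 1/2)" .
 qed auto
 also have "\<dots> = 68 * hh 0 * (real n powr (2 * eta + 1/2) * real n powr (-2))"
  using n by (simp add: powr_minus powr_numeral field_simps)
 also have "real n powr (2 * eta + 1/2) * real n powr (-2) = real n powr (2 * eta - 3/2)"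
  unfolding powr_add[symmetric] by simp
 finally show "(\<integral>x. om x * (cmod (mp (1/4 - eta) (1/4 + eta) n (of_real x)))\<^sup>2 / (1 + x\<^sup>2) \<partial>lborel) \<le> 68 * hh 0 * real n powr (2 * eta - 3/2)"
  by (simp only: a_def b_def)
qed

section \<open>The Macdonald-type weight\<close>
definition KI :: "real \<Rightarrow> real \<Rightarrow> real \<Rightarrow> real" where
 "KI nu y v = (v\<^sup>2 + 2 * v) powr (nu - 1/2) * exp (- (y * v))"

text \<open>Up to a positive constant depending on \<open>nu\<close>, this is the Macdonald
  function: its representation as the integral of \<open>(t^2 - 1)^(nu - 1/2) exp(- y t)\<close>
  over \<open>t > 1\<close>, with \<open>t = 1 + v\<close>.\<close>

definition KK :: "real \<Rightarrow> real \<Rightarrow> real" where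
 "KK nu y = exp (- y) * y powr nu * (\<integral>v. indicator {0<..} v * KI nu y v \<partial>lborel)"

lemma Gamma_scaled:
 fixes a y :: real
 assumes a: "0 < a" and y: "0 < y"
 shows "integrable lborel (\<lambda>v. indicator {0<..} v * (v powr (a - 1) * exp (- (y * v))))"
  "(\<integral>v. indicator {0<..} v * (v powr (a - 1) * exp (- (y * v))) \<partial>lborel) = Gamma a / y powr a"
proof -
 have nn: "(\<integral>\<^sup>+t. ennreal (indicator {0..} t * (t powr (a - 1) / exp t)) \<partial>lborel) = ennreal (Gamma a)"
  using Gamma_conv_nn_integral_real[OF a] by simp
 let ?g = "\<lambda>t. indicator {0..} t * (t powr (a - 1) / exp t)"
 have g: "integrable lborel ?g" using nn by (intro integrableI_nonneg) (auto simp: indicator_def)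
 have gv: "integral\<^sup>L lborel ?g = Gamma a"
  using nn by (subst integral_eq_nn_integral) (auto simp: indicator_def Gamma_real_pos a less_imp_le)
 have e: "?g (0 + y * v) = y powr (a - 1) * (indicator {0<..} v * (v powr (a - 1) * exp (- (y * v))))" for v
  using y by (auto simp: indicator_def powr_mult exp_minus field_simps zero_le_mult_iff)
 have i: "integrable lborel (\<lambda>v. ?g (0 + y * v))" using y by (intro lborel_integrable_real_affine g) auto
 show I: "integrable lborel (\<lambda>v. indicator {0<..} v * (v powr (a - 1) * exp (- (y * v))))"
  using i y unfolding e by simp
 have "Gamma a = y * (\<integral>v. ?g (0 + y * v) \<partial>lborel)"
  using lborel_integral_real_affine[of y ?g 0] y gv by simp
 also have "\<dots> = y * (y powr (a - 1) * (\<integral>v. indicator {0<..} v * (v powr (a - 1) * exp (- (y * v))) \<partial>lborel))"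
  unfolding e by simp
 also have "y * (y powr (a - 1) * (\<integral>v. indicator {0<..} v * (v powr (a - 1) * exp (- (y * v))) \<partial>lborel)) =
  y powr a * (\<integral>v. indicator {0<..} v * (v powr (a - 1) * exp (- (y * v))) \<partial>lborel)"
  using y by (simp add: powr_diff)
 finally show "(\<integral>v. indicator {0<..} v * (v powr (a - 1) * exp (- (y * v))) \<partial>lborel) = Gamma a / y powr a"
  using y by (simp add: field_simps)
qed

context
 fixes nu :: real assumes nu: "0 < nu" "nu \<le> 1/2"
begin

text \<open>Write \<open>v^2 + 2v = 2v (1 + v/2)\<close>. Since \<open>nu <= 1/2\<close>, the factor
  \<open>(1 + v/2)^(nu - 1/2)\<close> lies between \<open>1 - v\<close> and \<open>1\<close>;
  integrating gives the first term of the large-\<open>y\<close> expansion with an error of the next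
  order.\<close>

lemma KI_bounds:
 assumes v: "0 < v"
 shows "KI nu y v \<le> 2 powr (nu - 1/2) * (v powr (nu + 1/2 - 1) * exp (- (y * v)))"
  "2 powr (nu - 1/2) * (v powr (nu + 1/2 - 1) * exp (- (y * v))) - 2 powr (nu - 1/2) * (v powr (nu + 3/2 - 1) * exp (- (y * v))) \<le> KI nu y v"
  "0 \<le> KI nu y v"
proof -
 have e: "v\<^sup>2 + 2 * v = (2 * v) * (1 + v / 2)" by (simp add: power2_eq_square algebra_simps)
 have K: "KI nu y v = 2 powr (nu - 1/2) * (v powr (nu - 1/2) * exp (- (y * v))) * (1 + v / 2) powr (nu - 1/2)"
 proof -
  have "((2 * v) * (1 + v / 2)) powr (nu - 1/2) = 2 powr (nu - 1/2) * v powr (nu - 1/2) * (1 + v / 2) powr (nu - 1/2)"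
   using v powr_mult[of "2 * v" "1 + v / 2" "nu - 1/2"] powr_mult[of 2 v "nu - 1/2"] by simp
  then show ?thesis unfolding KI_def e by (simp only: mult_ac)
 qed
 have t: "v powr (nu + 1/2 - 1) = v powr (nu - 1/2)" "v powr (nu + 3/2 - 1) = v powr (nu - 1/2) * v"
  using v powr_add[of v "nu - 1/2" 1] by simp_all
 have up: "(1 + v / 2) powr (nu - 1/2) \<le> 1"
  using v nu powr_mono[of "nu - 1/2" 0 "1 + v / 2"] by simp
 have lo: "1 - v \<le> (1 + v / 2) powr (nu - 1/2)"
 proof -
  have "(1/2 - nu) * ln (1 + v / 2) \<le> 1 * (v / 2)"
   using v nu by (intro mult_mono ln_add_one_self_le_self) auto
  moreover have "1 + (nu - 1/2) * ln (1 + v / 2) \<le> exp ((nu - 1/2) * ln (1 + v / 2))" by (rule exp_ge_add_one_self)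
  ultimately have "1 - v / 2 \<le> (1 + v / 2) powr (nu - 1/2)" using v by (simp add: powr_def algebra_simps)
  then show ?thesis using v by linarith
 qed
 define M where "M = 2 powr (nu - 1/2) * (v powr (nu - 1/2) * exp (- (y * v)))"
 have M: "0 \<le> M" by (simp add: M_def)
 show "KI nu y v \<le> 2 powr (nu - 1/2) * (v powr (nu + 1/2 - 1) * exp (- (y * v)))"
  unfolding K t M_def[symmetric] using mult_left_mono[OF up M] by simp
 have "2 powr (nu - 1/2) * (v powr (nu - 1/2) * exp (- (y * v))) - 2 powr (nu - 1/2) * (v powr (nu - 1/2) * v * exp (- (y * v))) = M * (1 - v)"
  by (simp add: M_def algebra_simps)
 then show "2 powr (nu - 1/2) * (v powr (nu + 1/2 - 1) * exp (- (y * v))) - 2 powr (nu - 1/2) * (v powr (nu + 3/2 - 1) * exp (- (y * v))) \<le> KI nu y v"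
  unfolding K t M_def[symmetric] using mult_left_mono[OF lo M] by simp
 show "0 \<le> KI nu y v" by (simp add: KI_def)
qed

lemma KI_integrable:
 assumes y: "0 < y" shows "integrable lborel (\<lambda>v. indicator {0<..} v * KI nu y v)"
proof (rule Bochner_Integration.integrable_bound)
 show "integrable lborel (\<lambda>v. 2 powr (nu - 1/2) * (indicator {0<..} v * (v powr (nu + 1/2 - 1) * exp (- (y * v)))))"
  using nu y by (intro integrable_mult_right Gamma_scaled) auto
 show "(\<lambda>v. indicator {0<..} v * KI nu y v) \<in> borel_measurable lborel" unfolding KI_def by measurable
 show "AE v in lborel. norm (indicator {0<..} v * KI nu y v) \<le> norm (2 powr (nu - 1/2) * (indicator {0<..} v * (v powr (nu + 1/2 - 1) * exp (- (y * v)))))"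
  using KI_bounds by (intro AE_I2) (auto simp: indicator_def)
qed

definition c0 where "c0 = 2 powr (nu - 1/2) * Gamma (nu + 1/2)"
definition c2 where "c2 = 2 powr (nu - 1/2) * Gamma (nu + 3/2)"

lemma c0_pos: "0 < c0" "0 < c2" using nu by (auto simp: c0_def c2_def)

lemma KK_upper: "0 < y \<Longrightarrow> KK nu y \<le> c0 * exp (- y) * y powr (-1/2)"
 and KK_lower: "0 < y \<Longrightarrow> c0 * exp (- y) * y powr (-1/2) - c2 * exp (- y) * y powr (-3/2) \<le> KK nu y"
proof -
 assume y: "0 < y"
 let ?J = "\<integral>v. indicator {0<..} v * KI nu y v \<partial>lborel"
 let ?g1 = "\<lambda>v. 2 powr (nu - 1/2) * (indicator {0<..} v * (v powr (nu + 1/2 - 1) * exp (- (y * v))))"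
 let ?g2 = "\<lambda>v. 2 powr (nu - 1/2) * (indicator {0<..} v * (v powr (nu + 3/2 - 1) * exp (- (y * v))))"
 have g: "integrable lborel ?g1" "integrable lborel ?g2"
  using nu y by (intro integrable_mult_right Gamma_scaled; simp)+
 have gv: "integral\<^sup>L lborel ?g1 = c0 / y powr (nu + 1/2)" "integral\<^sup>L lborel ?g2 = c2 / y powr (nu + 3/2)"
  using Gamma_scaled(2)[of "nu + 1/2" y] Gamma_scaled(2)[of "nu + 3/2" y] nu y by (simp_all add: c0_def c2_def)
 have "?J \<le> integral\<^sup>L lborel ?g1"
  using KI_bounds by (intro integral_mono KI_integrable y g) (auto simp: indicator_def)
 then have u: "?J \<le> c0 / y powr (nu + 1/2)" by (simp only: gv)
 have "integral\<^sup>L lborel (\<lambda>v. ?g1 v - ?g2 v) \<le> ?J"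
  using KI_bounds by (intro integral_mono KI_integrable y Bochner_Integration.integrable_diff g) (auto simp: indicator_def)
 then have l: "c0 / y powr (nu + 1/2) - c2 / y powr (nu + 3/2) \<le> ?J"
  using Bochner_Integration.integral_diff[OF g] gv by simp
 have p: "y powr nu * (c / y powr (nu + d)) = c * y powr (- d)" for c d
  using y by (simp add: powr_add powr_minus field_simps)
 have "exp (- y) * y powr nu * ?J \<le> exp (- y) * y powr nu * (c0 / y powr (nu + 1/2))"
  using u by (intro mult_left_mono) auto
 then show "KK nu y \<le> c0 * exp (- y) * y powr (-1/2)"
  unfolding KK_def mult.assoc p by (simp add: mult_ac)
 have "exp (- y) * (y powr nu * (c0 / y powr (nu + 1/2)) - y powr nu * (c2 / y powr (nu + 3/2))) \<le> exp (- y) * (y powr nu * ?J)"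
  unfolding right_diff_distrib[symmetric] using l by (intro mult_left_mono) auto
 then show "c0 * exp (- y) * y powr (-1/2) - c2 * exp (- y) * y powr (-3/2) \<le> KK nu y"
  unfolding KK_def mult.assoc p by (simp add: algebra_simps)
qed

text \<open>A lower bound that stays positive down to \<open>y = 0\<close> and has the right order
  at infinity. It comes from the window \<open>1/y <= v <= 2/y\<close>, where
  \<open>exp (- (y * v)) >= exp (-2)\<close> and the remaining powers are decreasing in
  \<open>v\<close> because \<open>nu <= 1/2\<close>.\<close>

lemma KK_lower2: "0 < y \<Longrightarrow> exp (-2) * 2 powr (2 * nu - 1) * (exp (- y) * (1 + 2 * y) powr (-1/2)) \<le> KK nu y"
proof -
 assume y: "0 < y"
 define m where "m = (1 + 2 * y) powr (nu - 1/2) * ((2 / y) powr (2 * nu - 1) * exp (-2))"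
 have low: "indicator {1/y..2/y} v * m \<le> indicator {0<..} v * KI nu y v" for v
 proof (cases "v \<in> {1/y..2/y}")
  case True
  then have v: "1 \<le> y * v" "y * v \<le> 2" "0 < v" using y by (auto simp: field_simps intro: less_le_trans[of 0 "1 / y"])
  have e: "v\<^sup>2 + 2 * v = v\<^sup>2 * (1 + 2 / v)" using v by (simp add: power2_eq_square field_simps)
  have "(v\<^sup>2 + 2 * v) powr (nu - 1/2) = v powr (2 * nu - 1) * (1 + 2 / v) powr (nu - 1/2)"
  proof -
   have "(v\<^sup>2) powr (nu - 1/2) = v powr (2 * nu - 1)"
    using v powr_powr[of v 2 "nu - 1/2"] by (simp add: powr_numeral algebra_simps)
   then show ?thesis unfolding e using v by (subst powr_mult) auto
  qed
  moreover have "(2 / y) powr (2 * nu - 1) \<le> v powr (2 * nu - 1)"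
   using True nu v by (intro powr_mono2') auto
  moreover have "(1 + 2 * y) powr (nu - 1/2) \<le> (1 + 2 / v) powr (nu - 1/2)"
  proof (rule powr_mono2')
   have "1 / v \<le> y" using v by (simp add: field_simps)
   then show "1 + 2 / v \<le> 1 + 2 * y" by (simp add: field_simps)
  qed (use nu v in \<open>auto intro: add_pos_pos\<close>)
  ultimately have "(2 / y) powr (2 * nu - 1) * (1 + 2 * y) powr (nu - 1/2) \<le> (v\<^sup>2 + 2 * v) powr (nu - 1/2)"
   by (simp add: mult_mono)
  moreover have "exp (-2) \<le> exp (- (y * v))" using v by simp
  ultimately have "((2 / y) powr (2 * nu - 1) * (1 + 2 * y) powr (nu - 1/2)) * exp (-2) \<le> KI nu y v"
   unfolding KI_def by (intro mult_mono) auto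
  then show ?thesis using True v by (simp add: m_def mult_ac)
 next
  case False
  then show ?thesis using KI_bounds(3)[of v y] by (auto simp: indicator_def)
 qed
 have "(\<integral>v. indicator {1/y..2/y} v * m \<partial>lborel) \<le> (\<integral>v. indicator {0<..} v * KI nu y v \<partial>lborel)"
  using y by (intro integral_mono KI_integrable low integrable_mult_left integrable_real_indicator)
   (auto simp: emeasure_lborel_Icc_eq)
 moreover have "(\<integral>v. indicator {1/y..2/y} v * m \<partial>lborel) = m / y" using y by (simp add: field_simps)
 ultimately have "exp (- y) * y powr nu * (m / y) \<le> KK nu y"
  unfolding KK_def by (intro mult_left_mono) auto
 moreover have "exp (- y) * y powr nu * (m / y) = exp (-2) * 2 powr (2 * nu - 1) * (exp (- y) * (y powr (- nu) * (1 + 2 * y) powr (nu - 1/2)))"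
 proof -
  have "(2 / y) powr (2 * nu - 1) = 2 powr (2 * nu - 1) * (y powr (- nu) * y powr (- nu) * y)"
  proof -
   have "y powr (- nu) * y powr (- nu) * y = y powr (1 - 2 * nu)"
    using y powr_add[of y "- nu" "- nu"] powr_add[of y "- nu + - nu" 1] by simp
   moreover have "(2 / y) powr (2 * nu - 1) = 2 powr (2 * nu - 1) * y powr (1 - 2 * nu)"
    using y powr_minus_divide[of y "2 * nu - 1"] by (simp add: powr_divide)
   ultimately show ?thesis by simp
  qed
  moreover have "y powr nu * y powr (- nu) = 1" using y powr_add[of y nu "- nu"] by simp
  ultimately show ?thesis unfolding m_def using y by (simp add: field_simps)
 qed
 moreover have "(1 + 2 * y) powr (-1/2) \<le> y powr (- nu) * (1 + 2 * y) powr (nu - 1/2)"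
 proof -
  have "(1 + 2 * y) powr (-1/2) = (1 + 2 * y) powr (- nu) * (1 + 2 * y) powr (nu - 1/2)"
   unfolding powr_add[symmetric] by simp
  also have "\<dots> \<le> y powr (- nu) * (1 + 2 * y) powr (nu - 1/2)"
   using y nu by (intro mult_right_mono powr_mono2') auto
  finally show ?thesis .
 qed
 then have "exp (-2) * 2 powr (2 * nu - 1) * (exp (- y) * (1 + 2 * y) powr (-1/2)) \<le>
  exp (-2) * 2 powr (2 * nu - 1) * (exp (- y) * (y powr (- nu) * (1 + 2 * y) powr (nu - 1/2)))"
  by (intro mult_left_mono) auto
 ultimately show ?thesis by linarith
qed

end

section \<open>Asymptotics of the comparison weight through a ratio of Gamma functions\<close>

definition vv :: "complex \<Rightarrow> complex" where "vv z = Gamma z * csqrt z / Gamma (z + 1/2)"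

text \<open>Relative defect of \<open>vv\<close> under a unit step:
  \<open>vv z = vv (z + 1) * (1 + dd z)\<close>. As \<open>vv\<close> tends to \<open>1\<close>
  along \<open>z + m\<close>, it equals the infinite product of \<open>1 + dd (z + k)\<close>, which
  serves in place of Stirling's formula.\<close>

definition dd :: "complex \<Rightarrow> complex" where "dd z = (1 + 1 / (2 * z)) / csqrt (1 + 1 / z) - 1"

lemma Re_inverse_pos: "0 < Re z \<Longrightarrow> 0 < Re (1 / z)"
proof -
 assume z: "0 < Re z"
 then have "0 < (Re z)\<^sup>2 + (Im z)\<^sup>2" by (intro add_pos_nonneg) auto
 then show ?thesis using z by (simp add: Re_divide)
qed

lemma csqrt_quotient:
 assumes "0 < Re z"
 shows "csqrt (z + 1) = csqrt z * csqrt (1 + 1 / z)"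
proof -
 have z0: "z \<noteq> 0" using assms by auto
 have "Re (1 / z) > 0" using assms by (rule Re_inverse_pos)
 then have r: "Re (1 + 1 / z) > 0" by simp
 have "-pi/2 < Arg z" "Arg z < pi/2" "-pi/2 < Arg (1 + 1 / z)" "Arg (1 + 1 / z) < pi/2"
  using assms r Arg_Re_pos[of z] Arg_Re_pos[of "1 + 1 / z"] by (auto simp: abs_less_iff)
 then have "csqrt (z * (1 + 1 / z)) = csqrt z * csqrt (1 + 1 / z)"
  by (intro csqrt_mult) auto
 also have "z * (1 + 1 / z) = z + 1" using z0 by (simp add: field_simps)
 finally show ?thesis .
qed

lemma vv_step:
 assumes "0 < Re z"
 shows "vv z = vv (z + 1) * (1 + dd z)"
proof -
 have "0 < Re (z + 1/2)" "0 < Re (1 + 1 / z)" using assms Re_inverse_pos[OF assms] by simp_all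
 then have z0: "z \<noteq> 0" "z + 1/2 \<noteq> 0" "1 + 1 / z \<noteq> 0" using assms by (metis less_irrefl zero_complex.sel(1))+
 have nn: "z \<notin> \<int>\<^sub>\<le>\<^sub>0" "z + 1/2 \<notin> \<int>\<^sub>\<le>\<^sub>0" using assms by (auto elim!: nonpos_Ints_cases simp: complex_eq_iff)
 have G: "Gamma (z + 1) = z * Gamma z" "Gamma (z + 1 + 1/2) = (z + 1/2) * Gamma (z + 1/2)"
  using Gamma_plus1[OF nn(1)] Gamma_plus1[OF nn(2)] by (simp_all add: add_ac)
 have Gn: "Gamma (z + 1/2) \<noteq> 0" using nn by (simp add: Gamma_eq_zero_iff)
 define q where "q = csqrt (1 + 1 / z)"
 have q: "q \<noteq> 0" using z0 by (simp add: q_def)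
 have "vv (z + 1) * (1 + dd z) = (z * Gamma z) * (csqrt z * q) / ((z + 1/2) * Gamma (z + 1/2)) * ((1 + 1 / (2 * z)) / q)"
  unfolding vv_def dd_def G csqrt_quotient[OF assms] q_def[symmetric] by simp
 also have "\<dots> = (Gamma z * csqrt z / Gamma (z + 1/2)) * (z * (1 + 1 / (2 * z)) / (z + 1/2))"
 proof -
  have "(z * g) * (C * q) / (t * h) * (s / q) = (g * C / h) * (z * s / t)" for g C h t s
   using q by (simp add: mult_ac)
  then show ?thesis .
 qed
 also have "z * (1 + 1 / (2 * z)) = z + 1/2" using z0 by (simp add: field_simps)
 finally show ?thesis using z0 by (simp add: vv_def)
qed

text \<open>With \<open>w = 1/z\<close> and \<open>q\<close> the square root of
  \<open>1 + w\<close>, the first-order terms cancel: \<open>1 + w/2 - q = (q - 1)^2 / 2\<close> and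
  \<open>q - 1 = w/(q + 1)\<close>.\<close>

lemma dd_bound:
 assumes "1 \<le> cmod z" "0 < Re z"
 shows "cmod (dd z) \<le> 1 / (cmod z)\<^sup>2"
proof -
 have z0: "z \<noteq> 0" using assms by auto
 define w where "w = 1 / z"
 define q where "q = csqrt (1 + w)"
 have rw: "Re w > 0" unfolding w_def using assms(2) by (rule Re_inverse_pos)
 have q2: "q\<^sup>2 = 1 + w" by (simp add: q_def)
 have rq: "0 \<le> Re q" using csqrt_principal[of "1 + w"] by (auto simp: q_def)
 have q1: "1 \<le> cmod q"
 proof -
  have "1 \<le> Re (1 + w)" using rw by simp
  also have "\<dots> \<le> cmod (1 + w)" by (rule complex_Re_le_cmod)
  finally have "1 \<le> (cmod q)\<^sup>2" unfolding q2[symmetric] by (simp add: norm_power)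
  then show ?thesis using abs_le_square_iff[of 1 "cmod q"] by simp
 qed
 have qn: "q \<noteq> 0" using q1 by auto
 have q11: "1 \<le> cmod (q + 1)" using rq complex_Re_le_cmod[of "q + 1"] by simp
 have "dd z = (1 + w / 2) / q - 1" by (simp add: dd_def w_def q_def)
 also have "\<dots> = (1 + w / 2 - q) / q" using qn by (simp add: field_simps)
 also have "1 + w / 2 - q = (q - 1)\<^sup>2 / 2"
 proof -
  have "(q - 1)\<^sup>2 = q\<^sup>2 - 2 * q + 1" by (simp add: power2_eq_square algebra_simps)
  also have "\<dots> = 2 * (1 + w / 2 - q)" unfolding q2 by (simp add: algebra_simps)
  finally show ?thesis by simp
 qed
 also have "q - 1 = w / (q + 1)"
 proof -
  have "(q - 1) * (q + 1) = w" using q2 by (simp add: power2_eq_square algebra_simps)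
  moreover have "q + 1 \<noteq> 0" using q11 by auto
  ultimately show ?thesis by (simp add: field_simps)
 qed
 finally have "cmod (dd z) = ((cmod w)\<^sup>2 / (cmod (q + 1))\<^sup>2) / 2 / cmod q"
  by (simp add: norm_divide norm_power norm_mult power_divide)
 also have "\<dots> \<le> ((cmod w)\<^sup>2 / 1\<^sup>2) / 1 / 1"
  using q1 q11 by (intro frac_le power_mono divide_nonneg_nonneg) auto
 finally show ?thesis by (simp add: w_def norm_divide power_divide)
qed

text \<open>Euler's limit says that \<open>Gamma (z + n + 1)\<close> is asymptotic to
  \<open>n! n^z\<close>; this is applied at \<open>z\<close> and at \<open>z + 1/2\<close>.\<close>

lemma vv_tendsto:
 assumes "0 < Re z"
 shows "(\<lambda>m. vv (z + of_nat m)) \<longlonglongrightarrow> 1"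
proof -
 define r where "r z n = Gamma (z + of_nat (Suc n)) / (fact n * exp (z * of_real (ln (of_nat n))))" for z :: complex and n :: nat
 have rl: "r z \<longlonglongrightarrow> 1" if z: "0 < Re z" for z
 proof -
  have nn: "z \<notin> \<int>\<^sub>\<le>\<^sub>0" using z by (auto elim!: nonpos_Ints_cases simp: complex_eq_iff)
  have Gz: "Gamma z \<noteq> 0" using nn by (simp add: Gamma_eq_zero_iff)
  have "(\<lambda>n. Gamma z / Gamma_series z n) \<longlonglongrightarrow> Gamma z / Gamma z"
   by (intro tendsto_divide tendsto_const Gamma_series_LIMSEQ Gz)
  moreover have "Gamma z / Gamma_series z n = r z n" for n
  proof -
   have "pochhammer z (Suc n) = Gamma (z + of_nat (Suc n)) / Gamma z" by (rule pochhammer_Gamma[OF nn])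
   then show ?thesis using Gz by (simp add: r_def Gamma_series_def)
  qed
  ultimately show ?thesis using Gz by simp
 qed
 have l1: "(\<lambda>n. r z n / r (z + 1/2) n) \<longlonglongrightarrow> 1 / 1"
  using assms by (intro tendsto_divide rl) auto
 have l2: "(\<lambda>n. csqrt (z / of_nat n + 1 + 1 / of_nat n)) \<longlonglongrightarrow> csqrt (0 + 1 + 0)"
 proof (rule isCont_tendsto_compose[where g = csqrt])
  show "isCont csqrt (0 + 1 + 0)" by (rule continuous_at_csqrt) simp
  have "(\<lambda>n. z / of_nat n) \<longlonglongrightarrow> 0" "(\<lambda>n. 1 / of_nat n :: complex) \<longlonglongrightarrow> 0"
   by (rule lim_const_over_n)+
  then show "(\<lambda>n. z / of_nat n + 1 + 1 / of_nat n) \<longlonglongrightarrow> 0 + 1 + 0" by (intro tendsto_intros)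
 qed
 have "(\<lambda>n. vv (z + of_nat (Suc n))) \<longlonglongrightarrow> 1 / 1 * csqrt (0 + 1 + 0)"
 proof (rule Lim_transform_eventually[OF tendsto_mult[OF l1 l2]])
  show "\<forall>\<^sub>F n in sequentially. r z n / r (z + 1/2) n * csqrt (z / of_nat n + 1 + 1 / of_nat n) = vv (z + of_nat (Suc n))"
   using eventually_gt_at_top[of 0]
  proof eventually_elim
   case (elim n)
   have ex: "exp ((z + 1/2) * of_real (ln (real n))) = exp (z * of_real (ln (real n))) * of_real (sqrt (real n))"
   proof -
    have "exp (1/2 * complex_of_real (ln (real n))) = of_real (exp (1/2 * ln (real n)))" by (simp add: exp_of_real[symmetric])
    also have "exp (1/2 * ln (real n)) = sqrt (real n)" using elim by (simp add: powr_def[symmetric] powr_half_sqrt[symmetric] powr_def)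
    finally have "exp (1/2 * complex_of_real (ln (real n))) = of_real (sqrt (real n))" .
    then show ?thesis by (simp add: distrib_right exp_add)
   qed
   have cs: "csqrt (z + of_nat (Suc n)) = of_real (sqrt (real n)) * csqrt (z / of_nat n + 1 + 1 / of_nat n)"
   proof -
    have "z + of_nat (Suc n) = of_real (real n) * (z / of_nat n + 1 + 1 / of_nat n)"
     using elim by (simp add: field_simps)
    then have "csqrt (z + of_nat (Suc n)) = csqrt (of_real (real n) * (z / of_nat n + 1 + 1 / of_nat n))" by simp
    also have "\<dots> = csqrt (of_real (real n)) * csqrt (z / of_nat n + 1 + 1 / of_nat n)"
    proof (rule csqrt_mult)
     have "Arg (of_real (real n)) = 0" using elim by (simp add: Arg_eq_0)
     then show "Arg (of_real (real n)) + Arg (z / of_nat n + 1 + 1 / of_nat n) \<in> {- pi<..pi}"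
      using mpi_less_Arg Arg_le_pi by simp
    qed
    finally show ?thesis by (simp add: csqrt_of_real)
   qed
   show ?case
    unfolding vv_def cs r_def ex
    using elim by (simp add: add_ac)
  qed
 qed
 then have "(\<lambda>n. vv (z + of_nat (Suc n))) \<longlonglongrightarrow> 1" by simp
 then show ?thesis by (subst (asm) filterlim_sequentially_Suc)
qed

text \<open>With \<open>X = |x| + k\<close>, the defects are at most
  \<open>2/X^2 <= 2 (1/(X - 1) - 1/X)\<close>. The sum over \<open>k\<close> telescopes to at most
  \<open>4/|x|\<close>, whatever \<open>a\<close> is.\<close>

lemma vv_bound:
 assumes a: "0 < a" and x: "2 \<le> \<bar>x\<bar>"
 shows "cmod (vv (Complex a x) - 1) \<le> exp (4 / \<bar>x\<bar>) - 1"
proof -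
 define z where "z = Complex a x"
 have pos: "0 < Re (z + of_nat k)" for k using a by (simp add: z_def)
 have db: "cmod (dd (z + of_nat k)) \<le> 2 * (1 / (\<bar>x\<bar> + real k - 1) - 1 / (\<bar>x\<bar> + real k))" for k
 proof -
  define X where "X = \<bar>x\<bar> + real k"
  have X: "2 \<le> X" using x by (simp add: X_def)
  have n2: "X\<^sup>2 / 2 \<le> (cmod (z + of_nat k))\<^sup>2"
  proof -
   have "(cmod (z + of_nat k))\<^sup>2 = (a + real k)\<^sup>2 + x\<^sup>2" unfolding cmod_power2 by (simp add: z_def)
   moreover have "(real k)\<^sup>2 \<le> (a + real k)\<^sup>2" using a by (intro power_mono) auto
   moreover have "0 \<le> (\<bar>x\<bar> - real k)\<^sup>2" by simp
   ultimately show ?thesis by (simp add: X_def power2_eq_square algebra_simps)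
  qed
  have "1 \<le> X\<^sup>2 / 2" using X power_mono[of 2 X 2] by simp
  then have "1 \<le> (cmod (z + of_nat k))\<^sup>2" using n2 by linarith
  then have "1 \<le> cmod (z + of_nat k)" using abs_le_square_iff[of 1 "cmod (z + of_nat k)"] by simp
  then have "cmod (dd (z + of_nat k)) \<le> 1 / (cmod (z + of_nat k))\<^sup>2" by (intro dd_bound pos)
  also have "\<dots> \<le> 1 / (X\<^sup>2 / 2)" using n2 X by (intro divide_left_mono mult_pos_pos) (auto intro: less_le_trans[of 0 "X\<^sup>2 / 2"])
  also have "\<dots> \<le> 2 * (1 / (X - 1) - 1 / X)" using X by (simp add: field_simps power2_eq_square)
  finally show ?thesis by (simp add: X_def)
 qed
 have tel: "(\<Sum>k<m. cmod (dd (z + of_nat k))) \<le> 4 / \<bar>x\<bar>" for m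
 proof -
  have "(\<Sum>k<m. cmod (dd (z + of_nat k))) \<le> (\<Sum>k<m. 2 * (1 / (\<bar>x\<bar> + real k - 1) - 1 / (\<bar>x\<bar> + real k)))"
   by (intro sum_mono db)
  also have "\<dots> = 2 * (1 / (\<bar>x\<bar> - 1) - 1 / (\<bar>x\<bar> + real m - 1))"
  proof (induction m)
   case (Suc m)
   then show ?case by (simp add: algebra_simps)
  qed simp
  also have "\<dots> \<le> 2 * (1 / (\<bar>x\<bar> - 1))" using x by simp
  also have "\<dots> \<le> 4 / \<bar>x\<bar>" using x by (simp add: field_simps)
  finally show ?thesis .
 qed
 have prod: "vv z = vv (z + of_nat m) * (\<Prod>k<m. 1 + dd (z + of_nat k))" for m
 proof (induction m)
  case (Suc m)
  have "vv (z + of_nat m) = vv (z + of_nat (Suc m)) * (1 + dd (z + of_nat m))"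
   using vv_step[OF pos[of m]] by (simp add: add_ac)
  then show ?case using Suc by (simp add: mult_ac)
 qed simp
 have pb: "cmod ((\<Prod>k<m. 1 + dd (z + of_nat k)) - 1) \<le> exp (4 / \<bar>x\<bar>) - 1" for m
 proof -
  have "cmod ((\<Prod>k<m. 1 + dd (z + of_nat k)) - 1) \<le> (\<Prod>k<m. 1 + cmod (dd (z + of_nat k))) - 1"
   by (rule norm_prod_minus1_le_prod_minus1)
  also have "(\<Prod>k<m. 1 + cmod (dd (z + of_nat k))) \<le> exp (\<Sum>k<m. cmod (dd (z + of_nat k)))"
   unfolding exp_sum[OF finite_lessThan] by (intro prod_mono) (auto intro: exp_ge_add_one_self)
  also have "\<dots> \<le> exp (4 / \<bar>x\<bar>)" using tel by simp
  finally show ?thesis by simp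
 qed
 have nz: "vv (z + of_nat m) \<noteq> 0" for m
 proof -
  have "z + of_nat m \<notin> \<int>\<^sub>\<le>\<^sub>0" "z + of_nat m + 1/2 \<notin> \<int>\<^sub>\<le>\<^sub>0" "z + of_nat m \<noteq> 0"
   using pos[of m] a by (auto elim!: nonpos_Ints_cases simp: complex_eq_iff z_def)
  then show ?thesis by (auto simp: vv_def Gamma_eq_zero_iff)
 qed
 have "(\<lambda>m. vv z / vv (z + of_nat m) - 1) \<longlonglongrightarrow> vv z / 1 - 1"
  using pos[of 0] by (intro tendsto_intros vv_tendsto) auto
 moreover have "vv z / vv (z + of_nat m) - 1 = (\<Prod>k<m. 1 + dd (z + of_nat k)) - 1" for m
  using prod[of m] nz[of m] by (simp add: field_simps)
 ultimately have "(\<lambda>m. (\<Prod>k<m. 1 + dd (z + of_nat k)) - 1) \<longlonglongrightarrow> vv z - 1" by simp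
 then have "cmod (vv z - 1) \<le> exp (4 / \<bar>x\<bar>) - 1"
  by (rule Lim_norm_ubound[OF sequentially_bot]) (simp add: pb)
 then show ?thesis by (simp add: z_def)
qed

text \<open>Since the parameters add up to \<open>1/2\<close>, the second Gamma factor is
  \<open>Gamma (1 - (z + 1/2))\<close> with \<open>z = a + i x\<close>, and the reflection formula
  turns the product into the ratio \<open>vv\<close>. The condition \<open>a <= 1/4\<close> keeps
  \<open>Re (exp (2 pi i z)) >= 0\<close>, so the factor \<open>1 + exp (2 pi i z)\<close> cannot
  vanish.\<close>

lemma rho_vv:
 assumes a: "0 < a" "a \<le> 1/4"
 shows "rho a (1/2 - a) (of_real x) * (1 + exp (2 * \<i> * of_real pi * Complex a x)) * csqrt (Complex a x) =
  2 * of_real pi * exp (\<i> * of_real pi * Complex a x) * vv (Complex a x)"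
proof -
 define z where "z = Complex a x"
 have nn: "z + 1/2 \<notin> \<int>\<^sub>\<le>\<^sub>0" using a(1) by (auto elim!: nonpos_Ints_cases simp: complex_eq_iff z_def)
 then have Gn: "Gamma (z + 1/2) \<noteq> 0" by (simp add: Gamma_eq_zero_iff)
 have e: "of_real a + \<i> * of_real x = z" "of_real (1/2 - a) - \<i> * of_real x = 1 - (z + 1/2)"
  by (auto simp: z_def complex_eq_iff)
 define E where "E = exp (\<i> * of_real pi * z)"
 have E0: "E \<noteq> 0" by (simp add: E_def)
 have s: "sin (of_real pi * (z + 1/2)) = (E + 1 / E) / 2"
 proof -
  have "sin (of_real pi * (z + 1/2)) = cos (of_real pi * z)"
   using sin_cos_eq[of "of_real pi * (z + 1/2)"] cos_minus[of "of_real pi * z"] by (simp add: algebra_simps)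
  also have "\<dots> = (E + 1 / E) / 2" by (simp add: cos_exp_eq E_def exp_minus mult_ac inverse_eq_divide)
  finally show ?thesis .
 qed
 have E2: "exp (2 * \<i> * of_real pi * z) = E * E"
  unfolding E_def exp_add[symmetric] by (rule arg_cong[where f = exp]) (simp add: algebra_simps)
 have refl: "Gamma (z + 1/2) * Gamma (1 - (z + 1/2)) = of_real pi / ((E + 1 / E) / 2)"
  unfolding Gamma_reflection_complex s ..
 have "0 \<le> Re (E * E)"
 proof -
  have "0 \<le> cos (2 * pi * a)" using a pi_gt_zero by (intro cos_ge_zero order_trans[of "- (pi / 2)" 0 "2 * pi * a"]) auto
  then show ?thesis unfolding E2[symmetric] by (simp add: Re_exp z_def)
 qed
 then have "0 < Re (E * E + 1)" by simp
 then have False': "E * E + 1 \<noteq> 0" by (metis less_irrefl zero_complex.sel(1))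
 show ?thesis
 proof -
  have "(E + 1 / E) / 2 = (E * E + 1) / (2 * E)" using E0 by (simp add: field_simps)
  then have "Gamma (1 - (z + 1/2)) * (E * E + 1) = 2 * of_real pi * E / Gamma (z + 1/2)"
   using refl Gn False' E0 by (simp add: field_simps)
  then have "Gamma z * csqrt z * (Gamma (1 - (z + 1/2)) * (E * E + 1)) = Gamma z * csqrt z * (2 * of_real pi * E / Gamma (z + 1/2))"
   by simp
  then show ?thesis unfolding rho_def e z_def[symmetric] E2 E_def[symmetric] vv_def
   by (simp add: mult_ac add.commute)
 qed
qed

lemma rho_cnj: "rho a b (of_real (- x)) = cnj (rho a b (of_real x))"
 by (simp add: rho_def cnj_Gamma)

text \<open>The phase is the quotient of \<open>exp (i pi a)\<close>, from
  \<open>exp (i pi z)\<close>, by \<open>exp (i pi/4)\<close>, from the square root of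
  \<open>i x\<close>. With \<open>a = 1/4 - eta\<close> it becomes \<open>exp (- i pi eta)\<close>,
  the phase of the Macdonald weight when \<open>eta = nu/2\<close>.\<close>

lemma rho_asymp_pos:
 assumes a: "0 < a" "a \<le> 1/4" and x: "2 \<le> x"
 shows "cmod (rho a (1/2 - a) (of_real x) - 2 * of_real pi * exp (- \<i> * of_real (pi * (1/4 - a))) * of_real (x powr (-1/2) * exp (- pi * x)))
  \<le> 2 * pi * (40 * x powr (-3/2) * exp (- pi * x))"
proof -
 define z where "z = Complex a x"
 define v where "v = vv z"
 define E2 where "E2 = exp (2 * \<i> * of_real pi * z)"
 define s where "s = csqrt (1 - \<i> * of_real (a / x))"
 define S where "S = of_real (sqrt x) * exp (\<i> * of_real (pi / 4))"
 have x0: "0 < x" using x by simp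
 have z: "z = (\<i> * of_real x) * (1 - \<i> * of_real (a / x))" using x0 by (auto simp: z_def complex_eq_iff)
 have s2: "s\<^sup>2 = 1 - \<i> * of_real (a / x)" by (simp add: s_def)
 have rs: "0 \<le> Re s" using csqrt_principal[of "1 - \<i> * of_real (a / x)"] by (auto simp: s_def)
 have s1: "1 \<le> cmod s"
 proof -
  have "1 \<le> cmod (1 - \<i> * of_real (a / x))" using complex_Re_le_cmod[of "1 - \<i> * of_real (a / x)"] by simp
  then have "1 \<le> (cmod s)\<^sup>2" unfolding s2[symmetric] by (simp add: norm_power)
  then show ?thesis using abs_le_square_iff[of 1 "cmod s"] by simp
 qed
 have sb: "cmod (s - 1) \<le> 1 / x"
 proof -
  have "1 \<le> cmod (s + 1)" using rs complex_Re_le_cmod[of "s + 1"] by simp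
  then have "cmod (s - 1) * 1 \<le> cmod (s - 1) * cmod (s + 1)" by (intro mult_left_mono) auto
  also have "\<dots> = cmod (s\<^sup>2 - 1)" unfolding norm_mult[symmetric] by (simp add: power2_eq_square algebra_simps)
  also have "\<dots> = a / x" unfolding s2 using a x0 by (simp add: norm_mult norm_divide)
  also have "\<dots> \<le> 1 / x" using a x0 by (intro divide_right_mono) auto
  finally show ?thesis by simp
 qed
 have Sq: "csqrt (\<i> * of_real x) = S"
 proof (rule csqrt_unique)
  have "exp (\<i> * of_real (pi / 4)) * exp (\<i> * of_real (pi / 4)) = exp (\<i> * of_real (pi / 2))"
   unfolding exp_add[symmetric] by (rule arg_cong[where f = exp]) (simp add: algebra_simps)
  also have "\<dots> = \<i>" using cis_pi_half by (simp only: cis_conv_exp)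
  finally have ee: "exp (\<i> * of_real (pi / 4)) * exp (\<i> * of_real (pi / 4)) = \<i>" .
  have "S\<^sup>2 = of_real (sqrt x * sqrt x) * (exp (\<i> * of_real (pi / 4)) * exp (\<i> * of_real (pi / 4)))"
   by (simp only: S_def power2_eq_square of_real_mult mult_ac)
  then show "S\<^sup>2 = \<i> * of_real x" unfolding ee using x0 by simp
  have "0 < cos (pi / 4)" by (simp add: cos_45)
  then have "0 < Re S" using x0 by (simp add: S_def Re_exp)
  then show "0 < Re S \<or> Re S = 0 \<and> 0 \<le> Im S" by simp
 qed
 have cz: "csqrt z = S * s"
 proof -
  have "Arg (\<i> * of_real x) = pi / 2" using x0 by (simp add: Arg_times_of_real2)
  moreover have "\<bar>Arg (1 - \<i> * of_real (a / x))\<bar> < pi / 2" unfolding Arg_Re_pos by simp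
  ultimately have "Arg (\<i> * of_real x) + Arg (1 - \<i> * of_real (a / x)) \<in> {- pi<..pi}" by (auto simp: abs_less_iff)
  then have "csqrt ((\<i> * of_real x) * (1 - \<i> * of_real (a / x))) = csqrt (\<i> * of_real x) * csqrt (1 - \<i> * of_real (a / x))"
   by (rule csqrt_mult)
  then show ?thesis unfolding z Sq s_def .
 qed
 have vb: "cmod (v - 1) \<le> 36 / x"
 proof -
  have "cmod (v - 1) \<le> exp (4 / x) - 1" using vv_bound[OF a(1), of x] x by (simp add: v_def z_def)
  also have "\<dots> \<le> (4 / x) * exp (4 / x)"
  proof -
   have "1 - 4 / x \<le> exp (- (4 / x))" using exp_ge_add_one_self[of "- (4 / x)"] by simp
   then have "(1 - 4 / x) * exp (4 / x) \<le> exp (- (4 / x)) * exp (4 / x)" by (intro mult_right_mono) auto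
   then show ?thesis by (simp add: exp_minus algebra_simps)
  qed
  also have "\<dots> \<le> (4 / x) * 9"
  proof (intro mult_left_mono)
   have "exp (4 / x) \<le> exp (1 + 1)" using x0 x by (simp add: field_simps)
   also have "\<dots> = exp 1 * exp 1" by (rule exp_add)
   also have "\<dots> \<le> 3 * 3" using exp_le by (intro mult_mono) auto
   finally show "exp (4 / x) \<le> 9" by simp
  qed (use x0 in auto)
  finally show ?thesis by simp
 qed
 have nE: "cmod E2 = exp (- 2 * pi * x)" by (simp add: E2_def z_def)
 have Eb: "cmod E2 \<le> 1 / x"
 proof -
  have "x \<le> exp x" using exp_ge_add_one_self[of x] by linarith
  also have "\<dots> \<le> exp (2 * pi * x)" using x0 pi_gt3 by simp
  finally have "1 / exp (2 * pi * x) \<le> 1 / x" using x0 by (intro divide_left_mono) auto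
  then show ?thesis unfolding nE by (simp add: exp_minus inverse_eq_divide)
 qed
 have E1: "1 \<le> cmod (1 + E2)"
 proof -
  have "0 \<le> cos (2 * pi * a)" using a pi_gt_zero by (intro cos_ge_zero order_trans[of "- (pi / 2)" 0 "2 * pi * a"]) auto
  then have "0 \<le> Re E2" by (simp add: E2_def Re_exp z_def)
  then show ?thesis using complex_Re_le_cmod[of "1 + E2"] by simp
 qed
 have nz: "1 + E2 \<noteq> 0" "s \<noteq> 0" "S \<noteq> 0" using E1 s1 x0 by (auto simp: S_def)
 define P where "P = exp (- \<i> * of_real (pi * (1/4 - a))) * of_real (x powr (-1/2) * exp (- pi * x))"
 have PS: "exp (\<i> * of_real pi * z) / S = P"
 proof -
  have "exp (\<i> * of_real pi * z) = exp (- \<i> * of_real (pi * (1/4 - a))) * exp (\<i> * of_real (pi / 4)) * of_real (exp (- pi * x))"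
   unfolding exp_of_real[symmetric] exp_add[symmetric] by (rule arg_cong[where f = exp]) (simp add: z_def complex_eq_iff algebra_simps)
  moreover have "x powr (-1/2) = 1 / sqrt x" using x0 by (simp add: powr_minus_divide powr_half_sqrt)
  then have "complex_of_real (x powr (-1/2)) = 1 / of_real (sqrt x)" by (simp only: of_real_divide of_real_1)
  moreover have "\<alpha> * \<beta> * \<gamma> / (\<delta> * \<beta>) = \<alpha> * ((1 / \<delta>) * \<gamma>)" if "\<beta> \<noteq> 0" for \<alpha> \<beta> \<gamma> \<delta> :: complex
   using that by simp
  ultimately show ?thesis using \<open>exp (\<i> * of_real pi * z) = _\<close> unfolding P_def S_def of_real_mult by simp
 qed
 have "rho a (1/2 - a) (of_real x) = 2 * of_real pi * exp (\<i> * of_real pi * z) * v / ((1 + E2) * (S * s))"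
 proof -
  have "rho a (1/2 - a) (of_real x) * ((1 + E2) * (S * s)) = 2 * of_real pi * exp (\<i> * of_real pi * z) * v"
   using rho_vv[OF a, of x] unfolding z_def[symmetric] E2_def[symmetric] cz v_def[symmetric] by (simp only: mult.assoc)
  then show ?thesis using nz by (metis mult_eq_0_iff nonzero_eq_divide_eq)
 qed
 also have "\<dots> = 2 * of_real pi * (P * (v / ((1 + E2) * s)))"
  unfolding PS[symmetric] by (simp add: mult_ac)
 finally have rr: "rho a (1/2 - a) (of_real x) = 2 * of_real pi * (P * (v / ((1 + E2) * s)))" .
 have "rho a (1/2 - a) (of_real x) - 2 * of_real pi * P = 2 * of_real pi * (P * ((v - (1 + E2) * s) / ((1 + E2) * s)))"
 proof -
  have nn: "(1 + E2) * s \<noteq> 0" using nz by simp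
  then have "(v - (1 + E2) * s) / ((1 + E2) * s) = v / ((1 + E2) * s) - 1" by (simp only: diff_divide_distrib divide_self[OF nn])
  then show ?thesis unfolding rr by (simp only: right_diff_distrib mult_1_right mult.assoc)
 qed
 then have "cmod (rho a (1/2 - a) (of_real x) - 2 * of_real pi * P) = 2 * pi * (cmod P * (cmod (v - (1 + E2) * s) / (cmod (1 + E2) * cmod s)))"
  by (simp add: norm_mult norm_divide)
 \<comment> \<open>The \<open>40\<close> rounds up \<open>36 + 1 + 2\<close>: the errors of
   \<open>vv\<close>, of \<open>s\<close> and of \<open>1 + E2\<close>, each of order
   \<open>1/x\<close>.\<close>
 also have "\<dots> \<le> 2 * pi * (cmod P * ((40 / x) / (1 * 1)))"
 proof (intro mult_left_mono frac_le)
  have e: "v - (1 + E2) * s = (v - 1) - (s - 1) - E2 * s" by (simp add: algebra_simps)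
  have "cmod (v - (1 + E2) * s) \<le> cmod (v - 1) + cmod (s - 1) + cmod (E2 * s)"
   unfolding e using norm_triangle_ineq4[of "v - 1 - (s - 1)" "E2 * s"] norm_triangle_ineq4[of "v - 1" "s - 1"] by linarith
  moreover have "cmod (E2 * s) \<le> (1 / x) * 2"
  proof -
   have "1 / x \<le> 1" using x by simp
   then have "cmod s \<le> 2" using norm_triangle_ineq[of "s - 1" 1] sb by simp
   then show ?thesis unfolding norm_mult using Eb x0 by (intro mult_mono) auto
  qed
  ultimately have "cmod (v - (1 + E2) * s) \<le> 36 / x + 1 / x + (1 / x) * 2" using vb sb by linarith
  also have "\<dots> \<le> 40 / x" using x0 by (simp add: divide_simps)
  finally show "cmod (v - (1 + E2) * s) \<le> 40 / x" .
  show "1 * 1 \<le> cmod (1 + E2) * cmod s" using E1 s1 by (intro mult_mono) auto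
 qed (use x0 in auto)
 also have "cmod P = x powr (-1/2) * exp (- pi * x)" by (simp add: P_def norm_mult)
 also have "x powr (-1/2) * exp (- pi * x) * (40 / x / (1 * 1)) = 40 * x powr (-3/2) * exp (- pi * x)"
  using x0 powr_diff[of x "-1/2" 1] by simp
 finally show ?thesis by (simp add: P_def mult_ac)
qed

lemma Gamma_bounded_compact:
 assumes "0 < l"
 shows "\<exists>B>0. \<forall>s t. l \<le> s \<and> s \<le> u \<longrightarrow> cmod (Gamma (Complex s t)) \<le> B"
proof -
 have "continuous_on {l..u} (\<lambda>x::real. Gamma x)"
  using assms by (intro continuous_intros) (auto elim!: nonpos_Ints_cases)
 then have "bounded ((\<lambda>x::real. Gamma x) ` {l..u})"
  by (intro compact_imp_bounded compact_continuous_image) auto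
 then obtain B where B: "B > 0" "\<And>x. x \<in> {l..u} \<Longrightarrow> \<bar>Gamma x\<bar> \<le> B" unfolding bounded_pos by auto
 show ?thesis
 proof (intro exI[of _ B] conjI allI impI B)
  fix s t assume s: "l \<le> s \<and> s \<le> u"
  have "cmod (Gamma (Complex s t)) \<le> Gamma s" using s assms by (intro norm_Gamma_le) auto
  also have "\<dots> \<le> B" using B(2)[of s] s by auto
  finally show "cmod (Gamma (Complex s t)) \<le> B" .
 qed
qed

text \<open>Uniform as \<open>a\<close> tends to \<open>0\<close>, where
  \<open>Gamma (a + i x)\<close> develops a pole at the origin: the factor \<open>|a + i x|\<close>
  is absorbed by the functional equation.\<close>

lemma rho_crude: "\<exists>B>0. \<forall>a x. 0 < a \<and> a \<le> 1/4 \<longrightarrow> cmod (rho a (1/2 - a) (of_real x)) * cmod (Complex a x) \<le> B"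
proof -
 obtain B1 where B1: "B1 > 0" "\<And>s t. 1 \<le> s \<and> s \<le> 2 \<Longrightarrow> cmod (Gamma (Complex s t)) \<le> B1"
  using Gamma_bounded_compact[of 1 2] by auto
 obtain B2 where B2: "B2 > 0" "\<And>s t. 1/4 \<le> s \<and> s \<le> 1/2 \<Longrightarrow> cmod (Gamma (Complex s t)) \<le> B2"
  using Gamma_bounded_compact[of "1/4" "1/2"] by auto
 show ?thesis
 proof (intro exI[of _ "B1 * B2"] conjI allI impI)
  show "0 < B1 * B2" using B1 B2 by simp
  fix a x :: real assume a: "0 < a \<and> a \<le> 1/4"
  have "Complex a x * rho a (1/2 - a) (of_real x) = rho (a + 1) (1/2 - a) (of_real x)"
   using rho_step(1)[of a x "1/2 - a"] a by (simp add: Complex_eq)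
  also have "\<dots> = Gamma (Complex (a + 1) x) * Gamma (Complex (1/2 - a) (- x))"
   by (simp add: rho_def Complex_eq)
  finally have "cmod (Complex a x * rho a (1/2 - a) (of_real x)) = cmod (Gamma (Complex (a + 1) x) * Gamma (Complex (1/2 - a) (- x)))"
   by (rule arg_cong)
  then have "cmod (rho a (1/2 - a) (of_real x)) * cmod (Complex a x) = cmod (Gamma (Complex (a + 1) x)) * cmod (Gamma (Complex (1/2 - a) (- x)))"
   by (simp only: norm_mult mult.commute)
  also have "\<dots> \<le> B1 * B2" using B1 B2 a by (intro mult_mono) auto
  finally show "cmod (rho a (1/2 - a) (of_real x)) * cmod (Complex a x) \<le> B1 * B2" .
 qed
qed

definition tail :: "real \<Rightarrow> real" where "tail x = \<bar>x\<bar> powr (-1/2) * exp (- pi * \<bar>x\<bar>)"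

text \<open>Beyond \<open>|x| = 2\<close> this is \<open>rho_asymp_pos\<close>; between
  \<open>x0\<close> and \<open>2\<close> the crude bound suffices because \<open>tail\<close> is
  bounded below there. Negative \<open>x\<close> follows by conjugation. The constant depends on
  \<open>x0\<close> only, not on \<open>a\<close>.\<close>

lemma rho_asymp:
 assumes x0: "0 < x0"
 shows "\<exists>C>0. \<forall>a x. 0 < a \<and> a \<le> 1/4 \<and> x0 \<le> \<bar>x\<bar> \<longrightarrow>
  cmod (rho a (1/2 - a) (of_real x) - 2 * of_real pi * exp (- \<i> * of_real (pi * (1/4 - a) * sgn x)) * of_real (tail x)) \<le> C / \<bar>x\<bar> * tail x"
proof -
 obtain B where B: "B > 0" "\<And>a x. 0 < a \<and> a \<le> 1/4 \<Longrightarrow> cmod (rho a (1/2 - a) (of_real x)) * cmod (Complex a x) \<le> B"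
  using rho_crude by blast
 define C1 where "C1 = (B / x0) / (2 powr (-1/2) * exp (- pi * 2)) * 2 + 2 * pi * 2"
 have C1: "C1 > 0" using B x0 by (simp add: C1_def add_pos_pos)
 define C where "C = max (2 * pi * 40) C1"
 have pos: "cmod (rho a (1/2 - a) (of_real x) - 2 * of_real pi * exp (- \<i> * of_real (pi * (1/4 - a))) * of_real (tail x)) \<le> C / x * tail x"
  if a: "0 < a" "a \<le> 1/4" and x: "x0 \<le> x" for a x
 proof (cases "2 \<le> x")
  case True
  have "x powr (-3/2) = x powr (-1/2) / x" using True powr_diff[of x "-1/2" 1] by simp
  then have "cmod (rho a (1/2 - a) (of_real x) - 2 * of_real pi * exp (- \<i> * of_real (pi * (1/4 - a))) * of_real (tail x)) \<le> (2 * pi * 40) / x * tail x"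
   using rho_asymp_pos[OF a True] True by (simp add: tail_def mult_ac)
  also have "\<dots> \<le> C / x * tail x" using True by (intro mult_right_mono divide_right_mono) (auto simp: C_def tail_def)
  finally show ?thesis .
 next
  case False
  have xp: "0 < x" using x x0 by simp
  have t2: "2 powr (-1/2) * exp (- pi * 2) \<le> tail x"
   unfolding tail_def using xp False by (intro mult_mono powr_mono2') auto
  have tp: "0 < 2 powr (-1/2) * exp (- pi * (2::real))" by simp
  have "x \<le> cmod (Complex a x)" using abs_Im_le_cmod[of "Complex a x"] xp by simp
  then have "cmod (rho a (1/2 - a) (of_real x)) * x0 \<le> cmod (rho a (1/2 - a) (of_real x)) * cmod (Complex a x)"
   using x by (intro mult_left_mono) auto
  then have "cmod (rho a (1/2 - a) (of_real x)) \<le> B / x0" using B(2)[of a x] a x0 by (simp add: field_simps)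
  also have "\<dots> = (B / x0) / (2 powr (-1/2) * exp (- pi * 2)) * (2 powr (-1/2) * exp (- pi * 2))" using less_imp_neq[OF tp] by (simp only: times_divide_eq_left nonzero_mult_div_cancel_right) simp
  also have "\<dots> \<le> (B / x0) / (2 powr (-1/2) * exp (- pi * 2)) * tail x" using t2 B x0 by (intro mult_left_mono) auto
  finally have r: "cmod (rho a (1/2 - a) (of_real x)) \<le> (B / x0) / (2 powr (-1/2) * exp (- pi * 2)) * tail x" .
  have tn: "0 \<le> tail x" by (simp add: tail_def)
  have q: "cmod (2 * of_real pi * exp (- \<i> * of_real (pi * (1/4 - a))) * of_real (tail x)) = 2 * pi * tail x"
   using tn by (simp add: norm_mult)
  have "cmod (rho a (1/2 - a) (of_real x) - 2 * of_real pi * exp (- \<i> * of_real (pi * (1/4 - a))) * of_real (tail x))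
   \<le> (B / x0) / (2 powr (-1/2) * exp (- pi * 2)) * tail x + 2 * pi * tail x"
   by (rule norm_triangle_le_diff) (use r q in linarith)
  also have "\<dots> = (C1 / 2) * tail x" by (simp add: C1_def algebra_simps)
  also have "\<dots> \<le> (C / x) * tail x"
  proof (intro mult_right_mono tn)
   have "C1 / 2 \<le> C1 / x" using False xp C1 by (intro divide_left_mono) auto
   also have "\<dots> \<le> C / x" using xp by (intro divide_right_mono) (auto simp: C_def)
   finally show "C1 / 2 \<le> C / x" .
  qed
  finally show ?thesis .
 qed
 show ?thesis
 proof (intro exI[of _ C] conjI allI impI)
  show "0 < C" using C1 by (simp add: C_def)
  fix a x :: real assume A: "0 < a \<and> a \<le> 1/4 \<and> x0 \<le> \<bar>x\<bar>"
  show "cmod (rho a (1/2 - a) (of_real x) - 2 * of_real pi * exp (- \<i> * of_real (pi * (1/4 - a) * sgn x)) * of_real (tail x)) \<le> C / \<bar>x\<bar> * tail x"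
  proof (cases "0 < x")
   case True
   then show ?thesis using pos[of a x] A by simp
  next
   case False
   then have x: "x < 0" using A x0 by auto
   have e: "rho a (1/2 - a) (of_real x) - 2 * of_real pi * exp (- \<i> * of_real (pi * (1/4 - a) * sgn x)) * of_real (tail x) =
    cnj (rho a (1/2 - a) (of_real (- x)) - 2 * of_real pi * exp (- \<i> * of_real (pi * (1/4 - a))) * of_real (tail (- x)))"
    using x rho_cnj[of a "1/2 - a" "- x"] by (simp add: exp_cnj tail_def)
   show ?thesis unfolding e complex_mod_cnj using pos[of a "- x"] A x by (simp add: tail_def)
  qed
 qed
qed

section \<open>Two-sided envelopes of the reference weight\<close>

lemma om_rho: "om x = cmod (rho (1/4) (1/2 - 1/4) (of_real x))"
 using rho_om[of x] om_pos[of x] by simp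

lemma om_continuous: "continuous_on UNIV om"
proof -
 have "continuous_on UNIV (\<lambda>x. Gamma (Complex (1/4) x))"
 proof (rule continuous_on_compose2[where g = Gamma and f = "\<lambda>x. Complex (1/4) x" and t = "{z. 0 < Re z}"])
  show "continuous_on {z. 0 < Re z} (Gamma :: complex \<Rightarrow> complex)"
   by (intro holomorphic_on_imp_continuous_on holomorphic_Gamma) (auto elim!: nonpos_Ints_cases)
 qed (auto intro!: continuous_intros simp: Complex_eq)
 then show ?thesis unfolding om_def[abs_def] by (intro continuous_intros)
qed

lemma tail_pos: "x \<noteq> 0 \<Longrightarrow> 0 < tail x" by (simp add: tail_def)

lemma om_lower:
 assumes x0: "0 < x0"
 shows "\<exists>c>0. \<forall>x. x0 \<le> \<bar>x\<bar> \<longrightarrow> c * tail x \<le> om x"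
proof -
 obtain C where C: "C > 0" "\<And>a x. 0 < a \<and> a \<le> 1/4 \<and> x0 \<le> \<bar>x\<bar> \<Longrightarrow>
  cmod (rho a (1/2 - a) (of_real x) - 2 * of_real pi * exp (- \<i> * of_real (pi * (1/4 - a) * sgn x)) * of_real (tail x)) \<le> C / \<bar>x\<bar> * tail x"
  using rho_asymp[OF x0] by blast
 \<comment> \<open>Beyond \<open>X\<close> the remainder is at most \<open>tail x\<close>, to be
   compared with the main term \<open>2 pi * tail x\<close>; between \<open>x0\<close> and
   \<open>X\<close> compactness gives the bound.\<close>
 define X where "X = max x0 C"
 have X: "X > 0" "x0 \<le> X" "C \<le> X" using x0 by (auto simp: X_def)
 have far: "1 * tail x \<le> om x" if x: "X \<le> \<bar>x\<bar>" for x
 proof -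
  have xp: "0 < \<bar>x\<bar>" using x X by linarith
  have tn: "0 \<le> tail x" by (simp add: tail_def)
  have "cmod (rho (1/4) (1/2 - 1/4) (of_real x) - 2 * of_real pi * of_real (tail x)) \<le> C / \<bar>x\<bar> * tail x"
   using C(2)[of "1/4" x] x X by simp
  also have "\<dots> \<le> 1 * tail x" using x X xp tn by (intro mult_right_mono) auto
  finally have d: "cmod (rho (1/4) (1/2 - 1/4) (of_real x) - 2 * of_real pi * of_real (tail x)) \<le> tail x" by simp
  have "2 * pi * tail x = cmod (2 * of_real pi * of_real (tail x))" using tn by (simp add: norm_mult)
  also have "\<dots> \<le> om x + tail x"
   unfolding om_rho using d norm_triangle_sub[of "2 * of_real pi * of_real (tail x)" "rho (1/4) (1/2 - 1/4) (of_real x)"]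
   by (simp add: norm_minus_commute)
  finally have "(2 * pi - 1) * tail x \<le> om x" by (simp add: algebra_simps)
  moreover have "1 * tail x \<le> (2 * pi - 1) * tail x" using pi_gt3 tn by (intro mult_right_mono) auto
  ultimately show ?thesis by simp
 qed
 define K where "K = {- X..- x0} \<union> {x0..X}"
 have K: "compact K" "K \<noteq> {}" using X by (auto simp: K_def)
 have "continuous_on K (\<lambda>x. om x / tail x)"
  unfolding tail_def by (intro continuous_intros continuous_on_subset[OF om_continuous]) (use x0 in \<open>auto simp: K_def\<close>)
 from continuous_attains_inf[OF K this] obtain y where y: "y \<in> K" "\<And>x. x \<in> K \<Longrightarrow> om y / tail y \<le> om x / tail x" by blast
 have y0: "y \<noteq> 0" using y(1) x0 by (auto simp: K_def)
 define m where "m = om y / tail y"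
 have m: "m > 0" using om_pos[of y] tail_pos[OF y0] by (simp add: m_def)
 show ?thesis
 proof (intro exI[of _ "min 1 m"] conjI allI impI)
  show "0 < min 1 m" using m by simp
  fix x assume x: "x0 \<le> \<bar>x\<bar>"
  then have t: "0 < tail x" using x0 by (intro tail_pos) auto
  show "min 1 m * tail x \<le> om x"
  proof (cases "X \<le> \<bar>x\<bar>")
   case True
   have "min 1 m * tail x \<le> 1 * tail x" using t by (intro mult_right_mono) auto
   then show ?thesis using far[OF True] by linarith
  next
   case False
   then have "x \<in> K" using x by (auto simp: K_def abs_if split: if_splits)
   then have "m \<le> om x / tail x" using y by (simp add: m_def)
   then have "m * tail x \<le> om x" using t by (simp add: field_simps)
   moreover have "min 1 m * tail x \<le> m * tail x" using t by (intro mult_right_mono) auto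
   ultimately show ?thesis by linarith
  qed
 qed
qed

text \<open>The envelope is the one of \<open>KK_lower2\<close> at \<open>y = pi |x|\<close>, finite
  at the origin, so that \<open>om\<close> becomes dominated by the Macdonald weight.\<close>

lemma om_upper: "\<exists>C>0. \<forall>x. om x \<le> C * ((1 + 2 * (pi * \<bar>x\<bar>)) powr (-1/2) * exp (- (pi * \<bar>x\<bar>)))"
proof -
 obtain C where C: "C > 0" "\<And>a x. 0 < a \<and> a \<le> 1/4 \<and> 1 \<le> \<bar>x\<bar> \<Longrightarrow>
  cmod (rho a (1/2 - a) (of_real x) - 2 * of_real pi * exp (- \<i> * of_real (pi * (1/4 - a) * sgn x)) * of_real (tail x)) \<le> C / \<bar>x\<bar> * tail x"
  using rho_asymp[of 1] by auto
 obtain B where B: "B > 0" "\<And>x. om x \<le> B"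
 proof -
  have "om x \<le> (Gamma (1/4))\<^sup>2" for x
   unfolding om_def by (intro power_mono norm_Gamma_le) auto
  then show ?thesis using that[of "(Gamma (1/4 :: real))\<^sup>2"] Gamma_real_pos[of "1/4"] by (meson zero_less_power zero_less_divide_1_iff zero_less_numeral)
 qed
 define g where "g x = (1 + 2 * (pi * \<bar>x\<bar>)) powr (-1/2) * exp (- (pi * \<bar>x\<bar>))" for x
 define C1 where "C1 = (2 * pi + C) * (1 + 2 * pi) powr (1/2)"
 define C2 where "C2 = B / g 1"
 have "0 < 1 + 2 * pi" using pi_gt_zero by linarith
 then have g1: "0 < g 1" unfolding g_def by (intro mult_pos_pos) (auto simp: less_imp_neq[THEN not_sym])
 have C12: "C1 > 0" "C2 > 0" using C B g1 \<open>0 < 1 + 2 * pi\<close>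
  by (auto simp: C1_def C2_def less_imp_neq[THEN not_sym] intro!: mult_pos_pos add_pos_pos)
 have "om x \<le> (C1 + C2) * g x" for x
 proof (cases "1 \<le> \<bar>x\<bar>")
  case True
  have tn: "0 \<le> tail x" by (simp add: tail_def)
  have "cmod (rho (1/4) (1/2 - 1/4) (of_real x) - 2 * of_real pi * of_real (tail x)) \<le> C / \<bar>x\<bar> * tail x"
   using C(2)[of "1/4" x] True by simp
  also have "\<dots> \<le> C / 1 * tail x" using True C tn by (intro mult_right_mono divide_left_mono) auto
  finally have "om x \<le> cmod (2 * of_real pi * of_real (tail x) :: complex) + C * tail x"
   unfolding om_rho using norm_triangle_sub[of "rho (1/4) (1/2 - 1/4) (of_real x)" "2 * of_real pi * of_real (tail x)"] by simp
  also have "\<dots> = (2 * pi + C) * tail x" using tn by (simp add: norm_mult algebra_simps)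
  also have "\<dots> \<le> (2 * pi + C) * ((1 + 2 * pi) powr (1/2) * g x)"
  proof (intro mult_left_mono)
   have "(1 + 2 * (pi * \<bar>x\<bar>)) \<le> (1 + 2 * pi) * \<bar>x\<bar>" using True by (simp add: algebra_simps)
   then have "((1 + 2 * pi) * \<bar>x\<bar>) powr (-1/2) \<le> (1 + 2 * (pi * \<bar>x\<bar>)) powr (-1/2)"
    by (intro powr_mono2') (auto intro: add_pos_nonneg)
   moreover have "((1 + 2 * pi) * \<bar>x\<bar>) powr (-1/2) = (1 + 2 * pi) powr (-1/2) * \<bar>x\<bar> powr (-1/2)"
    by (rule powr_mult)
   ultimately have "(1 + 2 * pi) powr (1/2) * ((1 + 2 * pi) powr (-1/2) * \<bar>x\<bar> powr (-1/2)) \<le> (1 + 2 * pi) powr (1/2) * (1 + 2 * (pi * \<bar>x\<bar>)) powr (-1/2)"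
    by (intro mult_left_mono) auto
   moreover have "(1 + 2 * pi) powr (1/2) * ((1 + 2 * pi) powr (-1/2) * \<bar>x\<bar> powr (-1/2)) = \<bar>x\<bar> powr (-1/2)"
    unfolding mult.assoc[symmetric] powr_add[symmetric] using pi_gt_zero by (simp add: add_pos_pos less_imp_neq[THEN not_sym])
   ultimately have "\<bar>x\<bar> powr (-1/2) \<le> (1 + 2 * pi) powr (1/2) * (1 + 2 * (pi * \<bar>x\<bar>)) powr (-1/2)" by (simp only:)
   from mult_right_mono[OF this, of "exp (- (pi * \<bar>x\<bar>))"]
   show "tail x \<le> (1 + 2 * pi) powr (1/2) * g x" by (simp add: tail_def g_def mult_ac)
  qed (use C in auto)
  also have "\<dots> = C1 * g x" by (simp add: C1_def)
  also have "\<dots> \<le> (C1 + C2) * g x" using C12 by (intro mult_right_mono) (auto simp: g_def)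
  finally show ?thesis .
 next
  case False
  have "om x \<le> C2 * g 1" using B g1 by (simp add: C2_def)
  also have "\<dots> \<le> C2 * g x"
  proof (intro mult_left_mono)
   show "g 1 \<le> g x" unfolding g_def using False by (intro mult_mono powr_mono2') (auto intro: add_pos_nonneg)
  qed (use C12 in auto)
  also have "\<dots> \<le> (C1 + C2) * g x" using C12 by (intro mult_right_mono) (auto simp: g_def)
  finally show ?thesis .
 qed
 then show ?thesis unfolding g_def using C12 by (intro exI[of _ "C1 + C2"]) auto
qed

lemma tail_poly_integrable: "integrable lborel (\<lambda>x. complex_of_real (tail x) * poly p (of_real x))"
proof -
 have mono: "integrable lborel (\<lambda>x. complex_of_real (tail x * x ^ i))" for i
 proof (rule integrable_of_real)
  have "set_integrable lborel {0..} (\<lambda>v::real. v powr (real i + 1/2 - 1) * exp (- (pi * v)))"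
  proof -
   have "integrable lborel (\<lambda>v. indicator {0<..} v * (v powr (real i + 1/2 - 1) * exp (- (pi * v))))"
    by (rule Gamma_scaled(1)) auto
   moreover have "indicator {0<..} v * (v powr (real i + 1/2 - 1) * exp (- (pi * v))) = indicator {0..} v *\<^sub>R (v powr (real i + 1/2 - 1) * exp (- (pi * v)))" for v :: real
    by (cases "v = 0") (simp_all add: indicator_def)
   ultimately show ?thesis unfolding set_integrable_def by (simp only:)
  qed
  from integrable_abs_line[OF this]
  have "integrable lborel (\<lambda>x::real. \<bar>x\<bar> powr (real i + 1/2 - 1) * exp (- (pi * \<bar>x\<bar>)))" .
  then show "integrable lborel (\<lambda>x. tail x * x ^ i)"
  proof (rule Bochner_Integration.integrable_bound)
   show "AE x in lborel. norm (tail x * x ^ i) \<le> norm (\<bar>x\<bar> powr (real i + 1/2 - 1) * exp (- (pi * \<bar>x\<bar>)))"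
   proof (rule AE_I2)
    fix x :: real
    have "\<bar>x\<bar> powr (real i + 1/2 - 1) = \<bar>x\<bar> powr (-1/2) * \<bar>x\<bar> ^ i" if "x \<noteq> 0"
     using that by (simp add: powr_realpow[symmetric] powr_add[symmetric])
    then show "norm (tail x * x ^ i) \<le> norm (\<bar>x\<bar> powr (real i + 1/2 - 1) * exp (- (pi * \<bar>x\<bar>)))"
     by (cases "x = 0") (auto simp: tail_def abs_mult power_abs mult_ac)
   qed
  qed (simp add: tail_def)
 qed
 have "complex_of_real (tail x) * poly p (of_real x) = (\<Sum>i\<le>degree p. complex_of_real (tail x * x ^ i) * Polynomial.coeff p i)" for x
  unfolding poly_altdef sum_distrib_left by (intro sum.cong refl) (simp add: mult_ac)
 then show ?thesis using mono by (simp only:) (intro Bochner_Integration.integrable_sum integrable_mult_left)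
qed

lemma poly_line_measurable[measurable]: "(\<lambda>x. poly p (complex_of_real x)) \<in> borel_measurable borel"
 by (intro borel_measurable_continuous_onI continuous_intros)

lemma tail_dominated_integrable:
 fixes f :: "real \<Rightarrow> complex"
 assumes f: "f \<in> borel_measurable lborel" and bd: "\<And>x. x \<noteq> 0 \<Longrightarrow> cmod (f x) \<le> C * tail x"
 shows "integrable lborel (\<lambda>x. f x * poly p (of_real x))"
proof (rule Bochner_Integration.integrable_bound)
 show "integrable lborel (\<lambda>x. of_real C * (complex_of_real (tail x) * poly p (of_real x)))"
  by (intro integrable_mult_right tail_poly_integrable)
 show "(\<lambda>x. f x * poly p (of_real x)) \<in> borel_measurable lborel" using f by measurable
 show "AE x in lborel. norm (f x * poly p (of_real x)) \<le> norm (of_real C * (complex_of_real (tail x) * poly p (of_real x)))"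
  using AE_lborel_singleton[of "0::real"]
 proof eventually_elim
  case (elim x)
  have "cmod (f x) \<le> \<bar>C\<bar> * tail x" using bd[OF elim] abs_ge_self[of C] tail_pos[OF elim]
   by (meson mult_right_mono order_trans less_imp_le)
  then have "cmod (f x) * cmod (poly p (of_real x)) \<le> (\<bar>C\<bar> * tail x) * cmod (poly p (of_real x))" by (rule mult_right_mono) simp
  then show ?case using tail_pos[OF elim] by (simp add: norm_mult mult.assoc)
 qed
qed

lemma KK_measurable[measurable]: "KK nu \<in> borel_measurable lborel"
proof -
 have "(\<lambda>y. \<integral>v. indicator {0<..} v * KI nu y v \<partial>lborel) \<in> borel_measurable lborel"
  unfolding KI_def by measurable
 then show ?thesis unfolding KK_def[abs_def] by measurable
qed

section \<open>Relative distance between the Macdonald weight and the Gamma weight\<close>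

definition KX :: "real \<Rightarrow> real \<Rightarrow> real" where "KX nu x = KK nu (pi * \<bar>x\<bar>)"
definition ww :: "real \<Rightarrow> real \<Rightarrow> complex" where
 "ww nu x = exp (- \<i> * of_real (pi * (nu / 2) * sgn x)) * of_real (KX nu x)"
text \<open>Matches the leading tails: \<open>2 pi * C0 nu\<close> equals
  \<open>c0 nu / sqrt pi\<close>, the coefficient of \<open>tail\<close> in
  \<open>KX nu\<close>.\<close>

definition C0 :: "real \<Rightarrow> real" where "C0 nu = c0 nu / (2 * pi * sqrt pi)"

lemma KX_measurable[measurable]: "KX nu \<in> borel_measurable lborel"
 unfolding KX_def[abs_def] by (rule measurable_compose[OF _ KK_measurable]) simp

lemma ww_measurable[measurable]: "ww nu \<in> borel_measurable lborel"
proof -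
 have "(sgn :: real \<Rightarrow> real) \<in> borel_measurable borel"
 proof -
  have "(sgn :: real \<Rightarrow> real) = (\<lambda>x. indicator {0<..} x - indicator {..<0} x)" by (auto simp: fun_eq_iff sgn_real_def)
  moreover have "(\<lambda>x::real. indicator {0<..} x - indicator {..<0} x :: real) \<in> borel_measurable borel" by measurable
  ultimately show ?thesis by simp
 qed
 then show ?thesis unfolding ww_def[abs_def] by measurable
qed

lemma cmod_exp_im[simp]: "cmod (exp (- \<i> * of_real t)) = 1" "cmod (exp (- (\<i> * of_real t))) = 1"
 by simp_all

context
 fixes nu :: real assumes nu: "0 < nu" "nu \<le> 1/2"
begin

lemma C0_pos: "0 < C0 nu" using c0_pos(1)[OF nu] by (simp add: C0_def)

lemma tail_pi: "x \<noteq> 0 \<Longrightarrow> exp (- (pi * \<bar>x\<bar>)) * (pi * \<bar>x\<bar>) powr (-1/2) = tail x / sqrt pi"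
proof -
 assume x: "x \<noteq> 0"
 have "(pi * \<bar>x\<bar>) powr (-1/2) = pi powr (-1/2) * \<bar>x\<bar> powr (-1/2)" by (rule powr_mult)
 moreover have "pi powr (-1/2) = 1 / sqrt pi" by (simp add: powr_minus_divide powr_half_sqrt)
 ultimately show ?thesis by (simp add: tail_def)
qed

lemma KX_upper: "x \<noteq> 0 \<Longrightarrow> KX nu x \<le> c0 nu / sqrt pi * tail x"
 using KK_upper[OF nu, of "pi * \<bar>x\<bar>"] tail_pi[of x] by (simp add: KX_def mult.assoc)

lemma KX_lower: "x \<noteq> 0 \<Longrightarrow> c0 nu / sqrt pi * tail x - c2 nu / sqrt pi / pi / \<bar>x\<bar> * tail x \<le> KX nu x"
proof -
 assume x: "x \<noteq> 0"
 have "(pi * \<bar>x\<bar>) powr (-3/2) = (pi * \<bar>x\<bar>) powr (-1/2) / (pi * \<bar>x\<bar>)" using x powr_diff[of "pi * \<bar>x\<bar>" "-1/2" 1] by simp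
 then have "exp (- (pi * \<bar>x\<bar>)) * (pi * \<bar>x\<bar>) powr (-3/2) = tail x / sqrt pi / (pi * \<bar>x\<bar>)"
  using tail_pi[OF x] by simp
 with KK_lower[OF nu, of "pi * \<bar>x\<bar>"] tail_pi[OF x] x show ?thesis by (simp add: KX_def mult.assoc)
qed

lemma KX_lower2: "x \<noteq> 0 \<Longrightarrow> exp (-2) * 2 powr (2 * nu - 1) * (exp (- (pi * \<bar>x\<bar>)) * (1 + 2 * (pi * \<bar>x\<bar>)) powr (-1/2)) \<le> KX nu x"
 using KK_lower2[OF nu, of "pi * \<bar>x\<bar>"] by (simp add: KX_def)

lemma KX_pos: "x \<noteq> 0 \<Longrightarrow> 0 < KX nu x"
proof -
 assume x: "x \<noteq> 0"
 have "0 < exp (-2) * 2 powr (2 * nu - 1) * (exp (- (pi * \<bar>x\<bar>)) * (1 + 2 * (pi * \<bar>x\<bar>)) powr (-1/2))"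
  by (intro mult_pos_pos) (auto simp: add_pos_nonneg intro!: less_imp_neq[THEN not_sym] add_pos_nonneg)
 then show ?thesis using KX_lower2[OF x] by linarith
qed

lemma KX_nonneg: "0 \<le> KX nu x"
proof (cases "x = 0")
 case True
 then show ?thesis by (simp add: KX_def KK_def)
qed (simp add: KX_pos less_imp_le)

lemma norm_ww: "cmod (ww nu x) = KX nu x" using KX_nonneg[of x] by (simp add: ww_def norm_mult)

lemma ww_integrable: "integrable lborel (\<lambda>x. ww nu x * poly p (of_real x))"
proof (rule tail_dominated_integrable)
 show "cmod (ww nu x) \<le> c0 nu / sqrt pi * tail x" if "x \<noteq> 0" for x
  unfolding norm_ww by (rule KX_upper[OF that])
qed measurable

lemma KX_integrable: "integrable lborel (\<lambda>x. complex_of_real (KX nu x) * poly p (of_real x))"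
proof (rule tail_dominated_integrable)
 show "cmod (of_real (KX nu x)) \<le> c0 nu / sqrt pi * tail x" if "x \<noteq> 0" for x
  using KX_upper[OF that] KX_nonneg[of x] by (simp only: norm_of_real abs_of_nonneg)
qed measurable

lemma Re_ww: "x \<noteq> 0 \<Longrightarrow> Re (ww nu x) = cos (pi * nu / 2) * KX nu x"
proof -
 assume x: "x \<noteq> 0"
 then have "\<bar>pi * (nu / 2) * sgn x\<bar> = pi * nu / 2" using nu by (auto simp: sgn_real_def)
 then have "cos (pi * (nu / 2) * sgn x) = cos (pi * nu / 2)" by (metis cos_abs_real)
 then show ?thesis by (simp add: ww_def Re_exp)
qed

text \<open>Transfers a bound on the error polynomial from the Macdonald norm, where coercivity
  acts, to the reference norm, where the Christoffel kernel is available.\<close>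

lemma om_le_KX: "\<exists>C>0. \<forall>x. x \<noteq> 0 \<longrightarrow> om x \<le> C * KX nu x"
proof -
 obtain C where C: "C > 0" "\<And>x. om x \<le> C * ((1 + 2 * (pi * \<bar>x\<bar>)) powr (-1/2) * exp (- (pi * \<bar>x\<bar>)))" using om_upper by blast
 define k where "k = exp (-2) * 2 powr (2 * nu - 1)"
 have k: "0 < k" by (simp add: k_def)
 show ?thesis
 proof (intro exI[of _ "C / k"] conjI allI impI)
  fix x :: real assume x: "x \<noteq> 0"
  have "om x \<le> (C / k) * (k * (exp (- (pi * \<bar>x\<bar>)) * (1 + 2 * (pi * \<bar>x\<bar>)) powr (-1/2)))" using C(2)[of x] k by (simp add: mult.commute)
  also have "\<dots> \<le> (C / k) * KX nu x" using KX_lower2[OF x] C k unfolding k_def[symmetric] by (intro mult_left_mono) auto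
  finally show "om x \<le> (C / k) * KX nu x" .
 qed (use C k in auto)
qed

text \<open>The density left for the comparison polynomial after the pairing of the weight
  difference with the error is split by Cauchy--Schwarz relative to \<open>KX nu\<close>.\<close>

definition DD where "DD eta x = (cmod (ww nu x - of_real (C0 nu) * rho (1/4 - eta) (1/4 + eta) (of_real x)))\<^sup>2 / KX nu x"

text \<open>Three sources of error away from the origin: the second term of the Macdonald expansion
  and the remainder of the Gamma weight, both \<open>O(1/|x|)\<close> relative to
  \<open>tail\<close>, and the phase mismatch, at most \<open>pi (nu/2 - eta)\<close>.\<close>

lemma DD_far:
 assumes x0: "0 < x0"
 shows "\<exists>C>0. \<forall>eta x. 0 \<le> eta \<and> eta < 1/4 \<and> eta \<le> nu/2 \<and> x0 \<le> \<bar>x\<bar> \<longrightarrow> DD eta x \<le> C * (((nu/2 - eta)\<^sup>2 + 1 / (1 + x\<^sup>2)) * om x)"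
proof -
 obtain Cr where Cr: "Cr > 0" "\<And>a x. 0 < a \<and> a \<le> 1/4 \<and> x0 \<le> \<bar>x\<bar> \<Longrightarrow>
  cmod (rho a (1/2 - a) (of_real x) - 2 * of_real pi * exp (- \<i> * of_real (pi * (1/4 - a) * sgn x)) * of_real (tail x)) \<le> Cr / \<bar>x\<bar> * tail x"
  using rho_asymp[OF x0] by blast
 obtain c where c: "c > 0" "\<And>x. x0 \<le> \<bar>x\<bar> \<Longrightarrow> c * tail x \<le> om x" using om_lower[OF x0] by blast
 define k where "k = c0 nu / sqrt pi"
 define k2 where "k2 = c2 nu / sqrt pi / pi"
 have k: "0 < k" "0 < k2" using c0_pos[OF nu] by (auto simp: k_def k2_def)
 define M where "M = k2 + k * pi + C0 nu * Cr"
 have M: "0 < M" using k C0_pos Cr by (simp add: M_def add_pos_pos)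
 define l where "l = exp (-2) * 2 powr (2 * nu - 1) * (1 / x0 + 2 * pi) powr (-1/2)"
 have x0p: "0 < 1 / x0 + 2 * pi" using x0 by (simp add: add_pos_pos)
 have l: "0 < l" using x0p by (simp add: l_def less_imp_neq[THEN not_sym])
 define Cf where "Cf = 2 * M\<^sup>2 / l / c * (1 + 1 / x0\<^sup>2)"
 show ?thesis
 proof (rule exI[of _ Cf], intro conjI allI impI)
  show "0 < Cf" using M l c by (auto simp: Cf_def intro!: mult_pos_pos divide_pos_pos add_pos_nonneg)
  fix eta x :: real assume A: "0 \<le> eta \<and> eta < 1/4 \<and> eta \<le> nu/2 \<and> x0 \<le> \<bar>x\<bar>"
  then have x: "x \<noteq> 0" using x0 by auto
  define T where "T = tail x"
  define \<theta> where "\<theta> = nu/2 - eta"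
  have T: "0 < T" using tail_pos[OF x] by (simp add: T_def)
  have \<theta>: "0 \<le> \<theta>" using A by (simp add: \<theta>_def)
  define u where "u = 1 / \<bar>x\<bar>"
  have u: "0 < u" "u \<le> 1 / x0" using x x0 A by (auto simp: u_def intro!: divide_left_mono mult_pos_pos)
  have kt: "cmod (of_real (KX nu x) - of_real (k * T) :: complex) \<le> k2 * u * T"
  proof -
   have "\<bar>KX nu x - k * T\<bar> \<le> k2 * u * T"
    using KX_upper[OF x] KX_lower[OF x] unfolding k_def[symmetric] T_def[symmetric] k2_def[symmetric] by (simp add: u_def abs_le_iff)
   then show ?thesis by (simp only: of_real_diff[symmetric] norm_of_real)
  qed
  define e1 where "e1 = exp (- \<i> * of_real (pi * (nu/2) * sgn x))"
  define e2 where "e2 = exp (- \<i> * of_real (pi * eta * sgn x))"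
  have e: "cmod e1 = 1" "cmod e2 = 1" by (simp_all add: e1_def e2_def)
  have e12: "cmod (e1 - e2) \<le> pi * \<theta>"
  proof -
   have "e1 - e2 = e2 * (exp (\<i> * of_real (- (pi * \<theta> * sgn x))) - 1)"
    unfolding e1_def e2_def right_diff_distrib exp_add[symmetric] by (simp add: \<theta>_def algebra_simps)
   then have "cmod (e1 - e2) = cmod (exp (\<i> * of_real (- (pi * \<theta> * sgn x))) - 1)" by (simp only: norm_mult e mult_1_left)
   also have "\<dots> \<le> \<bar>- (pi * \<theta> * sgn x)\<bar>" unfolding dist_exp_i_1 using abs_sin_x_le_abs_x[of "- (pi * \<theta> * sgn x) / 2"] by simp
   also have "\<dots> \<le> pi * \<theta>" using \<theta> by (auto simp: abs_mult sgn_real_def)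
   finally show ?thesis .
  qed
  have r: "cmod (rho (1/4 - eta) (1/4 + eta) (of_real x) - 2 * of_real pi * e2 * of_real T) \<le> Cr * u * T"
   using Cr(2)[of "1/4 - eta" x] A by (simp add: e2_def T_def u_def)
  have w1: "ww nu x = e1 * of_real (KX nu x)" by (simp only: ww_def e1_def)
  have C0k: "of_real (C0 nu) * (2 * of_real pi) = complex_of_real k"
   using pi_gt_zero by (simp add: C0_def k_def)
  have "ww nu x - of_real (C0 nu) * rho (1/4 - eta) (1/4 + eta) (of_real x) =
   e1 * (of_real (KX nu x) - of_real (k * T)) + of_real (k * T) * (e1 - e2) - of_real (C0 nu) * (rho (1/4 - eta) (1/4 + eta) (of_real x) - 2 * of_real pi * e2 * of_real T)"
   unfolding w1 of_real_mult C0k[symmetric] by (simp only: algebra_simps)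
  also have "cmod \<dots> \<le> cmod (e1 * (of_real (KX nu x) - of_real (k * T))) + cmod (of_real (k * T) * (e1 - e2)) + cmod (of_real (C0 nu) * (rho (1/4 - eta) (1/4 + eta) (of_real x) - 2 * of_real pi * e2 * of_real T))"
   by (rule order_trans[OF norm_triangle_ineq4]) (intro add_right_mono norm_triangle_ineq)
  also have "\<dots> = cmod (of_real (KX nu x) - of_real (k * T) :: complex) + k * T * cmod (e1 - e2) + C0 nu * cmod (rho (1/4 - eta) (1/4 + eta) (of_real x) - 2 * of_real pi * e2 * of_real T)"
   using k T C0_pos by (simp add: norm_mult e)
  also have "\<dots> \<le> k2 * u * T + k * T * (pi * \<theta>) + C0 nu * (Cr * u * T)"
   using k T C0_pos by (intro add_mono kt mult_left_mono e12 r) auto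
  also have "\<dots> \<le> M * (\<theta> + u) * T"
  proof -
   have "M * (\<theta> + u) * T = (k2 * u * T + k * T * (pi * \<theta>) + C0 nu * (Cr * u * T)) + (k2 * \<theta> * T + k * pi * u * T + C0 nu * Cr * \<theta> * T)"
    by (simp add: M_def algebra_simps)
   moreover have "0 \<le> k2 * \<theta> * T + k * pi * u * T + C0 nu * Cr * \<theta> * T"
    using k T C0_pos Cr u \<theta> by (intro add_nonneg_nonneg mult_nonneg_nonneg) auto
   ultimately show ?thesis by linarith
  qed
  finally have W: "cmod (ww nu x - of_real (C0 nu) * rho (1/4 - eta) (1/4 + eta) (of_real x)) \<le> M * (\<theta> + u) * T" .
  have lT: "l * T \<le> KX nu x"
  proof -
   have "(1 + 2 * (pi * \<bar>x\<bar>)) \<le> (1 / x0 + 2 * pi) * \<bar>x\<bar>"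
    using A x0 by (simp add: distrib_right)
   then have "((1 / x0 + 2 * pi) * \<bar>x\<bar>) powr (-1/2) \<le> (1 + 2 * (pi * \<bar>x\<bar>)) powr (-1/2)"
    by (intro powr_mono2') (auto intro: add_pos_nonneg)
   moreover have "((1 / x0 + 2 * pi) * \<bar>x\<bar>) powr (-1/2) = (1 / x0 + 2 * pi) powr (-1/2) * \<bar>x\<bar> powr (-1/2)" by (rule powr_mult)
   ultimately have "exp (-2) * 2 powr (2 * nu - 1) * (exp (- (pi * \<bar>x\<bar>)) * ((1 / x0 + 2 * pi) powr (-1/2) * \<bar>x\<bar> powr (-1/2))) \<le>
    exp (-2) * 2 powr (2 * nu - 1) * (exp (- (pi * \<bar>x\<bar>)) * (1 + 2 * (pi * \<bar>x\<bar>)) powr (-1/2))"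
    by (intro mult_left_mono) auto
   also have "\<dots> \<le> KX nu x" by (rule KX_lower2[OF x])
   finally show ?thesis by (simp add: l_def T_def tail_def mult_ac)
  qed
  have "DD eta x \<le> (M * (\<theta> + u) * T)\<^sup>2 / (l * T)"
   unfolding DD_def using W lT l T by (intro frac_le power_mono) auto
  also have "\<dots> = M\<^sup>2 / l * (\<theta> + u)\<^sup>2 * T" using T l by (simp add: power2_eq_square)
  also have "\<dots> \<le> M\<^sup>2 / l * (2 * (\<theta>\<^sup>2 + u\<^sup>2)) * T"
  proof -
   have "0 \<le> (\<theta> - u)\<^sup>2" by simp
   then have "(\<theta> + u)\<^sup>2 \<le> 2 * (\<theta>\<^sup>2 + u\<^sup>2)" by (simp add: power2_eq_square algebra_simps)
   then show ?thesis using l T by (intro mult_right_mono mult_left_mono) auto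
  qed
  also have "\<dots> \<le> M\<^sup>2 / l * (2 * ((1 + 1 / x0\<^sup>2) * (\<theta>\<^sup>2 + 1 / (1 + x\<^sup>2)))) * (om x / c)"
  proof (intro mult_mono mult_left_mono)
   show "T \<le> om x / c" using c(2)[of x] A c(1) by (simp add: T_def pos_le_divide_eq mult.commute)
   have "u\<^sup>2 \<le> (1 + 1 / x0\<^sup>2) * (1 / (1 + x\<^sup>2))"
   proof -
    have px: "0 < 1 + x\<^sup>2" by (simp add: add_pos_nonneg)
    have "u\<^sup>2 * (1 + x\<^sup>2) = 1 + u\<^sup>2" using x by (simp add: u_def power_divide distrib_left)
    also have "\<dots> \<le> 1 + 1 / x0\<^sup>2" using power_mono[OF u(2), of 2] u(1) by (simp add: power_divide)
    finally show ?thesis using px by (simp add: pos_le_divide_eq)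
   qed
   moreover have "1 * \<theta>\<^sup>2 \<le> (1 + 1 / x0\<^sup>2) * \<theta>\<^sup>2" by (intro mult_right_mono) auto
   ultimately show "\<theta>\<^sup>2 + u\<^sup>2 \<le> (1 + 1 / x0\<^sup>2) * (\<theta>\<^sup>2 + 1 / (1 + x\<^sup>2))" unfolding distrib_left by linarith
  qed (use T l in \<open>auto intro!: mult_nonneg_nonneg add_nonneg_nonneg\<close>)
  also have "\<dots> = Cf * (((nu/2 - eta)\<^sup>2 + 1 / (1 + x\<^sup>2)) * om x)"
   by (simp add: Cf_def \<theta>_def[symmetric] mult_ac)
  finally show "DD eta x \<le> Cf * (((nu/2 - eta)\<^sup>2 + 1 / (1 + x\<^sup>2)) * om x)" .
 qed
qed

text \<open>No cancellation is sought here: both weights are bounded separately. The loss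
  \<open>(1/4 - eta)^(-2)\<close> comes from the near-pole of the Gamma weight at the
  origin.\<close>

lemma DD_near:
 assumes x0: "0 < x0" "x0 \<le> 1"
 shows "\<exists>C>0. \<forall>eta x. 0 \<le> eta \<and> eta < 1/4 \<and> x \<noteq> 0 \<and> \<bar>x\<bar> \<le> x0 \<longrightarrow> DD eta x \<le> C * (tail x / (1/4 - eta)\<^sup>2)"
proof -
 obtain B where B: "B > 0" "\<And>a x. 0 < a \<and> a \<le> 1/4 \<Longrightarrow> cmod (rho a (1/2 - a) (of_real x)) * cmod (Complex a x) \<le> B"
  using rho_crude by blast
 define k where "k = c0 nu / sqrt pi"
 have k: "0 < k" using c0_pos[OF nu] by (auto simp: k_def)
 define l where "l = exp (-2) * 2 powr (2 * nu - 1) * (exp (- pi) * (1 + 2 * pi) powr (-1/2))"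
 have p12: "0 < 1 + 2 * pi" using pi_gt_zero by linarith
 have l: "0 < l" using p12 by (simp add: l_def less_imp_neq[THEN not_sym])
 define M where "M = 2 * (C0 nu * B)\<^sup>2 / l"
 have M: "0 \<le> M" using l by (simp add: M_def)
 define Cn where "Cn = 2 * k + M * exp pi"
 show ?thesis
 proof (rule exI[of _ Cn], intro conjI allI impI)
  show "0 < Cn" using k M by (simp add: Cn_def add_pos_nonneg)
  fix eta x :: real assume A: "0 \<le> eta \<and> eta < 1/4 \<and> x \<noteq> 0 \<and> \<bar>x\<bar> \<le> x0"
  define a where "a = 1/4 - eta"
  have a: "0 < a" "a \<le> 1/4" using A by (auto simp: a_def)
  have x: "x \<noteq> 0" "\<bar>x\<bar> \<le> 1" using A x0 by auto
  let ?r = "rho (1/4 - eta) (1/4 + eta) (of_real x)"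
  have rb: "cmod ?r \<le> B / a"
  proof -
   have "a \<le> cmod (Complex a x)" using complex_Re_le_cmod[of "Complex a x"] by simp
   then have "cmod ?r * a \<le> cmod ?r * cmod (Complex a x)" by (rule mult_left_mono) simp
   also have "\<dots> \<le> B" using B(2)[of a x] a by (simp add: a_def)
   finally show ?thesis using a by (simp add: pos_le_divide_eq)
  qed
  have lK: "l \<le> KX nu x"
  proof -
   have "exp (- pi) * (1 + 2 * pi) powr (-1/2) \<le> exp (- (pi * \<bar>x\<bar>)) * (1 + 2 * (pi * \<bar>x\<bar>)) powr (-1/2)"
    using x by (intro mult_mono powr_mono2') (auto simp: mult_left_le add_pos_nonneg)
   then have "l \<le> exp (-2) * 2 powr (2 * nu - 1) * (exp (- (pi * \<bar>x\<bar>)) * (1 + 2 * (pi * \<bar>x\<bar>)) powr (-1/2))"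
    unfolding l_def by (intro mult_left_mono) auto
   also note KX_lower2[OF x(1)]
   finally show ?thesis .
  qed
  have t1: "1 \<le> exp pi * tail x"
  proof -
   have "1 \<le> \<bar>x\<bar> powr (-1/2)" using powr_mono2'[of "-1/2" "\<bar>x\<bar>" 1] x by simp
   moreover have "1 \<le> exp (pi + - (pi * \<bar>x\<bar>))" using x by (simp add: mult_left_le)
   ultimately have "1 * 1 \<le> \<bar>x\<bar> powr (-1/2) * exp (pi + - (pi * \<bar>x\<bar>))" by (intro mult_mono) auto
   then show ?thesis unfolding exp_add by (simp add: tail_def mult_ac)
  qed
  have "(cmod (ww nu x - of_real (C0 nu) * ?r))\<^sup>2 \<le> (KX nu x + C0 nu * (B / a))\<^sup>2"
  proof (intro power_mono)
   have "cmod (ww nu x - of_real (C0 nu) * ?r) \<le> cmod (ww nu x) + cmod (of_real (C0 nu) * ?r)" by (rule norm_triangle_ineq4)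
   also have "\<dots> = KX nu x + C0 nu * cmod ?r" using C0_pos by (simp add: norm_ww norm_mult)
   also have "\<dots> \<le> KX nu x + C0 nu * (B / a)" using C0_pos rb by (intro add_left_mono mult_left_mono) auto
   finally show "cmod (ww nu x - of_real (C0 nu) * ?r) \<le> KX nu x + C0 nu * (B / a)" .
  qed simp
  also have "\<dots> \<le> 2 * (KX nu x)\<^sup>2 + 2 * (C0 nu * (B / a))\<^sup>2"
  proof -
   have "0 \<le> (X - Y)\<^sup>2 \<Longrightarrow> (X + Y)\<^sup>2 \<le> 2 * X\<^sup>2 + 2 * Y\<^sup>2" for X Y :: real by (simp add: power2_eq_square algebra_simps)
   then show ?thesis by simp
  qed
  finally have "DD eta x \<le> (2 * (KX nu x)\<^sup>2 + 2 * (C0 nu * (B / a))\<^sup>2) / KX nu x"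
   unfolding DD_def by (intro divide_right_mono KX_nonneg)
  also have "\<dots> = 2 * KX nu x + 2 * (C0 nu * (B / a))\<^sup>2 / KX nu x"
   using KX_pos[OF x(1)] by (simp add: add_divide_distrib power2_eq_square)
  also have "\<dots> \<le> 2 * (k * tail x) + 2 * (C0 nu * (B / a))\<^sup>2 / l"
   using KX_upper[OF x(1)] lK l unfolding k_def[symmetric] by (intro add_mono divide_left_mono) auto
  also have "2 * (C0 nu * (B / a))\<^sup>2 / l = M * 1 / a\<^sup>2" by (simp add: M_def power_mult_distrib power_divide)
  also have "2 * (k * tail x) + M * 1 / a\<^sup>2 \<le> 2 * (k * (tail x / a\<^sup>2)) + M * (exp pi * tail x) / a\<^sup>2"
  proof (intro add_mono mult_left_mono divide_right_mono t1 M)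
   have "a\<^sup>2 \<le> 1" using a by (intro power_le_one) auto
   then show "tail x \<le> tail x / a\<^sup>2" using tail_pos[OF x(1)] a by (simp add: pos_le_divide_eq mult_left_le)
  qed (use k in auto)
  also have "\<dots> = Cn * (tail x / (1/4 - eta)\<^sup>2)" by (simp add: Cn_def a_def[symmetric] algebra_simps add_divide_distrib)
  finally show "DD eta x \<le> Cn * (tail x / (1/4 - eta)\<^sup>2)" .
 qed
qed

end

section \<open>The logarithmic potential of the limiting density\<close>
lemma slit_disk_scale:
 assumes "p \<in> slit_disk" "\<bar>t\<bar> \<le> 1"
 shows "of_real t * p \<in> slit_disk"
proof -
 have "\<bar>t * Re p\<bar> < 1" if "\<bar>Re p\<bar> < 1"
 proof -
  have "\<bar>t * Re p\<bar> \<le> 1 * \<bar>Re p\<bar>" unfolding abs_mult using assms by (intro mult_right_mono) auto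
  then show ?thesis using that by simp
 qed
 then show ?thesis using assms by (auto simp: slit_disk_def)
qed

lemma starlike_const:
 assumes d: "\<And>p. p \<in> slit_disk \<Longrightarrow> (f has_field_derivative 0) (at p)" and p: "p \<in> slit_disk"
 shows "f p = f 0"
proof -
 have "starlike slit_disk"
 proof -
  have "closed_segment 0 q \<subseteq> slit_disk" if q: "q \<in> slit_disk" for q
  proof
   fix x assume "x \<in> closed_segment 0 q"
   then obtain u where u: "0 \<le> u" "u \<le> 1" "x = u *\<^sub>R q" by (auto simp: in_segment)
   then have "x = of_real u * q" by (simp add: scaleR_conv_of_real)
   then show "x \<in> slit_disk" using slit_disk_scale[OF q, of u] u by auto
  qed
  moreover have "0 \<in> slit_disk" by (simp add: slit_disk_def)
  ultimately show ?thesis unfolding starlike_def by blast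
 qed
 then have "connected slit_disk" by (rule starlike_imp_connected)
 moreover have "0 \<in> slit_disk" by (simp add: slit_disk_def)
 ultimately show ?thesis
 proof -
  assume a: "connected slit_disk" "0 \<in> slit_disk"
  have "continuous_on slit_disk f" by (intro continuous_at_imp_continuous_on ballI DERIV_isCont[OF d])
  from DERIV_zero_connected_constant[OF a(1) open_slit_disk finite.emptyI this] obtain c where "\<And>x. x \<in> slit_disk \<Longrightarrow> f x = c"
   using d by auto
  then show ?thesis using a(2) p by simp
 qed
qed

section \<open>Poisson and logarithmic integrals of the arcsine law\<close>

lemma one_minus_notin: "w \<in> slit_disk \<Longrightarrow> 1 - w \<notin> \<real>\<^sub>\<le>\<^sub>0"
 by (auto simp: slit_disk_def complex_nonpos_Reals_iff)

text \<open>With \<open>q = p/(1 + c)\<close>, so that \<open>2q/(1 + q^2) = p\<close> and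
  \<open>|q| < 1\<close>, the integrand is \<open>1/c\<close> times a sum of two geometric series in
  \<open>q E\<close> and \<open>q/E\<close>, where \<open>sin theta = (E + 1/E)/2\<close>. Their
  primitives are logarithms whose contributions cancel at both ends, where \<open>E\<close> is
  \<open>1\<close> and \<open>-1\<close>.\<close>

lemma arcsine_poisson:
 assumes p: "p \<in> slit_disk"
 shows "((\<lambda>\<theta>. 1 / (1 - of_real (sin \<theta>) * p)) has_integral (of_real pi / cc p)) {- pi/2..pi/2}"
proof -
 define c where "c = cc p"
 define q where "q = p / (1 + c)"
 have c: "c \<noteq> 0" "1 + c \<noteq> 0" "0 < Re c" "c\<^sup>2 = 1 - p\<^sup>2"
  using cc_nz[OF p] one_plus_cc[OF p] Re_cc[OF p] by (auto simp: c_def)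
 have pp: "p\<^sup>2 = (1 - c) * (1 + c)" using c(4) by (simp add: power2_eq_square algebra_simps)
 have q1: "cmod q < 1"
 proof -
  have "(cmod p)\<^sup>2 = cmod (1 - c) * cmod (1 + c)" using pp by (metis norm_mult norm_power)
  moreover have "(cmod (1 - c))\<^sup>2 < (cmod (1 + c))\<^sup>2" unfolding cmod_power2 using c(3) by (simp add: power2_eq_square algebra_simps)
  then have "cmod (1 - c) < cmod (1 + c)" by (rule power2_less_imp_less) simp
  ultimately have "(cmod p)\<^sup>2 < (cmod (1 + c))\<^sup>2"
   using c(2) by (simp add: power2_eq_square mult_strict_right_mono)
  then have "cmod p < cmod (1 + c)" by (rule power2_less_imp_less) simp
  then show ?thesis using c(2) by (simp add: q_def norm_divide divide_less_eq_1)
 qed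
 have q2: "q\<^sup>2 = (1 - c) / (1 + c)" unfolding q_def power_divide pp using c(2) by (simp add: power2_eq_square)
 have q2p: "(1 + c) * q\<^sup>2 = 1 - c" using q2 c(2) by simp
 have qp: "(1 + c) * q = p" using c(2) by (simp add: q_def)
 define E where "E \<theta> = - \<i> * exp (\<i> * of_real \<theta>)" for \<theta> :: real
 have E: "cmod (E \<theta>) = 1" "E \<theta> \<noteq> 0" for \<theta> by (auto simp: E_def norm_mult)
 have qe: "cmod (q * E \<theta>) < 1" "cmod (q / E \<theta>) < 1" for \<theta> using q1 E by (auto simp: norm_mult norm_divide)
 have nz: "1 - w \<noteq> 0" "1 - w \<notin> \<real>\<^sub>\<le>\<^sub>0" if "cmod w < 1" for w
 proof -
  show "1 - w \<notin> \<real>\<^sub>\<le>\<^sub>0" using that complex_Re_le_cmod[of w] by (auto simp: complex_nonpos_Reals_iff)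
  then show "1 - w \<noteq> 0" by auto
 qed
 have sE: "of_real (sin \<theta>) = (E \<theta> + 1 / E \<theta>) / 2" for \<theta>
 proof -
  have "1 / E \<theta> = \<i> * exp (- (\<i> * of_real \<theta>))" by (simp add: E_def exp_minus field_simps)
  moreover have "complex_of_real (sin \<theta>) = (exp (\<i> * of_real \<theta>) - exp (- (\<i> * of_real \<theta>))) / (2 * \<i>)"
   unfolding sin_of_real[symmetric] sin_exp_eq ..
  moreover have "(X - Y) / (2 * \<i>) = (- \<i> * X + \<i> * Y) / 2" for X Y :: complex by (simp add: field_simps)
  ultimately show ?thesis by (simp only: E_def)
 qed
 have id: "1 / (1 - of_real (sin \<theta>) * p) = (1 / c) * (1 + (q * E \<theta>) / (1 - q * E \<theta>) + (q / E \<theta>) / (1 - q / E \<theta>))" for \<theta>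
 proof -
  define A B where "A = q * E \<theta>" and "B = q / E \<theta>"
  have AB: "A * B = q\<^sup>2" "1 - A \<noteq> 0" "1 - B \<noteq> 0" using nz(1)[OF qe(1)[of \<theta>]] nz(1)[OF qe(2)[of \<theta>]] E(2)[of \<theta>] by (auto simp: A_def B_def power2_eq_square)
  have "of_real (sin \<theta>) * p = (1 + c) * (A + B) / 2" unfolding sE qp[symmetric] A_def B_def by (simp add: field_simps)
  moreover have "(1 + c) * ((1 - A) * (1 - B)) = (1 + c) - (1 + c) * (A + B) + (1 + c) * q\<^sup>2" by (simp add: algebra_simps AB(1)[symmetric])
  ultimately have den: "1 - of_real (sin \<theta>) * p = (1 + c) * ((1 - A) * (1 - B)) / 2" unfolding q2p by (simp add: field_simps)
  have "1 + A / (1 - A) + B / (1 - B) = (1 - A * B) / ((1 - A) * (1 - B))" using AB(2,3) by (simp add: divide_simps) (simp add: algebra_simps)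
  also have "1 - A * B = 2 * c / (1 + c)" unfolding AB(1) q2 using c(2) by (simp add: field_simps)
  finally show ?thesis unfolding den A_def[symmetric] B_def[symmetric] using c AB by simp
 qed
 have dE: "(E has_vector_derivative (\<i> * E \<theta>)) (at \<theta> within X)" for \<theta> X
  unfolding E_def by (auto intro!: derivative_eq_intros has_vector_derivative_real_field simp: algebra_simps)
 let ?F = "\<lambda>\<theta>. (1 / c) * (of_real \<theta> + \<i> * Ln (1 - q * E \<theta>) - \<i> * Ln (1 - q / E \<theta>))"
 have "((\<lambda>\<theta>. (1 / c) * (1 + (q * E \<theta>) / (1 - q * E \<theta>) + (q / E \<theta>) / (1 - q / E \<theta>))) has_integral (?F (pi/2) - ?F (- pi/2))) {- pi/2..pi/2}"
 proof (rule fundamental_theorem_of_calculus)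
  fix \<theta> :: real
  have d1: "((\<lambda>w. Ln (1 - q * w)) has_field_derivative (- q / (1 - q * E \<theta>))) (at (E \<theta>))"
  proof -
   have "((\<lambda>w. 1 - q * w) has_field_derivative (0 - q * 1)) (at (E \<theta>))" by (intro DERIV_diff DERIV_const DERIV_cmult DERIV_ident)
   from DERIV_chain2[OF has_field_derivative_Ln[OF nz(2)[OF qe(1)[of \<theta>]]] this] show ?thesis by (simp add: divide_inverse mult.commute)
  qed
  have d2: "((\<lambda>w. Ln (1 - q / w)) has_field_derivative ((q / (E \<theta>)\<^sup>2) / (1 - q / E \<theta>))) (at (E \<theta>))"
  proof -
   have "((\<lambda>w. 1 - q * inverse w) has_field_derivative (0 - q * (- (inverse (E \<theta>) ^ Suc (Suc 0))))) (at (E \<theta>))"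
    by (intro DERIV_diff DERIV_const DERIV_cmult DERIV_inverse E)
   then have "((\<lambda>w. 1 - q / w) has_field_derivative (q / (E \<theta>)\<^sup>2)) (at (E \<theta>))"
    by (simp add: divide_inverse power_inverse numeral_2_eq_2)
   from DERIV_chain2[OF has_field_derivative_Ln[OF nz(2)[OF qe(2)[of \<theta>]]] this] show ?thesis by (simp add: divide_inverse mult.commute)
  qed
  have v1: "((\<lambda>\<theta>. Ln (1 - q * E \<theta>)) has_vector_derivative (\<i> * E \<theta> * (- q / (1 - q * E \<theta>)))) (at \<theta> within {- pi/2..pi/2})"
   using field_vector_diff_chain_within[OF dE has_field_derivative_at_within[OF d1]] by (simp add: o_def)
  have v2: "((\<lambda>\<theta>. Ln (1 - q / E \<theta>)) has_vector_derivative (\<i> * E \<theta> * ((q / (E \<theta>)\<^sup>2) / (1 - q / E \<theta>)))) (at \<theta> within {- pi/2..pi/2})"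
   using field_vector_diff_chain_within[OF dE has_field_derivative_at_within[OF d2]] by (simp add: o_def)
  have v3: "(complex_of_real has_vector_derivative 1) (at \<theta> within {- pi/2..pi/2})"
   by (auto intro!: derivative_eq_intros)
  have "(?F has_vector_derivative (1 / c) * (1 + \<i> * (\<i> * E \<theta> * (- q / (1 - q * E \<theta>))) - \<i> * (\<i> * E \<theta> * ((q / (E \<theta>)\<^sup>2) / (1 - q / E \<theta>))))) (at \<theta> within {- pi/2..pi/2})"
   by (intro has_vector_derivative_mult_right has_vector_derivative_diff has_vector_derivative_add v1 v2 v3)
  moreover have "\<i> * (\<i> * E \<theta> * (- q / (1 - q * E \<theta>))) = (q * E \<theta>) / (1 - q * E \<theta>)" by (simp add: field_simps)
  moreover have "- (\<i> * (\<i> * E \<theta> * ((q / (E \<theta>)\<^sup>2) / (1 - q / E \<theta>)))) = (q / E \<theta>) / (1 - q / E \<theta>)"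
  proof -
   have "E \<theta> * (q / (E \<theta>)\<^sup>2) = q / E \<theta>" using E(2)[of \<theta>] by (simp add: power2_eq_square)
   moreover have "- (\<i> * (\<i> * e * (Q / D))) = (e * Q) / D" for e Q D :: complex by (simp add: mult.assoc times_divide_eq_right[symmetric] del: times_divide_eq_right)
   ultimately show ?thesis by (simp only:)
  qed
  ultimately show "(?F has_vector_derivative (1 / c) * (1 + (q * E \<theta>) / (1 - q * E \<theta>) + (q / E \<theta>) / (1 - q / E \<theta>))) (at \<theta> within {- pi/2..pi/2})"
   by (simp only: diff_conv_add_uminus)
 qed simp
 moreover have "?F (pi/2) - ?F (- pi/2) = of_real pi / c"
 proof -
  have "exp (\<i> * of_real (pi/2)) = \<i>" using cis_pi_half by (simp only: cis_conv_exp)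
  moreover have "exp (\<i> * of_real (- pi/2)) = - \<i>" using cis_minus_pi_half by (simp add: cis_conv_exp)
  ultimately have "E (pi/2) = 1" "E (- pi/2) = - 1" by (simp_all add: E_def)
  then show ?thesis using c(1) by (simp add: field_simps)
 qed
 ultimately show ?thesis unfolding id c_def by simp
qed

text \<open>Differentiating under the integral reduces the derivative in \<open>p\<close> to
  \<open>arcsine_poisson\<close>, and \<open>slit_disk\<close> is star-shaped about
  \<open>0\<close>, where both sides vanish. The formula for the derivative is multiplied by
  \<open>p\<close>, hence the separate case \<open>p = 0\<close>.\<close>

lemma arcsine_log:
 assumes p: "p \<in> slit_disk"
 shows "integral {- pi/2..pi/2} (\<lambda>\<theta>. Ln (1 - of_real (sin \<theta>) * p)) = of_real pi * ell p"
proof -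
 let ?I = "{- pi/2..pi/2}"
 define M where "M p = integral ?I (\<lambda>\<theta>. Ln (1 - of_real (sin \<theta>) * p))" for p
 have notin: "1 - of_real (sin \<theta>) * p \<notin> \<real>\<^sub>\<le>\<^sub>0" if "p \<in> slit_disk" for p \<theta>
  by (intro one_minus_notin slit_disk_scale that) auto
 have notz: "1 - of_real (sin \<theta>) * p \<noteq> 0" if "p \<in> slit_disk" for p \<theta>
  using notin[OF that, of \<theta>] by auto
 have dM: "(M has_field_derivative integral ?I (\<lambda>\<theta>. - of_real (sin \<theta>) / (1 - of_real (sin \<theta>) * p))) (at p)"
  if p: "p \<in> slit_disk" for p
 proof -
  obtain r where r: "r > 0" "ball p r \<subseteq> slit_disk" using open_slit_disk p by (auto simp: open_contains_ball)
  have "((\<lambda>p. integral (cbox (- pi/2) (pi/2)) (\<lambda>\<theta>. Ln (1 - of_real (sin \<theta>) * p))) has_field_derivative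
   integral (cbox (- pi/2) (pi/2)) (\<lambda>\<theta>. - of_real (sin \<theta>) / (1 - of_real (sin \<theta>) * p))) (at p within ball p r)"
  proof (rule leibniz_rule_field_derivative)
   fix x \<theta> assume "x \<in> ball p r"
   then have x: "x \<in> slit_disk" using r by auto
   show "((\<lambda>x. Ln (1 - of_real (sin \<theta>) * x)) has_field_derivative - of_real (sin \<theta>) / (1 - of_real (sin \<theta>) * x)) (at x within ball p r)"
    
   proof -
    have "((\<lambda>x. 1 - of_real (sin \<theta>) * x) has_field_derivative (0 - of_real (sin \<theta>) * 1)) (at x within ball p r)"
     by (intro DERIV_diff DERIV_const DERIV_cmult DERIV_ident)
    from DERIV_chain2[OF has_field_derivative_Ln[OF notin[OF x, of \<theta>]] this] show ?thesis by (simp add: divide_inverse mult.commute)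
   qed
  next
   fix x assume "x \<in> ball p r"
   then have x: "x \<in> slit_disk" using r by auto
   show "(\<lambda>\<theta>. Ln (1 - of_real (sin \<theta>) * x)) integrable_on cbox (- pi/2) (pi/2)"
    by (intro integrable_continuous continuous_intros) (use notin[OF x] in auto)
  next
   show "continuous_on (ball p r \<times> cbox (- pi/2) (pi/2)) (\<lambda>(x, \<theta>). - of_real (sin \<theta>) / (1 - of_real (sin \<theta>) * x))"
    unfolding case_prod_beta by (intro continuous_intros) (use notz r in auto)
  qed (use r in auto)
  then show ?thesis unfolding M_def using r by (simp add: at_within_open[of p "ball p r"])
 qed
 have val: "p * integral ?I (\<lambda>\<theta>. - of_real (sin \<theta>) / (1 - of_real (sin \<theta>) * p)) = of_real pi - of_real pi / cc p"
  if p: "p \<in> slit_disk" for p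
 proof -
  have "((\<lambda>\<theta>. 1 - 1 / (1 - of_real (sin \<theta>) * p)) has_integral (of_real pi - of_real pi / cc p)) ?I"
   using has_integral_diff[OF has_integral_const_real[of "1::complex" "- pi/2" "pi/2"] arcsine_poisson[OF p]]
   by (simp add: scaleR_conv_of_real)
  moreover have "1 - 1 / (1 - of_real (sin \<theta>) * p) = p * (- of_real (sin \<theta>) / (1 - of_real (sin \<theta>) * p))" for \<theta>
   using notz[OF p, of \<theta>] by (simp add: divide_simps)
  ultimately have "((\<lambda>\<theta>. p * (- of_real (sin \<theta>) / (1 - of_real (sin \<theta>) * p))) has_integral (of_real pi - of_real pi / cc p)) ?I"
   by (simp only:)
  then have "integral ?I (\<lambda>\<theta>. p * (- of_real (sin \<theta>) / (1 - of_real (sin \<theta>) * p))) = of_real pi - of_real pi / cc p"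
   by (rule integral_unique)
  then show ?thesis by (simp only: integral_mult_right)
 qed
 have d0: "((\<lambda>p. M p - of_real pi * ell p) has_field_derivative 0) (at p)" if p: "p \<in> slit_disk" for p
 proof -
  define D where "D = integral ?I (\<lambda>\<theta>. - of_real (sin \<theta>) / (1 - of_real (sin \<theta>) * p))"
  have Deq: "D = of_real pi * (- p / (cc p * (1 + cc p)))"
  proof (cases "p = 0")
   case True
   have "((\<lambda>\<theta>. - complex_of_real (sin \<theta>)) has_integral (of_real (cos (pi/2)) - of_real (cos (- pi/2)))) ?I"
   proof (rule fundamental_theorem_of_calculus)
    fix x :: real
    have "(cos has_real_derivative - sin x) (at x within ?I)" by (auto intro!: derivative_eq_intros)
    then show "((\<lambda>x. complex_of_real (cos x)) has_vector_derivative - complex_of_real (sin x)) (at x within ?I)"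
     using has_vector_derivative_of_real[of cos "- sin x"] by (simp add: has_real_derivative_iff_has_vector_derivative)
   qed simp
   from integral_unique[OF this] show ?thesis unfolding D_def True by simp
  next
   case False
   have c: "cc p \<noteq> 0" "1 + cc p \<noteq> 0" using cc_nz[OF p] one_plus_cc[OF p] by auto
   have "p * p = (1 - cc p) * (1 + cc p)" using cc_sq[of p] by (simp add: power2_eq_square algebra_simps)
   then have "p * (of_real pi * (- p / (cc p * (1 + cc p)))) = of_real pi * (- ((1 - cc p) * (1 + cc p)) / (cc p * (1 + cc p)))"
    by (simp only: mult.left_commute[of p] times_divide_eq_right mult_minus_right)
   also have "\<dots> = of_real pi - of_real pi / cc p" using c by (simp add: divide_simps) (simp add: algebra_simps)
   finally have "p * D = p * (of_real pi * (- p / (cc p * (1 + cc p))))" using val[OF p] unfolding D_def by simp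
   then show ?thesis using False by (simp only: mult_cancel_left) simp
  qed
  then have "((\<lambda>p. M p - of_real pi * ell p) has_field_derivative (D - of_real pi * (- p / (cc p * (1 + cc p))))) (at p)"
   unfolding D_def using dM[OF p] ell_deriv[OF p] by (intro DERIV_diff DERIV_cmult)
  then show ?thesis using Deq by simp
 qed
 have "M p - of_real pi * ell p = M 0 - of_real pi * ell 0" by (rule starlike_const[OF d0 p])
 also have "\<dots> = 0" by (simp add: M_def ell_def cc_def)
 finally show ?thesis by (simp add: M_def)
qed

section \<open>The density \<open>psi_density\<close> as a mixture of scaled arcsine laws\<close>

lemma psi_bounds_cont: "continuous_on {-1..1} (\<lambda>x. x * psi_density x)"
proof -
 have "isCont (\<lambda>x. x * psi_density x) x" if "x \<in> {-1..1}" "x \<noteq> 0" for x :: real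
 proof -
  have "0 < 1 + sqrt (1 - x\<^sup>2)" using that by (intro add_pos_nonneg) (auto simp: abs_square_le_1 abs_le_iff)
  then show ?thesis unfolding psi_density_def using that by (intro continuous_intros) (auto simp: abs_le_iff)
 qed
 moreover have "isCont (\<lambda>x. x * psi_density x) 0"
 proof -
  have "((\<lambda>x. x * psi_density x) \<longlongrightarrow> 0) (at_right 0)"
  proof (rule Lim_transform_eventually)
   show "((\<lambda>x. x * (ln ((1 + sqrt (1 - x\<^sup>2)) / x) / pi)) \<longlongrightarrow> 0) (at_right 0)" by real_asymp
   show "\<forall>\<^sub>F x in at_right 0. x * (ln ((1 + sqrt (1 - x\<^sup>2)) / x) / pi) = x * psi_density x"
    by (auto simp: eventually_at_right_field psi_density_def intro: exI[of _ 1])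
  qed
  moreover have "((\<lambda>x. x * psi_density x) \<longlongrightarrow> 0) (at_left 0)"
  proof -
   have "((\<lambda>x. - (x * psi_density x)) \<longlongrightarrow> - 0) (at_right 0)" using \<open>_ (at_right 0)\<close> by (rule tendsto_minus)
   then show ?thesis unfolding filterlim_at_left_to_right by (simp add: psi_density_def)
  qed
  ultimately show ?thesis unfolding isCont_def by (simp add: filterlim_at_split psi_density_def)
 qed
 ultimately show ?thesis by (intro continuous_at_imp_continuous_on) blast
qed

lemma psi_deriv:
 assumes "x \<in> {-1<..<1}" "x \<noteq> 0"
 shows "(psi_density has_real_derivative (- 1 / (pi * x * sqrt (1 - x\<^sup>2)))) (at x)"
proof -
 define s where "s = sqrt (1 - x\<^sup>2)"
 have x2: "x\<^sup>2 < 1" using assms by (auto simp: abs_square_less_1 abs_less_iff)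
 have s: "0 < s" "s\<^sup>2 = 1 - x\<^sup>2" using x2 by (auto simp: s_def)
 have d1: "((\<lambda>x. ln (1 + sqrt (1 - x\<^sup>2))) has_real_derivative (- x / (s * (1 + s)))) (at x)"
  using x2 s by (auto intro!: derivative_eq_intros simp: s_def add_pos_pos field_simps)
 have d2: "((\<lambda>x. ln \<bar>x\<bar>) has_real_derivative (1 / x)) (at x)"
 proof (cases "0 < x")
  case True
  have "open {0::real<..}" "x \<in> {0<..}" using True by auto
  from has_field_derivative_transform_within_open[OF DERIV_ln_divide[OF True] this, of "\<lambda>x. ln \<bar>x\<bar>"]
  show ?thesis by simp
 next
  case False
  then have x: "0 < - x" using assms by simp
  have "open {..<0::real}" "x \<in> {..<0}" using x by auto
  from has_field_derivative_transform_within_open[OF DERIV_chain2[OF DERIV_ln_divide[OF x] DERIV_minus[OF DERIV_ident]] this, of "\<lambda>x. ln \<bar>x\<bar>"]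
  show ?thesis by simp
 qed
 have "((\<lambda>x. (ln (1 + sqrt (1 - x\<^sup>2)) - ln \<bar>x\<bar>) / pi) has_real_derivative ((- x / (s * (1 + s)) - 1 / x) / pi)) (at x)"
  by (intro DERIV_cdivide DERIV_diff d1 d2)
 moreover have "(- x / (s * (1 + s)) - 1 / x) / pi = - 1 / (pi * x * s)"
 proof -
  have s1: "1 + s \<noteq> 0" using s by simp
  have "x * (- x / (s * (1 + s))) = - ((1 - s) * (1 + s)) / (s * (1 + s))"
  proof -
   have "(1 - s) * (1 + s) = x * x" using s(2) by (simp add: power2_eq_square algebra_simps)
   then show ?thesis by simp
  qed
  also have "- ((1 - s) * (1 + s)) = (s - 1) * (1 + s)" by (simp add: algebra_simps)
  also have "(s - 1) * (1 + s) / (s * (1 + s)) = (s - 1) / s" by (rule nonzero_mult_divide_mult_cancel_right[OF s1])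
  also have "\<dots> = 1 - 1 / s" using s by (simp add: diff_divide_distrib)
  finally have "x * (- x / (s * (1 + s)) - 1 / x) = - 1 / s" using assms by (simp add: right_diff_distrib)
  then have "- x / (s * (1 + s)) - 1 / x = (- 1 / s) / x" using assms by (metis nonzero_mult_div_cancel_left)
  then show ?thesis by (simp add: mult.commute mult.left_commute)
 qed
 ultimately have d: "((\<lambda>x. (ln (1 + sqrt (1 - x\<^sup>2)) - ln \<bar>x\<bar>) / pi) has_real_derivative (- 1 / (pi * x * sqrt (1 - x\<^sup>2)))) (at x)"
  by (simp add: s_def)
 have op: "open ({-1<..<1} - {0::real})" by (intro open_Diff) auto
 have mem: "x \<in> {-1<..<1} - {0}" using assms by simp
 have eq: "(ln (1 + sqrt (1 - y\<^sup>2)) - ln \<bar>y\<bar>) / pi = psi_density y" if "y \<in> {-1<..<1} - {0}" for y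
 proof -
  have "0 < 1 + sqrt (1 - y\<^sup>2)" using that by (intro add_pos_nonneg) (auto simp: abs_square_le_1 abs_le_iff)
  then show ?thesis using that by (simp add: psi_density_def ln_div)
 qed
 show ?thesis by (rule has_field_derivative_transform_within_open[OF d op mem eq])
qed

text \<open>Integration by parts: \<open>psi_density\<close> has derivative
  \<open>- 1/(pi x sqrt(1 - x^2))\<close> and vanishes at both ends, and \<open>A x = x B x\<close>
  removes the singularity at \<open>0\<close>. What remains is an arcsine integral of
  \<open>B\<close>.\<close>

lemma psi_integral:
 fixes h A B :: "real \<Rightarrow> complex"
 assumes B: "continuous_on {-1..1} B" and A: "\<And>x. x \<in> {-1..1} \<Longrightarrow> A x = of_real x * B x"
  and d: "\<And>x. x \<in> {-1<..<1} \<Longrightarrow> (A has_vector_derivative h x) (at x)"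
 shows "((\<lambda>x. h x * of_real (psi_density x)) has_integral (1 / of_real pi) * integral {- pi/2..pi/2} (\<lambda>\<theta>. B (sin \<theta>))) {-1..1}"
proof -
 let ?F = "\<lambda>x. A x * of_real (psi_density x)"
 have i1: "((\<lambda>x. h x * of_real (psi_density x) - (1 / of_real pi) * ((1 / sqrt (1 - x\<^sup>2)) *\<^sub>R B x)) has_integral (?F 1 - ?F (-1))) {-1..1}"
 proof (rule fundamental_theorem_of_calculus_strong[of "{-1, 0, 1}"])
  have "continuous_on {-1..1} (\<lambda>x. B x * of_real (x * psi_density x))"
   by (intro continuous_intros B psi_bounds_cont)
  moreover have "B x * of_real (x * psi_density x) = ?F x" if "x \<in> {-1..1}" for x using A[OF that] by simp
  ultimately show "continuous_on {-1..1} ?F" by (rule continuous_on_eq)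
  fix x :: real assume "x \<in> {-1..1} - {-1, 0, 1}"
  then have x: "x \<in> {-1<..<1}" "x \<noteq> 0" by auto
  have "((\<lambda>x. complex_of_real (psi_density x)) has_vector_derivative of_real (- 1 / (pi * x * sqrt (1 - x\<^sup>2)))) (at x)"
   using psi_deriv[OF x] by (intro has_vector_derivative_of_real) (simp add: has_real_derivative_iff_has_vector_derivative)
  then have "(?F has_vector_derivative (A x * of_real (- 1 / (pi * x * sqrt (1 - x\<^sup>2))) + h x * of_real (psi_density x))) (at x)"
   by (intro has_vector_derivative_mult d x)
  moreover have "A x * of_real (- 1 / (pi * x * sqrt (1 - x\<^sup>2))) = - ((1 / of_real pi) * ((1 / sqrt (1 - x\<^sup>2)) *\<^sub>R B x))"
   using A[of x] x by (simp add: scaleR_conv_of_real field_simps)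
  ultimately show "(?F has_vector_derivative h x * of_real (psi_density x) - (1 / of_real pi) * ((1 / sqrt (1 - x\<^sup>2)) *\<^sub>R B x)) (at x)"
   by simp
 qed auto
 have i2: "((\<lambda>x. (1 / sqrt (1 - x\<^sup>2)) *\<^sub>R B x) has_integral (integral {- pi/2..pi/2} (\<lambda>\<theta>. B (sin \<theta>)))) {-1..1}"
 proof -
  have "((\<lambda>x. (1 / sqrt (1 - x\<^sup>2)) *\<^sub>R (\<lambda>\<theta>. B (sin \<theta>)) (arcsin x)) has_integral (integral {arcsin (-1)..arcsin 1} (\<lambda>\<theta>. B (sin \<theta>)))) {-1..1}"
  proof (rule has_integral_substitution_strong[of "{-1, 1}" "-1" 1 arcsin "- pi/2" "pi/2"])
   show "continuous_on {- pi/2..pi/2} (\<lambda>\<theta>. B (sin \<theta>))"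
    by (rule continuous_on_compose2[OF B]) (auto intro!: continuous_intros)
   show "continuous_on {-1..1} arcsin" by (rule continuous_on_arcsin')
   show "arcsin ` {-1..1} \<subseteq> {- pi/2..pi/2}" using arcsin_lbound arcsin_ubound by fastforce
   fix x :: real assume "x \<in> {-1..1} - {-1, 1}"
   then have "(arcsin has_real_derivative inverse (sqrt (1 - x\<^sup>2))) (at x)" by (intro DERIV_arcsin) auto
   then show "(arcsin has_real_derivative 1 / sqrt (1 - x\<^sup>2)) (at x within {-1..1})"
    unfolding inverse_eq_divide by (rule has_field_derivative_at_within)
  qed auto
  then have "((\<lambda>x. (1 / sqrt (1 - x\<^sup>2)) *\<^sub>R B (sin (arcsin x))) has_integral (integral {- pi/2..pi/2} (\<lambda>\<theta>. B (sin \<theta>)))) {-1..1}"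
   by simp
  then show ?thesis by (rule has_integral_eq[rotated]) simp
 qed
 have "psi_density 1 = 0" "psi_density (-1) = 0" by (auto simp: psi_density_def)
 then show ?thesis
  using has_integral_add[OF i1 has_integral_mult_right[OF i2, of "1 / of_real pi"]] by simp
qed

lemma psi_total: "((\<lambda>x. complex_of_real (psi_density x)) has_integral 1) {-1..1}"
proof -
 have "((\<lambda>x. 1 * complex_of_real (psi_density x)) has_integral (1 / of_real pi) * integral {- pi/2..pi/2} (\<lambda>\<theta>. 1 :: complex)) {-1..1}"
  by (rule psi_integral[where A = complex_of_real]) (auto intro!: derivative_eq_intros)
 then show ?thesis by (simp add: scaleR_conv_of_real)
qed

text \<open>Here \<open>B x\<close> is the mean of the logarithm over the segment from
  \<open>0\<close> to \<open>x\<close>. Exchanging the two integrations leaves the mean of the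
  arcsine potential \<open>ell (u zeta)\<close> over \<open>u\<close> in \<open>[0, 1]\<close>, and
  \<open>LL\<close> is a primitive of \<open>ell\<close>.\<close>

lemma log_potential:
 assumes \<zeta>: "\<zeta> \<in> slit_disk" "\<zeta> \<noteq> 0"
 shows "((\<lambda>x. Ln (1 - of_real x * \<zeta>) * of_real (psi_density x)) has_integral (LL \<zeta> / \<zeta>)) {-1..1}"
proof -
 define h where "h x = Ln (1 - of_real x * \<zeta>)" for x :: real
 define B where "B x = integral {0..1} (\<lambda>u. Ln (1 - of_real (u * x) * \<zeta>))" for x :: real
 have notin: "1 - of_real t * \<zeta> \<notin> \<real>\<^sub>\<le>\<^sub>0" if "\<bar>t\<bar> \<le> 1" for t
  by (intro one_minus_notin slit_disk_scale \<zeta> that)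
 have ux: "\<bar>u * x\<bar> \<le> 1" if "u \<in> {0..1}" "x \<in> {-1..1}" for u x :: real
 proof -
  have "\<bar>u * x\<bar> \<le> 1 * 1" unfolding abs_mult using that by (intro mult_mono) auto
  then show ?thesis by simp
 qed
 define A where "A x = - ((1 - of_real x * \<zeta>) * Ln (1 - of_real x * \<zeta>) + of_real x * \<zeta>) / \<zeta>" for x :: real
 have dA: "(A has_vector_derivative h x) (at x within X)" if x: "\<bar>x\<bar> \<le> 1" for x X
 proof -
  have nz: "1 - of_real x * \<zeta> \<noteq> 0" using notin[OF x] by auto
  have "((\<lambda>w. - ((1 - w * \<zeta>) * Ln (1 - w * \<zeta>) + w * \<zeta>) / \<zeta>) has_field_derivative
    - ((1 - of_real x * \<zeta>) * (- \<zeta> / (1 - of_real x * \<zeta>)) + (- \<zeta>) * Ln (1 - of_real x * \<zeta>) + \<zeta>) / \<zeta>) (at (of_real x))"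
  proof -
   have d: "((\<lambda>w. 1 - w * \<zeta>) has_field_derivative (- \<zeta>)) (at (of_real x))" by (auto intro!: derivative_eq_intros)
   have L: "((\<lambda>w. Ln (1 - w * \<zeta>)) has_field_derivative (- \<zeta> / (1 - of_real x * \<zeta>))) (at (of_real x))"
    using DERIV_chain2[OF has_field_derivative_Ln[OF notin[OF x]] d] by (simp add: divide_inverse mult.commute)
   have "((\<lambda>w. w * \<zeta>) has_field_derivative \<zeta>) (at (of_real x))" by (auto intro!: derivative_eq_intros)
   from DERIV_cdivide[OF DERIV_minus[OF DERIV_add[OF DERIV_mult[OF d L] this]], of \<zeta>]
   show ?thesis by (simp only: mult.commute[of "- \<zeta> / (1 - of_real x * \<zeta>)"] add.commute[of "(- \<zeta>) * Ln (1 - of_real x * \<zeta>)"])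
  qed
  moreover have "- ((1 - of_real x * \<zeta>) * (- \<zeta> / (1 - of_real x * \<zeta>)) + (- \<zeta>) * Ln (1 - of_real x * \<zeta>) + \<zeta>) / \<zeta> = h x"
   using \<zeta> nz by (simp add: h_def)
  ultimately show ?thesis unfolding A_def by (intro has_vector_derivative_real_field[THEN has_vector_derivative_at_within]) simp
 qed
 have AB: "A x = of_real x * B x" if x: "x \<in> {-1..1}" for x
 proof -
  have "((\<lambda>u. x *\<^sub>R h (u * x)) has_integral (A (1 * x) - A (0 * x))) {0..1}"
  proof (rule fundamental_theorem_of_calculus)
   fix u :: real assume u: "u \<in> {0..1}"
   have "((\<lambda>u. u * x) has_real_derivative x) (at u within {0..1})" by (auto intro!: derivative_eq_intros)
   then have "((A \<circ> (\<lambda>u. u * x)) has_vector_derivative x *\<^sub>R h (u * x)) (at u within {0..1})"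
    using dA[of "u * x"] ux[OF u x] by (intro vector_diff_chain_within) (auto simp: has_real_derivative_iff_has_vector_derivative)
   then show "((\<lambda>u. A (u * x)) has_vector_derivative x *\<^sub>R h (u * x)) (at u within {0..1})" by (simp add: o_def)
  qed simp
  then have "integral {0..1} (\<lambda>u. x *\<^sub>R h (u * x)) = A (1 * x) - A (0 * x)" by (rule integral_unique)
  also have "\<dots> = A x" by (simp add: A_def)
  finally have "integral {0..1} (\<lambda>u. x *\<^sub>R h (u * x)) = A x" .
  then show ?thesis by (simp add: B_def h_def scaleR_conv_of_real)
 qed
 have contLn: "continuous_on ({-1..1} \<times> {0..1}) (\<lambda>(x, u). Ln (1 - of_real (u * x) * \<zeta>))"
  unfolding case_prod_beta using notin ux by (intro continuous_intros) (auto simp del: of_real_mult)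
 have "((\<lambda>x. h x * of_real (psi_density x)) has_integral (1 / of_real pi) * integral {- pi/2..pi/2} (\<lambda>\<theta>. B (sin \<theta>))) {-1..1}"
 proof (rule psi_integral[where A = A])
  show "continuous_on {-1..1} B"
   unfolding B_def using integral_continuous_on_param[of "{-1..1}" 0 1 "\<lambda>x u. Ln (1 - of_real (u * x) * \<zeta>)"] contLn by simp
  show "A x = of_real x * B x" if "x \<in> {-1..1}" for x using AB that .
  show "(A has_vector_derivative h x) (at x)" if "x \<in> {-1<..<1}" for x
   using dA[of x UNIV] that by (auto simp: abs_le_iff)
 qed
 moreover have "integral {- pi/2..pi/2} (\<lambda>\<theta>. B (sin \<theta>)) = of_real pi * (LL \<zeta> / \<zeta>)"
 proof -
  have "integral (cbox (- pi/2) (pi/2)) (\<lambda>\<theta>. integral (cbox 0 1) (\<lambda>u. Ln (1 - of_real (u * sin \<theta>) * \<zeta>)))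
   = integral (cbox 0 1) (\<lambda>u. integral (cbox (- pi/2) (pi/2)) (\<lambda>\<theta>. Ln (1 - of_real (u * sin \<theta>) * \<zeta>)))"
  proof (rule integral_swap_continuous)
   show "continuous_on (cbox (- pi/2, 0) (pi/2, 1)) (\<lambda>(\<theta>, u). Ln (1 - of_real (u * sin \<theta>) * \<zeta>))"
    unfolding case_prod_beta using notin ux by (intro continuous_intros) (auto simp: cbox_Pair_eq simp del: of_real_mult)
  qed
  also have "\<dots> = integral {0..1} (\<lambda>u. of_real pi * ell (of_real u * \<zeta>))"
  proof (unfold cbox_interval, rule integral_cong)
   fix u :: real assume "u \<in> {0..1}"
   then have "of_real u * \<zeta> \<in> slit_disk" by (intro slit_disk_scale \<zeta>) auto
   from arcsine_log[OF this] show "integral {- pi/2..pi/2} (\<lambda>\<theta>. Ln (1 - of_real (u * sin \<theta>) * \<zeta>)) = of_real pi * ell (of_real u * \<zeta>)"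
    by (simp add: mult_ac)
  qed
  also have "\<dots> = of_real pi * (LL \<zeta> / \<zeta>)"
  proof -
   have "((\<lambda>u. ell (of_real u * \<zeta>)) has_integral (LL (of_real 1 * \<zeta>) / \<zeta> - LL (of_real 0 * \<zeta>) / \<zeta>)) {0..1}"
   proof (rule fundamental_theorem_of_calculus)
    fix u :: real assume "u \<in> {0..1}"
    then have u: "of_real u * \<zeta> \<in> slit_disk" by (intro slit_disk_scale \<zeta>) auto
    have "((\<lambda>w. w * \<zeta>) has_field_derivative \<zeta>) (at (of_real u))" by (auto intro!: derivative_eq_intros)
    from DERIV_cdivide[OF DERIV_chain2[OF LL_deriv[OF u] this], of \<zeta>]
    have "((\<lambda>w. LL (w * \<zeta>) / \<zeta>) has_field_derivative ell (of_real u * \<zeta>)) (at (of_real u))" using \<zeta> by simp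
    then show "((\<lambda>u. LL (of_real u * \<zeta>) / \<zeta>) has_vector_derivative ell (of_real u * \<zeta>)) (at u within {0..1})"
     by (rule has_vector_derivative_real_field[THEN has_vector_derivative_at_within])
   qed simp
   then have "integral {0..1} (\<lambda>u. ell (of_real u * \<zeta>)) = LL \<zeta> / \<zeta>"
    by (simp add: integral_unique LL_def ell_def cc_def)
   then show ?thesis by simp
  qed
  finally show ?thesis by (simp add: B_def)
 qed
 ultimately show ?thesis by (simp add: h_def)
qed

text \<open>The potential is \<open>g z = Ln z + z * LL (1/z)\<close>. The point is the branch: the
  principal logarithm of \<open>z - x\<close> must split as \<open>Ln z + Ln (1 - x/z)\<close>
  without a jump.\<close>

lemma g_fun_eq:
 assumes z: "z \<in> slit_plane"
 shows "exp (of_nat n * g_fun z) = z ^ n * exp (of_nat n * (z * LL (1 / z)))"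
proof -
 have z0: "z \<noteq> 0" using z by (rule slit_plane_nonzero)
 have \<zeta>: "1 / z \<in> slit_disk" "1 / z \<noteq> 0" using slit_plane_inverse[OF z, of 1] z0 by simp_all
 have ln: "Ln (z - of_real x) = Ln z + Ln (1 - of_real x * (1 / z))" if x: "x \<in> {-1..1}" for x
 proof -
  define v where "v = 1 - of_real x * (1 / z)"
  have v: "v \<notin> \<real>\<^sub>\<le>\<^sub>0" unfolding v_def using x by (intro one_minus_notin slit_disk_scale \<zeta>) auto
  then have v0: "v \<noteq> 0" by auto
  have zv: "z - of_real x = z * v" using z0 by (simp add: v_def right_diff_distrib)
  define t where "t = Im (Ln z) + Im (Ln v)"
  have iv: "- pi < Im (Ln v)" "Im (Ln v) \<le> pi" "- pi < Im (Ln z)" "Im (Ln z) \<le> pi"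
   using mpi_less_Im_Ln Im_Ln_le_pi v0 z0 by auto
  have sn: "Im z = exp (Re (Ln z + Ln v)) * sin t"
  proof -
   have "Im z = Im (exp (Ln z + Ln v))" using z0 v0 zv by (simp add: exp_add flip: zv)
   then show ?thesis by (simp add: Im_exp t_def)
  qed
  \<comment> \<open>If the sum \<open>t\<close> of the two arguments left \<open>(-pi, pi]\<close>,
    then \<open>sin t\<close> would have the wrong sign, since \<open>Im (z - x) = Im z\<close>. For
    real \<open>z\<close> the second logarithm is real.\<close>
  have "- pi < t \<and> t \<le> pi"
  proof (cases "Im z" "0::real" rule: linorder_cases)
   case greater
   then have "0 < Im (Ln z)" using Im_Ln_pos_lt[OF z0] by simp
   moreover have zl: "Im (Ln z) < pi" using Im_Ln_pos_lt[OF z0] greater by simp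
   moreover have "t \<le> pi"
   proof (rule ccontr)
    assume "\<not> t \<le> pi"
    then have "sin t \<le> 0" using iv zl by (intro sin_le_zero) (auto simp: t_def)
    then show False using sn greater by (simp add: zero_less_mult_iff)
   qed
   ultimately show ?thesis using iv by (simp add: t_def)
  next
   case less
   then have n: "Im (Ln z) < 0" using Im_Ln_pos_le[OF z0] iv by linarith
   moreover have "- pi < t"
   proof (rule ccontr)
    assume "\<not> - pi < t"
    then have "sin (- t) \<le> 0" using iv by (intro sin_le_zero) (auto simp: t_def)
    then have "0 \<le> sin t" by simp
    then have "0 \<le> Im z" unfolding sn by (intro mult_nonneg_nonneg) auto
    then show False using less by simp
   qed
   ultimately show ?thesis using iv by (simp add: t_def)
  next
   case equal
   then have "Im v = 0" by (simp add: v_def Im_divide)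
   then have "0 < Re v" using v by (auto simp: complex_nonpos_Reals_iff)
   have "v = of_real (Re v)" using \<open>Im v = 0\<close> by (simp add: complex_eq_iff)
   then have "Ln v = of_real (ln (Re v))" using Ln_of_real[OF \<open>0 < Re v\<close>] by simp
   then have "Im (Ln v) = 0" by simp
   then show ?thesis using iv by (simp add: t_def)
  qed
  then show ?thesis unfolding zv v_def[symmetric] using z0 v0 by (intro Ln_times_simple) (auto simp: t_def)
 qed
 have "((\<lambda>x. Ln z * of_real (psi_density x) + Ln (1 - of_real x * (1 / z)) * of_real (psi_density x)) has_integral
   (Ln z * 1 + LL (1 / z) / (1 / z))) {-1..1}"
  by (intro has_integral_add has_integral_mult_right psi_total log_potential \<zeta>)
 then have "((\<lambda>x. Ln (z - of_real x) * of_real (psi_density x)) has_integral (Ln z * 1 + LL (1 / z) / (1 / z))) {-1..1}"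
  by (rule has_integral_eq[rotated]) (simp only: ln distrib_right)
 then have "((\<lambda>x. Ln (z - of_real x) * of_real (psi_density x)) has_integral (Ln z + z * LL (1 / z))) {-1..1}"
  using z0 by (simp add: mult.commute)
 then have gz: "g_fun z = Ln z + z * LL (1 / z)" unfolding g_fun_def by (rule integral_unique)
 have "exp (of_nat n * g_fun z) = exp (of_nat n * Ln z) * exp (of_nat n * (z * LL (1 / z)))"
  unfolding gz by (simp only: distrib_left exp_add)
 also have "exp (of_nat n * Ln z) = z ^ n" using z0 by (simp add: exp_of_nat_mult)
 finally show ?thesis .
qed

text \<open>Identifies the stated asymptotic term with the WKB ansatz at \<open>p = 1/z\<close>,
  where \<open>sqrt_branch z = z * cc (1/z)\<close>. The work lies in checking that the principal
  powers agree with the exponentials of \<open>ell\<close>, \<open>Ln (cc p)\<close> and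
  \<open>Arcsin\<close>.\<close>

lemma leading_term_eq:
 assumes z: "z \<in> slit_plane"
 shows "leading_term nu n z = z ^ n * exp (of_nat n * z * LL (1 / z) + AA (nu / 2) (1 / z))"
proof -
 define \<zeta> where "\<zeta> = 1 / z"
 have z0: "z \<noteq> 0" using z by (rule slit_plane_nonzero)
 have \<zeta>: "\<zeta> \<in> slit_disk" "\<zeta> \<noteq> 0" using slit_plane_inverse[OF z, of 1] z0 by (simp_all add: \<zeta>_def)
 define c where "c = cc \<zeta>"
 have c: "0 < Re c" "c \<noteq> 0" "1 + c \<noteq> 0" using Re_cc[OF \<zeta>(1)] cc_nz[OF \<zeta>(1)] one_plus_cc[OF \<zeta>(1)] by (auto simp: c_def)
 have sb: "sqrt_branch z = z * c" unfolding sqrt_branch_def c_def cc_def \<zeta>_def by (simp add: power_divide)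
 have q: "quarter_base z = (1 + c) / (2 * c\<^sup>2)"
 proof -
  have "z\<^sup>2 - 1 = z\<^sup>2 * c\<^sup>2" using sqrt_branch_sq[OF z] unfolding sb by (simp add: power_mult_distrib)
  then have "2 * (z\<^sup>2 - 1) = z * z * (2 * c\<^sup>2)" by (simp add: power2_eq_square)
  moreover have "z * (z + z * c) = z * z * (1 + c)" by (simp add: algebra_simps)
  ultimately have "quarter_base z = (z * z * (1 + c)) / (z * z * (2 * c\<^sup>2))" unfolding quarter_base_def sb by (simp only:)
  then show ?thesis using z0 by simp
 qed
 have Lq: "Ln (quarter_base z) = ell \<zeta> - 2 * Ln c"
 proof (rule Ln_unique)
  have "exp (ell \<zeta> - 2 * Ln c) = exp (ell \<zeta>) / (exp (Ln c) * exp (Ln c))" by (simp only: exp_diff mult_2 exp_add)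
  also have "\<dots> = quarter_base z" using c by (simp add: q ell_def c_def[symmetric] power2_eq_square)
  finally show "exp (ell \<zeta> - 2 * Ln c) = quarter_base z" .
  have h: "(1 + c) / 2 \<noteq> 0" using c by simp
  have b: "\<bar>Im (Ln c)\<bar> < pi / 2" "\<bar>Im (Ln ((1 + c) / 2))\<bar> < pi / 2"
   using Re_Ln_pos_lt[OF c(2)] Re_Ln_pos_lt[OF h] c(1) by auto
  \<comment> \<open>\<open>c\<close> and \<open>(1 + c)/2\<close> lie on the same side of the real
    axis, so in the combination of the two arguments the parts have opposite signs and cannot add up
    beyond \<open>pi\<close>.\<close>
  have "(0 \<le> Im (Ln c) \<and> 0 \<le> Im (Ln ((1 + c) / 2))) \<or> (Im (Ln c) \<le> 0 \<and> Im (Ln ((1 + c) / 2)) \<le> 0)"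
  proof (cases "0 \<le> Im c")
   case True
   then show ?thesis using Im_Ln_pos_le[OF c(2)] Im_Ln_pos_le[OF h] by simp
  next
   case False
   then have "\<not> 0 < Im c" "\<not> 0 < Im ((1 + c) / 2)" by auto
   then show ?thesis using Im_Ln_pos_lt[OF c(2)] Im_Ln_pos_lt[OF h] b by auto
  qed
  then show "- pi < Im (ell \<zeta> - 2 * Ln c)" "Im (ell \<zeta> - 2 * Ln c) \<le> pi"
   using b unfolding ell_def c_def[symmetric] by (auto simp: abs_less_iff)
 qed
 have qp: "quarter_base z powr (1 / 4) = exp (ell \<zeta> / 4 - Ln c / 2)"
 proof -
  have "quarter_base z \<noteq> 0" using q c by simp
  moreover have "(1 / 4) * (ell \<zeta> - 2 * Ln c) = ell \<zeta> / 4 - Ln c / 2" by (simp add: field_simps)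
  ultimately show ?thesis unfolding powr_def Lq by (simp only: if_False)
 qed
 have nb: "nu_base z powr (- of_real nu / 4) = exp (of_real (nu / 2) * (\<i> * Arcsin \<zeta>))"
 proof -
  define e1 e2 where "e1 = c + \<i> * \<zeta>" and "e2 = c - \<i> * \<zeta>"
  have e: "e1 = exp (\<i> * Arcsin \<zeta>)" "e2 = exp (- (\<i> * Arcsin \<zeta>))"
   unfolding e1_def e2_def c_def using exp_Arcsin[of \<zeta>] by simp_all
  have e12: "e2 = inverse e1" unfolding e by (rule exp_minus)
  \<comment> \<open>\<open>e2\<close> is the inverse of \<open>e1\<close>, so their real parts have
    the same sign, and their sum is \<open>2 Re c > 0\<close>.\<close>
  have "Re e1 > 0"
  proof (rule ccontr)
   assume n: "\<not> Re e1 > 0"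
   then have "Re e2 \<le> 0" unfolding e12 by (auto simp: divide_nonpos_nonneg)
   moreover have "Re e1 + Re e2 = 2 * Re c" by (simp add: e1_def e2_def)
   ultimately show False using n c by simp
  qed
  moreover have "e1 \<noteq> 0" by (simp add: e)
  ultimately have "\<bar>Im (Ln e1)\<bar> < pi / 2" using Re_Ln_pos_lt[of e1] by simp
  moreover have "Arcsin \<zeta> = - \<i> * Ln e1" by (simp add: Arcsin_def e1_def c_def cc_def add.commute)
  ultimately have rA: "\<bar>Re (Arcsin \<zeta>)\<bar> < pi / 2" by simp
  have "nu_base z = (z * e2) / (z * e1)"
   unfolding nu_base_def sb e1_def e2_def using z0 by (simp add: \<zeta>_def algebra_simps)
  also have "\<dots> = exp (- (\<i> * Arcsin \<zeta>)) / exp (\<i> * Arcsin \<zeta>)" using z0 by (simp add: e)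
  also have "\<dots> = exp (- 2 * (\<i> * Arcsin \<zeta>))" unfolding exp_diff[symmetric] by (rule arg_cong[where f = exp]) simp
  finally have nu: "nu_base z = exp (- 2 * (\<i> * Arcsin \<zeta>))" .
  have "Ln (nu_base z) = - 2 * (\<i> * Arcsin \<zeta>)"
   by (rule Ln_unique) (use nu rA in \<open>auto simp: abs_less_iff\<close>)
  moreover have "nu_base z \<noteq> 0" by (simp add: nu)
  ultimately show ?thesis by (simp add: powr_def mult_ac)
 qed
 show ?thesis
  unfolding leading_term_def g_fun_eq[OF z] qp nb AA_def \<zeta>_def[symmetric] c_def[symmetric]
  by (simp only: exp_add mult.assoc)
qed

section \<open>Comparison of the orthogonal polynomials\<close>
context
 fixes nu :: real assumes nu: "0 < nu" "nu \<le> 1/2"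
begin

text \<open>The first term covers the neighbourhood of the origin and the relative
  \<open>1/|x|\<close> error; the second is the phase mismatch times the squared norm of the
  comparison polynomial.\<close>

definition approx_bound :: "real \<Rightarrow> nat \<Rightarrow> real" where
 "approx_bound eta n = real n powr (2 * eta + nu/4 - 3/2) / (1/4 - eta)\<^sup>2 + (nu/2 - eta)\<^sup>2 * real n powr (-1/2)"

lemma integral_combination:
 fixes f g h :: "real \<Rightarrow> real"
 assumes "integrable M f" "integrable M g" "integrable M h"
 shows "(\<integral>x. A * f x + (B * g x + C * h x) \<partial>M) = A * integral\<^sup>L M f + (B * integral\<^sup>L M g + C * integral\<^sup>L M h)"
 using assms by simp

lemma DD_bound:
 "\<exists>C>0. \<forall>eta n. 0 \<le> eta \<and> eta < 1/4 \<and> eta \<le> nu/2 \<and> 1 \<le> n \<longrightarrow>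
  integrable lborel (\<lambda>x. DD nu eta x * (cmod (mp (1/4 - eta) (1/4 + eta) n (of_real x)))\<^sup>2) \<and>
  (\<integral>x. DD nu eta x * (cmod (mp (1/4 - eta) (1/4 + eta) n (of_real x)))\<^sup>2 \<partial>lborel) \<le> C * approx_bound eta n"
proof -
 \<comment> \<open>The cut-off trades against the pointwise bound: on \<open>|x| <= x0\<close> the
   squared polynomial is at most \<open>4 (n + 1)^(2 eta + 2 x0 - 3/2)\<close>. With
   \<open>x0 = nu/8\<close> this costs \<open>nu/4\<close> in the exponent, below the room that the
   claimed rate leaves.\<close>
 define x0 where "x0 = nu / 8"
 have x0: "0 < x0" "x0 \<le> 1" using nu by (auto simp: x0_def)
 obtain Cf where Cf: "Cf > 0" "\<And>eta x. 0 \<le> eta \<and> eta < 1/4 \<and> eta \<le> nu/2 \<and> x0 \<le> \<bar>x\<bar> \<Longrightarrow> DD nu eta x \<le> Cf * (((nu/2 - eta)\<^sup>2 + 1 / (1 + x\<^sup>2)) * om x)"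
  using DD_far[OF nu x0(1)] by blast
 obtain Cn where Cn: "Cn > 0" "\<And>eta x. 0 \<le> eta \<and> eta < 1/4 \<and> x \<noteq> 0 \<and> \<bar>x\<bar> \<le> x0 \<Longrightarrow> DD nu eta x \<le> Cn * (tail x / (1/4 - eta)\<^sup>2)"
  using DD_near[OF nu x0] by blast
 have tail_int: "integrable lborel tail"
  using integrable_Re[OF tail_poly_integrable[of 1]] by simp
 define T0 where "T0 = (\<integral>x. tail x \<partial>lborel)"
 have T0: "0 \<le> T0" unfolding T0_def by (intro integral_nonneg_AE AE_I2) (simp add: tail_def)
 have h0: "0 < hh 0" by (rule hh_bounds)
 define C where "C = Cn * (4 * T0) + Cf * (20 * hh 0) + Cf * (68 * hh 0)"
 have C: "0 < C" unfolding C_def using Cn(1) Cf(1) T0 h0 by (intro add_nonneg_pos add_nonneg_nonneg mult_nonneg_nonneg mult_pos_pos) auto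
 show ?thesis
 proof (rule exI[of _ C], rule conjI[OF C], intro allI impI)
  fix eta :: real and n :: nat assume A: "0 \<le> eta \<and> eta < 1/4 \<and> eta \<le> nu/2 \<and> 1 \<le> n"
  define a where "a = 1/4 - eta"
  define \<theta> where "\<theta> = nu/2 - eta"
  have a: "0 < a" "a \<le> 1" using A by (auto simp: a_def)
  let ?c = "\<lambda>x::real. cmod (mp (1/4 - eta) (1/4 + eta) n (of_real x))"
  define M where "M = 2 * (real n + 1) powr (eta + x0 - 3/4)"
  have M0: "0 \<le> M" by (simp add: M_def)
  have cM: "?c x \<le> M" if "\<bar>x\<bar> \<le> x0" for x
   unfolding M_def
  proof (rule mp_pointwise)
   have "cmod (of_real x + \<i> * of_real eta) \<le> cmod (of_real x) + cmod (\<i> * of_real eta)" by (rule norm_triangle_ineq)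
   also have "\<dots> \<le> eta + x0" using that A by (simp add: norm_mult)
   finally show "cmod (of_real x + \<i> * of_real eta) \<le> eta + x0" .
   show "eta + x0 \<le> 1/2" using A nu by (simp add: x0_def)
  qed
  let ?H = "\<lambda>x. Cn * (M\<^sup>2 / a\<^sup>2) * tail x + (Cf * \<theta>\<^sup>2 * (om x * (?c x)\<^sup>2) + Cf * (om x * (?c x)\<^sup>2 / (1 + x\<^sup>2)))"
  have w: "integrable lborel (\<lambda>x. om x * (?c x)\<^sup>2 / (1 + x\<^sup>2))"
   "(\<integral>x. om x * (?c x)\<^sup>2 / (1 + x\<^sup>2) \<partial>lborel) \<le> 68 * hh 0 * real n powr (2 * eta - 3/2)"
   using mp_weighted_norm[of eta n] A by auto
  have H: "integrable lborel ?H"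
   by (intro Bochner_Integration.integrable_add integrable_mult_right tail_int nrm_integrable w)
  have le: "DD nu eta x * (?c x)\<^sup>2 \<le> ?H x" if x: "x \<noteq> 0" for x
  proof (cases "\<bar>x\<bar> \<le> x0")
   case True
   have "DD nu eta x * (?c x)\<^sup>2 \<le> (Cn * (tail x / a\<^sup>2)) * M\<^sup>2"
    using Cn(2)[of eta x] A x True cM[OF True] Cn(1) tail_pos[OF x]
    by (intro mult_mono power_mono) (auto simp: a_def[symmetric])
   also have "\<dots> = Cn * (M\<^sup>2 / a\<^sup>2) * tail x" by simp
   also have "\<dots> \<le> ?H x" using Cf(1) om_pos[of x] by (intro add_increasing2[OF _ order_refl] add_nonneg_nonneg mult_nonneg_nonneg divide_nonneg_nonneg) auto
   finally show ?thesis .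
  next
   case False
   have "DD nu eta x * (?c x)\<^sup>2 \<le> (Cf * ((\<theta>\<^sup>2 + 1 / (1 + x\<^sup>2)) * om x)) * (?c x)\<^sup>2"
    using Cf(2)[of eta x] A False by (intro mult_right_mono) (auto simp: \<theta>_def)
   also have "\<dots> = Cf * \<theta>\<^sup>2 * (om x * (?c x)\<^sup>2) + Cf * (om x * (?c x)\<^sup>2 / (1 + x\<^sup>2))"
    by (simp add: distrib_left distrib_right mult_ac)
   also have "\<dots> \<le> ?H x" using Cn(1) tail_pos[OF x] by (intro add_increasing[OF _ order_refl] mult_nonneg_nonneg divide_nonneg_nonneg) auto
   finally show ?thesis .
  qed
  have nn: "0 \<le> DD nu eta x * (?c x)\<^sup>2" for x using KX_nonneg[OF nu, of x] by (auto simp: DD_def[OF nu])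
  have ms: "(\<lambda>x. DD nu eta x * (?c x)\<^sup>2) \<in> borel_measurable lborel"
  proof -
   have r: "(\<lambda>x. rho (1/4 - eta) (1/4 + eta) (complex_of_real x)) \<in> borel_measurable lborel"
    using borel_measurable_integrable[OF rho_poly_integrable[of "1/4 - eta" "1/4 + eta" 1]] A by simp
   have c: "(\<lambda>x. mp (1/4 - eta) (1/4 + eta) n (complex_of_real x)) \<in> borel_measurable lborel"
    using poly_line_measurable[of "mp_poly (1/4 - eta) (1/4 + eta) n"] by (simp add: poly_mp_poly)
   show ?thesis unfolding DD_def[OF nu] using r c by measurable
  qed
  have ae: "AE x in lborel. DD nu eta x * (?c x)\<^sup>2 \<le> ?H x"
   using AE_lborel_singleton[of "0::real"] by eventually_elim (rule le)
  have I: "integrable lborel (\<lambda>x. DD nu eta x * (?c x)\<^sup>2)"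
  proof (rule Bochner_Integration.integrable_bound[OF H ms])
   show "AE x in lborel. norm (DD nu eta x * (?c x)\<^sup>2) \<le> norm (?H x)"
    using ae
   proof eventually_elim
    case (elim x)
    then show ?case using nn[of x] by (simp only: real_norm_def abs_of_nonneg)
   qed
  qed
  have "(\<integral>x. DD nu eta x * (?c x)\<^sup>2 \<partial>lborel) \<le> (\<integral>x. ?H x \<partial>lborel)" by (rule integral_mono_AE[OF I H ae])
  also have "\<dots> = Cn * (M\<^sup>2 / a\<^sup>2) * T0 + (Cf * \<theta>\<^sup>2 * nrm (1/4 - eta) (1/4 + eta) n + Cf * (\<integral>x. om x * (?c x)\<^sup>2 / (1 + x\<^sup>2) \<partial>lborel))"
   unfolding T0_def nrm_def by (rule integral_combination[OF tail_int nrm_integrable w(1)])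
  also have "\<dots> \<le> Cn * (4 * T0) * (real n powr (2 * eta + nu/4 - 3/2) / a\<^sup>2) + (Cf * \<theta>\<^sup>2 * (20 * hh 0 * real n powr (-1/2)) + Cf * (68 * hh 0 * (real n powr (2 * eta + nu/4 - 3/2) / a\<^sup>2)))"
  proof (intro add_mono mult_left_mono)
   have "M\<^sup>2 \<le> 4 * real n powr (2 * eta + nu/4 - 3/2)"
   proof -
    have "M\<^sup>2 = 4 * (real n + 1) powr (2 * eta + nu/4 - 3/2)"
    proof -
     have e: "(eta + x0 - 3/4) + (eta + x0 - 3/4) = 2 * eta + nu/4 - 3/2" by (simp add: x0_def)
     have "(real n + 1) powr (eta + x0 - 3/4) * (real n + 1) powr (eta + x0 - 3/4) = (real n + 1) powr (2 * eta + nu/4 - 3/2)"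
      unfolding powr_add[symmetric] e ..
     then show ?thesis unfolding M_def power2_eq_square by simp
    qed
    also have "\<dots> \<le> 4 * real n powr (2 * eta + nu/4 - 3/2)"
     using A nu by (intro mult_left_mono powr_mono2') auto
    finally show ?thesis .
   qed
   then have "M\<^sup>2 / a\<^sup>2 * (Cn * T0) \<le> 4 * real n powr (2 * eta + nu/4 - 3/2) / a\<^sup>2 * (Cn * T0)"
    using Cn(1) T0 by (intro mult_right_mono divide_right_mono) auto
   then show "Cn * (M\<^sup>2 / a\<^sup>2) * T0 \<le> Cn * (4 * T0) * (real n powr (2 * eta + nu/4 - 3/2) / a\<^sup>2)"
    by (simp add: mult_ac)
   have "nrm (1/4 - eta) (1/4 + eta) n \<le> 20 * hh 0 / sqrt (real n + 1)" using nrm_0[of eta n] A by simp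
   also have "\<dots> \<le> 20 * hh 0 / sqrt (real n)" using h0 A by (intro divide_left_mono mult_pos_pos) auto
   also have "\<dots> = 20 * hh 0 * real n powr (-1/2)" by (simp add: powr_minus_divide powr_half_sqrt)
   finally show "nrm (1/4 - eta) (1/4 + eta) n \<le> 20 * hh 0 * real n powr (-1/2)" .
   have "real n powr (2 * eta - 3/2) \<le> real n powr (2 * eta + nu/4 - 3/2)" using A nu by (intro powr_mono) auto
   also have "\<dots> \<le> real n powr (2 * eta + nu/4 - 3/2) / a\<^sup>2"
    using a power_le_one[of a 2] by (simp add: pos_le_divide_eq mult_left_le)
   finally have "68 * hh 0 * real n powr (2 * eta - 3/2) \<le> 68 * hh 0 * (real n powr (2 * eta + nu/4 - 3/2) / a\<^sup>2)"
    using h0 by (intro mult_left_mono) auto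
   then show "(\<integral>x. om x * (?c x)\<^sup>2 / (1 + x\<^sup>2) \<partial>lborel) \<le> 68 * hh 0 * (real n powr (2 * eta + nu/4 - 3/2) / a\<^sup>2)"
    using w(2) by linarith
  qed (use Cf(1) in auto)
  also have "\<dots> = (Cn * (4 * T0) + Cf * (68 * hh 0)) * (real n powr (2 * eta + nu/4 - 3/2) / a\<^sup>2) + Cf * (20 * hh 0) * (\<theta>\<^sup>2 * real n powr (-1/2))"
   by (simp add: algebra_simps add_divide_distrib)
  also have "\<dots> \<le> C * (real n powr (2 * eta + nu/4 - 3/2) / a\<^sup>2) + C * (\<theta>\<^sup>2 * real n powr (-1/2))"
   using Cn(1) Cf(1) T0 h0 by (intro add_mono mult_right_mono) (auto simp: C_def)
  also have "\<dots> = C * approx_bound eta n" by (simp add: approx_bound_def a_def \<theta>_def distrib_left)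
  finally have "(\<integral>x. DD nu eta x * (?c x)\<^sup>2 \<partial>lborel) \<le> C * approx_bound eta n" .
  with I show "integrable lborel (\<lambda>x. DD nu eta x * (?c x)\<^sup>2) \<and>
  (\<integral>x. DD nu eta x * (?c x)\<^sup>2 \<partial>lborel) \<le> C * approx_bound eta n" by (rule conjI)
 qed
qed

section \<open>Coercivity of the complex form and the mean-square error\<close>

lemma KX_sq_integrable: "integrable lborel (\<lambda>x. KX nu x * (cmod (poly p (of_real x)))\<^sup>2)"
proof -
 have "integrable lborel (\<lambda>x. Re (complex_of_real (KX nu x) * poly (p * cnjp p) (of_real x)))"
  by (intro integrable_Re KX_integrable nu)
 moreover have "Re (complex_of_real (KX nu x) * poly (p * cnjp p) (of_real x)) = KX nu x * (cmod (poly p (of_real x)))\<^sup>2" for x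
  unfolding poly_mult poly_cnjp complex_norm_square[symmetric] by simp
 ultimately show ?thesis by (simp only:)
qed

lemma cos_pos: "0 < cos (pi * nu / 2)"
proof (intro cos_gt_zero_pi)
 have "0 < pi * nu" "pi * nu \<le> pi * (1/2)" using nu by (auto intro!: mult_left_mono)
 then show "- (pi / 2) < pi * nu / 2" "pi * nu / 2 < pi / 2" using pi_gt_zero by linarith+
qed

text \<open>The phase of the weight is constant in modulus, \<open>pi nu/2 <= pi/4\<close>, on both
  half-lines, so its real part is the fixed multiple \<open>cos (pi nu / 2)\<close> of
  \<open>KX nu\<close>.\<close>

lemma coercive: "Re (\<integral>x. ww nu x * poly (p * cnjp p) (of_real x) \<partial>lborel) = cos (pi * nu / 2) * (\<integral>x. KX nu x * (cmod (poly p (of_real x)))\<^sup>2 \<partial>lborel)"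
proof -
 have "Re (\<integral>x. ww nu x * poly (p * cnjp p) (of_real x) \<partial>lborel) = (\<integral>x. Re (ww nu x * poly (p * cnjp p) (of_real x)) \<partial>lborel)"
  by (intro integral_Re[symmetric] ww_integrable nu)
 also have "\<dots> = (\<integral>x. cos (pi * nu / 2) * (KX nu x * (cmod (poly p (of_real x)))\<^sup>2) \<partial>lborel)"
 proof (rule integral_cong_AE)
  show "(\<lambda>x. Re (ww nu x * poly (p * cnjp p) (of_real x))) \<in> borel_measurable lborel"
   by (intro borel_measurable_integrable integrable_Re ww_integrable nu)
  show "(\<lambda>x. cos (pi * nu / 2) * (KX nu x * (cmod (poly p (of_real x)))\<^sup>2)) \<in> borel_measurable lborel"
   by (intro borel_measurable_integrable integrable_mult_right KX_sq_integrable)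
  show "AE x in lborel. Re (ww nu x * poly (p * cnjp p) (of_real x)) = cos (pi * nu / 2) * (KX nu x * (cmod (poly p (of_real x)))\<^sup>2)"
   using AE_lborel_singleton[of "0::real"]
  proof eventually_elim
   case (elim x)
   have e: "ww nu x * poly (p * cnjp p) (of_real x) = ww nu x * of_real ((cmod (poly p (of_real x)))\<^sup>2)"
    unfolding poly_mult poly_cnjp complex_norm_square[symmetric] by simp
   show ?case unfolding e using Re_ww[OF nu elim] by simp
  qed
 qed
 finally show ?thesis by simp
qed

text \<open>Test with \<open>q = cnjp p\<close>: coercivity makes \<open>p\<close> vanish almost
  everywhere on the line, and a nonzero polynomial has finitely many roots.\<close>

lemma ww_definite:
 assumes "\<And>q. degree q \<le> degree p \<Longrightarrow> (\<integral>x. ww nu x * poly (p * q) (of_real x) \<partial>lborel) = 0"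
 shows "p = 0"
proof (rule ccontr)
 assume p: "p \<noteq> 0"
 have "cos (pi * nu / 2) * (\<integral>x. KX nu x * (cmod (poly p (of_real x)))\<^sup>2 \<partial>lborel) = 0"
  using assms[of "cnjp p"] coercive[of p] by (simp add: degree_cnjp)
 then have z: "(\<integral>x. KX nu x * (cmod (poly p (of_real x)))\<^sup>2 \<partial>lborel) = 0" using cos_pos by simp
 have "AE x in lborel. KX nu x * (cmod (poly p (of_real x)))\<^sup>2 = 0"
  using integral_nonneg_eq_0_iff_AE[OF KX_sq_integrable[of p]] z KX_nonneg[OF nu] by simp
 then have "AE x in lborel. x \<in> insert 0 {x. poly p (complex_of_real x) = 0}"
 proof eventually_elim
  case (elim x)
  then show ?case using KX_pos[OF nu, of x] by (cases "x = 0") auto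
 qed
 moreover have fin: "finite (insert 0 {x::real. poly p (complex_of_real x) = 0})"
 proof -
  have "finite (complex_of_real -` {z. poly p z = 0})" by (intro finite_vimageI poly_roots_finite p) (simp add: inj_on_def)
  then show ?thesis by (simp add: vimage_def)
 qed
 moreover have "AE x in lborel. x \<notin> insert 0 {x::real. poly p (complex_of_real x) = 0}"
  using fin by (intro AE_not_in countable_imp_null_set_lborel countable_finite)
 ultimately have "AE x in lborel. x \<in> insert 0 {x. poly p (complex_of_real x) = 0} \<and> x \<notin> insert 0 {x::real. poly p (complex_of_real x) = 0}"
  by (intro eventually_conj)
 then have "AE x in (lborel :: real measure). False" by (rule eventually_mono) blast
 then show False by (simp add: eventually_False ae_filter_eq_bot_iff)
qed

text \<open>A Cea-type estimate. For \<open>e = q - c\<close>, the form at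
  \<open>(e, cnjp e)\<close> loses its \<open>q\<close>-part by orthogonality of \<open>q\<close>;
  its \<open>c\<close>-part may be reduced by \<open>C0 nu * rho\<close>, against which
  \<open>c\<close> is orthogonal to \<open>cnjp e\<close>. So only the weight difference acts on
  \<open>c\<close>.\<close>

lemma error_bound:
 "\<exists>C>0. \<forall>eta n q. 0 \<le> eta \<and> eta < 1/4 \<and> eta \<le> nu/2 \<and> 1 \<le> n \<and>
  (\<forall>i\<ge>n. Polynomial.coeff (q - mp_poly (1/4 - eta) (1/4 + eta) n) i = 0) \<and>
  (\<forall>p. degree p < n \<longrightarrow> (\<integral>x. ww nu x * poly (q * p) (of_real x) \<partial>lborel) = 0) \<longrightarrow>
  (\<integral>x. om x * (cmod (poly (q - mp_poly (1/4 - eta) (1/4 + eta) n) (of_real x)))\<^sup>2 \<partial>lborel) \<le> C * approx_bound eta n"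
proof -
 obtain C1 where C1: "C1 > 0" "\<And>eta n. 0 \<le> eta \<and> eta < 1/4 \<and> eta \<le> nu/2 \<and> 1 \<le> n \<Longrightarrow>
  integrable lborel (\<lambda>x. DD nu eta x * (cmod (mp (1/4 - eta) (1/4 + eta) n (of_real x)))\<^sup>2) \<and>
  (\<integral>x. DD nu eta x * (cmod (mp (1/4 - eta) (1/4 + eta) n (of_real x)))\<^sup>2 \<partial>lborel) \<le> C1 * approx_bound eta n"
  using DD_bound by blast
 obtain C2 where C2: "C2 > 0" "\<And>x. x \<noteq> 0 \<Longrightarrow> om x \<le> C2 * KX nu x" using om_le_KX[OF nu] by blast
 define t where "t = cos (pi * nu / 2)"
 have t: "0 < t" using cos_pos by (simp add: t_def)
 show ?thesis
 proof (rule exI[of _ "C2 * (C1 / t\<^sup>2)"], rule conjI, use C1(1) C2(1) t in simp, intro allI impI)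
  fix eta :: real and n :: nat and q :: "complex poly"
  define c where "c = mp_poly (1/4 - eta) (1/4 + eta) n"
  define e where "e = q - c"
  assume A: "0 \<le> eta \<and> eta < 1/4 \<and> eta \<le> nu/2 \<and> 1 \<le> n \<and>
  (\<forall>i\<ge>n. Polynomial.coeff (q - mp_poly (1/4 - eta) (1/4 + eta) n) i = 0) \<and>
  (\<forall>p. degree p < n \<longrightarrow> (\<integral>x. ww nu x * poly (q * p) (of_real x) \<partial>lborel) = 0)"
  have dege: "degree e < n"
  proof -
   have "degree e \<le> n - 1" using A by (intro degree_le) (auto simp: e_def c_def)
   then show ?thesis using A by linarith
  qed
  define E where "E = (\<integral>x. KX nu x * (cmod (poly e (of_real x)))\<^sup>2 \<partial>lborel)"
  define F where "F = (\<integral>x. DD nu eta x * (cmod (poly c (of_real x)))\<^sup>2 \<partial>lborel)"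
  have F: "integrable lborel (\<lambda>x. DD nu eta x * (cmod (poly c (of_real x)))\<^sup>2)" "F \<le> C1 * approx_bound eta n"
   using C1(2)[of eta n] A by (auto simp: F_def c_def poly_mp_poly)
  let ?r = "\<lambda>x. rho (1/4 - eta) (1/4 + eta) (complex_of_real x)"
  let ?X = "\<lambda>x. ww nu x * poly (c * cnjp e) (of_real x) - of_real (C0 nu) * (?r x * poly (c * cnjp e) (of_real x))"
  have ri: "integrable lborel (\<lambda>x. ?r x * poly (c * cnjp e) (of_real x))" using A by (intro rho_poly_integrable) auto
  have Xi: "integrable lborel ?X" by (intro Bochner_Integration.integrable_diff integrable_mult_right ww_integrable nu ri)
  have "(\<integral>x. ww nu x * poly (e * cnjp e) (of_real x) \<partial>lborel) =
   (\<integral>x. ww nu x * poly (q * cnjp e) (of_real x) - ww nu x * poly (c * cnjp e) (of_real x) \<partial>lborel)"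
   by (simp add: e_def algebra_simps)
  also have "\<dots> = (\<integral>x. ww nu x * poly (q * cnjp e) (of_real x) \<partial>lborel) - (\<integral>x. ww nu x * poly (c * cnjp e) (of_real x) \<partial>lborel)"
   by (intro Bochner_Integration.integral_diff ww_integrable nu)
  also have "(\<integral>x. ww nu x * poly (q * cnjp e) (of_real x) \<partial>lborel) = 0" using A dege by (simp only: degree_cnjp)
  also have "(\<integral>x. ww nu x * poly (c * cnjp e) (of_real x) \<partial>lborel) = (\<integral>x. ?X x \<partial>lborel)"
  proof -
   have "(\<integral>x. ?r x * poly (c * cnjp e) (of_real x) \<partial>lborel) = 0"
    unfolding c_def using A dege by (intro mp_orthogonal) (auto simp: degree_cnjp)
   moreover have "(\<integral>x. ?X x \<partial>lborel) = (\<integral>x. ww nu x * poly (c * cnjp e) (of_real x) \<partial>lborel) - (\<integral>x. of_real (C0 nu) * (?r x * poly (c * cnjp e) (of_real x)) \<partial>lborel)"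
    by (intro Bochner_Integration.integral_diff ww_integrable nu integrable_mult_right ri)
   ultimately show ?thesis by simp
  qed
  finally have "(\<integral>x. ww nu x * poly (e * cnjp e) (of_real x) \<partial>lborel) = - (\<integral>x. ?X x \<partial>lborel)" by simp
  then have "t * E = Re (- (\<integral>x. ?X x \<partial>lborel))" using coercive[of e] unfolding t_def E_def by simp
  also have "\<dots> \<le> cmod (\<integral>x. ?X x \<partial>lborel)" using complex_Re_le_cmod[of "- (\<integral>x. ?X x \<partial>lborel)"] by (simp only: norm_minus_cancel)
  also have "\<dots> \<le> (\<integral>x. cmod (?X x) \<partial>lborel)" by (rule integral_norm_bound)
  \<comment> \<open>Young's inequality with weight \<open>t/2\<close>, so that half of the coercive
    term \<open>t * E\<close> absorbs the contribution of \<open>e\<close>.\<close>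
  also have "\<dots> \<le> (\<integral>x. t / 2 * (KX nu x * (cmod (poly e (of_real x)))\<^sup>2) + 1 / (2 * t) * (DD nu eta x * (cmod (poly c (of_real x)))\<^sup>2) \<partial>lborel)"
  proof (rule integral_mono_AE)
   show "integrable lborel (\<lambda>x. cmod (?X x))" by (intro integrable_norm Xi)
   show "integrable lborel (\<lambda>x. t / 2 * (KX nu x * (cmod (poly e (of_real x)))\<^sup>2) + 1 / (2 * t) * (DD nu eta x * (cmod (poly c (of_real x)))\<^sup>2))"
    by (intro Bochner_Integration.integrable_add integrable_mult_right KX_sq_integrable F)
   show "AE x in lborel. cmod (?X x) \<le> t / 2 * (KX nu x * (cmod (poly e (of_real x)))\<^sup>2) + 1 / (2 * t) * (DD nu eta x * (cmod (poly c (of_real x)))\<^sup>2)"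
    using AE_lborel_singleton[of "0::real"]
   proof eventually_elim
    case (elim x)
    define W where "W = cmod (ww nu x - of_real (C0 nu) * ?r x)"
    define k where "k = KX nu x"
    define A B where "A = cmod (poly e (of_real x))" and "B = cmod (poly c (of_real x))"
    have k: "0 < k" using KX_pos[OF nu elim] by (simp add: k_def)
    have "?X x = (ww nu x - of_real (C0 nu) * ?r x) * (poly c (of_real x) * cnj (poly e (of_real x)))"
     by (simp add: poly_cnjp algebra_simps)
    then have X: "cmod (?X x) = W * (B * A)" by (simp only: norm_mult complex_mod_cnj W_def A_def B_def)
    have "0 \<le> (t * k * A - W * B)\<^sup>2 / (2 * t * k)" using t k by simp
    also have "\<dots> = t / 2 * (k * A\<^sup>2) + 1 / (2 * t) * (W\<^sup>2 / k * B\<^sup>2) - W * (B * A)"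
     using t k by (simp add: power2_eq_square field_simps)
    finally show ?case unfolding X DD_def[OF nu] W_def[symmetric] k_def[symmetric] A_def[symmetric] B_def[symmetric] by simp
   qed
  qed
  also have "\<dots> = t / 2 * E + 1 / (2 * t) * F"
   using KX_sq_integrable[of e] F(1) unfolding E_def F_def by simp
  finally have "t * E \<le> t / 2 * E + 1 / (2 * t) * F" .
  then have "t * (t * E) \<le> t * (t / 2 * E + 1 / (2 * t) * F)" using t by (intro mult_left_mono) auto
  then have "E \<le> F / t\<^sup>2" using t by (simp add: pos_le_divide_eq distrib_left power2_eq_square mult_ac)
  also have "\<dots> \<le> C1 * approx_bound eta n / t\<^sup>2" using F(2) t by (intro divide_right_mono) auto
  finally have E: "E \<le> C1 * approx_bound eta n / t\<^sup>2" .
  have "(\<integral>x. om x * (cmod (poly e (of_real x)))\<^sup>2 \<partial>lborel) \<le> (\<integral>x. C2 * (KX nu x * (cmod (poly e (of_real x)))\<^sup>2) \<partial>lborel)"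
  proof (rule integral_mono_AE)
   show "integrable lborel (\<lambda>x. om x * (cmod (poly e (of_real x)))\<^sup>2)" by (rule om_sq_integrable)
   show "integrable lborel (\<lambda>x. C2 * (KX nu x * (cmod (poly e (of_real x)))\<^sup>2))" by (intro integrable_mult_right KX_sq_integrable)
   show "AE x in lborel. om x * (cmod (poly e (of_real x)))\<^sup>2 \<le> C2 * (KX nu x * (cmod (poly e (of_real x)))\<^sup>2)"
    using AE_lborel_singleton[of "0::real"]
   proof eventually_elim
    case (elim x)
    show ?case unfolding mult.assoc[symmetric] using C2(2)[OF elim] by (intro mult_right_mono) auto
   qed
  qed
  also have "\<dots> = C2 * E" by (simp add: E_def)
  also have "\<dots> \<le> C2 * (C1 / t\<^sup>2) * approx_bound eta n" using mult_left_mono[OF E, of C2] C2(1) by simp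
  finally show "(\<integral>x. om x * (cmod (poly (q - mp_poly (1/4 - eta) (1/4 + eta) n) (of_real x)))\<^sup>2 \<partial>lborel) \<le> C2 * (C1 / t\<^sup>2) * approx_bound eta n"
   unfolding e_def c_def .
 qed
qed

end

section \<open>Pointwise consequences of the WKB estimate on compact sets\<close>

lemma inverse_bounded:
 assumes K: "compact K" "K \<subseteq> slit_plane" and f: "continuous_on slit_disk f"
 shows "\<exists>B\<ge>0. \<forall>z\<in>K. cmod (f (1 / z)) \<le> B"
proof -
 have "compact ((\<lambda>z. 1 / z) ` K)"
  using K slit_plane_nonzero by (intro compact_continuous_image continuous_intros) auto
 moreover have "(\<lambda>z. 1 / z) ` K \<subseteq> slit_disk" using K slit_plane_inverse[of _ 1] by auto
 ultimately obtain B where "B \<ge> 0" "\<forall>p\<in>(\<lambda>z. 1 / z) ` K. cmod (f p) \<le> B" using bounded_on_compact[OF f] by blast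
 then show ?thesis by (intro exI[of _ B]) auto
qed

lemma Arcsin_cont: "continuous_on slit_disk Arcsin"
 by (intro continuous_at_imp_continuous_on ballI DERIV_isCont[OF Arcsin_deriv])

lemma exp_minus_one_bound: "cmod (exp w - 1) \<le> exp (cmod w) * cmod w"
proof -
 have "cmod (exp w - (\<Sum>k\<le>0. w ^ k / fact k)) \<le> exp \<bar>Re w\<bar> * cmod w ^ Suc 0 / fact 0" by (rule Taylor_exp)
 also have "\<dots> \<le> exp (cmod w) * cmod w" by (simp add: mult_right_mono abs_Re_le_cmod)
 finally show ?thesis by simp
qed

lemma mp_mono_ratio: "x \<noteq> 0 \<Longrightarrow> mp (1/4 - eta) (1/4 + eta) k x = mono_ratio eta x k * ((2 * x) ^ k / fact k)"
 by (simp add: mono_ratio_def)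

definition wkb_good :: "real \<Rightarrow> real \<Rightarrow> nat \<Rightarrow> complex \<Rightarrow> real \<Rightarrow> bool" where
 "wkb_good C r n z eta \<longleftrightarrow>
  (\<forall>k\<le>n. cmod (mono_ratio eta (of_nat n * z) k / wkb eta (of_nat n * z) k - 1) \<le> C / real n) \<and>
  (\<forall>k<n. real (Suc k) * cmod (wkb eta (of_nat n * z) k) \<le> r * cmod (2 * (of_nat n * z) * wkb eta (of_nat n * z) (Suc k)))"

lemma mp_wkb_good:
 assumes K: "compact K" "K \<subseteq> slit_plane"
 shows "\<exists>C N r. 0 < C \<and> 0 < r \<and> r < 1 \<and> N \<ge> 1 \<and> (\<forall>n\<ge>N. \<forall>z\<in>K. \<forall>eta. 0 \<le> eta \<and> eta \<le> 1 \<longrightarrow> wkb_good C r n z eta)"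
 unfolding wkb_good_def by (rule mp_wkb[OF K])

text \<open>Off the support the terms of the Christoffel sum grow geometrically up to the last one,
  so the sum is comparable to its top term divided by \<open>hh n\<close>, of order
  \<open>sqrt n\<close>. Replacing the symmetric polynomial by the one for \<open>eta\<close> costs
  at most \<open>exp B\<close>, since the two ansatz functions differ by the factor
  \<open>exp (i eta Arcsin (1/z))\<close>.\<close>

lemma kernel_ratio:
 assumes K: "compact K" "K \<subseteq> slit_plane"
 shows "\<exists>C N. 0 < C \<and> (\<forall>n\<ge>N. \<forall>z\<in>K. \<forall>eta. 0 \<le> eta \<and> eta \<le> 1 \<longrightarrow>
  mp (1/4 - eta) (1/4 + eta) n (of_nat n * z) \<noteq> 0 \<and>
  (\<Sum>k<n. (cmod (mp (1/4) (1/4) k (of_nat n * z)))\<^sup>2 / hh k) \<le> C * sqrt (real n) * (cmod (mp (1/4 - eta) (1/4 + eta) n (of_nat n * z)))\<^sup>2)"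
proof -
 obtain C N r where W: "0 < C" "0 < r" "r < 1" "N \<ge> (1::nat)" "\<And>n z eta. n \<ge> N \<Longrightarrow> z \<in> K \<Longrightarrow> 0 \<le> eta \<and> eta \<le> 1 \<Longrightarrow> wkb_good C r n z eta"
  using mp_wkb_good[OF K] by blast
 obtain B where B: "B \<ge> 0" "\<And>z. z \<in> K \<Longrightarrow> cmod (Arcsin (1 / z)) \<le> B" using inverse_bounded[OF K Arcsin_cont] by blast
 obtain N2 :: nat where N2: "2 * C \<le> real N2" using real_arch_simple by blast
 define D where "D = 8 * (2 * exp B)\<^sup>2 / (hh 0 * (1 - r))"
 have h0: "0 < hh 0" by (rule hh_bounds)
 have D: "0 < D" using W h0 by (simp add: D_def)
 show ?thesis
 proof (rule exI[of _ D], rule exI[of _ "max N N2"], intro conjI D allI impI ballI)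
  fix n z and eta :: real
  assume n: "max N N2 \<le> n" and z: "z \<in> K" and eta: "0 \<le> eta \<and> eta \<le> 1"
  define x where "x = of_nat n * z"
  have n1: "0 < n" "n \<ge> N" "2 * C \<le> real n" using n W(4) N2 by auto
  have z0: "z \<noteq> 0" using z K slit_plane_nonzero by auto
  have x0: "x \<noteq> 0" using z0 n1 by (simp add: x_def)
  have Cn: "C / real n \<le> 1/2" using n1 by (simp add: pos_divide_le_eq)
  have near: "cmod (wkb \<epsilon> x k) / 2 \<le> cmod (mono_ratio \<epsilon> x k)" "cmod (mono_ratio \<epsilon> x k) \<le> 2 * cmod (wkb \<epsilon> x k)"
   if e: "0 \<le> \<epsilon> \<and> \<epsilon> \<le> 1" and k: "k \<le> n" for \<epsilon> k
  proof -
   define R where "R = mono_ratio \<epsilon> x k / wkb \<epsilon> x k"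
   have R: "cmod (R - 1) \<le> 1/2"
   proof -
    have "cmod (R - 1) \<le> C / real n" using W(5)[OF n1(2) z e] k unfolding x_def[symmetric] R_def wkb_good_def by blast
    then show ?thesis using Cn by linarith
   qed
   have m: "mono_ratio \<epsilon> x k = R * wkb \<epsilon> x k" using wkb_nz[of \<epsilon> x k] by (simp add: R_def)
   have "1/2 \<le> cmod R" "cmod R \<le> 2" using R norm_triangle_ineq[of "R - 1" 1] norm_triangle_ineq[of R "1 - R"] norm_minus_commute[of R 1] by simp_all
   then show "cmod (wkb \<epsilon> x k) / 2 \<le> cmod (mono_ratio \<epsilon> x k)" "cmod (mono_ratio \<epsilon> x k) \<le> 2 * cmod (wkb \<epsilon> x k)"
    unfolding m norm_mult using mult_right_mono[of "1/2" "cmod R" "cmod (wkb \<epsilon> x k)"] mult_right_mono[of "cmod R" 2 "cmod (wkb \<epsilon> x k)"] by simp_all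
  qed
  define P where "P k = cmod (2 * x) ^ k / fact k" for k
  have P: "0 < P k" for k using x0 by (simp add: P_def)
  \<comment> \<open>\<open>u k\<close> is the ansatz for the symmetric polynomial in its own
    normalization, with the leading monomial restored; it is comparable to the polynomial within a
    factor \<open>2\<close>.\<close>
  define u where "u k = cmod (wkb 0 x k) * P k" for k
  have u0: "0 \<le> u k" for k using P[of k] by (simp add: u_def)
  have step: "u k \<le> r * u (Suc k)" if "k < n" for k
  proof -
   have "real (Suc k) * cmod (wkb 0 x k) \<le> r * cmod (2 * x * wkb 0 x (Suc k))"
    using W(5)[OF n1(2) z, of 0] that unfolding x_def[symmetric] wkb_good_def by simp
   then have "(real (Suc k) * cmod (wkb 0 x k)) * (cmod (2 * x) ^ k / fact (Suc k)) \<le> (r * cmod (2 * x * wkb 0 x (Suc k))) * (cmod (2 * x) ^ k / fact (Suc k))"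
    by (rule mult_right_mono) simp
   moreover have "(real (Suc k) * cmod (wkb 0 x k)) * (cmod (2 * x) ^ k / fact (Suc k)) = u k"
    using of_nat_neq_0[of k, where 'a = real] by (simp add: u_def P_def del: of_nat_Suc)
   moreover have "(r * cmod (2 * x * wkb 0 x (Suc k))) * (cmod (2 * x) ^ k / fact (Suc k)) = r * u (Suc k)"
    by (simp add: u_def P_def norm_mult del: of_nat_Suc fact_Suc)
   ultimately show ?thesis by simp
  qed
  have geo: "j \<le> n \<Longrightarrow> u (n - j) \<le> r ^ j * u n" for j
  proof (induction j)
   case (Suc j)
   have "u (n - Suc j) \<le> r * u (Suc (n - Suc j))" using Suc.prems by (intro step) auto
   also have "Suc (n - Suc j) = n - j" using Suc.prems by simp
   also have "r * u (n - j) \<le> r * (r ^ j * u n)" using Suc W by (intro mult_left_mono) auto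
   finally show ?case by simp
  qed simp
  have mp0: "cmod (mp (1/4) (1/4) k x) \<le> 2 * u k" if "k \<le> n" for k
   using near(2)[of 0 k] that mp_mono_ratio[OF x0, of 0 k] P[of k] mult_right_mono[of "cmod (mono_ratio 0 x k)" "2 * cmod (wkb 0 x k)" "P k"]
   by (simp add: u_def P_def norm_mult norm_divide norm_power mult.assoc)
  define m where "m = cmod (mp (1/4 - eta) (1/4 + eta) n x)"
  have un: "u n \<le> (2 * exp B) * m"
  proof -
   have q: "of_nat n / x = 1 / z" using n1 by (simp add: x_def)
   have "wkb 0 x n = wkb eta x n * exp (- (of_real eta * (\<i> * Arcsin (1 / z))))"
    unfolding wkb_def q exp_add[symmetric] AA_def by simp
   then have "cmod (wkb 0 x n) = cmod (wkb eta x n) * exp (Re (- (of_real eta * (\<i> * Arcsin (1 / z)))))" by (simp add: norm_mult)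
   also have "\<dots> \<le> cmod (wkb eta x n) * exp B"
   proof (intro mult_left_mono)
    have "Re (- (of_real eta * (\<i> * Arcsin (1 / z)))) \<le> cmod (- (of_real eta * (\<i> * Arcsin (1 / z))))" by (rule complex_Re_le_cmod)
    also have "\<dots> \<le> 1 * B" using eta B(2)[OF z] by (simp add: norm_mult) (use mult_mono[of "\<bar>eta\<bar>" 1 "cmod (Arcsin (1 / z))" B] in simp)
    finally show "exp (Re (- (of_real eta * (\<i> * Arcsin (1 / z))))) \<le> exp B" by simp
   qed simp
   also have "cmod (wkb eta x n) * exp B \<le> (2 * cmod (mono_ratio eta x n)) * exp B"
    using near(1)[OF eta, of n] by (intro mult_right_mono) auto
   finally have "u n \<le> (2 * cmod (mono_ratio eta x n)) * exp B * P n" unfolding u_def using P[of n] by (intro mult_right_mono) auto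
   also have "\<dots> = (2 * exp B) * m" unfolding m_def mp_mono_ratio[OF x0] by (simp add: P_def norm_mult norm_divide norm_power mult_ac)
   finally show ?thesis .
  qed
  have un_pos: "0 < u n" unfolding u_def using P[of n] wkb_nz[of 0 x n] by simp
  show "mp (1/4 - eta) (1/4 + eta) n (of_nat n * z) \<noteq> 0"
   using un un_pos unfolding m_def x_def[symmetric] by auto
  have "(\<Sum>k<n. (cmod (mp (1/4) (1/4) k x))\<^sup>2 / hh k) \<le> (\<Sum>k<n. (8 * sqrt (real n) / hh 0 * (u n)\<^sup>2) * r ^ (n - Suc k))"
  proof (rule sum_mono)
   fix k assume "k \<in> {..<n}"
   then have k: "k < n" by simp
   have "u k \<le> r ^ (n - k) * u n" using geo[of "n - k"] k by simp
   then have "cmod (mp (1/4) (1/4) k x) \<le> 2 * (r ^ (n - k) * u n)" using mp0[of k] k by linarith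
   then have "(cmod (mp (1/4) (1/4) k x))\<^sup>2 \<le> (2 * (r ^ (n - k) * u n))\<^sup>2" by (rule power_mono) simp
   also have "\<dots> = 4 * (u n)\<^sup>2 * (r ^ (n - k) * r ^ (n - k))" by (simp add: power2_eq_square)
   also have "\<dots> \<le> 4 * (u n)\<^sup>2 * (r ^ (n - Suc k) * 1)"
    using W by (intro mult_left_mono mult_mono power_decreasing power_le_one) auto
   finally have a: "(cmod (mp (1/4) (1/4) k x))\<^sup>2 \<le> 4 * (u n)\<^sup>2 * r ^ (n - Suc k)" by simp
   have b: "1 / hh k \<le> 2 * sqrt (real n) / hh 0"
   proof -
    have "hh 0 \<le> 2 * sqrt (real k + 1) * hh k" by (rule hh_bounds(3))
    also have "\<dots> \<le> 2 * sqrt (real n) * hh k" using k hh_bounds(1)[of k] by (intro mult_right_mono mult_left_mono) auto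
    finally show ?thesis using h0 hh_bounds(1)[of k] by (simp add: divide_simps mult.commute)
   qed
   have "(cmod (mp (1/4) (1/4) k x))\<^sup>2 * (1 / hh k) \<le> (4 * (u n)\<^sup>2 * r ^ (n - Suc k)) * (2 * sqrt (real n) / hh 0)"
    using a b hh_bounds(1)[of k] W by (intro mult_mono) auto
   then show "(cmod (mp (1/4) (1/4) k x))\<^sup>2 / hh k \<le> (8 * sqrt (real n) / hh 0 * (u n)\<^sup>2) * r ^ (n - Suc k)" by (simp add: mult_ac)
  qed
  also have "\<dots> = (8 * sqrt (real n) / hh 0 * (u n)\<^sup>2) * (\<Sum>k<n. r ^ k)"
   unfolding sum_distrib_left[symmetric] using sum.nat_diff_reindex[of "\<lambda>k. r ^ k" n] by simp
  also have "\<dots> \<le> (8 * sqrt (real n) / hh 0 * ((2 * exp B) * m)\<^sup>2) * (1 / (1 - r))"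
  proof (intro mult_mono mult_left_mono power_mono un u0)
   have "(\<Sum>k<n. r ^ k) = (1 - r ^ n) / (1 - r)" using W sum_gp_strict[of r n] by simp
   then show "(\<Sum>k<n. r ^ k) \<le> 1 / (1 - r)" using W by (simp add: divide_right_mono)
  qed (use h0 W in \<open>auto intro!: sum_nonneg mult_nonneg_nonneg divide_nonneg_nonneg\<close>)
  also have "\<dots> = D * sqrt (real n) * m\<^sup>2" by (simp add: D_def power_mult_distrib)
  finally show "(\<Sum>k<n. (cmod (mp (1/4) (1/4) k (of_nat n * z)))\<^sup>2 / hh k) \<le> D * sqrt (real n) * (cmod (mp (1/4 - eta) (1/4 + eta) n (of_nat n * z)))\<^sup>2"
   unfolding m_def x_def .
 qed
qed

text \<open>The ansatz at parameter \<open>eta\<close> differs from the target at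
  \<open>nu/2\<close> by \<open>exp (- i (nu/2 - eta) Arcsin (1/z))\<close>. This is the source of
  the term \<open>nu/2 - eta\<close> beside the WKB error \<open>1/n\<close>.\<close>

lemma mp_leading:
 assumes K: "compact K" "K \<subseteq> slit_plane"
 shows "\<exists>C N. 0 < C \<and> (\<forall>n\<ge>N. \<forall>z\<in>K. \<forall>eta. 0 \<le> eta \<and> eta \<le> 1 \<and> eta \<le> nu/2 \<and> nu \<le> 2 \<longrightarrow>
  (\<exists>\<delta>. fact n / (2 * of_nat n) ^ n * mp (1/4 - eta) (1/4 + eta) n (of_nat n * z) = leading_term nu n z * (1 + \<delta>) \<and>
   cmod \<delta> \<le> C * (1 / real n + (nu/2 - eta)) \<and> cmod (1 + \<delta>) \<le> C))"
proof -
 obtain C N r where W: "0 < C" "0 < r" "r < 1" "N \<ge> (1::nat)" "\<And>n z eta. n \<ge> N \<Longrightarrow> z \<in> K \<Longrightarrow> 0 \<le> eta \<and> eta \<le> 1 \<Longrightarrow> wkb_good C r n z eta"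
  using mp_wkb_good[OF K] by blast
 obtain B where B: "B \<ge> 0" "\<And>z. z \<in> K \<Longrightarrow> cmod (Arcsin (1 / z)) \<le> B" using inverse_bounded[OF K Arcsin_cont] by blast
 define G where "G = exp B * B"
 have G: "0 \<le> G" using B by (simp add: G_def)
 define D where "D = C * (1 + G) + G + 1 + G + C * (1 + G)"
 have D: "0 < D" using W G by (simp add: D_def add_pos_nonneg)
 show ?thesis
 proof (rule exI[of _ D], rule exI[of _ N], intro conjI D allI impI ballI)
  fix n z and eta :: real
  assume n: "N \<le> n" and z: "z \<in> K" and A: "0 \<le> eta \<and> eta \<le> 1 \<and> eta \<le> nu/2 \<and> nu \<le> 2"
  define x where "x = of_nat n * z"
  define \<theta> where "\<theta> = nu/2 - eta"
  have \<theta>: "0 \<le> \<theta>" "\<theta> \<le> 1" using A by (auto simp: \<theta>_def)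
  have n1: "0 < n" using n W by simp
  have zs: "z \<in> slit_plane" using z K by auto
  have z0: "z \<noteq> 0" using slit_plane_nonzero[OF zs] .
  have x0: "x \<noteq> 0" using z0 n1 by (simp add: x_def)
  define d1 where "d1 = mono_ratio eta x n / wkb eta x n - 1"
  have d1: "cmod d1 \<le> C / real n" using W(5)[OF n z, of eta] A unfolding x_def[symmetric] d1_def wkb_good_def by simp
  define w where "w = - (of_real \<theta> * (\<i> * Arcsin (1 / z)))"
  have w: "cmod w \<le> \<theta> * B" unfolding w_def using B(2)[OF z] \<theta> by (simp add: norm_mult mult_left_mono)
  have w1: "cmod w \<le> B" using w \<theta> B(1) mult_left_le_one_le[of B \<theta>] by linarith
  define d2 where "d2 = exp w - 1"
  have d2: "cmod d2 \<le> G * \<theta>"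
  proof -
   have "cmod d2 \<le> exp (cmod w) * cmod w" unfolding d2_def by (rule exp_minus_one_bound)
   also have "\<dots> \<le> exp B * (\<theta> * B)" using w w1 by (intro mult_mono) auto
   finally show ?thesis by (simp add: G_def mult_ac)
  qed
  define \<delta> where "\<delta> = d1 * (1 + d2) + d2"
  have 1: "1 + \<delta> = (1 + d1) * exp w" by (simp add: \<delta>_def d2_def algebra_simps)
  have "fact n / (2 * of_nat n) ^ n * mp (1/4 - eta) (1/4 + eta) n x = z ^ n * mono_ratio eta x n"
  proof -
   have "(2 * x) ^ n = (2 * of_nat n) ^ n * z ^ n" by (simp add: x_def power_mult_distrib mult_ac)
   then show ?thesis unfolding mp_mono_ratio[OF x0] using n1 by simp
  qed
  also have "mono_ratio eta x n = wkb eta x n * (1 + d1)" using wkb_nz[of eta x n] by (simp add: d1_def)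
  also have "wkb eta x n = exp (of_nat n * z * LL (1 / z) + AA (nu / 2) (1 / z)) * exp w"
  proof -
   have q: "of_nat n / x = 1 / z" using n1 by (simp add: x_def)
   show ?thesis unfolding wkb_def q exp_add[symmetric] AA_def w_def \<theta>_def by (rule arg_cong[where f = exp]) (simp add: x_def algebra_simps)
  qed
  also have "z ^ n * (exp (of_nat n * z * LL (1 / z) + AA (nu / 2) (1 / z)) * exp w * (1 + d1)) = leading_term nu n z * (1 + \<delta>)"
   unfolding leading_term_eq[OF zs] 1 by (simp only: mult_ac)
  finally have eq: "fact n / (2 * of_nat n) ^ n * mp (1/4 - eta) (1/4 + eta) n (of_nat n * z) = leading_term nu n z * (1 + \<delta>)"
   unfolding x_def .
  have G1: "cmod (1 + d2) \<le> 1 + G"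
   using norm_triangle_ineq[of 1 d2] d2 mult_left_le[of \<theta> G] \<theta> G by simp
  have dl: "cmod \<delta> \<le> C / real n * (1 + G) + G * \<theta>"
  proof -
   have "cmod \<delta> \<le> cmod d1 * cmod (1 + d2) + cmod d2" unfolding \<delta>_def norm_mult[symmetric] by (rule norm_triangle_ineq)
   moreover have "cmod d1 * cmod (1 + d2) \<le> C / real n * (1 + G)" using d1 G1 W by (intro mult_mono) auto
   ultimately show ?thesis using d2 by linarith
  qed
  have "cmod \<delta> \<le> D * (1 / real n + \<theta>)"
  proof -
   have "C / real n * (1 + G) + G * \<theta> = (C * (1 + G)) * (1 / real n) + G * \<theta>" by simp
   also have "\<dots> \<le> D * (1 / real n) + D * \<theta>" using W G \<theta> by (intro add_mono mult_right_mono) (auto simp: D_def)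
   finally show ?thesis using dl by (simp add: distrib_left)
  qed
  moreover have "cmod (1 + \<delta>) \<le> D"
  proof -
   have "C / real n * (1 + G) \<le> C * (1 + G)" using W G n1 by (intro mult_right_mono) (auto simp: pos_divide_le_eq mult_le_cancel_left1)
   moreover have "G * \<theta> \<le> G" using mult_left_le[of \<theta> G] \<theta> G by simp
   moreover have "0 \<le> C * (1 + G)" using W G by simp
   ultimately show ?thesis using norm_triangle_ineq[of 1 \<delta>] dl G by (simp add: D_def)
  qed
  ultimately show "\<exists>\<delta>. fact n / (2 * of_nat n) ^ n * mp (1/4 - eta) (1/4 + eta) n (of_nat n * z) = leading_term nu n z * (1 + \<delta>) \<and>
   cmod \<delta> \<le> D * (1 / real n + (nu/2 - eta)) \<and> cmod (1 + \<delta>) \<le> D"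
   using eq unfolding \<theta>_def by blast
 qed
qed

section \<open>Regularized Bessel moments\<close>
text \<open>Taylor coefficients of the entire function \<open>x^(- nu) J_nu(x)\<close>, generated
  from Bessel's equation so that \<open>bh_ode\<close> holds coefficientwise; \<open>hc_even\<close>
  recovers the usual series.\<close>

fun hc :: "real \<Rightarrow> nat \<Rightarrow> real" where
 "hc nu 0 = 2 powr (- nu) / Gamma (nu + 1)"
| "hc nu (Suc 0) = 0"
| "hc nu (Suc (Suc n)) = - hc nu n / ((real n + 2) * (real n + 2 + 2 * nu))"

definition bh :: "real \<Rightarrow> real \<Rightarrow> real" where "bh nu x = (\<Sum>n. hc nu n * x ^ n)"
definition bh' :: "real \<Rightarrow> real \<Rightarrow> real" where "bh' nu x = (\<Sum>n. diffs (hc nu) n * x ^ n)"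
definition bh'' :: "real \<Rightarrow> real \<Rightarrow> real" where "bh'' nu x = (\<Sum>n. diffs (diffs (hc nu)) n * x ^ n)"
definition Lap :: "(real \<Rightarrow> real) \<Rightarrow> real \<Rightarrow> real \<Rightarrow> real" where
 "Lap g p s = (\<integral>x. indicator {0<..} x * (x powr p * g x * exp (- (s * x))) \<partial>lborel)"

lemma Lap_integrable:
 assumes p: "-1 < p" and s: "0 < s" and g: "continuous_on UNIV g" "\<And>x. 0 < x \<Longrightarrow> \<bar>g x\<bar> \<le> B"
 shows "integrable lborel (\<lambda>x. indicator {0<..} x * (x powr p * g x * exp (- (s * x))))"
  "\<bar>Lap g p s\<bar> \<le> B * (Gamma (p + 1) / s powr (p + 1))"
proof -
 have ps: "0 < p + 1" using p by simp
 note G = Gamma_scaled[OF ps s, simplified]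
 let ?f = "\<lambda>x. indicator {0<..} x * (x powr p * g x * exp (- (s * x)))"
 let ?d = "\<lambda>x. B * (indicator {0<..} x * (x powr p * exp (- (s * x))))"
 have B: "0 \<le> B" using g(2)[of 1] by simp
 have le: "norm (?f x) \<le> ?d x" for x
 proof (cases "0 < x")
  case True
  have "\<bar>g x\<bar> * (x powr p * exp (- (s * x))) \<le> B * (x powr p * exp (- (s * x)))" using g(2)[OF True] by (intro mult_right_mono) auto
  then show ?thesis using True by (simp add: abs_mult mult_ac)
 qed simp
 have d: "integrable lborel ?d" by (intro integrable_mult_right G)
 have [measurable]: "g \<in> borel_measurable borel" using g(1) by (rule borel_measurable_continuous_onI)
 show I: "integrable lborel ?f"
 proof (rule Bochner_Integration.integrable_bound[OF d])
  show "AE x in lborel. norm (?f x) \<le> norm (?d x)"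
   using le order_trans[OF le abs_ge_self] by (intro AE_I2) simp
 qed measurable
 have "\<bar>Lap g p s\<bar> \<le> (\<integral>x. norm (?f x) \<partial>lborel)" using integral_norm_bound[of lborel ?f] by (simp add: Lap_def)
 also have "\<dots> \<le> (\<integral>x. ?d x \<partial>lborel)" using le by (intro integral_mono integrable_norm I d) auto
 also have "\<dots> = B * (Gamma (p + 1) / s powr (p + 1))" using G(2) by simp
 finally show "\<bar>Lap g p s\<bar> \<le> B * (Gamma (p + 1) / s powr (p + 1))" .
qed

lemma real_exp_second_order: "\<bar>exp r - 1 - r\<bar> \<le> exp \<bar>r\<bar> * r\<^sup>2" for r :: real
proof -
 have a: "cmod (exp (of_real r) - (\<Sum>k\<le>1. of_real r ^ k / fact k)) \<le> exp \<bar>Re (of_real r)\<bar> * cmod (of_real r) ^ Suc 1 / fact 1"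
  by (rule Taylor_exp)
 have b: "exp (of_real r) - (\<Sum>k\<le>1. complex_of_real r ^ k / fact k) = of_real (exp r - 1 - r)"
  by (simp add: exp_of_real)
 show ?thesis using a unfolding b norm_of_real by (simp add: power2_eq_square)
qed

text \<open>The second-order remainder of the exponential is integrated against the halved damping
  rate \<open>s/2\<close>, which is admissible for increments up to \<open>s/2\<close>.\<close>

lemma Lap_deriv:
 assumes p: "-1 < p" and s: "0 < s" and g: "continuous_on UNIV g" "\<And>x. 0 < x \<Longrightarrow> \<bar>g x\<bar> \<le> B"
 shows "(Lap g p has_real_derivative - Lap g (p + 1) s) (at s)"
proof -
 define C where "C = B * (Gamma (p + 2 + 1) / (s / 2) powr (p + 2 + 1))"
 have B: "0 \<le> B" using g(2)[of 1] by simp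
 have bd: "\<bar>(Lap g p (s + \<delta>) - Lap g p s) / \<delta> - (- Lap g (p + 1) s)\<bar> \<le> C * \<bar>\<delta>\<bar>" if d: "\<delta> \<noteq> 0" "\<bar>\<delta>\<bar> \<le> s / 2" for \<delta>
 proof -
  let ?k = "\<lambda>x. indicator {0<..} x * (x powr (p + 2) * exp (- (s / 2 * x)))"
  let ?i = "\<lambda>p s x. indicator {0<..} x * (x powr p * g x * exp (- (s * x)))"
  have ps: "0 < p + 2 + 1" "0 < s / 2" using p s by auto
  have G: "integrable lborel ?k" "integral\<^sup>L lborel ?k = Gamma (p + 2 + 1) / (s / 2) powr (p + 2 + 1)"
  proof -
   have e: "p + 2 + 1 - 1 = p + 2" by simp
   show "integrable lborel ?k" "integral\<^sup>L lborel ?k = Gamma (p + 2 + 1) / (s / 2) powr (p + 2 + 1)"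
    using Gamma_scaled[OF ps] unfolding e by simp_all
  qed
  have i1: "integrable lborel (?i p (s + \<delta>))" using d s by (intro Lap_integrable(1)[OF p _ g]) auto
  have i2: "integrable lborel (?i p s)" by (rule Lap_integrable(1)[OF p s g])
  have i3: "integrable lborel (?i (p + 1) s)" using p by (intro Lap_integrable(1)[OF _ s g]) auto
  have E: "Lap g p (s + \<delta>) - Lap g p s + \<delta> * Lap g (p + 1) s = (\<integral>x. ?i p (s + \<delta>) x - ?i p s x + \<delta> * ?i (p + 1) s x \<partial>lborel)"
   using i1 i2 i3 by (simp add: Lap_def)
  have le: "norm (?i p (s + \<delta>) x - ?i p s x + \<delta> * ?i (p + 1) s x) \<le> B * \<delta>\<^sup>2 * ?k x" for x
  proof (cases "0 < x")
   case True
   have e: "exp (- ((s + \<delta>) * x)) = exp (- (s * x)) * exp (- (\<delta> * x))" by (simp add: exp_add[symmetric] algebra_simps)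
   have "?i p (s + \<delta>) x - ?i p s x + \<delta> * ?i (p + 1) s x = (x powr p * g x * exp (- (s * x))) * (exp (- (\<delta> * x)) - 1 - (- (\<delta> * x)))"
    unfolding e using True by (simp add: powr_add algebra_simps)
   then have "norm (?i p (s + \<delta>) x - ?i p s x + \<delta> * ?i (p + 1) s x) = (x powr p * \<bar>g x\<bar> * exp (- (s * x))) * \<bar>exp (- (\<delta> * x)) - 1 - (- (\<delta> * x))\<bar>"
    by (simp only: real_norm_def abs_mult abs_exp_cancel powr_ge_zero abs_of_nonneg)
   also have "\<dots> \<le> (x powr p * B * exp (- (s * x))) * (exp (s / 2 * x) * (\<delta> * x)\<^sup>2)"
   proof (intro mult_mono mult_left_mono g(2) True)
    have "\<bar>exp (- (\<delta> * x)) - 1 - (- (\<delta> * x))\<bar> \<le> exp \<bar>- (\<delta> * x)\<bar> * (- (\<delta> * x))\<^sup>2" by (rule real_exp_second_order)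
    also have "\<dots> \<le> exp (s / 2 * x) * (\<delta> * x)\<^sup>2"
     using d True by (intro mult_mono) (auto simp: abs_mult intro!: mult_right_mono)
    finally show "\<bar>exp (- (\<delta> * x)) - 1 - (- (\<delta> * x))\<bar> \<le> exp (s / 2 * x) * (\<delta> * x)\<^sup>2" .
   qed (use B in auto)
   also have "\<dots> = B * \<delta>\<^sup>2 * ?k x"
   proof -
    have "exp (- (s * x)) * exp (s / 2 * x) = exp (- (s / 2 * x))" by (simp add: exp_add[symmetric])
    moreover have "x powr (p + 2) = x powr p * x\<^sup>2" using True by (simp add: powr_add powr_numeral)
    moreover have "(x powr p * B * exp (- (s * x))) * (exp (s / 2 * x) * (\<delta> * x)\<^sup>2) = B * \<delta>\<^sup>2 * ((x powr p * x\<^sup>2) * (exp (- (s * x)) * exp (s / 2 * x)))"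
     by (simp only: power_mult_distrib mult_ac)
    ultimately show ?thesis using True by (simp only:) simp
   qed
   finally show ?thesis .
  qed simp
  have "\<bar>Lap g p (s + \<delta>) - Lap g p s + \<delta> * Lap g (p + 1) s\<bar> \<le> (\<integral>x. norm (?i p (s + \<delta>) x - ?i p s x + \<delta> * ?i (p + 1) s x) \<partial>lborel)"
   unfolding E real_norm_def[symmetric] by (rule integral_norm_bound)
  also have "\<dots> \<le> (\<integral>x. B * \<delta>\<^sup>2 * ?k x \<partial>lborel)"
   by (intro integral_mono le integrable_norm integrable_mult_right G) (intro Bochner_Integration.integrable_add Bochner_Integration.integrable_diff integrable_mult_right i1 i2 i3)
  also have "\<dots> = C * \<delta>\<^sup>2" using G(2) by (simp add: C_def)
  finally have b: "\<bar>Lap g p (s + \<delta>) - Lap g p s + \<delta> * Lap g (p + 1) s\<bar> \<le> C * \<delta>\<^sup>2" .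
  have "(Lap g p (s + \<delta>) - Lap g p s) / \<delta> - (- Lap g (p + 1) s) = (Lap g p (s + \<delta>) - Lap g p s + \<delta> * Lap g (p + 1) s) / \<delta>"
   using d by (simp add: add_divide_distrib)
  then have "\<bar>(Lap g p (s + \<delta>) - Lap g p s) / \<delta> - (- Lap g (p + 1) s)\<bar> \<le> C * \<delta>\<^sup>2 / \<bar>\<delta>\<bar>"
   using b by (simp add: divide_right_mono)
  also have "\<dots> = C * \<bar>\<delta>\<bar>" using d by (simp add: power2_eq_square abs_if)
  finally show ?thesis .
 qed
 show ?thesis unfolding DERIV_def
 proof (rule LIM_zero_cancel, rule Lim_null_comparison[where g = "\<lambda>\<delta>. C * \<bar>\<delta>\<bar>"])
  have "\<forall>\<^sub>F \<delta> in at 0. \<bar>\<delta>\<bar> < s / 2 \<and> \<delta> \<noteq> 0" using s by (auto simp: eventually_at intro!: exI[of _ "s / 2"])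
  then show "\<forall>\<^sub>F \<delta> in at 0. norm ((Lap g p (s + \<delta>) - Lap g p s) / \<delta> - (- Lap g (p + 1) s)) \<le> C * \<bar>\<delta>\<bar>"
  proof eventually_elim
   case (elim \<delta>)
   then show ?case using bd[of \<delta>] by simp
  qed
  have "((\<lambda>\<delta>. C * \<bar>\<delta>\<bar>) \<longlongrightarrow> C * \<bar>0\<bar>) (at 0)" by (intro tendsto_intros)
  then show "((\<lambda>\<delta>. C * \<bar>\<delta>\<bar>) \<longlongrightarrow> 0) (at 0)" by simp
 qed
qed

context
 fixes nu :: real assumes nu: "0 < nu" "nu \<le> 1/2"
begin

lemma hc0: "0 < hc nu 0" using nu by (simp add: Gamma_real_pos)

lemma hc_bound: "\<bar>hc nu n\<bar> \<le> hc nu 0 / fact n"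
proof (induction n rule: induct_nat_012)
 show "\<bar>hc nu 0\<bar> \<le> hc nu 0 / fact 0" using hc0 by simp
 show "\<bar>hc nu (Suc 0)\<bar> \<le> hc nu 0 / fact (Suc 0)" using hc0 by simp
next
 fix n assume IH: "\<bar>hc nu n\<bar> \<le> hc nu 0 / fact n" and "\<bar>hc nu (Suc n)\<bar> \<le> hc nu 0 / fact (Suc n)"
 have "\<bar>hc nu (Suc (Suc n))\<bar> = \<bar>hc nu n\<bar> / ((real n + 2) * (real n + 2 + 2 * nu))"
  using nu by (simp add: abs_mult)
 also have "\<dots> \<le> (hc nu 0 / fact n) / ((real n + 2) * (real n + 1))"
  using nu IH hc0 by (intro frac_le mult_left_mono) auto
 also have "\<dots> = hc nu 0 / fact (Suc (Suc n))" by (simp add: algebra_simps)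
 finally show "\<bar>hc nu (Suc (Suc n))\<bar> \<le> hc nu 0 / fact (Suc (Suc n))" .
qed

lemma hc_summable: "summable (\<lambda>n. hc nu n * x ^ n)"
proof (rule summable_comparison_test')
 show "summable (\<lambda>n. hc nu 0 * (inverse (fact n) * \<bar>x\<bar> ^ n))" by (intro summable_mult summable_exp)
 show "norm (hc nu n * x ^ n) \<le> hc nu 0 * (inverse (fact n) * \<bar>x\<bar> ^ n)" if "n \<ge> 0" for n
  using mult_right_mono[OF hc_bound[of n], of "\<bar>x\<bar> ^ n"] by (simp add: abs_mult power_abs divide_inverse)
qed

lemma hc'_summable: "summable (\<lambda>n. diffs (hc nu) n * x ^ n)"
 by (rule termdiff_converges_all) (rule hc_summable)

lemma hc''_summable: "summable (\<lambda>n. diffs (diffs (hc nu)) n * x ^ n)"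
 by (rule termdiff_converges_all) (rule hc'_summable)

lemma bh_deriv: "(bh nu has_real_derivative bh' nu x) (at x)" "(bh' nu has_real_derivative bh'' nu x) (at x)"
 unfolding bh_def[abs_def] bh'_def[abs_def] bh''_def
 by (intro termdiffs_strong_converges_everywhere hc_summable hc'_summable)+

lemma bh_cont: "continuous_on UNIV (bh nu)" "continuous_on UNIV (bh' nu)"
 by (auto intro!: continuous_at_imp_continuous_on DERIV_isCont bh_deriv)

lemma bh_ode: "x * bh'' nu x + (2 * nu + 1) * bh' nu x + x * bh nu x = 0"
proof -
 have a: "(\<lambda>n. x * (diffs (diffs (hc nu)) n * x ^ n)) sums (x * bh'' nu x)"
  unfolding bh''_def by (intro sums_mult summable_sums hc''_summable)
 have b: "(\<lambda>n. (2 * nu + 1) * (diffs (hc nu) (Suc n) * x ^ Suc n)) sums ((2 * nu + 1) * bh' nu x)"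
 proof -
  have "(\<lambda>n. diffs (hc nu) (Suc n) * x ^ Suc n) sums (bh' nu x - diffs (hc nu) 0 * x ^ 0)"
   by (rule sums_Suc_iff[THEN iffD2, of "\<lambda>n. diffs (hc nu) n * x ^ n"]) (simp add: bh'_def summable_sums[OF hc'_summable])
  then show ?thesis by (intro sums_mult) (simp add: diffs_def)
 qed
 have c: "(\<lambda>n. x * (hc nu n * x ^ n)) sums (x * bh nu x)"
  unfolding bh_def by (intro sums_mult summable_sums hc_summable)
 have "(\<lambda>n. x * (diffs (diffs (hc nu)) n * x ^ n) + (2 * nu + 1) * (diffs (hc nu) (Suc n) * x ^ Suc n) + x * (hc nu n * x ^ n)) sums
  (x * bh'' nu x + (2 * nu + 1) * bh' nu x + x * bh nu x)"
  by (intro sums_add a b c)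
 moreover have "x * (diffs (diffs (hc nu)) n * x ^ n) + (2 * nu + 1) * (diffs (hc nu) (Suc n) * x ^ Suc n) + x * (hc nu n * x ^ n) = 0" for n
 proof -
  define t where "t = (real n + 2) * (real n + 2 + 2 * nu)"
  have t: "t \<noteq> 0" using nu by (simp add: t_def)
  have "t * hc nu (Suc (Suc n)) = - hc nu n" unfolding hc.simps t_def[symmetric] using t by simp
  moreover have "x * (diffs (diffs (hc nu)) n * x ^ n) + (2 * nu + 1) * (diffs (hc nu) (Suc n) * x ^ Suc n) + x * (hc nu n * x ^ n)
   = (t * hc nu (Suc (Suc n)) + hc nu n) * x ^ Suc n"
   unfolding diffs_def t_def by (simp add: algebra_simps del: hc.simps)
  ultimately show ?thesis by simp
 qed
 ultimately have "(\<lambda>n. 0) sums (x * bh'' nu x + (2 * nu + 1) * bh' nu x + x * bh nu x)" by simp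
 then show ?thesis using sums_unique2[OF _ sums_zero] by blast
qed

lemma bh_0: "bh nu 0 = hc nu 0" "bh' nu 0 = 0"
 unfolding bh_def bh'_def powser_zero by (simp_all add: diffs_def)

text \<open>The energy \<open>bh^2 + bh'^2\<close> decreases on the half-line: by
  \<open>bh_ode\<close> its derivative is \<open>- 2 (2 nu + 1) bh'^2 / x\<close>. At
  \<open>0\<close> it equals the square of \<open>hc nu 0\<close>.\<close>

lemma bh_bound: "0 < x \<Longrightarrow> \<bar>bh nu x\<bar> \<le> hc nu 0" "0 < x \<Longrightarrow> \<bar>bh' nu x\<bar> \<le> hc nu 0"
proof -
 assume x: "0 < x"
 let ?E = "\<lambda>x. (bh nu x)\<^sup>2 + (bh' nu x)\<^sup>2"
 have "?E x \<le> ?E 0"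
 proof (rule DERIV_nonpos_imp_decreasing_open[OF less_imp_le[OF x]])
  fix y assume y: "0 < y" "y < x"
  have d: "(?E has_real_derivative (of_nat 2 * (bh' nu y * bh nu y ^ (2 - Suc 0)) + of_nat 2 * (bh'' nu y * bh' nu y ^ (2 - Suc 0)))) (at y)"
   by (intro DERIV_add DERIV_power bh_deriv)
  have "y * (of_nat 2 * (bh' nu y * bh nu y ^ (2 - Suc 0)) + of_nat 2 * (bh'' nu y * bh' nu y ^ (2 - Suc 0))) = 2 * bh' nu y * (y * bh'' nu y + y * bh nu y)"
   by (simp add: algebra_simps)
  also have "y * bh'' nu y + y * bh nu y = - (2 * nu + 1) * bh' nu y" using bh_ode[of y] by (simp add: algebra_simps)
  also have "2 * bh' nu y * (- (2 * nu + 1) * bh' nu y) = - (2 * (2 * nu + 1)) * (bh' nu y)\<^sup>2" by (simp add: power2_eq_square)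
  also have "\<dots> \<le> 0" using nu by (intro mult_nonpos_nonneg) auto
  finally have "of_nat 2 * (bh' nu y * bh nu y ^ (2 - Suc 0)) + of_nat 2 * (bh'' nu y * bh' nu y ^ (2 - Suc 0)) \<le> 0" using y by (simp only: mult_le_0_iff) auto
  with d show "\<exists>z. (?E has_real_derivative z) (at y) \<and> z \<le> 0" by blast
 next
  show "continuous_on {0..x} ?E" by (intro continuous_intros continuous_on_subset[OF bh_cont(1)] continuous_on_subset[OF bh_cont(2)]) auto
 qed
 then have E: "?E x \<le> (hc nu 0)\<^sup>2" by (simp only: bh_0) simp
 have "\<bar>bh nu x\<bar>\<^sup>2 \<le> (hc nu 0)\<^sup>2" unfolding power2_abs using E zero_le_power2[of "bh' nu x"] by linarith
 then show "\<bar>bh nu x\<bar> \<le> hc nu 0" using hc0 by (elim power2_le_imp_le) simp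
 have "\<bar>bh' nu x\<bar>\<^sup>2 \<le> (hc nu 0)\<^sup>2" unfolding power2_abs using E zero_le_power2[of "bh nu x"] by linarith
 then show "\<bar>bh' nu x\<bar> \<le> hc nu 0" using hc0 by (elim power2_le_imp_le) simp
qed

lemma hc_even: "hc nu (2 * k) = (-1) ^ k / (fact k * Gamma (real k + nu + 1)) * (2 powr (- nu) / 4 ^ k)"
proof (induction k)
 case (Suc k)
 have G: "Gamma (real (Suc k) + nu + 1) = (real k + nu + 1) * Gamma (real k + nu + 1)"
 proof -
  have "real k + nu + 1 \<notin> \<int>\<^sub>\<le>\<^sub>0" using nonpos_Ints_nonpos[of "real k + nu + 1"] nu by auto
  from Gamma_plus1[OF this] show ?thesis by (simp add: add_ac)
 qed
 have "hc nu (2 * Suc k) = - hc nu (2 * k) / ((real (2 * k) + 2) * (real (2 * k) + 2 + 2 * nu))" by simp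
 also have "(real (2 * k) + 2) * (real (2 * k) + 2 + 2 * nu) = 4 * (real (Suc k) * (real k + nu + 1))" by (simp add: algebra_simps)
 also have "- hc nu (2 * k) / (4 * (real (Suc k) * (real k + nu + 1))) = (-1) ^ Suc k / (fact (Suc k) * Gamma (real (Suc k) + nu + 1)) * (2 powr (- nu) / 4 ^ Suc k)"
  unfolding Suc G fact_Suc by (simp add: mult_ac del: of_nat_Suc)
 finally show ?case .
qed simp

lemma bessel_J_bh: assumes x: "0 < x" shows "bessel_J nu x = x powr nu * bh nu x"
proof -
 have odd: "hc nu n = 0" if "odd n" for n
  using that by (induction n rule: induct_nat_012) auto
 have "(\<lambda>k. hc nu (2 * k) * x ^ (2 * k)) sums bh nu x"
 proof (subst sums_mono_reindex[of "\<lambda>k. 2 * k" "\<lambda>n. hc nu n * x ^ n"])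
  show "strict_mono ((*) (2::nat))" by (auto simp: strict_mono_def)
  show "hc nu n * x ^ n = 0" if "n \<notin> range ((*) 2)" for n
   using that odd[of n] by (cases "even n") (auto elim!: evenE)
  show "(\<lambda>n. hc nu n * x ^ n) sums bh nu x" unfolding bh_def by (rule summable_sums[OF hc_summable])
 qed
 then have "(\<lambda>k. x powr nu * (hc nu (2 * k) * x ^ (2 * k))) sums (x powr nu * bh nu x)" by (rule sums_mult)
 moreover have "x powr nu * (hc nu (2 * k) * x ^ (2 * k)) = (-1) ^ k / (fact k * Gamma (real k + nu + 1)) * (x / 2) powr (2 * real k + nu)" for k
 proof -
  have "(x / 2) powr (2 * real k + nu) = (x / 2) powr (real (2 * k)) * (x / 2) powr nu" by (simp add: powr_add)
  also have "(x / 2) powr (real (2 * k)) = (x / 2) ^ (2 * k)" using x by (intro powr_realpow) simp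
  also have "\<dots> = x ^ (2 * k) / 4 ^ k" by (simp add: power_divide power_mult)
  also have "(x / 2) powr nu = x powr nu * 2 powr (- nu)" using x by (simp add: powr_divide powr_minus_divide)
  finally show ?thesis unfolding hc_even by (simp add: mult_ac)
 qed
 ultimately have "(\<lambda>k. (-1) ^ k / (fact k * Gamma (real k + nu + 1)) * (x / 2) powr (2 * real k + nu)) sums (x powr nu * bh nu x)" by simp
 then show ?thesis unfolding bessel_J_def by (rule sums_unique[symmetric])
qed

text \<open>The damped moment, i.e. the Laplace transform of \<open>x^j J_nu(x)\<close>;
  \<open>FF_integral\<close> makes the link to \<open>bessel_J\<close>.\<close>

definition FF :: "nat \<Rightarrow> real \<Rightarrow> real" where "FF j s = Lap (bh nu) (real j + nu) s"

lemma FF_integral: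
 assumes s: "0 < s"
 shows "((\<lambda>x. x ^ j * bessel_J nu x * exp (- s * x)) has_integral FF j s) {0..}"
proof -
 have I: "integrable lborel (\<lambda>x. indicator {0<..} x * (x powr (real j + nu) * bh nu x * exp (- (s * x))))"
  using nu by (intro Lap_integrable(1)[OF _ s bh_cont(1) bh_bound(1)]) auto
 have "((\<lambda>x. indicator {0<..} x * (x powr (real j + nu) * bh nu x * exp (- (s * x)))) has_integral FF j s) UNIV"
  using has_integral_integral_lborel[OF I] by (simp add: FF_def Lap_def)
 then have "((\<lambda>x. if x \<in> {0..} then x ^ j * bessel_J nu x * exp (- s * x) else 0) has_integral FF j s) UNIV"
 proof (rule has_integral_spike[of "{0}", rotated 2])
  fix x :: real assume "x \<in> UNIV - {0}"
  then have x0: "x \<noteq> 0" by simp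
  have "x powr (real j + nu) = x ^ j * x powr nu" if "0 < x" using that by (simp add: powr_add powr_realpow)
  then show "(if x \<in> {0..} then x ^ j * bessel_J nu x * exp (- s * x) else 0) = indicator {0<..} x * (x powr (real j + nu) * bh nu x * exp (- (s * x)))"
   using x0 bessel_J_bh[of x] by (auto simp: indicator_def)
 qed auto
 then show ?thesis by (simp only: has_integral_restrict_UNIV)
qed

text \<open>Bessel's equation multiplied by a power and an exponential and integrated by parts; the
  boundary terms vanish at \<open>0\<close> because the powers are positive and at infinity by the
  damping. At \<open>s = 0\<close> it becomes the two-step recurrence of the regularized
  moments.\<close>

lemma FF_rec:
 assumes s: "0 < s"
 shows "(1 + s\<^sup>2) * FF (j + 2) s = (2 * real j + 3) * s * FF (j + 1) s - ((real j + 1)\<^sup>2 - nu\<^sup>2) * FF j s"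
proof -
 define p where "p = real j + nu + 1"
 have p: "1 < p" using nu by (simp add: p_def)
 \<comment> \<open>\<open>W\<close> collects the boundary terms: its derivative is \<open>f\<close>
   plus \<open>x^p exp(- s x)\<close> times the left side of \<open>bh_ode\<close>, hence equals
   \<open>f\<close>.\<close>
 define W where "W x = x powr (p + 1) * bh' nu x * exp (- (s * x)) + ((2 * nu - p) * x powr p + s * x powr (p + 1)) * bh nu x * exp (- (s * x))" for x
 define f where "f x = (p * (2 * nu - p)) * (x powr (p - 1) * bh nu x * exp (- (s * x))) + (s * (2 * p + 1 - 2 * nu)) * (x powr p * bh nu x * exp (- (s * x))) - (1 + s\<^sup>2) * (x powr (p + 1) * bh nu x * exp (- (s * x)))" for x
 have dW: "(W has_real_derivative f x) (at x)" if x: "0 < x" for x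
 proof -
  define X where "X = x powr (p - 1)"
  have P1: "x powr p = x * X" using x powr_add[of x "p - 1" 1] by (simp add: X_def mult.commute)
  have P2: "x powr (p + 1) = x * x * X" unfolding powr_add P1 using x by simp
  note P = P1 P2
  have d0: "((\<lambda>x. exp (- (s * x))) has_real_derivative (- s * exp (- (s * x)))) (at x)" by (auto intro!: derivative_eq_intros)
  have d1: "((\<lambda>x. x powr (p + 1)) has_real_derivative ((p + 1) * x powr p)) (at x)" "((\<lambda>x. x powr p) has_real_derivative (p * X)) (at x)"
   using has_real_derivative_powr[OF x, of "p + 1"] has_real_derivative_powr[OF x, of p] by (simp_all add: X_def)
  define e where "e = exp (- (s * x))"
  have "(W has_real_derivative
    (((((p + 1) * x powr p) * bh' nu x + bh'' nu x * x powr (p + 1)) * e + (- s * e) * (x powr (p + 1) * bh' nu x)) +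
    ((((2 * nu - p) * (p * X) + s * ((p + 1) * x powr p)) * bh nu x + bh' nu x * ((2 * nu - p) * x powr p + s * x powr (p + 1))) * e + (- s * e) * (((2 * nu - p) * x powr p + s * x powr (p + 1)) * bh nu x)))) (at x)"
   unfolding W_def[abs_def] e_def by (intro DERIV_add DERIV_mult DERIV_cmult d0 d1 bh_deriv)
  moreover have "(((((p + 1) * x powr p) * bh' nu x + bh'' nu x * x powr (p + 1)) * e + (- s * e) * (x powr (p + 1) * bh' nu x)) +
    ((((2 * nu - p) * (p * X) + s * ((p + 1) * x powr p)) * bh nu x + bh' nu x * ((2 * nu - p) * x powr p + s * x powr (p + 1))) * e + (- s * e) * (((2 * nu - p) * x powr p + s * x powr (p + 1)) * bh nu x)))
    = f x + e * (x * X) * (x * bh'' nu x + (2 * nu + 1) * bh' nu x + x * bh nu x)"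
   unfolding f_def e_def[symmetric] P X_def[symmetric] by (simp add: algebra_simps power2_eq_square)
  ultimately show ?thesis unfolding bh_ode by simp
 qed
 let ?i = "\<lambda>p x. indicator {0<..} x * (x powr p * bh nu x * exp (- (s * x)))"
 have int: "integrable lborel (?i q)" if "-1 < q" for q using that by (intro Lap_integrable(1)[OF _ s bh_cont(1) bh_bound(1)]) auto
 let ?F = "\<lambda>x. (p * (2 * nu - p)) * ?i (p - 1) x + (s * (2 * p + 1 - 2 * nu)) * ?i p x - (1 + s\<^sup>2) * ?i (p + 1) x"
 have FI: "integrable lborel ?F" using p by (intro Bochner_Integration.integrable_add Bochner_Integration.integrable_diff integrable_mult_right int) auto
 have Ff: "?F x = indicator {0<..} x * f x" for x by (simp add: f_def algebra_simps)
 have val: "(\<integral>x. ?F x \<partial>lborel) = (p * (2 * nu - p)) * Lap (bh nu) (p - 1) s + (s * (2 * p + 1 - 2 * nu)) * Lap (bh nu) p s - (1 + s\<^sup>2) * Lap (bh nu) (p + 1) s"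
  unfolding Lap_def using int[of "p - 1"] int[of p] int[of "p + 1"] p by simp
 have part: "(\<integral>x. indicator {..y} x *\<^sub>R ?F x \<partial>lborel) = W y" if y: "0 < y" for y
 proof -
  have W0: "W 0 = 0" using p by (simp add: W_def)
  have "(f has_integral (W y - W 0)) {0..y}"
  proof (rule fundamental_theorem_of_calculus_interior)
   have cp: "continuous_on {0..y} (\<lambda>x. x powr e)" if "0 < e" for e
    by (rule continuous_on_powr'[OF continuous_on_id continuous_on_const]) (use that in auto)
   have ce: "continuous_on {0..y} (\<lambda>x. exp (- (s * x)))" by (intro continuous_intros)
   have cb: "continuous_on {0..y} (bh nu)" "continuous_on {0..y} (bh' nu)"
    by (rule continuous_on_subset[OF bh_cont(1)], simp) (rule continuous_on_subset[OF bh_cont(2)], simp)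
   have p0: "0 < p + 1" "0 < p" using p by auto
   show "continuous_on {0..y} W" unfolding W_def
    by (intro continuous_on_add continuous_on_mult continuous_on_const cp ce cb p0)
   show "(W has_vector_derivative f x) (at x)" if "x \<in> {0<..<y}" for x
    using dW[of x] that by (simp add: has_real_derivative_iff_has_vector_derivative)
  qed (use y in simp)
  then have "((\<lambda>x. if x \<in> {0..y} then f x else 0) has_integral W y) UNIV" by (simp only: has_integral_restrict_UNIV W0 diff_zero)
  then have "((\<lambda>x. indicator {..y} x *\<^sub>R ?F x) has_integral W y) UNIV"
  proof (rule has_integral_spike[of "{0}", rotated 2])
   fix x :: real assume "x \<in> UNIV - {0}"
   then show "indicator {..y} x *\<^sub>R ?F x = (if x \<in> {0..y} then f x else 0)" unfolding Ff by (auto simp: indicator_def)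
  qed auto
  moreover have "integrable lborel (\<lambda>x. indicator {..y} x *\<^sub>R ?F x)" by (rule integrable_mult_indicator[OF _ FI]) simp
  ultimately show ?thesis using has_integral_integral_lborel has_integral_unique by blast
 qed
 have "((\<lambda>y. \<integral>x. indicator {..y} x *\<^sub>R ?F x \<partial>lborel) \<longlongrightarrow> (\<integral>x. ?F x \<partial>lborel)) at_top"
  by (rule tendsto_integral_at_top[OF _ FI]) simp
 moreover have "((\<lambda>y. \<integral>x. indicator {..y} x *\<^sub>R ?F x \<partial>lborel) \<longlongrightarrow> 0) at_top"
 proof (rule Lim_transform_eventually)
  show "\<forall>\<^sub>F y in at_top. W y = (\<integral>x. indicator {..y} x *\<^sub>R ?F x \<partial>lborel)"
   using eventually_gt_at_top[of 0] by eventually_elim (simp only: part)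
  show "(W \<longlongrightarrow> 0) at_top"
  proof (rule Lim_null_comparison)
   let ?K = "\<lambda>y. (y powr (p + 1) * hc nu 0 * exp (- (s * y)) + (\<bar>2 * nu - p\<bar> * y powr p + s * y powr (p + 1)) * hc nu 0 * exp (- (s * y)))"
   show "\<forall>\<^sub>F y in at_top. norm (W y) \<le> ?K y"
    using eventually_gt_at_top[of 0]
   proof eventually_elim
    case (elim y)
    have "norm (W y) \<le> \<bar>y powr (p + 1) * bh' nu y * exp (- (s * y))\<bar> + \<bar>((2 * nu - p) * y powr p + s * y powr (p + 1)) * bh nu y * exp (- (s * y))\<bar>"
     unfolding W_def real_norm_def by (rule abs_triangle_ineq)
    also have "\<dots> = y powr (p + 1) * \<bar>bh' nu y\<bar> * exp (- (s * y)) + \<bar>(2 * nu - p) * y powr p + s * y powr (p + 1)\<bar> * \<bar>bh nu y\<bar> * exp (- (s * y))"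
     by (simp add: abs_mult)
    also have "\<dots> \<le> ?K y"
    proof (intro add_mono mult_right_mono mult_mono mult_left_mono bh_bound elim)
     show "\<bar>(2 * nu - p) * y powr p + s * y powr (p + 1)\<bar> \<le> \<bar>2 * nu - p\<bar> * y powr p + s * y powr (p + 1)"
      using s abs_triangle_ineq[of "(2 * nu - p) * y powr p" "s * y powr (p + 1)"] by (simp add: abs_mult)
    qed (use s in \<open>auto intro!: add_nonneg_nonneg\<close>)
    finally show ?case .
   qed
   show "(?K \<longlongrightarrow> 0) at_top" using s by real_asymp
  qed
 qed
 ultimately have "(\<integral>x. ?F x \<partial>lborel) = 0" using tendsto_unique trivial_limit_at_top_linorder by blast
 moreover have "p * (2 * nu - p) = - ((real j + 1)\<^sup>2 - nu\<^sup>2)" "s * (2 * p + 1 - 2 * nu) = (2 * real j + 3) * s"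
  by (simp_all add: p_def power2_eq_square algebra_simps)
 moreover have "p - 1 = real j + nu" "p = real (j + 1) + nu" "p + 1 = real (j + 2) + nu" by (simp_all add: p_def)
 ultimately show ?thesis using val unfolding FF_def by (simp only:)
qed

end

section \<open>Moments of the Macdonald weight\<close>

lemma line_integral_fold:
 fixes f :: "real \<Rightarrow> complex"
 assumes f: "integrable lborel f"
 shows "(\<integral>x. f x \<partial>lborel) = (\<integral>x. indicator {0<..} x *\<^sub>R (f x + f (- x)) \<partial>lborel)"
proof -
 have fm: "integrable lborel (\<lambda>x. f (0 + (-1) * x))" by (intro lborel_integrable_real_affine f) auto
 have i1: "integrable lborel (\<lambda>x. indicator {0<..} x *\<^sub>R f x)" "integrable lborel (\<lambda>x. indicator {..<0} x *\<^sub>R f x)"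
  by (intro integrable_mult_indicator f; simp)+
 have i2: "integrable lborel (\<lambda>x. indicator {0<..} x *\<^sub>R f (- x))" using integrable_mult_indicator[OF _ fm, of "{0<..}"] by simp
 have "(\<integral>x. f x \<partial>lborel) = (\<integral>x. indicator {0<..} x *\<^sub>R f x + indicator {..<0} x *\<^sub>R f x \<partial>lborel)"
 proof (rule integral_cong_AE)
  show "AE x in lborel. f x = indicator {0<..} x *\<^sub>R f x + indicator {..<0} x *\<^sub>R f x"
   using AE_lborel_singleton[of "0::real"] by eventually_elim (auto simp: indicator_def)
 qed (use f i1 in auto)
 also have "\<dots> = (\<integral>x. indicator {0<..} x *\<^sub>R f x \<partial>lborel) + (\<integral>x. indicator {..<0} x *\<^sub>R f x \<partial>lborel)" by (intro Bochner_Integration.integral_add i1)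
 also have "(\<integral>x. indicator {..<0} x *\<^sub>R f x \<partial>lborel) = (\<integral>x. indicator {0<..} x *\<^sub>R f (- x) \<partial>lborel)"
  using lborel_integral_real_affine[of "-1" "\<lambda>x. indicator {..<0} x *\<^sub>R f x" 0] by (simp add: indicator_def)
 also have "(\<integral>x. indicator {0<..} x *\<^sub>R f x \<partial>lborel) + (\<integral>x. indicator {0<..} x *\<^sub>R f (- x) \<partial>lborel) = (\<integral>x. indicator {0<..} x *\<^sub>R (f x + f (- x)) \<partial>lborel)"
  using i1 i2 by (simp add: scaleR_add_right)
 finally show ?thesis .
qed

lemma Gamma_reflection_real: "Gamma x * Gamma (1 - x) * sin (pi * x) = pi" if "0 < x" "x < 1" for x :: real
proof -
 have "sin (pi * x) \<noteq> 0" using that mult_strict_left_mono[of x 1 pi] by (intro less_imp_neq[THEN not_sym] sin_gt_zero) auto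
 have "complex_of_real (Gamma x * Gamma (1 - x)) = of_real (pi / sin (pi * x))"
  using Gamma_reflection_complex[of "of_real x"] by (simp add: Gamma_complex_of_real[symmetric] sin_of_real[symmetric])
 then have "Gamma x * Gamma (1 - x) = pi / sin (pi * x)" by (simp only: of_real_eq_iff)
 then show ?thesis using \<open>sin (pi * x) \<noteq> 0\<close> by simp
qed

text \<open>The substitution is \<open>t = 1 - (1 + v)^(-2)\<close>, which turns
  \<open>v^2 + 2v\<close> into \<open>t/(1 - t)\<close>.\<close>

lemma Beta_substitution:
 fixes nu p :: real
 assumes nu: "0 < nu" and p: "2 * nu < p"
 shows "((\<lambda>v. (v\<^sup>2 + 2 * v) powr (nu - 1/2) * (1 + v) powr (- p)) has_integral (Beta (nu + 1/2) (p / 2 - nu) / 2)) {0<..}"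
proof -
 let ?f = "\<lambda>v::real. (v\<^sup>2 + 2 * v) powr (nu - 1/2) * (1 + v) powr (- p)"
 define g where "g t = (1 - t) powr (-1/2) - 1" for t :: real
 define g' where "g' t = (1/2) * (1 - t) powr (-3/2)" for t :: real
 have d: "(g has_field_derivative g' t) (at t within {0<..<1})" if "t \<in> {0<..<1}" for t
 proof -
  have t: "0 < 1 - t" using that by simp
  have "((\<lambda>t. 1 - t) has_real_derivative (0 - 1)) (at t)" by (intro DERIV_diff DERIV_const DERIV_ident)
  from DERIV_fun_powr[OF this t, of "-1/2"]
  have "((\<lambda>t. (1 - t) powr (-1/2)) has_real_derivative g' t) (at t)" by (simp add: g'_def)
  then have "(g has_real_derivative g' t - 0) (at t)" unfolding g_def[abs_def] by (intro DERIV_diff DERIV_const)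
  then have "(g has_real_derivative g' t) (at t)" by simp
  then show ?thesis by (rule has_field_derivative_at_within)
 qed
 have inj: "inj_on g {0<..<1}"
 proof (rule inj_onI)
  fix s t :: real assume st: "s \<in> {0<..<1}" "t \<in> {0<..<1}" "g s = g t"
  then have "(1 - s) powr (-1/2) = (1 - t) powr (-1/2)" by (simp add: g_def)
  then have "((1 - s) powr (-1/2)) powr (-2) = ((1 - t) powr (-1/2)) powr (-2)" by simp
  then show "s = t" using st by (simp add: powr_powr)
 qed
 have gp: "0 < g t" "1 + g t = (1 - t) powr (-1/2)" "(g t)\<^sup>2 + 2 * g t = t / (1 - t)" if "t \<in> {0<..<1}" for t
 proof -
  have t: "0 < 1 - t" "1 - t < 1" using that by auto
  have "1 powr (-1/2) < (1 - t) powr (-1/2)" using t by (intro powr_less_mono2_neg) auto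
  then show "0 < g t" by (simp add: g_def)
  show e: "1 + g t = (1 - t) powr (-1/2)" by (simp add: g_def)
  have "(g t)\<^sup>2 + 2 * g t = (1 + g t)\<^sup>2 - 1" by (simp add: power2_eq_square algebra_simps)
  also have "(1 + g t)\<^sup>2 = 1 / (1 - t)" unfolding e power2_eq_square powr_add[symmetric] using t by (simp add: powr_minus_divide)
  also have "1 / (1 - t) - 1 = t / (1 - t)" using t by (simp add: field_simps)
  finally show "(g t)\<^sup>2 + 2 * g t = t / (1 - t)" .
 qed
 have img: "g ` {0<..<1} = {0<..}"
 proof (intro equalityI subsetI)
  fix v assume "v \<in> g ` {0<..<1}" then show "v \<in> {0<..}" using gp by auto
 next
  fix v :: real assume v: "v \<in> {0<..}"
  define t where "t = 1 - (1 + v) powr (-2)"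
  have "(1 + v) powr (-2) < 1 powr (-2)" using v by (intro powr_less_mono2_neg) auto
  then have t: "t \<in> {0<..<1}" using v by (simp add: t_def)
  have "g t = v" using v by (simp add: g_def t_def powr_powr)
  with t show "v \<in> g ` {0<..<1}" by blast
 qed
 have eq: "\<bar>g' t\<bar> * ?f (g t) = (1/2) * (t powr (nu + 1/2 - 1) * (1 - t) powr (p / 2 - nu - 1))" if t: "t \<in> {0<..<1}" for t
 proof -
  have u: "0 < 1 - t" "0 < t" using t by auto
  have "(t / (1 - t)) powr (nu - 1/2) = t powr (nu - 1/2) * (1 - t) powr (- (nu - 1/2))" by (simp only: powr_divide powr_minus_divide) simp
  moreover have "((1 - t) powr (-1/2)) powr (- p) = (1 - t) powr (p / 2)" by (simp add: powr_powr)
  ultimately have "\<bar>g' t\<bar> * ?f (g t) = (1/2) * (t powr (nu - 1/2) * ((1 - t) powr (-3/2) * (1 - t) powr (- (nu - 1/2)) * (1 - t) powr (p / 2)))"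
   unfolding gp(2,3)[OF t] g'_def by (simp add: mult_ac)
  also have "(1 - t) powr (-3/2) * (1 - t) powr (- (nu - 1/2)) * (1 - t) powr (p / 2) = (1 - t) powr (p / 2 - nu - 1)"
   unfolding powr_add[symmetric] by (rule arg_cong[where f = "(powr) (1 - t)"]) simp
  finally show ?thesis by (simp add: algebra_simps)
 qed
 have hb: "((\<lambda>t. \<bar>g' t\<bar> * ?f (g t)) has_integral (Beta (nu + 1/2) (p / 2 - nu) / 2)) {0<..<1}"
 proof -
  have "((\<lambda>t. (1/2) * (t powr (nu + 1/2 - 1) * (1 - t) powr (p / 2 - nu - 1))) has_integral (1/2) * Beta (nu + 1/2) (p / 2 - nu)) {0..1}"
   using nu p by (intro has_integral_mult_right has_integral_Beta_real) auto
  then have "((\<lambda>t. (1/2) * (t powr (nu + 1/2 - 1) * (1 - t) powr (p / 2 - nu - 1))) has_integral (1/2) * Beta (nu + 1/2) (p / 2 - nu)) {0<..<1}"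
   unfolding has_integral_Icc_iff_Ioo .
  then show ?thesis using eq by (subst has_integral_cong[where g = "\<lambda>t. (1/2) * (t powr (nu + 1/2 - 1) * (1 - t) powr (p / 2 - nu - 1))"]) auto
 qed
 then have "(\<lambda>t. \<bar>g' t\<bar> * ?f (g t)) absolutely_integrable_on {0<..<1} \<and> integral {0<..<1} (\<lambda>t. \<bar>g' t\<bar> * ?f (g t)) = Beta (nu + 1/2) (p / 2 - nu) / 2"
  by (intro conjI nonnegative_absolutely_integrable_1 integral_unique) (auto simp: integrable_on_def)
 note hyp = this
 have sm: "{0<..<1::real} \<in> sets lebesgue" by simp
 have "?f absolutely_integrable_on {0<..} \<and> integral {0<..} ?f = Beta (nu + 1/2) (p / 2 - nu) / 2"
  by (rule iffD1[OF has_absolute_integral_change_of_variables_1'[OF sm d inj, of ?f "Beta (nu + 1/2) (p / 2 - nu) / 2", unfolded img]]) (assumption | rule hyp)+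
 then have "?f integrable_on {0<..}" "integral {0<..} ?f = Beta (nu + 1/2) (p / 2 - nu) / 2"
  using set_lebesgue_integral_eq_integral(1)[of "{0<..}" ?f] by blast+
 then show ?thesis unfolding has_integral_iff by (rule conjI)
qed

context
 fixes nu :: real assumes nu: "0 < nu" "nu \<le> 1/2"
begin

definition Kj :: "nat \<Rightarrow> real" where "Kj j = Gamma (real j + nu + 1) * (Beta (nu + 1/2) ((real j + nu + 1) / 2 - nu) / 2)"

lemma Kj_nonneg: "0 < Kj j"
 unfolding Kj_def Beta_def using nu by (intro mult_pos_pos divide_pos_pos Gamma_real_pos) (auto simp: field_simps)

text \<open>Tonelli for a nonnegative integrand: integrating over \<open>y\<close> first gives
  \<open>Gamma p / (1 + v)^p\<close> with \<open>p = j + nu + 1\<close>, and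
  \<open>Beta_substitution\<close> does the rest.\<close>

lemma KK_moment: "(\<integral>y. indicator {0<..} y * (y ^ j * KK nu y) \<partial>lborel) = Kj j"
proof -
 define p where "p = real j + nu + 1"
 have p: "0 < p" "2 * nu < p" using nu by (auto simp: p_def)
 let ?f = "\<lambda>v::real. (v\<^sup>2 + 2 * v) powr (nu - 1/2) * (1 + v) powr (- p)"
 have inner: "ennreal (indicator {0<..} y * (y ^ j * KK nu y)) = (\<integral>\<^sup>+v. ennreal (indicator {0<..} y * indicator {0<..} v * ((v\<^sup>2 + 2 * v) powr (nu - 1/2) * (y powr (p - 1) * exp (- ((1 + v) * y))))) \<partial>lborel)" for y
 proof (cases "0 < y")
  case True
  have nn: "0 \<le> indicator {0<..} v * KI nu y v" for v by (simp add: KI_def)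
  have "ennreal (indicator {0<..} y * (y ^ j * KK nu y)) = ennreal (y powr (p - 1) * exp (- y)) * ennreal (\<integral>v. indicator {0<..} v * KI nu y v \<partial>lborel)"
  proof -
   have "y powr (p - 1) = y ^ j * y powr nu" using True by (simp add: p_def powr_add powr_realpow)
   then show ?thesis using True by (simp add: KK_def ennreal_mult'[symmetric] mult_ac)
  qed
  also have "ennreal (\<integral>v. indicator {0<..} v * KI nu y v \<partial>lborel) = (\<integral>\<^sup>+v. ennreal (indicator {0<..} v * KI nu y v) \<partial>lborel)"
   using nn by (intro nn_integral_eq_integral[symmetric] KI_integrable[OF nu] True AE_I2)
  also have "ennreal (y powr (p - 1) * exp (- y)) * \<dots> = (\<integral>\<^sup>+v. ennreal (y powr (p - 1) * exp (- y)) * ennreal (indicator {0<..} v * KI nu y v) \<partial>lborel)"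
   unfolding KI_def by (intro nn_integral_cmult[symmetric]) measurable
  also have "\<dots> = (\<integral>\<^sup>+v. ennreal (indicator {0<..} y * indicator {0<..} v * ((v\<^sup>2 + 2 * v) powr (nu - 1/2) * (y powr (p - 1) * exp (- ((1 + v) * y))))) \<partial>lborel)"
  proof (intro nn_integral_cong)
   fix v :: real
   have "exp (- ((1 + v) * y)) = exp (- y) * exp (- (y * v))" by (simp add: exp_add[symmetric] algebra_simps)
   then show "ennreal (y powr (p - 1) * exp (- y)) * ennreal (indicator {0<..} v * KI nu y v) = ennreal (indicator {0<..} y * indicator {0<..} v * ((v\<^sup>2 + 2 * v) powr (nu - 1/2) * (y powr (p - 1) * exp (- ((1 + v) * y)))))"
    using True by (simp add: KI_def ennreal_mult'[symmetric] mult_ac)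
  qed
  finally show ?thesis .
 qed simp
 have "(\<integral>\<^sup>+y. ennreal (indicator {0<..} y * (y ^ j * KK nu y)) \<partial>lborel) =
  (\<integral>\<^sup>+v. \<integral>\<^sup>+y. ennreal (indicator {0<..} y * indicator {0<..} v * ((v\<^sup>2 + 2 * v) powr (nu - 1/2) * (y powr (p - 1) * exp (- ((1 + v) * y))))) \<partial>lborel \<partial>lborel)"
  unfolding inner by (rule lborel_pair.Fubini') measurable
 also have "\<dots> = (\<integral>\<^sup>+v. ennreal (Gamma p) * ennreal (indicator {0<..} v * ?f v) \<partial>lborel)"
 proof (intro nn_integral_cong)
  fix v :: real
  show "(\<integral>\<^sup>+y. ennreal (indicator {0<..} y * indicator {0<..} v * ((v\<^sup>2 + 2 * v) powr (nu - 1/2) * (y powr (p - 1) * exp (- ((1 + v) * y))))) \<partial>lborel) = ennreal (Gamma p) * ennreal (indicator {0<..} v * ?f v)"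
  proof (cases "0 < v")
   case True
   then have v: "0 < 1 + v" by simp
   let ?k = "\<lambda>y. (v\<^sup>2 + 2 * v) powr (nu - 1/2) * (indicator {0<..} y * (y powr (p - 1) * exp (- ((1 + v) * y))))"
   have "(\<integral>\<^sup>+y. ennreal (indicator {0<..} y * indicator {0<..} v * ((v\<^sup>2 + 2 * v) powr (nu - 1/2) * (y powr (p - 1) * exp (- ((1 + v) * y))))) \<partial>lborel) = (\<integral>\<^sup>+y. ennreal (?k y) \<partial>lborel)"
    using True by (intro nn_integral_cong) (simp add: mult_ac)
   also have "\<dots> = ennreal (\<integral>y. ?k y \<partial>lborel)"
    by (intro nn_integral_eq_integral integrable_mult_right Gamma_scaled(1) p v AE_I2) simp
   also have "(\<integral>y. ?k y \<partial>lborel) = (v\<^sup>2 + 2 * v) powr (nu - 1/2) * (Gamma p / (1 + v) powr p)"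
    using Gamma_scaled(2)[OF p(1) v] by simp
   also have "\<dots> = Gamma p * (indicator {0<..} v * ?f v)" using True by (simp add: powr_minus_divide)
   also have "ennreal \<dots> = ennreal (Gamma p) * ennreal (indicator {0<..} v * ?f v)"
    using p Gamma_real_pos[of p] by (intro ennreal_mult) (auto simp: less_imp_le)
   finally show ?thesis .
  qed simp
 qed
 also have "\<dots> = ennreal (Gamma p) * (\<integral>\<^sup>+v. ennreal (indicator {0<..} v * ?f v) \<partial>lborel)" by (intro nn_integral_cmult) measurable
 also have "(\<integral>\<^sup>+v. ennreal (indicator {0<..} v * ?f v) \<partial>lborel) = ennreal (Beta (nu + 1/2) (p / 2 - nu) / 2)"
 proof (rule nn_integral_has_integral_lborel)
  have "((\<lambda>v. if v \<in> {0<..} then ?f v else 0) has_integral (Beta (nu + 1/2) (p / 2 - nu) / 2)) UNIV"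
   unfolding has_integral_restrict_UNIV by (rule Beta_substitution[OF nu(1) p(2)])
  moreover have "(if v \<in> {0<..} then ?f v else 0) = indicator {0<..} v * ?f v" for v by (simp add: indicator_def)
  ultimately show "((\<lambda>v. indicator {0<..} v * ?f v) has_integral (Beta (nu + 1/2) (p / 2 - nu) / 2)) UNIV" by (simp only:)
  show "(\<lambda>v. indicator {0<..} v * ?f v) \<in> borel_measurable borel" by measurable
  show "0 \<le> indicator {0<..} v * ?f v" for v by (simp add: indicator_def)
 qed
 also have "ennreal (Gamma p) * ennreal (Beta (nu + 1/2) (p / 2 - nu) / 2) = ennreal (Kj j)"
  unfolding Kj_def p_def[symmetric] using p Gamma_real_pos[of p] by (intro ennreal_mult'[symmetric]) (auto simp: less_imp_le)
 finally have nn: "(\<integral>\<^sup>+y. ennreal (indicator {0<..} y * (y ^ j * KK nu y)) \<partial>lborel) = ennreal (Kj j)" .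
 have "0 \<le> indicator {0<..} y * (y ^ j * KK nu y)" for y
  using KX_nonneg[OF nu, of "y / pi"] by (cases "0 < y") (auto simp: KX_def)
 then show ?thesis using nn Kj_nonneg[of j] by (subst integral_eq_nn_integral) auto
qed

text \<open>The two half-lines contribute the same real moment with conjugate phases, from the power
  of \<open>i\<close> and from the weight.\<close>

definition cfac :: "nat \<Rightarrow> complex" where
 "cfac j = \<i> ^ j * exp (- \<i> * of_real (pi * (nu / 2))) + (- \<i>) ^ j * exp (\<i> * of_real (pi * (nu / 2)))"

lemma ww_moment: "(\<integral>x. ww nu x * (\<i> * of_real pi * of_real x) ^ j \<partial>lborel) = cfac j * of_real (Kj j / pi)"
proof -
 have pm: "poly ([:0, \<i> * of_real pi:] ^ j) (of_real x) = (\<i> * of_real pi * of_real x) ^ j" for x by (simp add: mult_ac)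
 have I: "integrable lborel (\<lambda>x. ww nu x * (\<i> * of_real pi * of_real x) ^ j)" using ww_integrable[OF nu, of "[:0, \<i> * of_real pi:] ^ j"] by (simp only: pm)
 have "(\<integral>x. ww nu x * (\<i> * of_real pi * of_real x) ^ j \<partial>lborel) = (\<integral>x. cfac j * of_real (indicator {0<..} (0 + pi * x) * ((0 + pi * x) ^ j * KK nu (0 + pi * x))) \<partial>lborel)"
  unfolding line_integral_fold[OF I]
 proof (intro Bochner_Integration.integral_cong refl)
  fix x :: real
  show "indicator {0<..} x *\<^sub>R (ww nu x * (\<i> * of_real pi * of_real x) ^ j + ww nu (- x) * (\<i> * of_real pi * of_real (- x)) ^ j) = cfac j * of_real (indicator {0<..} (0 + pi * x) * ((0 + pi * x) ^ j * KK nu (0 + pi * x)))"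
  proof (cases "0 < x")
   case True
   have 1: "(\<i> * of_real pi * of_real x) ^ j = \<i> ^ j * of_real ((pi * x) ^ j)" by (simp add: power_mult_distrib mult_ac)
   have 2: "(\<i> * of_real pi * of_real (- x)) ^ j = (- \<i>) ^ j * of_real ((pi * x) ^ j)"
   proof -
    have e: "\<i> * of_real pi * of_real (- x) = (- \<i>) * of_real (pi * x)" by simp
    show ?thesis unfolding e power_mult_distrib[of "- \<i>"] by (simp only: of_real_power)
   qed
   have 3: "ww nu x = exp (- \<i> * of_real (pi * (nu / 2))) * of_real (KK nu (pi * x))" "ww nu (- x) = exp (\<i> * of_real (pi * (nu / 2))) * of_real (KK nu (pi * x))"
    using True by (simp_all add: ww_def KX_def)
   have "0 < pi * x" using True by simp
   then show ?thesis using True unfolding 1 2 3 cfac_def by (simp add: algebra_simps)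
  qed (simp add: zero_less_mult_iff)
 qed
 also have "\<dots> = cfac j * of_real (\<integral>x. indicator {0<..} (0 + pi * x) * ((0 + pi * x) ^ j * KK nu (0 + pi * x)) \<partial>lborel)"
  by (simp only: integral_mult_right_zero integral_complex_of_real)
 also have "(\<integral>x. indicator {0<..} (0 + pi * x) * ((0 + pi * x) ^ j * KK nu (0 + pi * x)) \<partial>lborel) = Kj j / pi"
  using lborel_integral_real_affine[of pi "\<lambda>y. indicator {0<..} y * (y ^ j * KK nu y)" 0] KK_moment[of j] by simp
 finally show ?thesis .
qed

lemma Kj_rec: "Kj (j + 2) = ((real j + 1)\<^sup>2 - nu\<^sup>2) * Kj j"
proof -
 define a b where "a = real j + nu + 1" and "b = (real j + nu + 1) / 2 - nu"
 have ab: "0 < a" "0 < b" using nu by (auto simp: a_def b_def)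
 have G: "Gamma (y + 1) = y * Gamma y" if "0 < y" for y :: real
  using Gamma_plus1[of y] that nonpos_Ints_nonpos[of y] by force
 have g1: "Gamma (real (j + 2) + nu + 1) = (a + 1) * (a * Gamma a)"
  using G[of a] G[of "a + 1"] ab by (simp add: a_def add_ac)
 have b2: "(real (j + 2) + nu + 1) / 2 - nu = b + 1" by (simp add: b_def field_simps)
 have s: "nu + 1/2 + b = (a + 1) / 2" by (simp add: a_def b_def field_simps)
 define c where "c = (a + 1) / 2"
 have c: "0 < c" using ab by (simp add: c_def)
 have gc: "Gamma (c + 1) = c * Gamma c" "Gamma (b + 1) = b * Gamma b" by (intro G c ab)+
 have gn: "Gamma c \<noteq> 0" using Gamma_real_pos[OF c] by simp
 have s2: "nu + 1/2 + (b + 1) = c + 1" using s unfolding c_def by linarith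
 have "Kj (j + 2) = (a + 1) * (a * Gamma a) * (Gamma (nu + 1/2) * (b * Gamma b) / (c * Gamma c) / 2)"
  unfolding Kj_def b2 g1 Beta_def s2 gc by simp
 also have "\<dots> = (2 * a * b) * (Gamma a * (Gamma (nu + 1/2) * Gamma b / Gamma c / 2))"
 proof -
  have "a + 1 = 2 * c" by (simp add: c_def)
  then show ?thesis using c gn by (simp add: field_simps)
 qed
 also have "Gamma a * (Gamma (nu + 1/2) * Gamma b / Gamma c / 2) = Kj j"
 proof -
  have "Kj j = Gamma a * (Beta (nu + 1/2) b / 2)" unfolding Kj_def a_def b_def ..
  then show ?thesis unfolding Beta_def s c_def by simp
 qed
 also have "2 * a * b = (real j + 1)\<^sup>2 - nu\<^sup>2" by (simp add: a_def b_def power2_eq_square field_simps)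
 finally show ?thesis .
qed

text \<open>The reflection formula at \<open>nu/2\<close> and at \<open>(1 + nu)/2\<close> turns the
  trigonometric factors into Gamma values. It fixes the ratio of the first two moments of the
  complex weight to \<open>nu\<close>, the ratio found for the Bessel moments.\<close>

lemma Kj_ratio: "sin (pi * (nu / 2)) * Kj 1 = nu * (cos (pi * (nu / 2)) * Kj 0)"
proof -
 have G: "Gamma (y + 1) = y * Gamma y" if "0 < y" for y :: real
  using Gamma_plus1[of y] that nonpos_Ints_nonpos[of y] by force
 define A B C D where "A = Gamma (nu / 2)" and "B = Gamma (1 - nu / 2)" and "C = Gamma ((1 + nu) / 2)" and "D = Gamma ((1 - nu) / 2)"
 have pos: "0 < A" "0 < B" "0 < C" "0 < D" unfolding A_def B_def C_def D_def using nu by (intro Gamma_real_pos; simp)+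
 have r1: "A * B * sin (pi * (nu / 2)) = pi" unfolding A_def B_def using nu by (intro Gamma_reflection_real) auto
 have r2: "C * D * cos (pi * (nu / 2)) = pi"
 proof -
  have e1: "1 - (1 + nu) / 2 = (1 - nu) / 2" by (simp add: field_simps)
  have e3: "pi * ((1 + nu) / 2) = pi * (nu / 2) + pi / 2" by (simp add: field_simps)
  have e2: "sin (pi * ((1 + nu) / 2)) = cos (pi * (nu / 2))" unfolding e3 sin_add by simp
  have "Gamma ((1 + nu) / 2) * Gamma (1 - (1 + nu) / 2) * sin (pi * ((1 + nu) / 2)) = pi"
   using nu by (intro Gamma_reflection_real) auto
  then show ?thesis unfolding e1 e2 C_def D_def .
 qed
 define E where "E = Gamma (nu + 1) * Gamma (nu + 1/2)"
 have k0: "Kj 0 = E * D / (nu / 2 * A) / 2"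
 proof -
  have e: "(real 0 + nu + 1) / 2 - nu = (1 - nu) / 2" "nu + 1/2 + (1 - nu) / 2 = nu / 2 + 1" "real 0 + nu + 1 = nu + 1" by (simp_all add: field_simps)
  have g: "Gamma (nu / 2 + 1) = nu / 2 * Gamma (nu / 2)" by (rule G) (use nu in simp)
  show ?thesis unfolding Kj_def unfolding e(1) unfolding Beta_def unfolding e(2,3) unfolding g E_def A_def D_def by simp
 qed
 have k1: "Kj 1 = (nu + 1) * E * B / ((1 + nu) / 2 * C) / 2"
 proof -
  have e: "(real 1 + nu + 1) / 2 - nu = 1 - nu / 2" "nu + 1/2 + (1 - nu / 2) = (1 + nu) / 2 + 1" "real 1 + nu + 1 = (nu + 1) + 1" by (simp_all add: field_simps)
  have g: "Gamma ((1 + nu) / 2 + 1) = (1 + nu) / 2 * Gamma ((1 + nu) / 2)" "Gamma ((nu + 1) + 1) = (nu + 1) * Gamma (nu + 1)"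
   by (rule G, use nu in simp)+
  show ?thesis unfolding Kj_def unfolding e(1) unfolding Beta_def unfolding e(2,3) unfolding g E_def B_def C_def by simp
 qed
 have n: "nu + 1 \<noteq> 0" "nu \<noteq> 0" "A \<noteq> 0" "C \<noteq> 0" using nu pos by auto
 have a1: "w * E * B / (w / 2 * C) / 2 * C = E * B" if "w \<noteq> 0" for w using that n(4) by (simp add: field_simps)
 have a0: "w * (E * D / (w / 2 * A) / 2) * A = E * D" if "w \<noteq> 0" for w using that n(3) by (simp add: field_simps)
 have k1': "Kj 1 * C = E * B" using a1[OF n(1)] unfolding k1 by (simp only: add.commute[of 1 nu])
 have k0': "nu * Kj 0 * A = E * D" unfolding k0 by (rule a0[OF n(2)])
 have "sin (pi * (nu / 2)) * Kj 1 * (A * C) = (Kj 1 * C) * A * sin (pi * (nu / 2))" by (simp only: mult_ac)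
 also have "\<dots> = E * (A * B * sin (pi * (nu / 2)))" unfolding k1' by (simp only: mult_ac)
 also have "\<dots> = E * (C * D * cos (pi * (nu / 2)))" by (simp only: r1 r2)
 also have "\<dots> = (nu * Kj 0 * A) * C * cos (pi * (nu / 2))" unfolding k0' by (simp only: mult_ac)
 also have "\<dots> = nu * (cos (pi * (nu / 2)) * Kj 0) * (A * C)" by (simp only: mult_ac)
 finally show ?thesis using n by simp
qed

text \<open>The regularized moments, with \<open>B\<close> standing for the zeroth one; the
  recurrence is the limit of \<open>FF_rec\<close> as \<open>s\<close> tends to \<open>0\<close>.
  Only proportionality of moment sequences matters for the polynomials.\<close>

fun MM :: "real \<Rightarrow> nat \<Rightarrow> real" where
 "MM B 0 = B"
| "MM B (Suc 0) = nu * B"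
| "MM B (Suc (Suc j)) = - ((real j + 1)\<^sup>2 - nu\<^sup>2) * MM B j"

lemma cfac_rec: "cfac (Suc (Suc j)) = - cfac j" by (simp add: cfac_def)

lemma cfac_01: "cfac 0 = of_real (2 * cos (pi * (nu / 2)))" "cfac (Suc 0) = of_real (2 * sin (pi * (nu / 2)))"
proof -
 have e: "exp (\<i> * of_real t) = of_real (cos t) + \<i> * of_real (sin t)" "exp (- \<i> * of_real t) = of_real (cos t) - \<i> * of_real (sin t)" for t :: real
  using exp_Euler[of "of_real t"] exp_minus_Euler[of "of_real t"] by (simp_all add: cos_of_real sin_of_real)
 show "cfac 0 = of_real (2 * cos (pi * (nu / 2)))" "cfac (Suc 0) = of_real (2 * sin (pi * (nu / 2)))"
  unfolding cfac_def e by (simp_all add: algebra_simps)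
qed

text \<open>Both sequences satisfy the same two-step recurrence and have the same ratio of the first
  two entries, hence are proportional. This is the bridge from the Bessel moments to the complex
  weight on the line.\<close>

lemma MM_ww: "B \<noteq> 0 \<Longrightarrow> \<exists>C. C \<noteq> 0 \<and> (\<forall>j. of_real (MM B j) = C * (\<integral>x. ww nu x * (\<i> * of_real pi * of_real x) ^ j \<partial>lborel))"
proof -
 assume B: "B \<noteq> 0"
 have cp: "0 < cos (pi * (nu / 2))"
 proof (intro cos_gt_zero_pi)
  have "0 < pi * nu" "pi * nu \<le> pi * (1/2)" using nu by (auto intro!: mult_left_mono)
  then show "- (pi / 2) < pi * (nu / 2)" "pi * (nu / 2) < pi / 2" using pi_gt_zero by linarith+
 qed
 define L where "L j = cfac j * of_real (Kj j / pi)" for j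
 have L0: "L 0 \<noteq> 0" unfolding L_def cfac_01 using cp Kj_nonneg[of 0] by simp
 have L1: "L (Suc 0) = of_real nu * L 0"
 proof -
  have "L (Suc 0) = of_real (2 * (sin (pi * (nu / 2)) * Kj 1) / pi)" unfolding L_def cfac_01 by simp
  also have "\<dots> = of_real nu * L 0" unfolding Kj_ratio unfolding L_def cfac_01 by simp
  finally show ?thesis .
 qed
 have L2: "L (Suc (Suc j)) = - of_real ((real j + 1)\<^sup>2 - nu\<^sup>2) * L j" for j
 proof -
  define c where "c = (real j + 1)\<^sup>2 - nu\<^sup>2"
  have k: "Kj (Suc (Suc j)) = c * Kj j" using Kj_rec[of j] by (simp add: c_def)
  show ?thesis unfolding L_def cfac_rec k c_def[symmetric] by simp
 qed
 have "of_real (MM B j) = (of_real B / L 0) * L j" for j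
 proof (induction j rule: induct_nat_012)
  case 0 show ?case using L0 by simp
  case 1 show ?case using L0 by (simp add: L1)
  case (ge2 j) show ?case unfolding MM.simps L2 of_real_mult of_real_minus ge2(1) by simp
 qed
 then show ?thesis using B L0 unfolding ww_moment L_def[symmetric] by (intro exI[of _ "of_real B / L 0"]) auto
qed

section \<open>The Laplace transform of the Bessel function and its limit at zero\<close>

lemma FF_deriv: "0 < s \<Longrightarrow> (FF nu j has_real_derivative - FF nu (Suc j) s) (at s)"
 using Lap_deriv[OF _ _ bh_cont(1)[OF nu] bh_bound(1)[OF nu], of "real j + nu" s] nu
 unfolding FF_def[OF nu, abs_def] by (simp add: add_ac)

text \<open>Derives the closed form \<open>FF nu 0 s = B / (r q^nu)\<close> with
  \<open>r = sqrt (1 + s^2)\<close> and \<open>q = s + r\<close>, the classical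
  \<open>(r - s)^nu / r\<close> up to the constant \<open>B\<close>. It has a limit at
  \<open>0\<close>; so has the first moment, and \<open>FF_rec\<close> carries the limits to all
  orders.\<close>

lemma FF_limits: "\<exists>B. B \<noteq> 0 \<and> (\<forall>j. (FF nu j \<longlongrightarrow> MM B j) (at_right 0))"
proof -
 define r where "r s = sqrt (1 + s\<^sup>2)" for s :: real
 define q where "q s = s + r s" for s
 have rp: "0 < r s" "(r s)\<^sup>2 = 1 + s\<^sup>2" for s by (simp_all add: r_def add_pos_nonneg)
 have qp: "1 \<le> q s" if "0 < s" for s using that by (simp add: q_def r_def add_increasing)
 have dr: "(r has_real_derivative s / r s) (at s)" for s
 proof -
  have p: "0 < 1 + s\<^sup>2" by (simp add: add_pos_nonneg)
  have d1: "((\<lambda>s. 1 + s\<^sup>2) has_real_derivative (0 + of_nat 2 * (1 * s ^ (2 - Suc 0)))) (at s)"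
   by (intro DERIV_add DERIV_const DERIV_power DERIV_ident)
  have "((\<lambda>s. sqrt (1 + s\<^sup>2)) has_real_derivative inverse (sqrt (1 + s\<^sup>2)) / 2 * (0 + of_nat 2 * (1 * s ^ (2 - Suc 0)))) (at s)"
   by (rule DERIV_chain2[where f = sqrt and g = "\<lambda>s. 1 + s\<^sup>2" and x = s]) (rule DERIV_real_sqrt[OF p], rule d1)
  moreover have "inverse R / 2 * (0 + of_nat 2 * (1 * s ^ (2 - Suc 0))) = s / R" for R by (simp add: field_simps)
  ultimately show ?thesis unfolding r_def[abs_def] by (simp only:)
 qed
 have dq: "((\<lambda>s. q s powr e) has_real_derivative (e * q s powr e / r s)) (at s)" if s: "0 < s" for s e
 proof -
  have q0: "0 < q s" using qp[OF s] by simp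
  have "(q has_real_derivative (1 + s / r s)) (at s)" unfolding q_def[abs_def] by (intro DERIV_add DERIV_ident dr)
  from DERIV_fun_powr[OF this q0, of e]
  have "((\<lambda>s. q s powr e) has_real_derivative (e * q s powr (e - 1) * (1 + s / r s))) (at s)" by simp
  moreover have "1 + s / r s = q s / r s" using rp(1)[of s] by (simp add: q_def add_divide_distrib)
  moreover have "q s powr (e - 1) * q s = q s powr e" using q0 by (simp add: powr_diff)
  then have "e * q s powr (e - 1) * (q s / r s) = e * q s powr e / r s" by (simp only: times_divide_eq_right mult.assoc)
  ultimately show ?thesis by (simp only:)
 qed
 \<comment> \<open>\<open>P = 0\<close> is the first-order equation that the expected closed form
   satisfies. \<open>FF_rec\<close> at \<open>j = 0\<close> makes \<open>P\<close> itself solve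
   \<open>P' = (nu/r) P\<close>, so \<open>P q^(- nu)\<close> is constant.\<close>
 define P where "P s = (r s)\<^sup>2 * FF nu 1 s - s * FF nu 0 s - nu * r s * FF nu 0 s" for s
 have dP: "(P has_real_derivative (nu / r s) * P s) (at s)" if s: "0 < s" for s
 proof -
  have dr2: "((\<lambda>s. (r s)\<^sup>2) has_real_derivative 2 * s) (at s)"
   unfolding rp(2) by (auto intro!: derivative_eq_intros)
  have d1: "((\<lambda>s. (r s)\<^sup>2 * FF nu 1 s) has_real_derivative (2 * s * FF nu 1 s + - FF nu (Suc 1) s * (r s)\<^sup>2)) (at s)"
   by (rule DERIV_mult[OF dr2 FF_deriv[OF s]])
  have d2: "((\<lambda>s. s * FF nu 0 s) has_real_derivative (1 * FF nu 0 s + - FF nu (Suc 0) s * s)) (at s)"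
   by (rule DERIV_mult[OF DERIV_ident FF_deriv[OF s]])
  have d3: "((\<lambda>s. nu * r s * FF nu 0 s) has_real_derivative ((nu * (s / r s)) * FF nu 0 s + - FF nu (Suc 0) s * (nu * r s))) (at s)"
   by (rule DERIV_mult[OF DERIV_cmult[OF dr] FF_deriv[OF s]])
  note D = DERIV_diff[OF DERIV_diff[OF d1 d2] d3, folded P_def[abs_def]]
  have rec: "FF nu (Suc 1) s * (r s)\<^sup>2 = 3 * s * FF nu 1 s - (1 - nu\<^sup>2) * FF nu 0 s"
   unfolding rp(2) using FF_rec[OF nu s, of 0] by (simp add: mult.commute numeral_2_eq_2)
  have gen: "(nu / R) * (R\<^sup>2 * F1 - s * F0 - nu * R * F0) = nu * R * F1 - nu * (s / R) * F0 - nu\<^sup>2 * F0" if "0 < R" for R F1 F0 :: real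
   using that by (simp add: field_simps power2_eq_square)
  define w where "w = s / r s"
  have "(2 * s * FF nu 1 s + - FF nu (Suc 1) s * (r s)\<^sup>2) - (1 * FF nu 0 s + - FF nu (Suc 0) s * s) - ((nu * w) * FF nu 0 s + - FF nu (Suc 0) s * (nu * r s))
   = 2 * s * FF nu 1 s - (3 * s * FF nu 1 s - (1 - nu\<^sup>2) * FF nu 0 s) - (FF nu 0 s - FF nu 1 s * s) - ((nu * w) * FF nu 0 s - FF nu 1 s * (nu * r s))"
   unfolding rec[symmetric] by simp
  also have "\<dots> = nu * r s * FF nu 1 s - nu * w * FF nu 0 s - nu\<^sup>2 * FF nu 0 s" by (simp add: algebra_simps)
  also have "\<dots> = (nu / r s) * P s" unfolding P_def w_def gen[OF rp(1)] ..
  finally show ?thesis using D unfolding w_def P_def[abs_def] by (simp only:)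
 qed
 have P0: "P s = 0" if s: "0 < s" for s
 proof -
  have D: "((\<lambda>s. P s * q s powr (- nu)) has_real_derivative 0) (at s within {0<..})" if "s \<in> {0<..}" for s
  proof (rule has_field_derivative_at_within)
   have s: "0 < s" using that by simp
   have "(nu / r s * P s) * q s powr (- nu) + (- nu * q s powr (- nu) / r s) * P s = 0" by (simp add: mult_ac)
   then show "((\<lambda>s. P s * q s powr (- nu)) has_real_derivative 0) (at s)"
    using DERIV_mult[OF dP[OF s] dq[OF s, of "- nu"]] by (simp only:)
  qed
  have "\<exists>c. \<forall>s\<in>{0<..}. P s * q s powr (- nu) = c"
  proof (rule has_field_derivative_zero_constant)
   show "convex {0::real<..}" by (rule convex_real_interval)
  qed (rule D)
  then obtain c where c: "\<And>s. s \<in> {0<..} \<Longrightarrow> P s * q s powr (- nu) = c" by blast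
  \<comment> \<open>The constant is identified at infinity, where the transforms decay fast enough
    for \<open>P\<close> to vanish like \<open>s^(- nu)\<close>.\<close>
  have "((\<lambda>s. P s * q s powr (- nu)) \<longlongrightarrow> 0) at_top"
  proof (rule Lim_null_comparison)
   define A0 A1 where "A0 = hc nu 0 * Gamma (nu + 1)" and "A1 = hc nu 0 * Gamma (1 + nu + 1)"
   have A: "0 < A0" "0 < A1" unfolding A0_def A1_def using hc0[OF nu] nu by (intro mult_pos_pos Gamma_real_pos; simp)+
   let ?K = "\<lambda>s. (1 + s\<^sup>2) * (A1 / s powr (1 + nu + 1)) + s * (A0 / s powr (nu + 1)) + nu * sqrt (1 + s\<^sup>2) * (A0 / s powr (nu + 1))"
   show "\<forall>\<^sub>F s in at_top. norm (P s * q s powr (- nu)) \<le> ?K s"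
    using eventually_gt_at_top[of 0]
   proof eventually_elim
    case (elim s)
    have f0: "\<bar>FF nu 0 s\<bar> \<le> A0 / s powr (nu + 1)" "\<bar>FF nu 1 s\<bar> \<le> A1 / s powr (1 + nu + 1)"
     using Lap_integrable(2)[OF _ elim bh_cont(1)[OF nu] bh_bound(1)[OF nu], of nu] Lap_integrable(2)[OF _ elim bh_cont(1)[OF nu] bh_bound(1)[OF nu], of "1 + nu"] nu
     by (simp_all add: FF_def[OF nu] A0_def A1_def)
    have "q s powr (- nu) \<le> 1" using qp[OF elim] nu powr_mono2'[of "- nu" 1 "q s"] by simp
    then have "norm (P s * q s powr (- nu)) \<le> \<bar>P s\<bar>" by (simp add: abs_mult mult_left_le)
    also have "\<dots> \<le> \<bar>(1 + s\<^sup>2) * FF nu 1 s\<bar> + \<bar>s * FF nu 0 s\<bar> + \<bar>nu * r s * FF nu 0 s\<bar>" unfolding P_def rp(2) by linarith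
    also have "\<dots> \<le> ?K s" unfolding abs_mult using f0 nu elim rp(1)[of s]
     by (intro add_mono mult_mono) (auto simp: r_def add_nonneg_nonneg)
    finally show ?case .
   qed
   show "(?K \<longlongrightarrow> 0) at_top" using nu A by real_asymp
  qed
  moreover have "((\<lambda>s. P s * q s powr (- nu)) \<longlongrightarrow> c) at_top"
   by (rule tendsto_eventually) (use eventually_gt_at_top[of 0] in \<open>eventually_elim, simp add: c\<close>)
  ultimately have "c = 0" using tendsto_unique trivial_limit_at_top_linorder by blast
  then show ?thesis using c[of s] s qp[OF s] by simp
 qed
 have D: "((\<lambda>s. r s * FF nu 0 s * q s powr nu) has_real_derivative 0) (at s within {0<..})" if "s \<in> {0<..}" for s
 proof (rule has_field_derivative_at_within)
  have s: "0 < s" using that by simp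
  have gen: "(s / R * F0 + - F1 * R) * Q + (nu * Q / R) * (R * F0) = - (Q / R) * (R\<^sup>2 * F1 - s * F0 - nu * R * F0)" if "0 < R" for R F1 F0 Q :: real
   using that by (simp add: field_simps power2_eq_square)
  have "(s / r s * FF nu 0 s + - FF nu (Suc 0) s * r s) * q s powr nu + (nu * q s powr nu / r s) * (r s * FF nu 0 s) = 0"
   unfolding gen[OF rp(1)] using P0[OF s] by (simp add: P_def)
  then show "((\<lambda>s. r s * FF nu 0 s * q s powr nu) has_real_derivative 0) (at s)"
   using DERIV_mult[OF DERIV_mult[OF dr FF_deriv[OF s]] dq[OF s, of nu], of 0] by (simp only:)
 qed
 have "\<exists>B. \<forall>s\<in>{0<..}. r s * FF nu 0 s * q s powr nu = B"
 proof (rule has_field_derivative_zero_constant)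
  show "convex {0::real<..}" by (rule convex_real_interval)
 qed (rule D)
 then obtain B where B: "\<And>s. s \<in> {0<..} \<Longrightarrow> r s * FF nu 0 s * q s powr nu = B" by blast
 \<comment> \<open>Shows \<open>B\<close> to be nonzero. The mean value theorem gives
   \<open>bh >= h - h x\<close>, and at \<open>s = 2\<close> the resulting lower bound carries the
   factor \<open>1 - (nu + 1)/2\<close>, positive because \<open>nu < 1\<close>.\<close>
 have "0 < FF nu 0 2"
 proof -
  let ?i = "\<lambda>a x. indicator {0::real<..} x * (x powr (a - 1) * exp (- (2 * x)))"
  have i: "integrable lborel (?i a)" "integral\<^sup>L lborel (?i a) = Gamma a / 2 powr a" if "0 < a" for a :: real
   using Gamma_scaled[of a 2] that by auto
  define h where "h = hc nu 0"
  have low: "h - h * x \<le> bh nu x" if x: "0 < x" for x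
  proof -
   obtain y where y: "0 < y" "y < x" "bh nu x - bh nu 0 = (x - 0) * bh' nu y"
    using MVT2[OF x, of "bh nu" "bh' nu"] bh_deriv(1)[OF nu] by blast
   have "- h * x \<le> bh' nu y * x" using bh_bound(2)[OF nu y(1)] x unfolding h_def by (intro mult_right_mono) (auto simp: abs_le_iff)
   then show ?thesis using y(3) bh_0(1)[OF nu] by (simp add: h_def mult.commute)
  qed
  have "h * (Gamma (nu + 1) / 2 powr (nu + 1)) - h * (Gamma (nu + 2) / 2 powr (nu + 2)) = (\<integral>x. h * ?i (nu + 1) x - h * ?i (nu + 2) x \<partial>lborel)"
   using i[of "nu + 1"] i[of "nu + 2"] nu by simp
  also have "\<dots> \<le> (\<integral>x. indicator {0<..} x * (x powr (real 0 + nu) * bh nu x * exp (- (2 * x))) \<partial>lborel)"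
  proof (rule integral_mono)
   show "integrable lborel (\<lambda>x. h * ?i (nu + 1) x - h * ?i (nu + 2) x)" using nu by (intro Bochner_Integration.integrable_diff integrable_mult_right i) auto
   show "integrable lborel (\<lambda>x. indicator {0<..} x * (x powr (real 0 + nu) * bh nu x * exp (- (2 * x))))"
    using nu by (intro Lap_integrable(1)[OF _ _ bh_cont(1)[OF nu] bh_bound(1)[OF nu]]) auto
   fix x :: real
   show "h * ?i (nu + 1) x - h * ?i (nu + 2) x \<le> indicator {0<..} x * (x powr (real 0 + nu) * bh nu x * exp (- (2 * x)))"
   proof (cases "0 < x")
    case True
    have "x powr (nu + 2 - 1) = x powr nu * x" using True powr_add[of x nu 1] by (simp add: add.commute)
    then have "h * ?i (nu + 1) x - h * ?i (nu + 2) x = (x powr nu * exp (- (2 * x))) * (h - h * x)" using True by (simp add: algebra_simps)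
    also have "\<dots> \<le> (x powr nu * exp (- (2 * x))) * bh nu x" by (intro mult_left_mono low True) simp
    finally show ?thesis using True by (simp add: mult_ac)
   qed simp
  qed
  also have "\<dots> = FF nu 0 2" by (simp add: FF_def[OF nu] Lap_def)
  finally have "h * (Gamma (nu + 1) / 2 powr (nu + 1)) - h * (Gamma (nu + 2) / 2 powr (nu + 2)) \<le> FF nu 0 2" .
  moreover have "Gamma (nu + 2) = (nu + 1) * Gamma (nu + 1)"
   using Gamma_plus1[of "nu + 1"] nu nonpos_Ints_nonpos[of "nu + 1"] by (force simp: add_ac)
  moreover have "2 powr (nu + 2) = 2 * 2 powr (nu + 1)" using powr_add[of 2 "nu + 1" 1] by (simp add: add_ac)
  moreover have "h * (G / T) - h * ((nu + 1) * G / (2 * T)) = h * (G / T) * (1 - (nu + 1) / 2)" if "T \<noteq> 0" for G T :: real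
   using that by (simp add: field_simps)
  ultimately have "h * (Gamma (nu + 1) / 2 powr (nu + 1)) * (1 - (nu + 1) / 2) \<le> FF nu 0 2" by simp
  moreover have "0 < h * (Gamma (nu + 1) / 2 powr (nu + 1)) * (1 - (nu + 1) / 2)"
   using nu hc0[OF nu] Gamma_real_pos[of "nu + 1"] unfolding h_def by (intro mult_pos_pos divide_pos_pos) auto
  ultimately show ?thesis by linarith
 qed
 then have "B \<noteq> 0" using B[of 2] rp(1)[of 2] qp[of 2] by auto
 have f0: "FF nu 0 s = B / (r s * q s powr nu)" if "0 < s" for s
 proof -
  have "r s * q s powr nu \<noteq> 0" using rp(1)[of s] qp[OF that] by simp
  then show ?thesis using B[of s] that by (simp add: nonzero_eq_divide_eq mult_ac)
 qed
 have sl: "((\<lambda>s::real. s) \<longlongrightarrow> 0) (at_right 0)" by (rule tendsto_ident_at)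
 have "((\<lambda>s. sqrt (1 + s\<^sup>2)) \<longlongrightarrow> sqrt (1 + 0\<^sup>2)) (at_right 0)" by (intro tendsto_intros sl)
 then have lr: "(r \<longlongrightarrow> 1) (at_right 0)" by (simp add: r_def[abs_def])
 have lq: "(q \<longlongrightarrow> 0 + 1) (at_right 0)" unfolding q_def[abs_def] by (rule tendsto_add[OF sl lr])
 have lim0: "(FF nu 0 \<longlongrightarrow> B) (at_right 0)"
 proof (rule Lim_transform_eventually)
  have "((\<lambda>s. B / (r s * q s powr nu)) \<longlongrightarrow> B / (1 * (0 + 1) powr nu)) (at_right 0)"
   by (intro tendsto_divide tendsto_const tendsto_mult tendsto_powr lr lq) simp_all
  then show "((\<lambda>s. B / (r s * q s powr nu)) \<longlongrightarrow> B) (at_right 0)" by simp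
  show "\<forall>\<^sub>F s in at_right 0. B / (r s * q s powr nu) = FF nu 0 s"
   using eventually_at_right_less[of 0] by eventually_elim (simp only: f0)
 qed
 have lim1: "(FF nu (Suc 0) \<longlongrightarrow> nu * B) (at_right 0)"
 proof (rule Lim_transform_eventually)
  have "((\<lambda>s. (s + nu * r s) * FF nu 0 s / (1 + s\<^sup>2)) \<longlongrightarrow> (0 + nu * 1) * B / (1 + 0\<^sup>2)) (at_right 0)"
   by (intro tendsto_divide tendsto_mult tendsto_add tendsto_const tendsto_power sl lr lim0) simp
  then show "((\<lambda>s. (s + nu * sqrt (1 + s\<^sup>2)) * FF nu 0 s / (1 + s\<^sup>2)) \<longlongrightarrow> nu * B) (at_right 0)" by (simp add: r_def)
  show "\<forall>\<^sub>F s in at_right 0. (s + nu * sqrt (1 + s\<^sup>2)) * FF nu 0 s / (1 + s\<^sup>2) = FF nu (Suc 0) s"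
   using eventually_at_right_less[of 0]
  proof eventually_elim
   case (elim s)
   have n: "1 + s\<^sup>2 \<noteq> 0" unfolding rp(2)[symmetric] using rp(1)[of s] by simp
   have "(1 + s\<^sup>2) * FF nu (Suc 0) s = (s + nu * sqrt (1 + s\<^sup>2)) * FF nu 0 s"
    using P0[OF elim] unfolding P_def rp(2) by (simp add: r_def algebra_simps)
   then show ?case using n by (simp add: divide_eq_eq mult.commute)
  qed
 qed
 have "(FF nu j \<longlongrightarrow> MM B j) (at_right 0)" for j
 proof (induction j rule: induct_nat_012)
  case (ge2 j)
  show ?case
  proof (rule Lim_transform_eventually)
   have "((\<lambda>s. ((2 * real j + 3) * s * FF nu (j + 1) s - ((real j + 1)\<^sup>2 - nu\<^sup>2) * FF nu j s) / (1 + s\<^sup>2)) \<longlongrightarrow>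
    ((2 * real j + 3) * 0 * MM B (Suc j) - ((real j + 1)\<^sup>2 - nu\<^sup>2) * MM B j) / (1 + 0\<^sup>2)) (at_right 0)"
    by (intro tendsto_divide tendsto_diff tendsto_mult tendsto_add tendsto_const tendsto_power sl) (use ge2 in simp_all)
   then show "((\<lambda>s. ((2 * real j + 3) * s * FF nu (j + 1) s - ((real j + 1)\<^sup>2 - nu\<^sup>2) * FF nu j s) / (1 + s\<^sup>2)) \<longlongrightarrow> MM B (Suc (Suc j))) (at_right 0)"
    by (simp add: algebra_simps)
   show "\<forall>\<^sub>F s in at_right 0. ((2 * real j + 3) * s * FF nu (j + 1) s - ((real j + 1)\<^sup>2 - nu\<^sup>2) * FF nu j s) / (1 + s\<^sup>2) = FF nu (Suc (Suc j)) s"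
    using eventually_at_right_less[of 0]
   proof eventually_elim
    case (elim s)
    have n: "1 + s\<^sup>2 \<noteq> 0" unfolding rp(2)[symmetric] using rp(1)[of s] by simp
    show ?case unfolding FF_rec[OF nu elim, symmetric] using n by simp
   qed
  qed
 qed (simp_all add: lim0 lim1)
 with \<open>B \<noteq> 0\<close> show ?thesis by blast
qed

end

section \<open>Hankel determinants\<close>
lemma det_tendsto:
 fixes F :: "'b \<Rightarrow> real mat"
 assumes F: "\<And>s. F s \<in> carrier_mat n n" and A: "A \<in> carrier_mat n n"
  and lim: "\<And>i j. i < n \<Longrightarrow> j < n \<Longrightarrow> ((\<lambda>s. F s $$ (i, j)) \<longlongrightarrow> A $$ (i, j)) G"
 shows "((\<lambda>s. Determinant.det (F s)) \<longlongrightarrow> Determinant.det A) G"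
 unfolding Determinant.det_def'[OF F] Determinant.det_def'[OF A]
proof (intro tendsto_sum tendsto_mult tendsto_const tendsto_prod)
 fix p i assume "p \<in> {p. p permutes {0..<n}}" "i \<in> {0..<n}"
 then have "p i < n" "i < n" using permutes_in_image[of p "{0..<n}" i] by auto
 then show "((\<lambda>s. F s $$ (i, p i)) \<longlongrightarrow> A $$ (i, p i)) G" by (rule lim[rotated])
qed

lemma nonsingular_solution:
 fixes A :: "real mat"
 assumes A: "A \<in> carrier_mat n n" and b: "b \<in> carrier_vec n" and d: "Determinant.det A \<noteq> 0"
 shows "\<exists>x\<in>carrier_vec n. A *\<^sub>v x = b"
proof (intro bexI)
 let ?y = "adj_mat A *\<^sub>v b"
 have y: "?y \<in> carrier_vec n" using adj_mat(1)[OF A] b by simp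
 have "A *\<^sub>v ?y = (A * adj_mat A) *\<^sub>v b" using A adj_mat(1)[OF A] b by (simp add: assoc_mult_mat_vec)
 also have "\<dots> = Determinant.det A \<cdot>\<^sub>v b"
 proof (rule eq_vecI)
  fix i assume "i < dim_vec (Determinant.det A \<cdot>\<^sub>v b)"
  then have i: "i < n" using b by simp
  have "((A * adj_mat A) *\<^sub>v b) $ i = (\<Sum>k\<in>{0..<n}. Determinant.det A * (if k = i then 1 else 0) * b $ k)"
   unfolding adj_mat(2)[OF A] using i b by (simp add: scalar_prod_def)
  also have "\<dots> = (\<Sum>k\<in>{0..<n}. if k = i then Determinant.det A * b $ i else 0)" by (intro sum.cong) auto
  finally show "((A * adj_mat A) *\<^sub>v b) $ i = (Determinant.det A \<cdot>\<^sub>v b) $ i" using i b by simp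
 qed (use A b in simp)
 finally have e: "A *\<^sub>v ?y = Determinant.det A \<cdot>\<^sub>v b" .
 show "A *\<^sub>v ((1 / Determinant.det A) \<cdot>\<^sub>v ?y) = b"
  unfolding mult_mat_vec[OF A y] e using d b by (simp add: smult_smult_assoc)
 show "(1 / Determinant.det A) \<cdot>\<^sub>v ?y \<in> carrier_vec n" using y by simp
qed

lemma nonsingular_kernel:
 fixes h :: "nat \<Rightarrow> nat \<Rightarrow> real" and d :: "nat \<Rightarrow> complex"
 assumes det: "Determinant.det (Matrix.mat n n (\<lambda>(i, j). h i j)) \<noteq> 0"
  and z: "\<And>j. j < n \<Longrightarrow> (\<Sum>k<n. of_real (h j k) * d k) = 0" and k: "k < n"
 shows "d k = 0"
proof -
 let ?A = "Matrix.mat n n (\<lambda>(i, j). h i j)"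
 have A: "?A \<in> carrier_mat n n" by simp
 have main: "e k = 0" if e: "\<And>j. j < n \<Longrightarrow> (\<Sum>k<n. h j k * e k) = 0" for e :: "nat \<Rightarrow> real"
 proof -
  have "?A *\<^sub>v vec n e = 0\<^sub>v n"
  proof (rule eq_vecI)
   fix i assume i: "i < dim_vec (0\<^sub>v n :: real vec)"
   then show "(?A *\<^sub>v vec n e) $ i = 0\<^sub>v n $ i"
    using e[of i] by (simp add: scalar_prod_def atLeast0LessThan)
  qed simp
  then have "vec n e = 0\<^sub>v n" using det_0_iff_vec_prod_zero[OF A] det by (metis vec_carrier)
  then show ?thesis using k by (metis index_vec index_zero_vec(1))
 qed
 have "Re (d k) = 0"
 proof (rule main)
  fix j assume "j < n"
  then have "Re (\<Sum>k<n. of_real (h j k) * d k) = 0" using z by simp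
  then show "(\<Sum>k<n. h j k * Re (d k)) = 0" by simp
 qed
 moreover have "Im (d k) = 0"
 proof (rule main)
  fix j assume "j < n"
  then have "Im (\<Sum>k<n. of_real (h j k) * d k) = 0" using z by simp
  then show "(\<Sum>k<n. h j k * Im (d k)) = 0" by simp
 qed
 ultimately show ?thesis by (simp add: complex_eq_iff)
qed

lemma has_integral_zero_iff:
 fixes f :: "real \<Rightarrow> complex"
 assumes "(f has_integral S) A"
 shows "(f has_integral 0) A \<longleftrightarrow> S = 0"
 using assms has_integral_unique by metis

section \<open>Damped polynomials, their limit and its uniqueness\<close>

definition monic_of :: "nat \<Rightarrow> real vec \<Rightarrow> complex poly" where
 "monic_of n x = (\<Sum>k<n. Polynomial.monom (of_real (x $ k)) k) + Polynomial.monom 1 n"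

lemma coeff_monic_of: "Polynomial.coeff (monic_of n x) k = (if k < n then of_real (x $ k) else if k = n then 1 else 0)"
 by (auto simp: monic_of_def coeff_sum)

lemma monic_of_monic: "degree (monic_of n x) = n" "lead_coeff (monic_of n x) = 1"
proof -
 show d: "degree (monic_of n x) = n"
  by (intro antisym degree_le le_degree) (auto simp: coeff_monic_of)
 show "lead_coeff (monic_of n x) = 1" unfolding d coeff_monic_of by simp
qed

lemma poly_monic_of: "poly (monic_of n x) z = (\<Sum>k<n. of_real (x $ k) * z ^ k) + z ^ n"
 by (simp add: monic_of_def poly_sum poly_monom)

context
 fixes nu :: real assumes nu: "0 < nu" "nu \<le> 1/2"
begin

lemma damped_iff:
 assumes s: "0 < s"
 shows "damped_bessel_OP nu n s p \<longleftrightarrow> degree p = n \<and> lead_coeff p = 1 \<and>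
  (\<forall>j<n. (\<Sum>k\<le>n. Polynomial.coeff p k * of_real (FF nu (j + k) s)) = 0)"
proof -
 have "((\<lambda>x. poly p (of_real x) * of_real (x ^ j * bessel_J nu x * exp (- s * x))) has_integral (\<Sum>k\<le>n. Polynomial.coeff p k * of_real (FF nu (j + k) s))) {0..}"
  if d: "degree p = n" for j
 proof -
  have "((\<lambda>x. \<Sum>k\<le>n. Polynomial.coeff p k * of_real (x ^ (j + k) * bessel_J nu x * exp (- s * x))) has_integral (\<Sum>k\<le>n. Polynomial.coeff p k * of_real (FF nu (j + k) s))) {0..}"
  proof (intro has_integral_sum has_integral_mult_right)
   fix k
   show "((\<lambda>x. complex_of_real (x ^ (j + k) * bessel_J nu x * exp (- s * x))) has_integral of_real (FF nu (j + k) s)) {0..}"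
    using has_integral_linear[OF FF_integral[OF nu s, of "j + k"] bounded_linear_of_real] by (simp only: o_def)
  qed simp
  moreover have "(\<Sum>k\<le>n. Polynomial.coeff p k * of_real (x ^ (j + k) * bessel_J nu x * exp (- s * x))) = poly p (of_real x) * of_real (x ^ j * bessel_J nu x * exp (- s * x))" for x
   unfolding poly_altdef d sum_distrib_right by (intro sum.cong refl) (simp add: power_add mult_ac)
  ultimately show ?thesis by simp
 qed
 note I = this
 have "degree p = n \<longrightarrow> (\<forall>j<n. ((\<lambda>x. poly p (of_real x) * of_real (x ^ j * bessel_J nu x * exp (- s * x))) has_integral 0) {0..}) =
   (\<forall>j<n. (\<Sum>k\<le>n. Polynomial.coeff p k * of_real (FF nu (j + k) s)) = 0)"
  by (intro impI all_cong has_integral_zero_iff[OF I])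
 then show ?thesis unfolding damped_bessel_OP_def by argo
qed

text \<open>The damped Hankel determinant converges to the nonzero limit determinant, so for small
  \<open>s\<close> the damped polynomial exists and is unique; its coefficients are Cramer quotients
  and converge.\<close>

lemma hankel_main:
 assumes M: "\<And>j. (FF nu j \<longlongrightarrow> M j) (at_right 0)"
  and det: "Determinant.det (Matrix.mat n n (\<lambda>(i, j). M (i + j))) \<noteq> 0"
 shows "\<exists>p. (\<forall>p'. bessel_OP_rel nu n p' \<longleftrightarrow> p' = p) \<and> degree p = n \<and> lead_coeff p = 1 \<and>
  (\<forall>j<n. (\<Sum>k\<le>n. Polynomial.coeff p k * of_real (M (j + k))) = 0)"
proof -
 define H where "H s = Matrix.mat n n (\<lambda>(i, j). FF nu (i + j) s)" for s
 define b where "b s = vec n (\<lambda>i. - FF nu (i + n) s)" for s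
 define H0 where "H0 = Matrix.mat n n (\<lambda>(i, j). M (i + j))"
 define b0 where "b0 = vec n (\<lambda>i. - M (i + n))"
 have c: "H s \<in> carrier_mat n n" "H0 \<in> carrier_mat n n" "b s \<in> carrier_vec n" "b0 \<in> carrier_vec n" for s
  by (auto simp: H_def H0_def b_def b0_def)
 have dlim: "((\<lambda>s. Determinant.det (H s)) \<longlongrightarrow> Determinant.det H0) (at_right 0)"
  by (rule det_tendsto[OF c(1,2)]) (simp add: H_def H0_def M)
 have d0: "Determinant.det H0 \<noteq> 0" using det by (simp add: H0_def)
 have ev: "\<forall>\<^sub>F s in at_right 0. Determinant.det (H s) \<noteq> 0" by (rule tendsto_imp_eventually_ne[OF dlim d0])
 have ev0: "\<forall>\<^sub>F s in at_right 0. 0 < (s::real)" by (rule eventually_at_right_less)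
 obtain x0 where x0: "x0 \<in> carrier_vec n" "H0 *\<^sub>v x0 = b0" using nonsingular_solution[OF c(2) c(4) d0] by blast
 \<comment> \<open>The choice is arbitrary where the determinant vanishes, which does not happen for
   small \<open>s\<close>.\<close>
 define X where "X s = (SOME x. x \<in> carrier_vec n \<and> H s *\<^sub>v x = b s)" for s
 have X: "X s \<in> carrier_vec n \<and> H s *\<^sub>v X s = b s" if "Determinant.det (H s) \<noteq> 0" for s
  unfolding X_def by (rule someI_ex) (use nonsingular_solution[OF c(1) c(3) that] in blast)
 have Xlim: "((\<lambda>s. X s $ k) \<longlongrightarrow> x0 $ k) (at_right 0)" if k: "k < n" for k
 proof (rule Lim_transform_eventually)
  have "((\<lambda>s. Determinant.det (replace_col (H s) (b s) k)) \<longlongrightarrow> Determinant.det (replace_col H0 b0 k)) (at_right 0)"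
   by (rule det_tendsto[of _ n]) (auto simp: replace_col_def H_def H0_def b_def b0_def intro!: M tendsto_minus)
  from tendsto_divide[OF this dlim d0]
  show "((\<lambda>s. Determinant.det (replace_col (H s) (b s) k) / Determinant.det (H s)) \<longlongrightarrow> x0 $ k) (at_right 0)"
   using cramer_lemma_mat[OF c(2) x0(1) k] x0(2) d0 by simp
  show "\<forall>\<^sub>F s in at_right 0. Determinant.det (replace_col (H s) (b s) k) / Determinant.det (H s) = X s $ k"
   using ev
  proof eventually_elim
   case (elim s)
   then show ?case using cramer_lemma_mat[OF c(1)[of s] conjunct1[OF X[OF elim]] k] X[OF elim] by simp
  qed
 qed
 have ortho: "(\<Sum>k\<le>n. Polynomial.coeff (monic_of n x) k * of_real (f (j + k))) = 0"
  if x: "x \<in> carrier_vec n" "Matrix.mat n n (\<lambda>(i, j). f (i + j)) *\<^sub>v x = vec n (\<lambda>i. - f (i + n))" and j: "j < n" for x f j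
 proof -
  have "(\<Sum>k<n. f (j + k) * x $ k) = - f (j + n)"
  proof -
   have "(Matrix.mat n n (\<lambda>(i, j). f (i + j)) *\<^sub>v x) $ j = - f (j + n)" unfolding x(2) using j by simp
   then show ?thesis using j x(1) by (simp add: scalar_prod_def atLeast0LessThan)
  qed
  then have "complex_of_real (\<Sum>k<n. f (j + k) * x $ k) = of_real (- f (j + n))" by (simp only:)
  moreover have "(\<Sum>k\<le>n. Polynomial.coeff (monic_of n x) k * of_real (f (j + k))) = of_real (\<Sum>k<n. f (j + k) * x $ k) + of_real (f (j + n))"
   unfolding lessThan_Suc_atMost[symmetric] sum.lessThan_Suc by (simp add: coeff_monic_of mult.commute)
  ultimately show ?thesis by simp
 qed
 define p where "p = monic_of n x0"
 have damped: "\<forall>\<^sub>F s in at_right 0. damped_bessel_OP nu n s (monic_of n (X s))"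
  using ev ev0
 proof eventually_elim
  case (elim s)
  have "\<forall>j<n. (\<Sum>k\<le>n. Polynomial.coeff (monic_of n (X s)) k * of_real (FF nu (j + k) s)) = 0"
   using ortho[of "X s" "\<lambda>j. FF nu j s"] X[OF elim(1)] unfolding H_def b_def by blast
  then show ?case unfolding damped_iff[OF elim(2)] using monic_of_monic by blast
 qed
 have plim: "((\<lambda>s. poly (monic_of n (X s)) z) \<longlongrightarrow> poly p z) (at_right 0)" for z
  unfolding poly_monic_of p_def by (intro tendsto_intros Xlim) simp
 have rel: "bessel_OP_rel nu n p"
  unfolding bessel_OP_rel_def using monic_of_monic[of n x0] damped plim unfolding p_def[symmetric]
  by (intro conjI exI[of _ "\<lambda>s. monic_of n (X s)"]) auto
 have uniq: "p' = p" if p': "bessel_OP_rel nu n p'" for p'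
 proof -
  obtain Q where Q: "\<forall>\<^sub>F s in at_right 0. damped_bessel_OP nu n s (Q s)" "\<And>z. ((\<lambda>s. poly (Q s) z) \<longlongrightarrow> poly p' z) (at_right 0)"
   using p' unfolding bessel_OP_rel_def by blast
  \<comment> \<open>Any admissible choice \<open>Q s\<close> coincides with the constructed
    polynomial for small \<open>s\<close>, so all choices share one limit.\<close>
  have eq: "\<forall>\<^sub>F s in at_right 0. Q s = monic_of n (X s)"
   using Q(1) damped ev ev0
  proof eventually_elim
   case (elim s)
   define d where "d k = Polynomial.coeff (Q s) k - Polynomial.coeff (monic_of n (X s)) k" for k
   note D = elim(1)[unfolded damped_iff[OF elim(4)]] elim(2)[unfolded damped_iff[OF elim(4)]]
   have dn: "d n = 0" using D unfolding d_def by (metis diff_self)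
   have z: "(\<Sum>k<n. of_real (FF nu (j + k) s) * d k) = 0" if j: "j < n" for j
   proof -
    have "(\<Sum>k\<le>n. of_real (FF nu (j + k) s) * d k) = (\<Sum>k\<le>n. Polynomial.coeff (Q s) k * of_real (FF nu (j + k) s)) - (\<Sum>k\<le>n. Polynomial.coeff (monic_of n (X s)) k * of_real (FF nu (j + k) s))"
     unfolding d_def sum_subtractf[symmetric] by (intro sum.cong refl) (simp add: algebra_simps)
    also have "\<dots> = 0" using D j by simp
    finally show ?thesis unfolding lessThan_Suc_atMost[symmetric] sum.lessThan_Suc dn by simp
   qed
   have "d k = 0" if "k < n" for k
    by (rule nonsingular_kernel[OF _ z that]) (use elim(3) in \<open>simp_all add: H_def\<close>)
   show ?case
   proof (rule poly_eqI)
    fix k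
    show "Polynomial.coeff (Q s) k = Polynomial.coeff (monic_of n (X s)) k"
    proof (cases "k < n")
     case True
     then show ?thesis using \<open>\<And>k. k < n \<Longrightarrow> d k = 0\<close>[of k] by (simp add: d_def)
    next
     case False
     then show ?thesis using dn D by (cases "k = n") (auto simp: d_def coeff_eq_0)
    qed
   qed
  qed
  have "poly p' z = poly p z" for z
  proof (rule tendsto_unique[OF _ Q(2)[of z]])
   show "((\<lambda>s. poly (Q s) z) \<longlongrightarrow> poly p z) (at_right 0)"
    by (rule Lim_transform_eventually[OF plim[of z]]) (use eq in \<open>eventually_elim, simp\<close>)
  qed simp
  then show ?thesis by (intro poly_eq_poly_eq_iff[THEN iffD1] ext)
 qed
 show ?thesis
 proof (intro exI[of _ p] conjI allI impI)
  show "bessel_OP_rel nu n p' \<longleftrightarrow> p' = p" for p' using rel uniq by blast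
  show "degree p = n" "lead_coeff p = 1" unfolding p_def by (rule monic_of_monic)+
  show "(\<Sum>k\<le>n. Polynomial.coeff p k * of_real (M (j + k))) = 0" if "j < n" for j
   unfolding p_def by (rule ortho[OF x0(1) _ that]) (use x0(2) in \<open>simp add: H0_def b0_def\<close>)
 qed
qed

section \<open>Rotation of the variable to the real line and nondegeneracy\<close>

definition dil :: "complex poly \<Rightarrow> complex poly" where "dil p = pcompose p [:0, \<i> * of_real pi:]"

lemma poly_dil: "poly (dil p) x = poly p (\<i> * of_real pi * x)" by (simp add: dil_def poly_pcompose mult.commute)

lemma degree_dil: "degree (dil p) = degree p" by (simp add: dil_def degree_pcompose)

lemma dil_surj: "\<exists>r. dil r = q \<and> degree r = degree q"
proof (intro exI conjI)
 let ?r = "pcompose q [:0, 1 / (\<i> * of_real pi):]"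
 show "dil ?r = q"
  by (intro poly_eq_poly_eq_iff[THEN iffD1] ext) (simp add: dil_def poly_pcompose)
 show "degree ?r = degree q" by (simp add: degree_pcompose)
qed

lemma ww_dil:
 "(\<integral>x. ww nu x * poly (dil p * dil q) (of_real x) \<partial>lborel) =
 (\<Sum>j\<le>degree q. Polynomial.coeff q j * (\<Sum>k\<le>degree p. Polynomial.coeff p k * (\<integral>x. ww nu x * (\<i> * of_real pi * of_real x) ^ (j + k) \<partial>lborel)))"
proof -
 have I: "integrable lborel (\<lambda>x. ww nu x * (\<i> * of_real pi * of_real x) ^ i)" for i
  using ww_integrable[OF nu, of "dil (Polynomial.monom 1 i)"] by (simp add: poly_dil poly_monom)
 have "ww nu x * poly (dil p * dil q) (of_real x) = (\<Sum>j\<le>degree q. Polynomial.coeff q j * (\<Sum>k\<le>degree p. Polynomial.coeff p k * (ww nu x * (\<i> * of_real pi * of_real x) ^ (j + k))))" for x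
 proof -
  define y where "y = \<i> * of_real pi * complex_of_real x"
  have inner: "(\<Sum>k\<le>degree p. Polynomial.coeff p k * (ww nu x * y ^ (j + k))) = (ww nu x * poly p y) * y ^ j" for j
   unfolding poly_altdef[of p] sum_distrib_left sum_distrib_right by (intro sum.cong refl) (simp add: power_add mult_ac)
  have "(\<Sum>j\<le>degree q. Polynomial.coeff q j * ((ww nu x * poly p y) * y ^ j)) = (ww nu x * poly p y) * poly q y"
   unfolding poly_altdef[of q] sum_distrib_left by (intro sum.cong refl) (simp add: mult_ac)
  then show ?thesis unfolding y_def[symmetric] inner poly_mult poly_dil by (simp only: mult.assoc)
 qed
 then show ?thesis using I by (simp add: Bochner_Integration.integrable_sum)
qed

text \<open>A kernel vector of the Hankel matrix gives a polynomial of degree below \<open>n\<close>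
  that annihilates, after \<open>dil\<close>, every polynomial of no larger degree;
  \<open>ww_definite\<close> forces it to vanish. Hence nondegeneracy for every
  \<open>n\<close>.\<close>

lemma ww_hankel_det:
 assumes C: "C \<noteq> 0" "\<And>j. of_real (M j) = C * (\<integral>x. ww nu x * (\<i> * of_real pi * of_real x) ^ j \<partial>lborel)"
 shows "Determinant.det (Matrix.mat n n (\<lambda>(i, j). M (i + j))) \<noteq> 0"
proof
 let ?A = "Matrix.mat n n (\<lambda>(i, j). M (i + j)) :: real mat"
 have A: "?A \<in> carrier_mat n n" by simp
 assume "Determinant.det ?A = 0"
 then obtain v where v: "v \<in> carrier_vec n" "v \<noteq> 0\<^sub>v n" "?A *\<^sub>v v = 0\<^sub>v n" using det_0_iff_vec_prod_zero[OF A] by blast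
 define r where "r = (\<Sum>k<n. Polynomial.monom (complex_of_real (v $ k)) k)"
 have cr: "Polynomial.coeff r k = (if k < n then of_real (v $ k) else 0)" for k by (auto simp: r_def coeff_sum)
 obtain k0 where k0: "k0 < n" "v $ k0 \<noteq> 0"
 proof -
  have "\<exists>k<n. v $ k \<noteq> 0"
  proof (rule ccontr)
   assume "\<not> ?thesis"
   then have "v = 0\<^sub>v n" using v(1) by (intro eq_vecI) auto
   then show False using v(2) by simp
  qed
  then show ?thesis using that by blast
 qed
 have n: "0 < n" using k0 by simp
 have r0: "r \<noteq> 0" using cr[of k0] k0 by auto
 have dr: "degree r < n"
 proof -
  have "degree r \<le> n - 1" by (intro degree_le) (auto simp: cr)
  then show ?thesis using n by linarith
 qed
 have zero: "(\<Sum>k\<le>degree r. Polynomial.coeff r k * (\<integral>x. ww nu x * (\<i> * of_real pi * of_real x) ^ (j + k) \<partial>lborel)) = 0" if j: "j < n" for j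
 proof -
  have "(\<Sum>k<n. M (j + k) * v $ k) = 0"
  proof -
   have "(?A *\<^sub>v v) $ j = 0" unfolding v(3) using j by simp
   then show ?thesis using j v(1) by (simp add: scalar_prod_def atLeast0LessThan)
  qed
  then have "0 = complex_of_real (\<Sum>k<n. M (j + k) * v $ k)" by simp
  also have "\<dots> = (\<Sum>k<n. of_real (M (j + k)) * Polynomial.coeff r k)" unfolding of_real_sum by (intro sum.cong refl) (simp add: cr)
  also have "\<dots> = (\<Sum>k\<le>degree r. of_real (M (j + k)) * Polynomial.coeff r k)"
   using dr by (intro sum.mono_neutral_right) (auto simp: coeff_eq_0)
  also have "\<dots> = C * (\<Sum>k\<le>degree r. Polynomial.coeff r k * (\<integral>x. ww nu x * (\<i> * of_real pi * of_real x) ^ (j + k) \<partial>lborel))"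
   unfolding C(2) sum_distrib_left by (intro sum.cong refl) (simp add: mult_ac)
  finally show ?thesis using C(1) by simp
 qed
 have "dil r = 0"
 proof (rule ww_definite[OF nu])
  fix q :: "complex poly" assume q: "degree q \<le> degree (dil r)"
  obtain t where t: "dil t = q" "degree t = degree q" using dil_surj by blast
  show "(\<integral>x. ww nu x * poly (dil r * q) (of_real x) \<partial>lborel) = 0"
   unfolding t(1)[symmetric] ww_dil using zero q dr t(2) by (intro sum.neutral) (auto simp: degree_dil)
 qed
 then have "poly r x = 0" for x using poly_dil[of r "x / (\<i> * of_real pi)"] by simp
 then show False using r0 poly_all_0_iff_0 by blast
qed

end

section \<open>Assembly of the error terms and choice of the comparison parameter\<close>

context
 fixes nu :: real assumes nu: "0 < nu" "nu \<le> 1/2"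
begin

text \<open>The comparison parameter stays free. The relative error combines \<open>d1\<close>, the
  polynomial difference seen through the Christoffel kernel, with \<open>d2\<close>, the WKB error
  of the comparison polynomial.\<close>

lemma asymptotics_param:
 assumes K: "compact K" "K \<subseteq> slit_plane"
 shows "\<exists>C N. 0 < C \<and> (\<forall>n\<ge>N. \<forall>z\<in>K. \<forall>eta q. 0 \<le> eta \<and> eta < 1/4 \<and> eta \<le> nu/2 \<and>
  (\<forall>i\<ge>n. Polynomial.coeff (q - mp_poly (1/4 - eta) (1/4 + eta) n) i = 0) \<and>
  (\<forall>p. degree p < n \<longrightarrow> (\<integral>x. ww nu x * poly (q * p) (of_real x) \<partial>lborel) = 0) \<longrightarrow>
  (\<exists>\<delta>. fact n / (2 * of_nat n) ^ n * poly q (of_nat n * z) = leading_term nu n z * (1 + \<delta>) \<and>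
   cmod \<delta> \<le> C * (1 / real n + (nu/2 - eta) + real n powr (eta + nu/8 - 1/2) / (1/4 - eta))))"
proof -
 obtain C1 where C1': "C1 > 0 \<and> (\<forall>eta n q. 0 \<le> eta \<and> eta < 1/4 \<and> eta \<le> nu/2 \<and> 1 \<le> n \<and>
  (\<forall>i\<ge>n. Polynomial.coeff (q - mp_poly (1/4 - eta) (1/4 + eta) n) i = 0) \<and>
  (\<forall>p. degree p < n \<longrightarrow> (\<integral>x. ww nu x * poly (q * p) (of_real x) \<partial>lborel) = 0) \<longrightarrow>
  (\<integral>x. om x * (cmod (poly (q - mp_poly (1/4 - eta) (1/4 + eta) n) (of_real x)))\<^sup>2 \<partial>lborel) \<le> C1 * approx_bound nu eta n)"
  using error_bound[OF nu] by (rule exE)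
 note C1 = conjunct1[OF C1'] conjunct2[OF C1', THEN spec, THEN spec, THEN spec, THEN mp]
 obtain C2 N2 where C2': "0 < C2 \<and> (\<forall>n\<ge>N2. \<forall>z\<in>K. \<forall>eta. 0 \<le> eta \<and> eta \<le> 1 \<longrightarrow>
  mp (1/4 - eta) (1/4 + eta) n (of_nat n * z) \<noteq> 0 \<and>
  (\<Sum>k<n. (cmod (mp (1/4) (1/4) k (of_nat n * z)))\<^sup>2 / hh k) \<le> C2 * sqrt (real n) * (cmod (mp (1/4 - eta) (1/4 + eta) n (of_nat n * z)))\<^sup>2)"
  using kernel_ratio[OF K] by (elim exE)
 note C2 = conjunct1[OF C2'] conjunct2[OF C2', THEN spec, THEN mp, THEN bspec, THEN spec, THEN mp]
 obtain C3 N3 where C3': "0 < C3 \<and> (\<forall>n\<ge>N3. \<forall>z\<in>K. \<forall>eta. 0 \<le> eta \<and> eta \<le> 1 \<and> eta \<le> nu/2 \<and> nu \<le> 2 \<longrightarrow>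
  (\<exists>\<delta>. fact n / (2 * of_nat n) ^ n * mp (1/4 - eta) (1/4 + eta) n (of_nat n * z) = leading_term nu n z * (1 + \<delta>) \<and>
   cmod \<delta> \<le> C3 * (1 / real n + (nu/2 - eta)) \<and> cmod (1 + \<delta>) \<le> C3))"
  using mp_leading[OF K, of nu] by (elim exE)
 note C3 = conjunct1[OF C3'] conjunct2[OF C3', THEN spec, THEN mp, THEN bspec, THEN spec, THEN mp]
 define S where "S = sqrt (C1 * C2)"
 have S: "0 < S" using C1(1) C2(1) by (simp add: S_def)
 define C where "C = C3 * S + C3"
 have C: "0 < C" using C3(1) S by (simp add: C_def add_pos_pos)
 show ?thesis
 proof (rule exI[of _ C], rule exI[of _ "max 1 (max N2 N3)"], rule conjI[OF C], intro allI ballI impI)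
  fix n z eta q
  assume n: "max 1 (max N2 N3) \<le> n" and z: "z \<in> K" and A: "0 \<le> eta \<and> eta < 1/4 \<and> eta \<le> nu/2 \<and>
  (\<forall>i\<ge>n. Polynomial.coeff (q - mp_poly (1/4 - eta) (1/4 + eta) n) i = 0) \<and>
  (\<forall>p. degree p < n \<longrightarrow> (\<integral>x. ww nu x * poly (q * p) (of_real x) \<partial>lborel) = 0)"
  have n1: "1 \<le> n" "N2 \<le> n" "N3 \<le> n" using n by auto
  define X where "X = of_nat n * z"
  define m where "m = mp (1/4 - eta) (1/4 + eta) n X"
  define e where "e = q - mp_poly (1/4 - eta) (1/4 + eta) n"
  define a where "a = 1/4 - eta"
  define \<theta> where "\<theta> = nu/2 - eta"
  have a: "0 < a" and \<theta>: "0 \<le> \<theta>" using A by (auto simp: a_def \<theta>_def)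
  have m0: "m \<noteq> 0" and ker: "(\<Sum>k<n. (cmod (mp (1/4) (1/4) k X))\<^sup>2 / hh k) \<le> C2 * sqrt (real n) * (cmod m)\<^sup>2"
   using C2(2)[OF n1(2) z, of eta] A unfolding m_def X_def by auto
  define p where "p = real n powr (eta + nu/8 - 1/2)"
  have e1: "(\<integral>x. om x * (cmod (poly e (of_real x)))\<^sup>2 \<partial>lborel) \<le> C1 * approx_bound nu eta n"
   unfolding e_def by (rule C1(2)) (use A n1(1) in blast)
  have "(cmod (poly e X))\<^sup>2 \<le> (\<integral>x. om x * (cmod (poly e (of_real x)))\<^sup>2 \<partial>lborel) * (\<Sum>k<n. (cmod (mp (1/4) (1/4) k X))\<^sup>2 / hh k)"
   using A unfolding e_def by (intro christoffel_mq) blast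
  also have "\<dots> \<le> (C1 * approx_bound nu eta n) * (C2 * sqrt (real n) * (cmod m)\<^sup>2)"
  proof (intro mult_mono e1 ker)
   have "0 \<le> approx_bound nu eta n" by (simp add: approx_bound_def[OF nu])
   then show "0 \<le> C1 * approx_bound nu eta n" using C1(1) by simp
   show "0 \<le> (\<Sum>k<n. (cmod (mp (1/4) (1/4) k X))\<^sup>2 / hh k)" using hh_bounds(1) by (intro sum_nonneg divide_nonneg_nonneg) (auto intro: less_imp_le)
  qed
  also have "\<dots> = (C1 * C2) * (approx_bound nu eta n * real n powr (1/2)) * (cmod m)\<^sup>2" by (simp add: powr_half_sqrt mult_ac)
  \<comment> \<open>The factor \<open>sqrt n\<close> is the cost of the kernel in
    \<open>kernel_ratio\<close>; it makes both terms of \<open>approx_bound\<close> perfect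
    squares.\<close>
  also have "approx_bound nu eta n * real n powr (1/2) = (p / a)\<^sup>2 + \<theta>\<^sup>2"
  proof -
   have "real n powr (2 * eta + nu/4 - 3/2) * real n powr (1/2) = p\<^sup>2"
    unfolding p_def power2_eq_square powr_add[symmetric] by (rule arg_cong[where f = "(powr) (real n)"]) simp
   moreover have "real n powr (-1/2) * real n powr (1/2) = 1" unfolding powr_add[symmetric] using n1 by simp
   ultimately show ?thesis unfolding approx_bound_def[OF nu] a_def[symmetric] \<theta>_def[symmetric]
    by (simp only: distrib_right times_divide_eq_left mult.assoc power_divide mult_1_right)
  qed
  also have "(C1 * C2) * ((p / a)\<^sup>2 + \<theta>\<^sup>2) * (cmod m)\<^sup>2 \<le> (S * (p / a + \<theta>) * cmod m)\<^sup>2"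
  proof -
   have "(p / a)\<^sup>2 + \<theta>\<^sup>2 \<le> (p / a + \<theta>)\<^sup>2" using a \<theta> by (simp add: power2_sum p_def)
   then have "(C1 * C2) * ((p / a)\<^sup>2 + \<theta>\<^sup>2) * (cmod m)\<^sup>2 \<le> (C1 * C2) * (p / a + \<theta>)\<^sup>2 * (cmod m)\<^sup>2"
    using C1(1) C2(1) by (intro mult_right_mono mult_left_mono) auto
   also have "\<dots> = (S * (p / a + \<theta>) * cmod m)\<^sup>2"
    unfolding power_mult_distrib using C1(1) C2(1) by (simp add: S_def)
   finally show ?thesis .
  qed
  finally have "cmod (poly e X) \<le> S * (p / a + \<theta>) * cmod m"
   using S a \<theta> by (elim power2_le_imp_le) (auto simp: p_def)
  then have d1: "cmod (poly e X / m) \<le> S * (p / a + \<theta>)" using m0 by (simp add: norm_divide pos_divide_le_eq)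
  define d1 where "d1 = poly e X / m"
  obtain d2 where d2: "fact n / (2 * of_nat n) ^ n * m = leading_term nu n z * (1 + d2)"
   "cmod d2 \<le> C3 * (1 / real n + \<theta>)" "cmod (1 + d2) \<le> C3"
   using C3(2)[OF n1(3) z, of eta] A nu unfolding m_def X_def \<theta>_def by auto
  define d where "d = d1 * (1 + d2) + d2"
  have "poly q X = m * (1 + d1)" using m0 by (simp add: d1_def e_def m_def poly_mp_poly distrib_left)
  then have "fact n / (2 * of_nat n) ^ n * poly q X = leading_term nu n z * (1 + d)"
  proof -
   have "fact n / (2 * of_nat n) ^ n * poly q X = (fact n / (2 * of_nat n) ^ n * m) * (1 + d1)" using \<open>poly q X = m * (1 + d1)\<close> by (simp only: mult.assoc)
   also have "\<dots> = leading_term nu n z * ((1 + d2) * (1 + d1))" unfolding d2(1) by (simp only: mult.assoc)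
   also have "(1 + d2) * (1 + d1) = 1 + d" by (simp add: d_def algebra_simps)
   finally show ?thesis .
  qed
  moreover have "cmod d \<le> C * (1 / real n + \<theta> + p / a)"
  proof -
   have pa: "0 \<le> p / a" using a by (simp add: p_def)
   have "cmod d \<le> cmod d1 * cmod (1 + d2) + cmod d2" unfolding d_def norm_mult[symmetric] by (rule norm_triangle_ineq)
   also have "\<dots> \<le> (S * (p / a + \<theta>)) * C3 + C3 * (1 / real n + \<theta>)"
    using d1 d2 S pa \<theta> C3(1) unfolding d1_def by (intro add_mono mult_mono) auto
   also have "\<dots> \<le> C * (1 / real n + \<theta> + p / a)"
   proof -
    have "C * (1 / real n + \<theta> + p / a) = ((S * (p / a + \<theta>)) * C3 + C3 * (1 / real n + \<theta>)) + (C3 * S * (1 / real n) + C3 * (p / a))"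
     by (simp add: C_def algebra_simps)
    moreover have "0 \<le> C3 * S * (1 / real n) + C3 * (p / a)" using C3(1) S pa by (intro add_nonneg_nonneg mult_nonneg_nonneg) auto
    ultimately show ?thesis by linarith
   qed
   finally show ?thesis .
  qed
  ultimately show "\<exists>\<delta>. fact n / (2 * of_nat n) ^ n * poly q (of_nat n * z) = leading_term nu n z * (1 + \<delta>) \<and>
   cmod \<delta> \<le> C * (1 / real n + (nu/2 - eta) + real n powr (eta + nu/8 - 1/2) / (1/4 - eta))"
   unfolding X_def \<theta>_def p_def a_def by blast
 qed
qed

lemma err_pos: "n \<ge> 3 \<Longrightarrow> 0 < err nu n"
 unfolding err_def by (intro divide_pos_pos) (auto simp: powr_gt_zero)

text \<open>For \<open>nu < 1/2\<close> the choice \<open>eta = nu/2\<close> removes the phase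
  mismatch and leaves order \<open>n^(5 nu/8 - 1/2)\<close>, below the claimed rate. For
  \<open>nu = 1/2\<close> the distance \<open>1/4 - eta\<close> must tend to \<open>0\<close>, since
  it is the phase mismatch, but slowly, since it also enters as a divisor.\<close>

lemma asymptotics:
 assumes K: "compact K" "K \<subseteq> slit_plane"
 shows "\<exists>C. \<forall>\<^sub>F n in sequentially. \<forall>z\<in>K. \<forall>q.
  (degree q \<le> n \<and> Polynomial.coeff q n = 2 ^ n / fact n) \<and>
  (\<forall>p. degree p < n \<longrightarrow> (\<integral>x. ww nu x * poly (q * p) (of_real x) \<partial>lborel) = 0) \<longrightarrow>
  (\<exists>\<delta>. fact n / (2 * of_nat n) ^ n * poly q (of_nat n * z) = leading_term nu n z * (1 + \<delta>) \<and>
   cmod \<delta> \<le> C * err nu n)"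
proof -
 obtain C N where C': "0 < C \<and> (\<forall>n\<ge>N. \<forall>z\<in>K. \<forall>eta q. 0 \<le> eta \<and> eta < 1/4 \<and> eta \<le> nu/2 \<and>
  (\<forall>i\<ge>n. Polynomial.coeff (q - mp_poly (1/4 - eta) (1/4 + eta) n) i = 0) \<and>
  (\<forall>p. degree p < n \<longrightarrow> (\<integral>x. ww nu x * poly (q * p) (of_real x) \<partial>lborel) = 0) \<longrightarrow>
  (\<exists>\<delta>. fact n / (2 * of_nat n) ^ n * poly q (of_nat n * z) = leading_term nu n z * (1 + \<delta>) \<and>
   cmod \<delta> \<le> C * (1 / real n + (nu/2 - eta) + real n powr (eta + nu/8 - 1/2) / (1/4 - eta))))"
  using asymptotics_param[OF K] by (elim exE)
 note C = conjunct1[OF C'] conjunct2[OF C', THEN spec, THEN mp, THEN bspec, THEN spec, THEN spec, THEN mp]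
 have "\<exists>D eta. 0 < D \<and> (\<forall>\<^sub>F n in sequentially. 0 \<le> eta n \<and> eta n < 1/4 \<and> eta n \<le> nu/2 \<and>
  1 / real n + (nu/2 - eta n) + real n powr (eta n + nu/8 - 1/2) / (1/4 - eta n) \<le> D * err nu n)"
 proof (cases "nu = 1/2")
  case False
  then have nu2: "0 < nu" "nu < 1/2" using nu by auto
  have "(\<lambda>n. 1 / real n + real n powr (nu/2 + nu/8 - 1/2) / (1/4 - nu/2)) \<in> O(\<lambda>n. real n powr (nu - 1/2) / ln (real n) powr (nu + 1/2))"
   using nu2 by real_asymp
  then obtain D where D: "0 < D" "\<forall>\<^sub>F n in sequentially. norm (1 / real n + real n powr (nu/2 + nu/8 - 1/2) / (1/4 - nu/2)) \<le> D * norm (real n powr (nu - 1/2) / ln (real n) powr (nu + 1/2))"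
   by (rule landau_o.bigE)
  show ?thesis
  proof (rule exI[of _ D], rule exI[of _ "\<lambda>_. nu/2"], rule conjI[OF D(1)])
   show "\<forall>\<^sub>F n in sequentially. 0 \<le> nu/2 \<and> nu/2 < 1/4 \<and> nu/2 \<le> nu/2 \<and>
    1 / real n + (nu/2 - nu/2) + real n powr (nu/2 + nu/8 - 1/2) / (1/4 - nu/2) \<le> D * err nu n"
    using D(2) eventually_ge_at_top[of 3]
   proof eventually_elim
    case (elim n)
    have "0 < err nu n" using err_pos elim by simp
    then show ?case using elim(1) nu2 unfolding err_def[symmetric] by (simp add: abs_le_iff)
   qed
  qed
 next
  case True
  have "(\<lambda>n. 1 / real n + real n powr (-1/8) + real n powr (- 1/16) * real n powr 0) \<in> O(\<lambda>n. real n powr 0 / ln (real n) powr 1)"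
   by real_asymp
  then obtain D where D: "0 < D" "\<forall>\<^sub>F n in sequentially. norm (1 / real n + real n powr (-1/8) + real n powr (- 1/16) * real n powr 0) \<le> D * norm (real n powr 0 / ln (real n) powr 1)"
   by (rule landau_o.bigE)
  have small: "\<forall>\<^sub>F n in sequentially. real n powr (-1/8) \<le> 1/4" by real_asymp
  show ?thesis
  proof (rule exI[of _ D], rule exI[of _ "\<lambda>n. 1/4 - real n powr (-1/8)"], rule conjI[OF D(1)])
   show "\<forall>\<^sub>F n in sequentially. 0 \<le> 1/4 - real n powr (-1/8) \<and> 1/4 - real n powr (-1/8) < 1/4 \<and> 1/4 - real n powr (-1/8) \<le> nu/2 \<and>
    1 / real n + (nu/2 - (1/4 - real n powr (-1/8))) + real n powr (1/4 - real n powr (-1/8) + nu/8 - 1/2) / (1/4 - (1/4 - real n powr (-1/8))) \<le> D * err nu n"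
    using D(2) small eventually_ge_at_top[of 3]
   proof eventually_elim
    case (elim n)
    define h where "h = real n powr (-1/8)"
    have n: "1 \<le> real n" "0 < real n" using elim(3) by auto
    have h: "0 < h" using n by (simp add: h_def)
    have e: "err nu n = real n powr 0 / ln (real n) powr 1" unfolding err_def True by simp
    have "0 < err nu n" using err_pos elim by simp
    then have le: "1 / real n + h + real n powr (- 1/16) \<le> D * err nu n"
     using elim(1) n unfolding e[symmetric] h_def by (simp add: abs_le_iff)
    \<comment> \<open>The exponent is at most \<open>1/4 + 1/16 - 1/2 = - 3/16\<close>; dividing by
      \<open>h = n^(-1/8)\<close> leaves \<open>n^(-1/16)\<close>, still smaller than
      \<open>err\<close>, which is \<open>1 / ln n\<close> in this case.\<close>
    have "real n powr (1/4 - h + nu/8 - 1/2) \<le> real n powr (- 3/16)"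
     using n h True by (intro powr_mono) auto
    then have "real n powr (1/4 - h + nu/8 - 1/2) / h \<le> real n powr (- 3/16) / real n powr (- 1/8)"
     using h unfolding h_def by (intro divide_right_mono) auto
    also have "\<dots> = real n powr (- 1/16)" unfolding powr_diff[symmetric] by simp
    finally have "real n powr (1/4 - h + nu/8 - 1/2) / h \<le> real n powr (- 1/16)" .
    then show ?case using le elim(2) h unfolding h_def[symmetric] unfolding True by simp
   qed
  qed
 qed
 then obtain D eta where D: "0 < D" "\<forall>\<^sub>F n in sequentially. 0 \<le> eta n \<and> eta n < 1/4 \<and> eta n \<le> nu/2 \<and>
  1 / real n + (nu/2 - eta n) + real n powr (eta n + nu/8 - 1/2) / (1/4 - eta n) \<le> D * err nu n" by blast
 show ?thesis
 proof (rule exI[of _ "C * D"])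
  show "\<forall>\<^sub>F n in sequentially. \<forall>z\<in>K. \<forall>q.
  (degree q \<le> n \<and> Polynomial.coeff q n = 2 ^ n / fact n) \<and>
  (\<forall>p. degree p < n \<longrightarrow> (\<integral>x. ww nu x * poly (q * p) (of_real x) \<partial>lborel) = 0) \<longrightarrow>
  (\<exists>\<delta>. fact n / (2 * of_nat n) ^ n * poly q (of_nat n * z) = leading_term nu n z * (1 + \<delta>) \<and>
   cmod \<delta> \<le> C * D * err nu n)"
   using D(2) eventually_ge_at_top[of N]
  proof eventually_elim
   case (elim n)
   show ?case
   proof (intro ballI allI impI)
    fix z q assume z: "z \<in> K" and q: "(degree q \<le> n \<and> Polynomial.coeff q n = 2 ^ n / fact n) \<and>
     (\<forall>p. degree p < n \<longrightarrow> (\<integral>x. ww nu x * poly (q * p) (of_real x) \<partial>lborel) = 0)"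
    have co: "\<forall>i\<ge>n. Polynomial.coeff (q - mp_poly (1/4 - eta n) (1/4 + eta n) n) i = 0"
    proof (intro allI impI)
     fix i assume "n \<le> i"
     then show "Polynomial.coeff (q - mp_poly (1/4 - eta n) (1/4 + eta n) n) i = 0"
      using q by (cases "i = n") (auto simp: mp_poly_coeff coeff_eq_0 mp_poly_degree le_less_trans[OF mp_poly_degree] le_less_trans)
    qed
    obtain \<delta> where d: "fact n / (2 * of_nat n) ^ n * poly q (of_nat n * z) = leading_term nu n z * (1 + \<delta>)"
     "cmod \<delta> \<le> C * (1 / real n + (nu/2 - eta n) + real n powr (eta n + nu/8 - 1/2) / (1/4 - eta n))"
     using C(2)[OF elim(2) z, of "eta n" q] elim(1) co q by blast
    have "C * (1 / real n + (nu/2 - eta n) + real n powr (eta n + nu/8 - 1/2) / (1/4 - eta n)) \<le> C * (D * err nu n)"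
     using elim(1) C(1) by (intro mult_left_mono) auto
    with d show "\<exists>\<delta>. fact n / (2 * of_nat n) ^ n * poly q (of_nat n * z) = leading_term nu n z * (1 + \<delta>) \<and>
      cmod \<delta> \<le> C * D * err nu n" by (intro exI[of _ \<delta>]) (simp add: mult.assoc)
   qed
  qed
 qed
qed

end

theorem theorem2p6:
  fixes \<nu> :: real
  assumes "0 < \<nu>" and "\<nu> \<le> 1 / 2"
  shows "(\<forall>\<^sub>F n in sequentially. bessel_hankel_det \<nu> n \<noteq> 0 \<and> (\<exists>!p. bessel_OP_rel \<nu> n p)) \<and>
         (\<forall>K. compact K \<and> K \<subseteq> slit_plane \<longrightarrow>
           (\<exists>C. \<forall>\<^sub>F n in sequentially. \<forall>z\<in>K. \<exists>\<delta>.
              rescaled_bessel_OP \<nu> n z = leading_term \<nu> n z * (1 + \<delta>) \<and>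
              norm \<delta> \<le> C * err \<nu> n))"
proof -
  note \<nu> = assms
  obtain B where B: "B \<noteq> 0" "\<And>j. (FF \<nu> j \<longlongrightarrow> MM \<nu> B j) (at_right 0)" using FF_limits[OF \<nu>] by blast
  obtain C where C: "C \<noteq> 0" "\<And>j. of_real (MM \<nu> B j) = C * (\<integral>x. ww \<nu> x * (\<i> * of_real pi * of_real x) ^ j \<partial>lborel)"
    using MM_ww[OF \<nu> B(1)] by blast
  have moment: "bessel_moment \<nu> j = MM \<nu> B j" for j
    unfolding bessel_moment_def
  proof (rule tendsto_Lim)
    show "((\<lambda>s. integral {0..} (\<lambda>x. x ^ j * bessel_J \<nu> x * exp (- s * x))) \<longlongrightarrow> MM \<nu> B j) (at_right 0)"
    proof (rule Lim_transform_eventually[OF B(2)])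
      show "\<forall>\<^sub>F s in at_right 0. FF \<nu> j s = integral {0..} (\<lambda>x. x ^ j * bessel_J \<nu> x * exp (- s * x))"
        using eventually_at_right_less[of 0] by eventually_elim (rule integral_unique[OF FF_integral[OF \<nu>], symmetric])
    qed
  qed simp
  have det: "Determinant.det (Matrix.mat n n (\<lambda>(i, j). MM \<nu> B (i + j))) \<noteq> 0" for n
    by (rule ww_hankel_det[OF \<nu> C])
  have main: "\<exists>p. (\<forall>p'. bessel_OP_rel \<nu> n p' \<longleftrightarrow> p' = p) \<and> degree p = n \<and> lead_coeff p = 1 \<and>
    (\<forall>j<n. (\<Sum>k\<le>n. Polynomial.coeff p k * of_real (MM \<nu> B (j + k))) = 0)" for n
    by (rule hankel_main[OF \<nu> B(2) det])
  have first: "bessel_hankel_det \<nu> n \<noteq> 0 \<and> (\<exists>!p. bessel_OP_rel \<nu> n p)" for n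
  proof
    show "bessel_hankel_det \<nu> n \<noteq> 0" unfolding bessel_hankel_det_def moment by (rule det)
    show "\<exists>!p. bessel_OP_rel \<nu> n p" using main[of n] by auto
  qed
  have OP: "degree (bessel_OP \<nu> n) = n" "lead_coeff (bessel_OP \<nu> n) = 1"
    "\<And>j. j < n \<Longrightarrow> (\<Sum>k\<le>n. Polynomial.coeff (bessel_OP \<nu> n) k * of_real (MM \<nu> B (j + k))) = 0" for n
  proof -
    obtain p where p: "\<And>p'. bessel_OP_rel \<nu> n p' \<longleftrightarrow> p' = p" "degree p = n" "lead_coeff p = 1"
      "\<And>j. j < n \<Longrightarrow> (\<Sum>k\<le>n. Polynomial.coeff p k * of_real (MM \<nu> B (j + k))) = 0"
      using main[of n] by blast
    have e: "bessel_OP \<nu> n = p" unfolding bessel_OP_def p(1) by simp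
    show "degree (bessel_OP \<nu> n) = n" "lead_coeff (bessel_OP \<nu> n) = 1"
      "\<And>j. j < n \<Longrightarrow> (\<Sum>k\<le>n. Polynomial.coeff (bessel_OP \<nu> n) k * of_real (MM \<nu> B (j + k))) = 0"
      unfolding e by (fact p)+
  qed
  \<comment> \<open>The Bessel polynomial in the rotated variable, rescaled to the leading
    coefficient \<open>2^n / n!\<close> of \<open>mp_poly\<close>, so that their difference has
    degree below \<open>n\<close>.\<close>
  define q where "q n = Polynomial.smult (2 ^ n / fact n / (\<i> * of_real pi) ^ n) (dil (bessel_OP \<nu> n))" for n
  have q1: "degree (q n) \<le> n \<and> Polynomial.coeff (q n) n = 2 ^ n / fact n" for n
  proof
    show "degree (q n) \<le> n" unfolding q_def using OP(1)[of n] by (simp add: degree_dil[OF \<nu>])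
    have "Polynomial.coeff (dil (bessel_OP \<nu> n)) n = (\<i> * of_real pi) ^ n"
    proof -
      have "lead_coeff (dil (bessel_OP \<nu> n)) = lead_coeff (bessel_OP \<nu> n) * lead_coeff [:0, \<i> * of_real pi:] ^ degree (bessel_OP \<nu> n)"
        unfolding dil_def[OF \<nu>] by (rule lead_coeff_comp) simp
      then show ?thesis using OP(1)[of n] OP(2)[of n] by (simp add: degree_dil[OF \<nu>])
    qed
    then show "Polynomial.coeff (q n) n = 2 ^ n / fact n" unfolding q_def by simp
  qed
  have q2: "(\<integral>x. ww \<nu> x * poly (q n * p) (of_real x) \<partial>lborel) = 0" if p: "degree p < n" for n p
  proof -
    obtain t where t: "dil t = p" "degree t = degree p" using dil_surj[OF \<nu>] by blast
    let ?P = "bessel_OP \<nu> n"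
    have "(\<Sum>k\<le>degree ?P. Polynomial.coeff ?P k * (\<integral>x. ww \<nu> x * (\<i> * of_real pi * of_real x) ^ (j + k) \<partial>lborel)) = 0" if j: "j < n" for j
    proof -
      have "0 = (\<Sum>k\<le>n. Polynomial.coeff ?P k * of_real (MM \<nu> B (j + k)))" using OP(3)[OF j] by simp
      also have "\<dots> = C * (\<Sum>k\<le>n. Polynomial.coeff ?P k * (\<integral>x. ww \<nu> x * (\<i> * of_real pi * of_real x) ^ (j + k) \<partial>lborel))"
        unfolding C(2) sum_distrib_left by (intro sum.cong refl) (simp add: mult_ac)
      finally show ?thesis using C(1) OP(1)[of n] by simp
    qed
    then have "(\<integral>x. ww \<nu> x * poly (dil ?P * p) (of_real x) \<partial>lborel) = 0"
      unfolding t(1)[symmetric] ww_dil[OF \<nu>] using p t(2) by (intro sum.neutral) auto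
    moreover have "ww \<nu> x * poly (q n * p) (of_real x) = (2 ^ n / fact n / (\<i> * of_real pi) ^ n) * (ww \<nu> x * poly (dil ?P * p) (of_real x))" for x
      by (simp add: q_def mult_ac)
    ultimately show ?thesis by (simp only: integral_mult_right_zero mult_zero_right)
  qed
  have resc: "rescaled_bessel_OP \<nu> n z = fact n / (2 * of_nat n) ^ n * poly (q n) (of_nat n * z)" for n z
  proof -
    have "poly (q n) (of_nat n * z) = 2 ^ n / fact n / (\<i> * of_real pi) ^ n * poly (bessel_OP \<nu> n) (\<i> * of_nat n * of_real pi * z)"
      unfolding q_def poly_smult poly_dil[OF \<nu>] by (simp add: mult_ac)
    moreover have "(\<i> * of_nat n * of_real pi) ^ n = of_nat n ^ n * (\<i> * of_real pi) ^ n" by (simp add: power_mult_distrib mult_ac)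
    ultimately show ?thesis unfolding rescaled_bessel_OP_def by (simp add: power_mult_distrib)
  qed
  have "\<exists>C. \<forall>\<^sub>F n in sequentially. \<forall>z\<in>K. \<exists>\<delta>. rescaled_bessel_OP \<nu> n z = leading_term \<nu> n z * (1 + \<delta>) \<and> norm \<delta> \<le> C * err \<nu> n"
    if K: "compact K \<and> K \<subseteq> slit_plane" for K
  proof -
    obtain C where C: "\<forall>\<^sub>F n in sequentially. \<forall>z\<in>K. \<forall>q.
       (degree q \<le> n \<and> Polynomial.coeff q n = 2 ^ n / fact n) \<and>
       (\<forall>p. degree p < n \<longrightarrow> (\<integral>x. ww \<nu> x * poly (q * p) (of_real x) \<partial>lborel) = 0) \<longrightarrow>
       (\<exists>\<delta>. fact n / (2 * of_nat n) ^ n * poly q (of_nat n * z) = leading_term \<nu> n z * (1 + \<delta>) \<and>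
         cmod \<delta> \<le> C * err \<nu> n)"
      using asymptotics[OF \<nu> conjunct1[OF K] conjunct2[OF K]] by (rule exE)
    show ?thesis
    proof (rule exI[of _ C])
      show "\<forall>\<^sub>F n in sequentially. \<forall>z\<in>K. \<exists>\<delta>. rescaled_bessel_OP \<nu> n z = leading_term \<nu> n z * (1 + \<delta>) \<and> norm \<delta> \<le> C * err \<nu> n"
        using C
      proof eventually_elim
        case (elim n)
        show ?case unfolding resc
          by (intro ballI elim[THEN bspec, THEN spec, THEN mp] conjI q1 allI impI q2) (assumption | simp)+
      qed
    qed
  qed
  then show ?thesis using first by auto
qed

end
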